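(* Let $n\ge 6$ be even and let $G$ be of type $\mathbf{D}_n$ with cocharacter lattice $X_*(T)=\langle Q^\vee,\omega_{n-1}\rangle$. (1) The Tits section $\mathcal N_\circ$ is optimal. Moreover $\mathcal N_\circ(s_i)^2\ne1$ for all $i=1,\dots,n$. Finally, for any section $\mathcal S$, $\mathcal S(s_i)$ has order $4$ for all $i$, so that there is only one order profile of sections. (2) Two sections are $T$-conjugate if and only if they have the same value of $c$.
   Context: $F$ is an algebraically closed field, $G$ an almost-simple connected reductive group over $F$, $T$ a maximal torus, $N=N_G(T)$, $W=N/T$, $\pi:N\to W$ the projection. Let $\alpha_1,\dots,\alpha_n$ be the simple roots in Bourbaki numbering ($\alpha_i=e_i-e_{i+1}$ for $i<n$, $\alpha_n=e_{n-1}+e_n$), $s_i$ the corresponding reflections, $\alpha_i^\vee$ the simple coroots, $Q^\vee$ the coroot lattice, $\omega_i$ the fundamental coweights. Fix a realization of the root system: isomorphisms $u_\alpha:\mathbf G_a\to U_\alpha$ onto the root subgroups with $tu_\alpha(x)t^{-1}=u_\alpha(\alpha(t)x)$, such that $\sigma_\alpha=u_\alpha(1)u_{-\alpha}(-1)u_\alpha(1)\in N$ maps to $s_\alpha$ and $u_\alpha(x)u_{-\alpha}(-x^{-1})u_\alpha(x)=\alpha^\vee(x)\sigma_\alpha$ for $x\in F^\times$; put $\sigma_i=\sigma_{\alpha_i}$. A section is a map $\mathcal S:W\to N$ with $\pi\circ\mathcal S=\mathrm{id}$ satisfying the braid relations (equivalently $\mathcal S$ is multiplicative along reduced expressions). It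 is determined by $\mathcal S(s_i)=t_i\sigma_i$, $t_i\in T$. The Tits section $\mathcal N_\circ$ is the one with all $t_i=1$. The order profile of $\mathcal S$ is the Dynkin diagram with the node of each $\alpha_i$ labeled by the order of $\mathcal S(s_i)$. For two sections write $\mathcal S'<\mathcal S$ if the order of $\mathcal S'(s_i)$ is greater than the order of $\mathcal S(s_i)$ for all $i$; this translates to a partial order on order profiles, and a section is called optimal if it has the unique maximal order profile with respect to this partial order. Two sections $\mathcal S,\mathcal S'$ are $T$-conjugate if there is $t\in T$ with $t\mathcal S(w)t^{-1}=\mathcal S'(w)$ for all $w\in W$. Coordinates: the basis of $X_*(T)$ used is $\lambda_1=\omega_{n-1}$ and $\lambda_i=\alpha_i^\vee$ for $2\le i\le n$, and $(x_1,\dots,x_n)$ denotes $\lambda_1(x_1)\cdots\lambda_n(x_n)\in T$. The sections are exactly those given by $t_i$ of the following form, with $a_{i,i}\in F^\times$ arbitrary and $a,b,c\in F^\times$ with $c^2=1$, $a^3=b^2$, and $x=a^{-1}b$: $t_1$ has first coordinate $a^{-1}$; for $2\le k\le n-2$ its $k$-th coordinate is $a^{k/2}$ if $k$ is even and $b\,a^{(k-3)/2}$ if $k$ is odd; its $(n-1)$-th coordinate is $c\,x^{n/2}$ and its $n$-th coordinate is $c\,x^{(n-2)/2}$. For $2\le i\le n$, $t_i$ has $i$-th coordinate $a_{i,i}$, and for $k\ne i$ its $k$-th coordinate is $c$ if $k\in\{n-1,n\}$ and $1$ otherwise.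
   Formalization: The field F is assumed to have characteristic different from 2; in characteristic 2 the claim fails, since the square of the Tits section at s_i is the coroot value at -1, which is then 1. That W is generated by the simple reflections is stated as an explicit (standard) assumption. *)

theory Defs
  imports
    "HOL-Analysis.Analysis"
    "HOL-Computational_Algebra.Computational_Algebra"
    "HOL-Library.Extended_Nat"
    "HOL-Algebra.Multiplicative_Group"
    "HOL-Algebra.Generated_Groups"
    "HOL-Algebra.Group_Action"
begin

section \<open>Linear algebraic groups over an algebraically closed field\<close>

text \<open>Groups are identified with their groups of points.  An algebraic group is recorded as a
  group together with an algebra of functions; only the restrictions of these functions to the
  carrier matter, so a subgroup inherits its structure by merely shrinking the carrier.\<close>

record ('a, 'f) alg_group = "'a monoid" +
  reg :: "('a \<Rightarrow> 'f) set"

inductive_set fun_algebra :: "('a \<Rightarrow> 'f::comm_ring_1) set \<Rightarrow> ('a \<Rightarrow> 'f) set" for C where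
  const: "(\<lambda>_. c) \<in> fun_algebra C"
| gen: "f \<in> C \<Longrightarrow> f \<in> fun_algebra C"
| add: "f \<in> fun_algebra C \<Longrightarrow> g \<in> fun_algebra C \<Longrightarrow> (\<lambda>x. f x + g x) \<in> fun_algebra C"
| mult: "f \<in> fun_algebra C \<Longrightarrow> g \<in> fun_algebra C \<Longrightarrow> (\<lambda>x. f x * g x) \<in> fun_algebra C"

definition matrix_entries :: "('f^'m^'m \<Rightarrow> 'f) set" where
  "matrix_entries = {\<lambda>A. A $ i $ j |i j. True}"

definition general_linear :: "('f::field^'m^'m, 'f) alg_group" where
  "general_linear = \<lparr>carrier = {A. invertible A}, mult = (**), one = mat 1,
     reg = fun_algebra (insert (\<lambda>A. inverse (det A)) matrix_entries)\<rparr>"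

definition Ga :: "('f::field, 'f) alg_group" where
  "Ga = \<lparr>carrier = UNIV, mult = (+), one = 0, reg = fun_algebra {\<lambda>x. x}\<rparr>"

definition Gm :: "('f::field, 'f) alg_group" where
  "Gm = \<lparr>carrier = {x. x \<noteq> 0}, mult = (*), one = 1, reg = fun_algebra {\<lambda>x. x, inverse}\<rparr>"

text \<open>The group \<open>(F\<^sup>\<times>)\<^sup>r\<close>; vectors are padded with ones beyond the first \<open>r\<close> places.\<close>

definition Gm_power :: "nat \<Rightarrow> (nat \<Rightarrow> 'f::field, 'f) alg_group" where
  "Gm_power r = \<lparr>carrier = {x. (\<forall>i<r. x i \<noteq> 0) \<and> (\<forall>i\<ge>r. x i = 1)},
     mult = (\<lambda>x y i. x i * y i), one = (\<lambda>_. 1),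
     reg = fun_algebra ({\<lambda>x. x i |i. i < r} \<union> {\<lambda>x. inverse (x i) |i. i < r})\<rparr>"

definition zariski :: "('a, 'f::field) alg_group \<Rightarrow> 'a topology" where
  "zariski X = topology (\<lambda>U. \<exists>I \<subseteq> reg X. U = {x \<in> carrier X. \<exists>f\<in>I. f x \<noteq> 0})"

lemma openin_zariski:
  assumes "\<And>f g. f \<in> reg X \<Longrightarrow> g \<in> reg X \<Longrightarrow> (\<lambda>x. f x * g x) \<in> reg X"
  shows "openin (zariski X) U \<longleftrightarrow> (\<exists>I \<subseteq> reg X. U = {x \<in> carrier X. \<exists>f\<in>I. f x \<noteq> 0})"
proof -
  have "istopology (\<lambda>U. \<exists>I \<subseteq> reg X. U = {x \<in> carrier X. \<exists>f\<in>I. f x \<noteq> 0})" (is "istopology ?O")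
    unfolding istopology_def
  proof (intro conjI allI impI)
    fix U V assume "?O U" "?O V"
    then obtain I J where I: "I \<subseteq> reg X" "U = {x \<in> carrier X. \<exists>f\<in>I. f x \<noteq> 0}"
      and J: "J \<subseteq> reg X" "V = {x \<in> carrier X. \<exists>f\<in>J. f x \<noteq> 0}" by blast
    define K where "K = {\<lambda>x. f x * g x |f g. f \<in> I \<and> g \<in> J}"
    have "K \<subseteq> reg X" unfolding K_def using assms I(1) J(1) by blast
    moreover have "U \<inter> V = {x \<in> carrier X. \<exists>f\<in>K. f x \<noteq> 0}"
    proof (intro equalityI subsetI)
      fix x assume "x \<in> U \<inter> V"
      then obtain f g where "x \<in> carrier X" "f \<in> I" "f x \<noteq> 0" "g \<in> J" "g x \<noteq> 0"
        using I(2) J(2) by blast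
      moreover from this have "(\<lambda>x. f x * g x) \<in> K" by (auto simp: K_def)
      ultimately show "x \<in> {x \<in> carrier X. \<exists>f\<in>K. f x \<noteq> 0}"
        by (auto intro!: bexI[of _ "\<lambda>x. f x * g x"])
    next
      fix x assume "x \<in> {x \<in> carrier X. \<exists>f\<in>K. f x \<noteq> 0}"
      then obtain f g where "x \<in> carrier X" "f \<in> I" "g \<in> J" "f x * g x \<noteq> 0"
        unfolding K_def by blast
      then show "x \<in> U \<inter> V" unfolding I(2) J(2) by auto
    qed
    ultimately show "?O (U \<inter> V)" by blast
  next
    fix \<U> assume *: "\<forall>U\<in>\<U>. ?O U"
    define I where "I = {f \<in> reg X. {x \<in> carrier X. f x \<noteq> 0} \<subseteq> \<Union>\<U>}"
    have "\<Union>\<U> \<subseteq> {x \<in> carrier X. \<exists>f\<in>I. f x \<noteq> 0}"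
    proof
      fix x assume "x \<in> \<Union>\<U>"
      then obtain U where U: "U \<in> \<U>" "x \<in> U" by blast
      with * obtain J where J: "J \<subseteq> reg X" "U = {x \<in> carrier X. \<exists>f\<in>J. f x \<noteq> 0}" by blast
      with U obtain f where f: "x \<in> carrier X" "f \<in> J" "f x \<noteq> 0" by blast
      have "{x \<in> carrier X. f x \<noteq> 0} \<subseteq> U" using J(2) f(2) by blast
      then have "f \<in> I" using J(1) f(2) U(1) unfolding I_def by blast
      with f show "x \<in> {x \<in> carrier X. \<exists>f\<in>I. f x \<noteq> 0}" by blast
    qed
    moreover have "{x \<in> carrier X. \<exists>f\<in>I. f x \<noteq> 0} \<subseteq> \<Union>\<U>" unfolding I_def by blast
    moreover have "I \<subseteq> reg X" unfolding I_def by blast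
    ultimately show "?O (\<Union>\<U>)" by (intro exI[of _ I] conjI equalityI)
  qed
  then show ?thesis by (simp add: zariski_def)
qed

definition closed_subgroup :: "'a set \<Rightarrow> ('a, 'f::field) alg_group \<Rightarrow> bool" where
  "closed_subgroup H G \<longleftrightarrow> subgroup H G \<and> closedin (zariski G) H"

definition alg_connected :: "('a, 'f::field) alg_group \<Rightarrow> bool" where
  "alg_connected G \<longleftrightarrow> connected_space (zariski G)"

definition linear_algebraic_group :: "('f::field^'m^'m, 'f) alg_group \<Rightarrow> bool" where
  "linear_algebraic_group G \<longleftrightarrow>
     (\<exists>H. closed_subgroup H general_linear \<and> G = general_linear\<lparr>carrier := H\<rparr>)"

definition alg_hom :: "('a, 'f::field) alg_group \<Rightarrow> ('b, 'f) alg_group \<Rightarrow> ('a \<Rightarrow> 'b) set" where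
  "alg_hom X Y =
     {\<phi> \<in> hom X Y. \<forall>g\<in>reg Y. \<exists>f\<in>reg X. \<forall>x\<in>carrier X. g (\<phi> x) = f x}"

definition alg_iso :: "('a, 'f::field) alg_group \<Rightarrow> ('b, 'f) alg_group \<Rightarrow> ('a \<Rightarrow> 'b) set" where
  "alg_iso X Y =
     {\<phi> \<in> alg_hom X Y. \<exists>\<psi> \<in> alg_hom Y X.
        (\<forall>x\<in>carrier X. \<psi> (\<phi> x) = x) \<and> (\<forall>y\<in>carrier Y. \<phi> (\<psi> y) = y)}"

text \<open>The operator \<open>^\<close> on \<open>'f^'m^'m\<close> is the entrywise power, hence the iteration of \<open>(**)\<close>.\<close>

definition unipotent :: "'f::field^'m^'m \<Rightarrow> bool" where
  "unipotent g \<longleftrightarrow> (\<exists>k. (((**) (g - mat 1)) ^^ k) (mat 1) = 0)"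

definition reductive :: "('f::field^'m^'m, 'f) alg_group \<Rightarrow> bool" where
  "reductive G \<longleftrightarrow>
     (\<forall>U. closed_subgroup U G \<and> U \<lhd> G \<and> alg_connected (G\<lparr>carrier := U\<rparr>) \<and> (\<forall>g\<in>U. unipotent g)
        \<longrightarrow> U = {\<one>\<^bsub>G\<^esub>})"

definition almost_simple :: "('a, 'f::field) alg_group \<Rightarrow> bool" where
  "almost_simple G \<longleftrightarrow>
     (\<exists>g\<in>carrier G. \<exists>h\<in>carrier G. g \<otimes>\<^bsub>G\<^esub> h \<noteq> h \<otimes>\<^bsub>G\<^esub> g) \<and>
     (\<forall>H. closed_subgroup H G \<and> H \<lhd> G \<and> alg_connected (G\<lparr>carrier := H\<rparr>)
        \<longrightarrow> H = {\<one>\<^bsub>G\<^esub>} \<or> H = carrier G)"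

definition is_torus :: "('a, 'f::field) alg_group \<Rightarrow> bool" where
  "is_torus T \<longleftrightarrow> (\<exists>r. alg_iso (Gm_power r) T \<noteq> {})"

definition maximal_torus :: "('a, 'f::field) alg_group \<Rightarrow> 'a set \<Rightarrow> bool" where
  "maximal_torus G T \<longleftrightarrow>
     closed_subgroup T G \<and> is_torus (G\<lparr>carrier := T\<rparr>) \<and>
     (\<forall>T'. closed_subgroup T' G \<and> is_torus (G\<lparr>carrier := T'\<rparr>) \<and> T \<subseteq> T' \<longrightarrow> T' = T)"


section \<open>Roots, coroots and the Weyl group\<close>

text \<open>Characters and cocharacters are made extensional so that equality of functions is equality
  of (co)characters.\<close>

definition characters :: "('a, 'f::field) alg_group \<Rightarrow> 'a set \<Rightarrow> ('a \<Rightarrow> 'f) set" where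
  "characters G T = alg_hom (G\<lparr>carrier := T\<rparr>) Gm \<inter> extensional T"

definition cocharacter_group ::
    "('a, 'f::field) alg_group \<Rightarrow> 'a set \<Rightarrow> ('f \<Rightarrow> 'a) monoid" where
  "cocharacter_group G T =
     \<lparr>carrier = alg_hom Gm (G\<lparr>carrier := T\<rparr>) \<inter> extensional (carrier Gm),
      mult = (\<lambda>l m. \<lambda>x\<in>carrier Gm. l x \<otimes>\<^bsub>G\<^esub> m x),
      one = (\<lambda>x\<in>carrier Gm. \<one>\<^bsub>G\<^esub>)\<rparr>"

definition pairing :: "('a \<Rightarrow> 'f::field) \<Rightarrow> ('f \<Rightarrow> 'a) \<Rightarrow> int" where
  "pairing chi l = (THE k. \<forall>x. x \<noteq> 0 \<longrightarrow> chi (l x) = x powi k)"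

definition neg_character :: "'a set \<Rightarrow> ('a \<Rightarrow> 'f::field) \<Rightarrow> ('a \<Rightarrow> 'f)" where
  "neg_character T chi = (\<lambda>t\<in>T. inverse (chi t))"

text \<open>The tangent space at the identity, inside the space of all matrices: along a tangent
  direction \<open>X\<close>, every polynomial \<open>f\<close> vanishing on \<open>G\<close> has \<open>f (1 + z X)\<close> without linear term
  in \<open>z\<close>.  As the field is infinite, \<open>p\<close> below is uniquely determined by \<open>f\<close> and \<open>X\<close>.\<close>

definition lie_algebra :: "('f::field^'m^'m, 'f) alg_group \<Rightarrow> ('f^'m^'m) set" where
  "lie_algebra G =
     {X. \<forall>f \<in> fun_algebra matrix_entries. (\<forall>g\<in>carrier G. f g = 0) \<longrightarrow>
           (\<forall>p. (\<forall>z. poly p z = f (mat 1 + mat z ** X)) \<longrightarrow> Polynomial.coeff p 1 = 0)}"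

definition roots :: "('f::field^'m^'m, 'f) alg_group \<Rightarrow> ('f^'m^'m) set \<Rightarrow> ('f^'m^'m \<Rightarrow> 'f) set" where
  "roots G T =
     {\<alpha> \<in> characters G T. (\<exists>t\<in>T. \<alpha> t \<noteq> 1) \<and>
        (\<exists>X \<in> lie_algebra G. X \<noteq> 0 \<and> (\<forall>t\<in>T. t ** X ** inv\<^bsub>G\<^esub> t = mat (\<alpha> t) ** X))}"

definition weyl_group :: "('a, 'f::field) alg_group \<Rightarrow> 'a set \<Rightarrow> 'a set monoid" where
  "weyl_group G T = G\<lparr>carrier := normalizer G T\<rparr> Mod T"

text \<open>The class \<open>w\<close> acts on \<open>T\<close> by \<open>t \<mapsto> t l(\<alpha>(t))\<^sup>-\<^sup>1\<close>, that is, on characters by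
  \<open>\<chi> \<mapsto> \<chi> - \<langle>\<chi>, l\<rangle> \<alpha>\<close>.\<close>

definition is_reflection ::
    "('a, 'f::field) alg_group \<Rightarrow> 'a set \<Rightarrow> ('a \<Rightarrow> 'f) \<Rightarrow> ('f \<Rightarrow> 'a) \<Rightarrow> 'a set \<Rightarrow> bool" where
  "is_reflection G T \<alpha> l w \<longleftrightarrow>
     w \<in> carrier (weyl_group G T) \<and>
     (\<forall>g\<in>w. \<forall>t\<in>T. g \<otimes>\<^bsub>G\<^esub> t \<otimes>\<^bsub>G\<^esub> inv\<^bsub>G\<^esub> g = t \<otimes>\<^bsub>G\<^esub> inv\<^bsub>G\<^esub> (l (\<alpha> t)))"

text \<open>The coroot of \<open>\<alpha>\<close> is \<open>l\<close>, and its reflection is \<open>w\<close>.\<close>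

definition coroot_reflection ::
    "('a, 'f::field) alg_group \<Rightarrow> 'a set \<Rightarrow> ('a \<Rightarrow> 'f) \<Rightarrow> ('f \<Rightarrow> 'a) \<Rightarrow> 'a set \<Rightarrow> bool" where
  "coroot_reflection G T \<alpha> l w \<longleftrightarrow>
     l \<in> carrier (cocharacter_group G T) \<and> pairing \<alpha> l = 2 \<and> is_reflection G T \<alpha> l w"

definition root_isomorphism ::
    "('a, 'f::field) alg_group \<Rightarrow> 'a set \<Rightarrow> ('a \<Rightarrow> 'f) \<Rightarrow> 'a set \<Rightarrow> ('f \<Rightarrow> 'a) \<Rightarrow> bool" where
  "root_isomorphism G T \<alpha> U v \<longleftrightarrow>
     v \<in> alg_iso Ga (G\<lparr>carrier := U\<rparr>) \<and>
     (\<forall>t\<in>T. \<forall>x. t \<otimes>\<^bsub>G\<^esub> v x \<otimes>\<^bsub>G\<^esub> inv\<^bsub>G\<^esub> t = v (\<alpha> t * x))"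

text \<open>The root subgroup of \<open>\<alpha>\<close> is the unique closed subgroup \<open>U\<close> for which there is a
  \<open>T\<close>-equivariant isomorphism from the additive group, \<open>T\<close> acting on the latter through \<open>\<alpha>\<close>.\<close>

definition is_root_subgroup ::
    "('a, 'f::field) alg_group \<Rightarrow> 'a set \<Rightarrow> ('a \<Rightarrow> 'f) \<Rightarrow> 'a set \<Rightarrow> bool" where
  "is_root_subgroup G T \<alpha> U \<longleftrightarrow>
     {U'. closed_subgroup U' G \<and> (\<exists>v. root_isomorphism G T \<alpha> U' v)} = {U}"

definition tits_lift ::
    "('a, 'f::field) alg_group \<Rightarrow> 'a set \<Rightarrow> (('a \<Rightarrow> 'f) \<Rightarrow> 'f \<Rightarrow> 'a) \<Rightarrow> ('a \<Rightarrow> 'f) \<Rightarrow> 'a" where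
  "tits_lift G T u \<alpha> = u \<alpha> 1 \<otimes>\<^bsub>G\<^esub> u (neg_character T \<alpha>) (- 1) \<otimes>\<^bsub>G\<^esub> u \<alpha> 1"

text \<open>A realization of the root system; \<open>cr\<close> and \<open>s\<close> give the coroots and the reflections.\<close>

definition realization ::
    "('f::field^'m^'m, 'f) alg_group \<Rightarrow> ('f^'m^'m) set \<Rightarrow>
     (('f^'m^'m \<Rightarrow> 'f) \<Rightarrow> ('f \<Rightarrow> 'f^'m^'m)) \<Rightarrow> (('f^'m^'m \<Rightarrow> 'f) \<Rightarrow> ('f^'m^'m) set) \<Rightarrow>
     (('f^'m^'m \<Rightarrow> 'f) \<Rightarrow> ('f \<Rightarrow> 'f^'m^'m)) \<Rightarrow> bool" where
  "realization G T cr s u \<longleftrightarrow>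
     (\<forall>\<alpha> \<in> roots G T.
        coroot_reflection G T \<alpha> (cr \<alpha>) (s \<alpha>) \<and>
        (\<exists>U. is_root_subgroup G T \<alpha> U \<and> root_isomorphism G T \<alpha> U (u \<alpha>)) \<and>
        tits_lift G T u \<alpha> \<in> normalizer G T \<and>
        T #>\<^bsub>G\<^esub> tits_lift G T u \<alpha> = s \<alpha> \<and>
        (\<forall>x. x \<noteq> 0 \<longrightarrow>
           u \<alpha> x \<otimes>\<^bsub>G\<^esub> u (neg_character T \<alpha>) (- inverse x) \<otimes>\<^bsub>G\<^esub> u \<alpha> x =
             cr \<alpha> x \<otimes>\<^bsub>G\<^esub> tits_lift G T u \<alpha>))"

definition simple_roots ::
    "('f::field^'m^'m, 'f) alg_group \<Rightarrow> ('f^'m^'m) set \<Rightarrow> nat \<Rightarrow> (nat \<Rightarrow> 'f^'m^'m \<Rightarrow> 'f) \<Rightarrow> bool" where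
  "simple_roots G T n \<alpha> \<longleftrightarrow>
     (\<forall>i\<in>{1..n}. \<alpha> i \<in> roots G T) \<and>
     (\<forall>k :: nat \<Rightarrow> int. (\<forall>t\<in>T. (\<Prod>i=1..n. \<alpha> i t powi k i) = 1) \<longrightarrow> (\<forall>i\<in>{1..n}. k i = 0)) \<and>
     (\<forall>\<beta> \<in> roots G T. \<exists>k :: nat \<Rightarrow> int.
        (\<forall>t\<in>T. \<beta> t = (\<Prod>i=1..n. \<alpha> i t powi k i)) \<and>
        ((\<forall>i\<in>{1..n}. 0 \<le> k i) \<or> (\<forall>i\<in>{1..n}. k i \<le> 0)))"

text \<open>The simple roots of the root system \<open>D\<^sub>n\<close> in Bourbaki's coordinates; all of them have
  squared length 2, so that Cartan integers are inner products.\<close>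

definition bourbaki_D :: "nat \<Rightarrow> nat \<Rightarrow> nat \<Rightarrow> int" where
  "bourbaki_D n i = (\<lambda>k.
     if i < n then of_bool (k = i) - of_bool (k = i + 1)
     else of_bool (k = n - 1) + of_bool (k = n))"

definition type_D ::
    "nat \<Rightarrow> (nat \<Rightarrow> 'a \<Rightarrow> 'f::field) \<Rightarrow> (('a \<Rightarrow> 'f) \<Rightarrow> ('f \<Rightarrow> 'a)) \<Rightarrow> bool" where
  "type_D n \<alpha> cr \<longleftrightarrow>
     (\<forall>i\<in>{1..n}. \<forall>j\<in>{1..n}.
        pairing (\<alpha> i) (cr (\<alpha> j)) = (\<Sum>k=1..n. bourbaki_D n i k * bourbaki_D n j k))"

definition is_fundamental_coweight ::
    "('a, 'f::field) alg_group \<Rightarrow> 'a set \<Rightarrow> nat \<Rightarrow> (nat \<Rightarrow> 'a \<Rightarrow> 'f) \<Rightarrow> nat \<Rightarrow> ('f \<Rightarrow> 'a) \<Rightarrow> bool" where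
  "is_fundamental_coweight G T n \<alpha> j \<omega> \<longleftrightarrow>
     \<omega> \<in> carrier (cocharacter_group G T) \<and>
     (\<forall>i\<in>{1..n}. pairing (\<alpha> i) \<omega> = of_bool (i = j))"


section \<open>Sections of the Weyl group\<close>

text \<open>A section is required to be multiplicative along reduced expressions, the usual form of the
  braid relations for a map that is defined on the whole Weyl group.
  Below, \<open>W\<close> is the Weyl group, \<open>s 1, \<dots>, s n\<close> are the simple reflections, and a word is a
  list over \<open>{1..n}\<close>.\<close>

definition word_prod :: "('a, 'b) monoid_scheme \<Rightarrow> (nat \<Rightarrow> 'a) \<Rightarrow> nat list \<Rightarrow> 'a" where
  "word_prod M g ws = foldr (\<lambda>i x. g i \<otimes>\<^bsub>M\<^esub> x) ws \<one>\<^bsub>M\<^esub>"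

definition reduced_word :: "('a, 'b) monoid_scheme \<Rightarrow> nat \<Rightarrow> (nat \<Rightarrow> 'a) \<Rightarrow> nat list \<Rightarrow> bool" where
  "reduced_word W n s ws \<longleftrightarrow>
     set ws \<subseteq> {1..n} \<and>
     (\<forall>vs. set vs \<subseteq> {1..n} \<and> word_prod W s vs = word_prod W s ws \<longrightarrow> length ws \<le> length vs)"

definition is_section ::
    "('a, 'f::field) alg_group \<Rightarrow> 'a set \<Rightarrow> nat \<Rightarrow> (nat \<Rightarrow> 'a set) \<Rightarrow> ('a set \<Rightarrow> 'a) \<Rightarrow> bool" where
  "is_section G T n s S \<longleftrightarrow>
     (\<forall>w \<in> carrier (weyl_group G T). S w \<in> normalizer G T \<and> T #>\<^bsub>G\<^esub> S w = w) \<and>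
     (\<forall>ws. reduced_word (weyl_group G T) n s ws \<longrightarrow>
        S (word_prod (weyl_group G T) s ws) = word_prod G (\<lambda>i. S (s i)) ws)"

definition is_tits_section ::
    "('a, 'f::field) alg_group \<Rightarrow> 'a set \<Rightarrow> nat \<Rightarrow> (nat \<Rightarrow> 'a set) \<Rightarrow> (nat \<Rightarrow> 'a) \<Rightarrow>
     ('a set \<Rightarrow> 'a) \<Rightarrow> bool" where
  "is_tits_section G T n s \<sigma> S \<longleftrightarrow> is_section G T n s S \<and> (\<forall>i\<in>{1..n}. S (s i) = \<sigma> i)"

text \<open>\<open>group.ord\<close> is zero on elements of infinite order.\<close>

definition elt_order :: "('a, 'b) monoid_scheme \<Rightarrow> 'a \<Rightarrow> enat" where
  "elt_order G g = (if group.ord G g = 0 then \<infinity> else enat (group.ord G g))"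

definition order_profile ::
    "('a, 'b) monoid_scheme \<Rightarrow> nat \<Rightarrow> (nat \<Rightarrow> 'a set) \<Rightarrow> ('a set \<Rightarrow> 'a) \<Rightarrow> nat \<Rightarrow> enat" where
  "order_profile G n s S = (\<lambda>i\<in>{1..n}. elt_order G (S (s i)))"

text \<open>Larger orders mean a smaller profile.\<close>

definition profile_less :: "nat \<Rightarrow> (nat \<Rightarrow> enat) \<Rightarrow> (nat \<Rightarrow> enat) \<Rightarrow> bool" where
  "profile_less n p' p \<longleftrightarrow> (\<forall>i\<in>{1..n}. p' i > p i)"

definition section_profiles ::
    "('a, 'f::field) alg_group \<Rightarrow> 'a set \<Rightarrow> nat \<Rightarrow> (nat \<Rightarrow> 'a set) \<Rightarrow> (nat \<Rightarrow> enat) set" where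
  "section_profiles G T n s = {order_profile G n s S |S. is_section G T n s S}"

definition maximal_profile ::
    "('a, 'f::field) alg_group \<Rightarrow> 'a set \<Rightarrow> nat \<Rightarrow> (nat \<Rightarrow> 'a set) \<Rightarrow> (nat \<Rightarrow> enat) \<Rightarrow> bool" where
  "maximal_profile G T n s p \<longleftrightarrow>
     p \<in> section_profiles G T n s \<and> (\<forall>q \<in> section_profiles G T n s. \<not> profile_less n p q)"

definition optimal_section ::
    "('a, 'f::field) alg_group \<Rightarrow> 'a set \<Rightarrow> nat \<Rightarrow> (nat \<Rightarrow> 'a set) \<Rightarrow> ('a set \<Rightarrow> 'a) \<Rightarrow> bool" where
  "optimal_section G T n s S \<longleftrightarrow>
     is_section G T n s S \<and> {p. maximal_profile G T n s p} = {order_profile G n s S}"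

definition T_conjugate ::
    "('a, 'f::field) alg_group \<Rightarrow> 'a set \<Rightarrow> ('a set \<Rightarrow> 'a) \<Rightarrow> ('a set \<Rightarrow> 'a) \<Rightarrow> bool" where
  "T_conjugate G T S S' \<longleftrightarrow>
     (\<exists>t\<in>T. \<forall>w \<in> carrier (weyl_group G T). t \<otimes>\<^bsub>G\<^esub> S w \<otimes>\<^bsub>G\<^esub> inv\<^bsub>G\<^esub> t = S' w)"


section \<open>The parametrization of the sections\<close>

text \<open>\<open>lam 1, \<dots>, lam n\<close> is the basis of the cocharacter lattice.\<close>

definition torus_element ::
    "('a, 'f::field) alg_group \<Rightarrow> nat \<Rightarrow> (nat \<Rightarrow> 'f \<Rightarrow> 'a) \<Rightarrow> (nat \<Rightarrow> 'f) \<Rightarrow> 'a" where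
  "torus_element G n lam x = word_prod G (\<lambda>k. lam k (x k)) [1..<Suc n]"

text \<open>The \<open>k\<close>-th coordinate of \<open>t\<^sub>i\<close>; \<open>d i\<close> stands for the free parameter \<open>a\<^bsub>i,i\<^esub>\<close>.\<close>

definition section_coord ::
    "nat \<Rightarrow> 'f::field \<Rightarrow> 'f \<Rightarrow> 'f \<Rightarrow> (nat \<Rightarrow> 'f) \<Rightarrow> nat \<Rightarrow> nat \<Rightarrow> 'f" where
  "section_coord n a b c d i k =
     (let x = inverse a * b in
      if i = 1 then
        (if k = 1 then inverse a
         else if k \<le> n - 2 then (if even k then a ^ (k div 2) else b * a ^ ((k - 3) div 2))
         else if k = n - 1 then c * x ^ (n div 2)
         else c * x ^ ((n - 2) div 2))
      else if k = i then d i
      else if k \<in> {n - 1, n} then c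
      else 1)"

definition has_parameters ::
    "('a, 'f::field) alg_group \<Rightarrow> nat \<Rightarrow> (nat \<Rightarrow> 'a set) \<Rightarrow> (nat \<Rightarrow> 'a) \<Rightarrow> (nat \<Rightarrow> 'f \<Rightarrow> 'a) \<Rightarrow>
     ('a set \<Rightarrow> 'a) \<Rightarrow> 'f \<Rightarrow> 'f \<Rightarrow> 'f \<Rightarrow> (nat \<Rightarrow> 'f) \<Rightarrow> bool" where
  "has_parameters G n s \<sigma> lam S a b c d \<longleftrightarrow>
     a \<noteq> 0 \<and> b \<noteq> 0 \<and> c \<noteq> 0 \<and> (\<forall>i\<in>{2..n}. d i \<noteq> 0) \<and> c\<^sup>2 = 1 \<and> a ^ 3 = b\<^sup>2 \<and>
     (\<forall>i\<in>{1..n}. S (s i) = torus_element G n lam (section_coord n a b c d i) \<otimes>\<^bsub>G\<^esub> \<sigma> i)"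

text \<open>The value is well defined, since \<open>c\<close> is the \<open>n\<close>-th coordinate of \<open>t\<^sub>2\<close>.\<close>

definition c_value ::
    "('a, 'f::field) alg_group \<Rightarrow> nat \<Rightarrow> (nat \<Rightarrow> 'a set) \<Rightarrow> (nat \<Rightarrow> 'a) \<Rightarrow> (nat \<Rightarrow> 'f \<Rightarrow> 'a) \<Rightarrow>
     ('a set \<Rightarrow> 'a) \<Rightarrow> 'f" where
  "c_value G n s \<sigma> lam S = (THE c. \<exists>a b d. has_parameters G n s \<sigma> lam S a b c d)"

end

theory Submission
  imports Defs "HOL-Algebra.Zassenhaus"
begin

text \<open>A section \<open>S\<close> is determined by the elements \<open>t\<^sub>i\<close> of \<open>T\<close> with \<open>S (s\<^sub>i) = t\<^sub>i \<sigma>\<^sub>i\<close>, and the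
  braid relations leave little freedom: they force \<open>t\<^sub>i = \<alpha>\<^sub>i\<^sup>\<or>(d\<^sub>i) z\<^sub>c\<close>, where the \<open>d\<^sub>i\<close> are
  non-zero scalars, \<open>c = \<plusminus>1\<close>, and \<open>z\<^sub>c = \<alpha>\<^sub>n\<^sub>-\<^sub>1\<^sup>\<or>(c) \<alpha>\<^sub>n\<^sup>\<or>(c)\<close> is one central element of order at most
  two for all \<open>i\<close> (\<open>section_form\<close>). Both parts of the theorem are read off from this form. The
  factor \<open>z\<^sub>c\<close> squares to 1 and the factor \<open>\<alpha>\<^sub>i\<^sup>\<or>(d\<^sub>i)\<close> is inverted by the reflection, so
  \<open>S (s\<^sub>i)\<^sup>2 = \<sigma>\<^sub>i\<^sup>2 = \<alpha>\<^sub>i\<^sup>\<or>(-1)\<close> (\<open>square_of_lift\<close>). For the half-spin lattice this is never 1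
  (\<open>coroot_minus_one\<close>), hence every \<open>S (s\<^sub>i)\<close> has order 4, and a partial order on a single
  profile is trivial. Conjugation by \<open>t\<close> in \<open>T\<close> multiplies \<open>d\<^sub>i\<close> by \<open>\<alpha>\<^sub>i(t)\<close> and fixes \<open>c\<close>
  (\<open>conj_lift\<close>); as the simple roots take arbitrary prescribed values on \<open>T\<close>
  (\<open>simple_roots_surjective\<close>), the conjugacy classes are exactly the values of \<open>c\<close>.

  To obtain the form of \<open>t\<^sub>i\<close>, the relations are compared coordinate by coordinate in the basis
  \<open>\<omega>\<^sub>n\<^sub>-\<^sub>1, \<alpha>\<^sub>2\<^sup>\<or>, \<dots>, \<alpha>\<^sub>n\<^sup>\<or>\<close> (\<open>braid_coordinates\<close>). A commuting pair \<open>i, j\<close> yields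
  \<open>\<alpha>\<^sub>i\<^sup>\<or>(\<alpha>\<^sub>i(t\<^sub>j)) = \<alpha>\<^sub>j\<^sup>\<or>(\<alpha>\<^sub>j(t\<^sub>i))\<close>, which by independence of the two coroots makes both sides
  trivial; an adjacent pair says that \<open>t\<^sub>i\<close> and \<open>t\<^sub>j\<close> agree up to values of the two coroots.
  Walking along the diagram, these conditions pin down all coordinates except the \<open>i\<close>-th
  coordinate of \<open>t\<^sub>i\<close>, a scalar for \<open>t\<^sub>1\<close>, and the common sign \<open>c\<close>.

  Three facts about the group have to be supplied first. The first is that \<open>\<omega>\<^sub>n\<^sub>-\<^sub>1, \<alpha>\<^sub>2\<^sup>\<or>, \<dots>, \<alpha>\<^sub>n\<^sup>\<or>\<close>
  really is a basis of the cocharacters and gives coordinates on \<open>T\<close> (\<open>coordinates_exist\<close>). The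
  lattice is generated by these and \<open>\<alpha>\<^sub>1\<^sup>\<or>\<close>, and \<open>\<alpha>\<^sub>1\<^sup>\<or>\<close> is redundant because it has the same
  pairings with the simple roots as an integral combination of the others (\<open>first_coroot\<close>). That
  pairings determine a cocharacter is where almost-simplicity enters: a cocharacter killed by
  all roots has a central image (\<open>central_if_roots_trivial\<close>), and the Zariski closure of a
  central image is a connected closed normal subgroup, hence trivial
  (\<open>central_cocharacter_trivial\<close>). The centrality rests on the principle that a semisimple
  element acting trivially on the Lie algebra of a connected group is central
  (\<open>centralizer_of_semisimple\<close>).

  The second fact is that the simple reflections satisfy the braid relations in \<open>N/T\<close>
  (\<open>weyl_commute\<close>, \<open>weyl_braid\<close>). Both express that an element of \<open>N\<close> taking \<open>\<alpha>\<close> to \<open>\<beta>\<close>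
  conjugates \<open>\<sigma>\<^sub>\<alpha>\<close> into \<open>T \<sigma>\<^sub>\<beta>\<close> (\<open>conj_tits_lift\<close>). The conjugate and a suitable \<open>T\<close>-multiple of
  \<open>\<sigma>\<^sub>\<beta>\<close> induce the same automorphism of \<open>T\<close>, so they differ by an element that centralizes \<open>T\<close>;
  it lies in a conjugate of the root subgroup of \<open>-\<beta>\<close>, and such an element can only be 1
  (\<open>opposite_root_centralizing\<close>).

  The third fact is that the two sides of a braid relation are reduced words (\<open>reduced_pair\<close>,
  \<open>reduced_triple\<close>), so that multiplicativity of a section along reduced words transports the
  relation to \<open>N\<close>. Shorter words are excluded by comparing which elements of \<open>T\<close> they fix, on
  elements with prescribed values of the simple roots.\<close>

section \<open>Characters and their linear independence\<close>

text \<open>If the field were finite, the polynomial \<open>1 + \<Prod>a. (X - a)\<close> would take the value 1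
  everywhere.\<close>

lemma infinite_alg_closed: "infinite (UNIV :: 'f::alg_closed_field set)"
proof
  assume fin: "finite (UNIV :: 'f set)"
  define p :: "'f poly" where "p = (\<Prod>a\<in>UNIV. [:- a, 1:])"
  have roots: "poly p x = 0" for x
    unfolding p_def poly_prod using fin by (intro prod_zero) auto
  have "degree p = (\<Sum>a\<in>(UNIV::'f set). degree [:- a, 1:])"
    unfolding p_def by (intro degree_prod_eq_sum_degree) auto
  then have "degree p > 0" using fin by (simp add: card_gt_0_iff)
  then have "degree (p + 1) > 0"
    by (metis add.commute degree_1 degree_add_eq_right)
  then obtain x where "poly (p + 1) x = 0"
    using alg_closed_imp_poly_has_root by blast
  then show False using roots by simp
qed

lemma poly_eq_if_agree:
  fixes p q :: "'f::alg_closed_field poly"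
  assumes "\<And>x. x \<noteq> 0 \<Longrightarrow> poly p x = poly q x"
  shows "p = q"
proof (rule ccontr)
  assume "p \<noteq> q"
  then have "finite {x. poly (p - q) x = 0}" by (intro poly_roots_finite) simp
  moreover have "UNIV - {0} \<subseteq> {x. poly (p - q) x = 0}" using assms by auto
  ultimately have "finite (UNIV - {0 :: 'f})" by (rule finite_subset[rotated])
  then have "finite (UNIV :: 'f set)" by simp
  then show False using infinite_alg_closed by blast
qed

lemma power_int_all_one:
  fixes k :: int
  assumes "\<And>x::'f::alg_closed_field. x \<noteq> 0 \<Longrightarrow> x powi k = 1"
  shows "k = 0"
proof -
  have pos: "m = 0" if "\<And>x::'f. x \<noteq> 0 \<Longrightarrow> x ^ m = 1" for m :: nat
  proof -
    have "Polynomial.monom 1 m = (1 :: 'f poly)"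
      by (rule poly_eq_if_agree) (simp add: poly_monom that)
    then show "m = 0" by (metis degree_1 degree_monom_eq one_neq_zero)
  qed
  show ?thesis
  proof (cases "k \<ge> 0")
    case True
    then have "nat k = 0" using assms by (intro pos) (simp add: power_int_def)
    with True show ?thesis by simp
  next
    case False
    have "nat (- k) = 0"
    proof (rule pos)
      fix x :: 'f assume "x \<noteq> 0"
      with assms[of "inverse x"] False show "x ^ nat (- k) = 1" by (simp add: power_int_def)
    qed
    with False show ?thesis by simp
  qed
qed

lemma power_int_exponent_unique:
  fixes k l :: int
  assumes "\<And>x::'f::alg_closed_field. x \<noteq> 0 \<Longrightarrow> x powi k = x powi l"
  shows "k = l"
proof -
  have "k - l = 0"
    by (rule power_int_all_one[where 'f = 'f]) (simp add: power_int_diff assms)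
  then show ?thesis by simp
qed

text \<open>Dedekind's lemma. Subtracting \<open>\<eta>\<^sub>a(y)\<close> times the relation at \<open>x\<close> from the relation at
  \<open>m x y\<close> removes the term of \<open>a\<close> and multiplies the coefficient of \<open>k\<close> by \<open>\<eta>\<^sub>k(y) - \<eta>\<^sub>a(y)\<close>,
  which is non-zero for a suitable \<open>y\<close>.\<close>

lemma characters_independent:
  fixes \<eta> :: "'k \<Rightarrow> 'a \<Rightarrow> 'f::field"
  assumes "finite K"
    and "\<And>x y. x \<in> H \<Longrightarrow> y \<in> H \<Longrightarrow> m x y \<in> H"
    and "\<And>k x y. k \<in> K \<Longrightarrow> x \<in> H \<Longrightarrow> y \<in> H \<Longrightarrow> \<eta> k (m x y) = \<eta> k x * \<eta> k y"
    and "\<And>k. k \<in> K \<Longrightarrow> \<exists>x\<in>H. \<eta> k x \<noteq> 0"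
    and "\<And>k l. k \<in> K \<Longrightarrow> l \<in> K \<Longrightarrow> k \<noteq> l \<Longrightarrow> \<exists>x\<in>H. \<eta> k x \<noteq> \<eta> l x"
    and "\<And>x. x \<in> H \<Longrightarrow> (\<Sum>k\<in>K. c k * \<eta> k x) = 0"
  shows "\<forall>k\<in>K. c k = 0"
  using assms
proof (induction K arbitrary: c rule: finite_induct)
  case empty
  then show ?case by simp
next
  case (insert a K)
  have key: "c k = 0" if k: "k \<in> K" for k
  proof -
    obtain y where y: "y \<in> H" "\<eta> k y \<noteq> \<eta> a y"
      using insert.prems(4)[of k a] k insert.hyps(2) by auto
    have "\<forall>k\<in>K. c k * (\<eta> k y - \<eta> a y) = 0"
    proof (rule insert.IH)
      fix x assume x: "x \<in> H"
      have "0 = (\<Sum>k\<in>insert a K. c k * \<eta> k (m x y)) - \<eta> a y * (\<Sum>k\<in>insert a K. c k * \<eta> k x)"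
        using insert.prems(5)[of x] insert.prems(5)[of "m x y"] insert.prems(1) x y by simp
      also have "(\<Sum>k\<in>insert a K. c k * \<eta> k (m x y)) = (\<Sum>k\<in>insert a K. c k * (\<eta> k x * \<eta> k y))"
        by (intro sum.cong refl) (use insert.prems(2) x y in auto)
      also have "\<dots> - \<eta> a y * (\<Sum>k\<in>insert a K. c k * \<eta> k x) =
          (\<Sum>k\<in>insert a K. c k * (\<eta> k y - \<eta> a y) * \<eta> k x)"
        by (simp add: sum_distrib_left sum_subtractf[symmetric] algebra_simps del: sum.insert)
      also have "\<dots> = (\<Sum>k\<in>K. c k * (\<eta> k y - \<eta> a y) * \<eta> k x)"
        using insert.hyps by simp
      finally show "(\<Sum>k\<in>K. c k * (\<eta> k y - \<eta> a y) * \<eta> k x) = 0" by simp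
    qed (use insert.prems in auto)
    then have "c k * (\<eta> k y - \<eta> a y) = 0" using k by blast
    then show ?thesis using y by simp
  qed
  obtain x where x: "x \<in> H" "\<eta> a x \<noteq> 0" using insert.prems(3)[of a] by auto
  have "c a * \<eta> a x + (\<Sum>k\<in>K. c k * \<eta> k x) = 0"
    using insert.prems(5)[OF x(1)] insert.hyps by simp
  then have "c a = 0" using key x(2) by simp
  with key show ?case by simp
qed

definition char_span :: "'a set \<Rightarrow> ('a \<Rightarrow> 'f::field) set \<Rightarrow> ('a \<Rightarrow> 'f) set" where
  "char_span H C = {f. \<exists>K c. finite K \<and> K \<subseteq> C \<and> (\<forall>x\<in>H. f x = (\<Sum>\<eta>\<in>K. c \<eta> * \<eta> x))}"

lemma char_span_single: "\<eta> \<in> C \<Longrightarrow> (\<And>x. x \<in> H \<Longrightarrow> f x = a * \<eta> x) \<Longrightarrow> f \<in> char_span H C"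
  unfolding char_span_def by (auto intro!: exI[of _ "{\<eta>}"] exI[of _ "\<lambda>_. a"])

lemma char_span_add:
  assumes "f \<in> char_span H C" "g \<in> char_span H C"
  shows "(\<lambda>x. f x + g x) \<in> char_span H C"
proof -
  obtain K c where K: "finite K" "K \<subseteq> C" "\<And>x. x \<in> H \<Longrightarrow> f x = (\<Sum>\<eta>\<in>K. c \<eta> * \<eta> x)"
    using assms(1) unfolding char_span_def by blast
  obtain L d where L: "finite L" "L \<subseteq> C" "\<And>x. x \<in> H \<Longrightarrow> g x = (\<Sum>\<eta>\<in>L. d \<eta> * \<eta> x)"
    using assms(2) unfolding char_span_def by blast
  define e where "e \<eta> = (if \<eta> \<in> K then c \<eta> else 0) + (if \<eta> \<in> L then d \<eta> else 0)" for \<eta>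
  have "f x + g x = (\<Sum>\<eta>\<in>K \<union> L. e \<eta> * \<eta> x)" if "x \<in> H" for x
  proof -
    have "(\<Sum>\<eta>\<in>K. c \<eta> * \<eta> x) = (\<Sum>\<eta>\<in>K \<union> L. (if \<eta> \<in> K then c \<eta> else 0) * \<eta> x)"
      by (intro sum.mono_neutral_cong_left) (use K(1) L(1) in auto)
    moreover have "(\<Sum>\<eta>\<in>L. d \<eta> * \<eta> x) = (\<Sum>\<eta>\<in>K \<union> L. (if \<eta> \<in> L then d \<eta> else 0) * \<eta> x)"
      by (intro sum.mono_neutral_cong_left) (use K(1) L(1) in auto)
    ultimately show ?thesis
      using K(3)[OF that] L(3)[OF that] by (simp add: e_def sum.distrib distrib_right)
  qed
  then show ?thesis using K L unfolding char_span_def by blast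
qed

lemma char_span_cong: "(\<And>x. x \<in> H \<Longrightarrow> f x = g x) \<Longrightarrow> f \<in> char_span H C \<Longrightarrow> g \<in> char_span H C"
  unfolding char_span_def by auto

lemma char_span_sum:
  assumes "finite I" "\<And>i. i \<in> I \<Longrightarrow> f i \<in> char_span H C"
  shows "(\<lambda>x. \<Sum>i\<in>I. f i x) \<in> char_span H C"
  using assms
proof (induction I rule: finite_induct)
  case empty
  show ?case unfolding char_span_def by (auto intro!: exI[of _ "{}"])
next
  case (insert a I)
  have "(\<lambda>x. f a x + (\<Sum>i\<in>I. f i x)) \<in> char_span H C"
    by (intro char_span_add insert) (use insert in auto)
  then show ?case using insert.hyps by simp
qed

lemma char_span_mult:
  assumes C: "\<And>\<eta> \<xi>. \<eta> \<in> C \<Longrightarrow> \<xi> \<in> C \<Longrightarrow> (\<lambda>x\<in>H. \<eta> x * \<xi> x) \<in> C"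
    and "f \<in> char_span H C" "g \<in> char_span H C"
  shows "(\<lambda>x. f x * g x) \<in> char_span H C"
proof -
  obtain K c where K: "finite K" "K \<subseteq> C" "\<And>x. x \<in> H \<Longrightarrow> f x = (\<Sum>\<eta>\<in>K. c \<eta> * \<eta> x)"
    using assms(2) unfolding char_span_def by blast
  obtain L d where L: "finite L" "L \<subseteq> C" "\<And>x. x \<in> H \<Longrightarrow> g x = (\<Sum>\<eta>\<in>L. d \<eta> * \<eta> x)"
    using assms(3) unfolding char_span_def by blast
  have "(\<lambda>x. \<Sum>\<eta>\<in>K. \<Sum>\<xi>\<in>L. c \<eta> * d \<xi> * (\<eta> x * \<xi> x)) \<in> char_span H C"
    by (intro char_span_sum K(1) L(1)) 
      (rule char_span_single[OF C], use K(2) L(2) in auto)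
  then show ?thesis
    by (rule char_span_cong[rotated]) (simp add: K(3) L(3) sum_product algebra_simps)
qed

text \<open>Since \<open>C\<close> is closed under products and contains the trivial character, its span is an
  algebra, so only generators need to be examined. The map \<open>p\<close> is a change of variables, such as
  coordinates on a torus.\<close>

lemma fun_algebra_char_span:
  assumes C: "\<And>\<eta> \<xi>. \<eta> \<in> C \<Longrightarrow> \<xi> \<in> C \<Longrightarrow> (\<lambda>x\<in>H. \<eta> x * \<xi> x) \<in> C"
    and one: "(\<lambda>x\<in>H. 1) \<in> C"
    and gens: "\<And>f. f \<in> B \<Longrightarrow> (\<lambda>x. f (p x)) \<in> char_span H C"
    and "f \<in> fun_algebra B"
  shows "(\<lambda>x. f (p x)) \<in> char_span H C"
  using assms(4)
proof induction
  case (const c)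
  show ?case by (rule char_span_single[OF one, of _ _ c]) simp
next
  case (gen f) then show ?case by (rule gens)
next
  case (add f g) show ?case by (rule char_span_add[OF add.IH])
next
  case (mult f g) show ?case by (rule char_span_mult[OF C mult.IH])
qed

text \<open>Linear independence leaves no room for a further character in the span of \<open>C\<close>. This
  identifies regular homomorphisms to the multiplicative group once the regular functions are
  known to be spanned by explicit characters.\<close>

lemma character_in_char_span:
  fixes \<eta> :: "'a \<Rightarrow> 'f::field"
  assumes m: "\<And>x y. x \<in> H \<Longrightarrow> y \<in> H \<Longrightarrow> m x y \<in> H"
    and C: "\<And>\<xi> x y. \<xi> \<in> insert \<eta> C \<Longrightarrow> x \<in> H \<Longrightarrow> y \<in> H \<Longrightarrow> \<xi> (m x y) = \<xi> x * \<xi> y"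
    and nz: "\<And>\<xi>. \<xi> \<in> insert \<eta> C \<Longrightarrow> \<exists>x\<in>H. \<xi> x \<noteq> 0"
    and ext: "insert \<eta> C \<subseteq> extensional H"
    and span: "\<eta> \<in> char_span H C"
  shows "\<eta> \<in> C"
proof (rule ccontr)
  assume n: "\<eta> \<notin> C"
  obtain K c where K: "finite K" "K \<subseteq> C" "\<And>x. x \<in> H \<Longrightarrow> \<eta> x = (\<Sum>\<xi>\<in>K. c \<xi> * \<xi> x)"
    using span unfolding char_span_def by blast
  have nK: "\<eta> \<notin> K" using n K(2) by blast
  define d where "d = c(\<eta> := - 1)"
  have "\<forall>\<xi>\<in>insert \<eta> K. d \<xi> = 0"
  proof (rule characters_independent[where H = H and m = m and \<eta> = "\<lambda>\<xi>. \<xi>"])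
    fix \<xi> \<xi>' assume *: "\<xi> \<in> insert \<eta> K" "\<xi>' \<in> insert \<eta> K" "\<xi> \<noteq> \<xi>'"
    then have "\<xi> \<in> extensional H" "\<xi>' \<in> extensional H" using ext K(2) by auto
    then show "\<exists>x\<in>H. \<xi> x \<noteq> \<xi>' x" using *(3) by (meson extensionalityI)
  next
    fix x assume x: "x \<in> H"
    have "(\<Sum>\<xi>\<in>K. d \<xi> * \<xi> x) = (\<Sum>\<xi>\<in>K. c \<xi> * \<xi> x)"
      by (intro sum.cong refl) (use nK in \<open>auto simp: d_def\<close>)
    then show "(\<Sum>\<xi>\<in>insert \<eta> K. d \<xi> * \<xi> x) = 0"
      using K(1) nK K(3)[OF x] by (simp add: d_def)
  next
    show "finite (insert \<eta> K)" using K(1) by simp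
  next
    fix \<xi> x y assume "\<xi> \<in> insert \<eta> K" "x \<in> H" "y \<in> H"
    with K(2) show "\<xi> (m x y) = \<xi> x * \<xi> y" by (intro C) auto
  next
    fix \<xi> assume "\<xi> \<in> insert \<eta> K"
    with K(2) show "\<exists>x\<in>H. \<xi> x \<noteq> 0" by (intro nz) auto
  qed (rule m)
  then show False by (simp add: d_def)
qed

section \<open>The multiplicative group\<close>

lemma carrier_Gm [simp]: "carrier Gm = {x. x \<noteq> 0}"
  and mult_Gm [simp]: "x \<otimes>\<^bsub>Gm\<^esub> y = x * y"
  and one_Gm [simp]: "\<one>\<^bsub>Gm\<^esub> = 1"
  and reg_Gm: "reg Gm = fun_algebra {\<lambda>x. x, inverse}"
  by (simp_all add: Gm_def)

text \<open>The regular functions on the multiplicative group are the Laurent polynomials, and the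
  Laurent monomials are characters; a homomorphism among their combinations is one of them.\<close>

lemma alg_hom_Gm_power:
  fixes f :: "'f::alg_closed_field \<Rightarrow> 'f"
  assumes "f \<in> alg_hom Gm Gm"
  shows "\<exists>k::int. \<forall>x. x \<noteq> 0 \<longrightarrow> f x = x powi k"
proof -
  define C :: "('f \<Rightarrow> 'f) set" where "C = {(\<lambda>x\<in>{x. x \<noteq> 0}. x powi k) | k::int. True}"
  have "(\<lambda>x. x) \<in> reg Gm" unfolding reg_Gm by (rule fun_algebra.gen) simp
  then obtain g where g: "g \<in> fun_algebra {\<lambda>x. x, inverse}" "\<And>x. x \<noteq> 0 \<Longrightarrow> f x = g x"
    using assms unfolding alg_hom_def reg_Gm[symmetric] by fastforce
  have prod: "(\<lambda>x\<in>{x. x \<noteq> 0}. \<eta> x * \<xi> x) \<in> C" if "\<eta> \<in> C" "\<xi> \<in> C" for \<eta> \<xi>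
  proof -
    have "\<exists>k::int. \<eta> = (\<lambda>x\<in>{x. x \<noteq> 0}. x powi k)" "\<exists>l::int. \<xi> = (\<lambda>x\<in>{x. x \<noteq> 0}. x powi l)"
      using that by (auto simp add: C_def)
    then obtain k l :: int where "\<eta> = (\<lambda>x\<in>{x. x \<noteq> 0}. x powi k)" "\<xi> = (\<lambda>x\<in>{x. x \<noteq> 0}. x powi l)"
      by (elim exE) (rule that)
    then show ?thesis unfolding C_def
      by (auto intro!: exI[of _ "k + l"] simp: power_int_add restrict_def)
  qed
  have one: "(\<lambda>x\<in>{x. x \<noteq> 0}. 1) \<in> C" unfolding C_def
    by (auto intro!: exI[of _ 0])
  have "(\<lambda>x. g x) \<in> char_span {x. x \<noteq> 0} C"
  proof (rule fun_algebra_char_span[OF prod one _ g(1)])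
    fix h :: "'f \<Rightarrow> 'f" assume "h \<in> {\<lambda>x. x, inverse}"
    then consider "h = (\<lambda>x. x)" | "h = inverse" by blast
    then show "(\<lambda>x. h x) \<in> char_span {x. x \<noteq> 0} C"
    proof cases
      case 1
      show ?thesis
        by (rule char_span_single[of "\<lambda>x\<in>{x. x \<noteq> 0}. x powi 1" _ _ _ 1]) (auto simp: C_def 1 restrict_def intro!: exI[of _ 1])
    next
      case 2
      show ?thesis
        by (rule char_span_single[of "\<lambda>x\<in>{x. x \<noteq> 0}. x powi (- 1)" _ _ _ 1])
          (auto simp: C_def 2 power_int_minus restrict_def intro!: exI[of _ "- 1"])
    qed
  qed auto
  then have "(\<lambda>x\<in>{x. x \<noteq> 0}. f x) \<in> char_span {x. x \<noteq> 0} C"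
    by (rule char_span_cong[rotated]) (simp add: g)
  then have "(\<lambda>x\<in>{x. x \<noteq> 0}. f x) \<in> C"
  proof (rule character_in_char_span[where m = "(*)", rotated 4])
    fix \<xi> and x y :: 'f assume *: "\<xi> \<in> insert (\<lambda>x\<in>{x. x \<noteq> 0}. f x) C" "x \<in> {x. x \<noteq> 0}" "y \<in> {x. x \<noteq> 0}"
    have "f (x * y) = f x * f y" 
      using assms * unfolding alg_hom_def hom_def by auto
    with * show "\<xi> (x * y) = \<xi> x * \<xi> y" unfolding C_def by (auto simp: power_int_mult_distrib)
  next
    fix \<xi> assume *: "\<xi> \<in> insert (\<lambda>x\<in>{x. x \<noteq> 0}. f x) C"
    have "f 1 \<noteq> 0" using assms unfolding alg_hom_def hom_def by auto
    with * show "\<exists>x\<in>{x. x \<noteq> 0}. \<xi> x \<noteq> 0"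
      unfolding C_def by (intro bexI[of _ 1]) auto
  qed (auto simp: C_def)
  then obtain k :: int where k: "(\<lambda>x\<in>{x. x \<noteq> 0}. f x) = (\<lambda>x\<in>{x. x \<noteq> 0}. x powi k)"
    unfolding C_def by blast
  have "f x = x powi k" if "x \<noteq> 0" for x
    using fun_cong[OF k, of x] that by simp
  then show ?thesis by blast
qed

text \<open>A regular function on the multiplicative group becomes a polynomial after multiplication
  by a power of the variable. Finiteness of zero sets is how irreducibility of the
  multiplicative group is used below.\<close>

lemma reg_Gm_zeros:
  fixes f :: "'f::alg_closed_field \<Rightarrow> 'f"
  assumes "f \<in> reg Gm" "f x \<noteq> 0" "x \<noteq> 0"
  shows "finite {y. y \<noteq> 0 \<and> f y = 0}"
proof -
  have "\<exists>p N. \<forall>y. y \<noteq> 0 \<longrightarrow> y ^ N * f y = poly p y"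
    using assms(1) unfolding reg_Gm
  proof induction
    case (const c)
    show ?case by (rule exI[of _ "[:c:]"], rule exI[of _ 0]) simp
  next
    case (gen f)
    then consider "f = (\<lambda>x. x)" | "f = inverse" by blast
    then show ?case
    proof cases
      case 1 show ?thesis by (rule exI[of _ "[:0, 1:]"], rule exI[of _ 0]) (simp add: 1)
    next
      case 2 show ?thesis by (rule exI[of _ "[:1:]"], rule exI[of _ 1]) (simp add: 2)
    qed
  next
    case (add f g)
    obtain p N where f: "\<forall>y. y \<noteq> 0 \<longrightarrow> y ^ N * f y = poly p y" using add.IH(1) by blast
    obtain q M where g: "\<forall>y. y \<noteq> 0 \<longrightarrow> y ^ M * g y = poly q y" using add.IH(2) by blast
    have "y ^ (N + M) * (f y + g y) = y ^ M * (y ^ N * f y) + y ^ N * (y ^ M * g y)" for y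
      by (simp add: power_add algebra_simps)
    then show ?case
      by (intro exI[of _ "Polynomial.monom 1 M * p + Polynomial.monom 1 N * q"] exI[of _ "N + M"])
        (simp add: poly_monom f g)
  next
    case (mult f g)
    obtain p N where f: "\<forall>y. y \<noteq> 0 \<longrightarrow> y ^ N * f y = poly p y" using mult.IH(1) by blast
    obtain q M where g: "\<forall>y. y \<noteq> 0 \<longrightarrow> y ^ M * g y = poly q y" using mult.IH(2) by blast
    show ?case
    proof (intro exI[of _ "p * q"] exI[of _ "N + M"] allI impI)
      fix y :: 'f assume y: "y \<noteq> 0"
      have "y ^ (N + M) * (f y * g y) = (y ^ N * f y) * (y ^ M * g y)"
        by (simp add: power_add algebra_simps)
      then show "y ^ (N + M) * (f y * g y) = poly (p * q) y"
        using f[rule_format, OF y] g[rule_format, OF y] by (simp only: poly_mult)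
    qed
  qed
  then obtain p N where p: "\<And>y. y \<noteq> 0 \<Longrightarrow> y ^ N * f y = poly p y" by blast
  have "p \<noteq> 0" using p[OF assms(3)] assms(2,3) by auto
  then have "finite {y. poly p y = 0}" by (rule poly_roots_finite)
  then show ?thesis by (rule rev_finite_subset) (use p in force)
qed

lemma alg_hom_compose:
  assumes f: "f \<in> alg_hom X Y" and g: "g \<in> alg_hom Y Z"
  shows "(\<lambda>x. g (f x)) \<in> alg_hom X Z"
proof -
  have m: "f x \<in> carrier Y" if "x \<in> carrier X" for x
    using f that unfolding alg_hom_def hom_def by auto
  have "(\<lambda>x. g (f x)) \<in> hom X Z"
    using f g unfolding alg_hom_def hom_def by (auto simp: Pi_iff)
  moreover have "\<exists>k\<in>reg X. \<forall>x\<in>carrier X. h (g (f x)) = k x" if h: "h \<in> reg Z" for h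
  proof -
    obtain k where k: "k \<in> reg Y" "\<And>y. y \<in> carrier Y \<Longrightarrow> h (g y) = k y"
      using g h unfolding alg_hom_def by blast
    obtain l where "l \<in> reg X" "\<And>x. x \<in> carrier X \<Longrightarrow> k (f x) = l x"
      using f k(1) unfolding alg_hom_def by blast
    then show ?thesis using k m by auto
  qed
  ultimately show ?thesis unfolding alg_hom_def by blast
qed

lemma alg_hom_cong:
  assumes f: "f \<in> alg_hom X Y" and g: "\<And>x. x \<in> carrier X \<Longrightarrow> f x = g x"
    and X: "\<And>x y. x \<in> carrier X \<Longrightarrow> y \<in> carrier X \<Longrightarrow> x \<otimes>\<^bsub>X\<^esub> y \<in> carrier X"
  shows "g \<in> alg_hom X Y"
  using assms unfolding alg_hom_def hom_def by (auto simp: Pi_iff)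

lemma alg_homI:
  assumes "f \<in> hom X Y" "\<And>g. g \<in> reg Y \<Longrightarrow> (\<lambda>x. g (f x)) \<in> reg X"
  shows "f \<in> alg_hom X Y"
  using assms unfolding alg_hom_def by (auto intro!: bexI)

lemma fun_algebra_compose:
  assumes "\<And>f. f \<in> B \<Longrightarrow> (\<lambda>x. f (p x)) \<in> fun_algebra B'" "f \<in> fun_algebra B"
  shows "(\<lambda>x. f (p x)) \<in> fun_algebra B'"
  using assms(2) by induction (auto intro: fun_algebra.intros assms(1))

lemma fun_algebra_mono: "B \<subseteq> B' \<Longrightarrow> f \<in> fun_algebra B \<Longrightarrow> f \<in> fun_algebra B'"
  by (rule fun_algebra_compose[where p = "\<lambda>x. x"]) (auto intro: fun_algebra.gen)

lemma fun_algebra_sum: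
  "finite I \<Longrightarrow> (\<And>i. i \<in> I \<Longrightarrow> f i \<in> fun_algebra B) \<Longrightarrow> (\<lambda>x. \<Sum>i\<in>I. f i x) \<in> fun_algebra B"
  by (induction I rule: finite_induct) (auto intro: fun_algebra.intros)

lemma fun_algebra_prod:
  "finite I \<Longrightarrow> (\<And>i. i \<in> I \<Longrightarrow> f i \<in> fun_algebra B) \<Longrightarrow> (\<lambda>x. \<Prod>i\<in>I. f i x) \<in> fun_algebra B"
  by (induction I rule: finite_induct) (auto intro: fun_algebra.intros)

lemma fun_algebra_diff:
  assumes "f \<in> fun_algebra B" "g \<in> fun_algebra B"
  shows "(\<lambda>x. f x - g x) \<in> fun_algebra B"
proof -
  have "(\<lambda>x. f x + (- 1) * g x) \<in> fun_algebra B"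
    by (intro fun_algebra.intros assms)
  then show ?thesis by simp
qed

section \<open>Polynomial functions on matrices\<close>

abbreviation polyfun :: "('f::field^'m::finite^'m \<Rightarrow> 'f) set" where
  "polyfun \<equiv> fun_algebra matrix_entries"

text \<open>Indexing the entries by pairs makes coordinates of the space of matrices a single family,
  so that sums over all entries are not nested.\<close>

definition ent :: "'f^'m^'m \<Rightarrow> 'm \<times> 'm \<Rightarrow> 'f" where
  "ent A p = A $ fst p $ snd p"

lemma ent_simps [simp]:
  "ent (A + B) p = ent A p + ent B p" "ent (A - B) p = ent A p - ent B p" "ent 0 p = 0"
  for A B :: "'f::field^'m::finite^'m"
  by (simp_all add: ent_def)

lemma ent_eqI: "(\<And>p. ent A p = ent B p) \<Longrightarrow> A = B"
  unfolding ent_def vec_eq_iff by (metis fst_conv snd_conv)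

lemma ent_mat_mult [simp]: "ent (mat z ** X) p = z * ent X p"
  for X :: "'f::field^'m::finite^'m"
proof -
  have "(\<Sum>k\<in>UNIV. (if fst p = k then z else 0) * X $ k $ snd p) =
      (\<Sum>k\<in>UNIV. if k = fst p then z * X $ fst p $ snd p else 0)"
    by (intro sum.cong) auto
  then show ?thesis by (simp add: ent_def matrix_matrix_mult_def mat_def)
qed

lemma ent_polyfun: "(\<lambda>A. ent A p) \<in> polyfun"
  unfolding ent_def by (rule fun_algebra.gen) (auto simp: matrix_entries_def)

lemma matrix_entriesE:
  assumes "f \<in> matrix_entries"
  obtains p where "f = (\<lambda>A. ent A p)"
proof -
  obtain i j where "f = (\<lambda>A. A $ i $ j)" using assms unfolding matrix_entries_def by blast
  then have "f = (\<lambda>A. ent A (i, j))" by (simp add: ent_def)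
  then show ?thesis by (rule that)
qed

lemma fun_algebra_matrix_mult:
  assumes "\<And>p. (\<lambda>x. ent (f x) p) \<in> fun_algebra B" "\<And>p. (\<lambda>x. ent (g x) p) \<in> fun_algebra B"
  shows "(\<lambda>x. ent (f x ** g x) p) \<in> fun_algebra B"
proof -
  have "(\<lambda>x. \<Sum>k\<in>UNIV. ent (f x) (fst p, k) * ent (g x) (k, snd p)) \<in> fun_algebra B"
    by (intro fun_algebra_sum fun_algebra.mult assms) simp
  then show ?thesis by (simp add: ent_def matrix_matrix_mult_def)
qed

lemma polyfun_compose:
  assumes "\<And>p. (\<lambda>x. ent (r x) p) \<in> fun_algebra B" "f \<in> polyfun"
  shows "(\<lambda>x. f (r x)) \<in> fun_algebra B"
  by (rule fun_algebra_compose[OF _ assms(2)]) (auto elim!: matrix_entriesE intro: assms(1))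

lemma polyfun_det:
  fixes M :: "'a \<Rightarrow> 'f::field^'k::finite^'k"
  assumes "\<And>i j. (\<lambda>x. M x $ i $ j) \<in> fun_algebra B"
  shows "(\<lambda>x. det (M x)) \<in> fun_algebra B"
  unfolding det_def
  by (intro fun_algebra_sum fun_algebra.mult fun_algebra_prod assms fun_algebra.const)
    (simp_all add: finite_permutations)

text \<open>Hadamard's lemma: \<open>f - f \<circ> r\<close> lies in the ideal generated by the entries of \<open>g - r g\<close>, by
  the product rule \<open>f h - f' h' = (f - f') h + f' (h - h')\<close>, where the prime denotes composition
  with \<open>r\<close>. With \<open>r\<close> constant it is the first-order Taylor expansion; with \<open>r\<close> a projection it
  describes the functions vanishing on a subspace.\<close>

lemma polyfun_difference:
  fixes r :: "'f::field^'m::finite^'m \<Rightarrow> 'f^'m^'m"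
  assumes r: "\<And>p. (\<lambda>g. ent (r g) p) \<in> polyfun" and "f \<in> polyfun"
  shows "\<exists>q. (\<forall>p. q p \<in> polyfun) \<and> (\<forall>g. f g - f (r g) = (\<Sum>p\<in>UNIV. ent (g - r g) p * q p g))"
  using assms(2)
proof induction
  case (const c)
  show ?case by (rule exI[of _ "\<lambda>_ _. 0"]) (simp add: fun_algebra.const)
next
  case (gen f)
  then obtain p where p: "f = (\<lambda>A. ent A p)" by (rule matrix_entriesE)
  have "ent g p - ent (r g) p = (\<Sum>p'\<in>UNIV. ent (g - r g) p' * (if p' = p then 1 else 0))" for g
    by (simp add: if_distrib[of "(*) _"] cong: if_cong)
  then show ?case unfolding p
    by (intro exI[of _ "\<lambda>p' _. if p' = p then 1 else 0"]) (simp add: fun_algebra.const)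
next
  case (add f h)
  then obtain q q' where q: "\<And>p. q p \<in> polyfun"
      "\<And>g. f g - f (r g) = (\<Sum>p\<in>UNIV. ent (g - r g) p * q p g)"
    and q': "\<And>p. q' p \<in> polyfun"
      "\<And>g. h g - h (r g) = (\<Sum>p\<in>UNIV. ent (g - r g) p * q' p g)" by blast
  have "f g + h g - (f (r g) + h (r g)) = (\<Sum>p\<in>UNIV. ent (g - r g) p * (q p g + q' p g))" for g
  proof -
    have "f g + h g - (f (r g) + h (r g)) = (f g - f (r g)) + (h g - h (r g))" by simp
    then show ?thesis unfolding q(2) q'(2) by (simp add: sum.distrib[symmetric] distrib_left)
  qed
  then show ?case
    by (intro exI[of _ "\<lambda>p g. q p g + q' p g"] conjI allI fun_algebra.add q q')
next
  case (mult f h)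
  then obtain q q' where q: "\<And>p. q p \<in> polyfun"
      "\<And>g. f g - f (r g) = (\<Sum>p\<in>UNIV. ent (g - r g) p * q p g)"
    and q': "\<And>p. q' p \<in> polyfun"
      "\<And>g. h g - h (r g) = (\<Sum>p\<in>UNIV. ent (g - r g) p * q' p g)" by blast
  have "f g * h g - f (r g) * h (r g) =
      (\<Sum>p\<in>UNIV. ent (g - r g) p * (q p g * h g + f (r g) * q' p g))" for g
  proof -
    have "f g * h g - f (r g) * h (r g) = (f g - f (r g)) * h g + f (r g) * (h g - h (r g))"
      by (simp add: algebra_simps)
    then show ?thesis unfolding q(2) q'(2)
      by (simp add: sum.distrib[symmetric] sum_distrib_left sum_distrib_right algebra_simps
          del: ent_simps)
  qed
  then show ?case
    by (intro exI[of _ "\<lambda>p g. q p g * h g + f (r g) * q' p g"] conjI allI fun_algebra.add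
        fun_algebra.mult q q' mult.hyps polyfun_compose[OF r])
qed

lemma polyfun_expand_at_one:
  fixes f :: "'f::field^'m::finite^'m \<Rightarrow> 'f"
  assumes "f \<in> polyfun"
  obtains q where "\<And>p. q p \<in> polyfun" "\<And>g. f g = f (mat 1) + (\<Sum>p\<in>UNIV. ent (g - mat 1) p * q p g)"
proof -
  obtain q where q: "\<And>p. q p \<in> polyfun"
    "\<And>g. f g - f (mat 1) = (\<Sum>p\<in>UNIV. ent (g - mat 1) p * q p g)"
    using polyfun_difference[of "\<lambda>_. mat 1" f] assms fun_algebra.const by blast
  have "f g = f (mat 1) + (\<Sum>p\<in>UNIV. ent (g - mat 1) p * q p g)" for g
    using q(2)[of g] by (simp add: algebra_simps del: ent_simps)
  with q(1) show ?thesis by (rule that)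
qed

lemma polyfun_on_line:
  fixes f :: "'f::field^'m::finite^'m \<Rightarrow> 'f"
  assumes "f \<in> polyfun"
  shows "\<exists>P. \<forall>z. poly P z = f (mat 1 + mat z ** X)"
  using assms
proof induction
  case (const c)
  show ?case by (rule exI[of _ "[:c:]"]) simp
next
  case (gen f)
  then obtain p where p: "f = (\<lambda>A. ent A p)" by (rule matrix_entriesE)
  show ?case by (rule exI[of _ "[:ent (mat 1) p, ent X p:]"]) (simp add: p)
next
  case (add f g)
  then obtain P Q where "\<forall>z. poly P z = f (mat 1 + mat z ** X)" "\<forall>z. poly Q z = g (mat 1 + mat z ** X)"
    by blast
  then show ?case by (intro exI[of _ "P + Q"]) simp
next
  case (mult f g)
  then obtain P Q where "\<forall>z. poly P z = f (mat 1 + mat z ** X)" "\<forall>z. poly Q z = g (mat 1 + mat z ** X)"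
    by blast
  then show ?case by (intro exI[of _ "P * Q"]) simp
qed

text \<open>The values \<open>q\<^sub>p(1)\<close> of the cofactors in a Taylor expansion at the identity are the partial
  derivatives there, although the cofactors themselves are not unique.\<close>

lemma derivative_along_line:
  fixes f :: "'f::field^'m::finite^'m \<Rightarrow> 'f"
  assumes q: "\<And>p. q p \<in> polyfun" "\<And>g. f g = (\<Sum>p\<in>UNIV. ent (g - mat 1) p * q p g)"
  shows "\<exists>P. (\<forall>z. poly P z = f (mat 1 + mat z ** X)) \<and>
    Polynomial.coeff P 1 = (\<Sum>p\<in>UNIV. ent X p * q p (mat 1))"
proof -
  have "\<forall>p. \<exists>Q. \<forall>z. poly Q z = q p (mat 1 + mat z ** X)" using polyfun_on_line q(1) by blast
  then obtain Q where Q: "\<And>p z. poly (Q p) z = q p (mat 1 + mat z ** X)" by metis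
  define P where "P = pCons 0 (\<Sum>p\<in>UNIV. Polynomial.smult (ent X p) (Q p))"
  have "poly P z = f (mat 1 + mat z ** X)" for z
    unfolding P_def q(2) by (simp add: poly_sum Q sum_distrib_left mult.assoc)
  moreover have "Polynomial.coeff P 1 = (\<Sum>p\<in>UNIV. ent X p * q p (mat 1))"
  proof -
    have "mat 0 ** X = 0" by (rule ent_eqI) simp
    then have "Polynomial.coeff (Q p) 0 = q p (mat 1)" for p
      using Q[of p 0] by (simp add: poly_0_coeff_0)
    then show ?thesis unfolding P_def by (simp add: coeff_sum)
  qed
  ultimately show ?thesis by blast
qed

section \<open>Linear algebraic groups\<close>

lemma group_general_linear: "Group.group (general_linear :: ('f::field^'m::finite^'m, 'f) alg_group)"
proof (rule groupI)
  fix x :: "'f^'m^'m" assume "x \<in> carrier general_linear"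
  then obtain y where "x ** y = mat 1" "y ** x = mat 1"
    unfolding general_linear_def invertible_def by auto
  then show "\<exists>y\<in>carrier general_linear. y \<otimes>\<^bsub>general_linear\<^esub> x = \<one>\<^bsub>general_linear\<^esub>"
    unfolding general_linear_def invertible_def by (auto intro!: bexI[of _ y])
next
  show "\<one>\<^bsub>general_linear\<^esub> \<in> carrier (general_linear :: ('f^'m^'m, 'f) alg_group)"
    by (auto simp: general_linear_def invertible_def intro!: exI[of _ "mat 1"])
qed (auto simp: general_linear_def invertible_mult matrix_mul_assoc)

locale linear_group =
  fixes G :: "('f::alg_closed_field^'m::finite^'m, 'f) alg_group"
  assumes linear: "linear_algebraic_group G"
begin

lemma G_eq: "\<exists>H. subgroup H general_linear \<and> G = general_linear\<lparr>carrier := H\<rparr>"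
  using linear unfolding linear_algebraic_group_def closed_subgroup_def by blast

lemma mult_G [simp]: "x \<otimes>\<^bsub>G\<^esub> y = x ** y"
  and one_G [simp]: "\<one>\<^bsub>G\<^esub> = mat 1"
  and reg_G: "reg G = fun_algebra (insert (\<lambda>A. inverse (det A)) matrix_entries)"
  using G_eq by (auto simp: general_linear_def)

lemma group_G: "Group.group G"
  using G_eq group.subgroup_imp_group[OF group_general_linear] by auto

sublocale group G by (rule group_G)

lemma polyfun_reg_G: "f \<in> polyfun \<Longrightarrow> f \<in> reg G"
  unfolding reg_G by (rule fun_algebra_mono[rotated]) auto

lemma inv_G [simp]: "x \<in> carrier G \<Longrightarrow> inv\<^bsub>G\<^esub> x ** x = mat 1" "x \<in> carrier G \<Longrightarrow> x ** inv\<^bsub>G\<^esub> x = mat 1"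
  using l_inv r_inv by auto

lemma mat_one_closed [simp]: "mat 1 \<in> carrier G" using one_closed by simp

lemma matrix_closed [simp]: "x \<in> carrier G \<Longrightarrow> y \<in> carrier G \<Longrightarrow> x ** y \<in> carrier G"
  using m_closed by simp

lemma reg_G_compose_mult:
  assumes "f \<in> reg G"
  shows "(\<lambda>x. f (a ** x ** b)) \<in> reg G"
  unfolding reg_G
proof (rule fun_algebra_compose[OF _ assms[unfolded reg_G]])
  fix h :: "'f^'m^'m \<Rightarrow> 'f" assume "h \<in> insert (\<lambda>A. inverse (det A)) matrix_entries"
  then consider "h = (\<lambda>A. inverse (det A))" | p where "h = (\<lambda>A. ent A p)"
    by (auto elim: matrix_entriesE)
  then show "(\<lambda>x. h (a ** x ** b)) \<in> fun_algebra (insert (\<lambda>A. inverse (det A)) matrix_entries)"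
  proof cases
    case 1
    have "(\<lambda>x :: 'f^'m^'m. inverse (det a * det b) * inverse (det x)) \<in>
        fun_algebra (insert (\<lambda>A. inverse (det A)) matrix_entries)"
      by (intro fun_algebra.mult fun_algebra.const fun_algebra.gen) simp
    moreover have "(\<lambda>x :: 'f^'m^'m. inverse (det a * det b) * inverse (det x)) = (\<lambda>x. h (a ** x ** b))"
      unfolding 1 by (simp add: det_mul algebra_simps)
    ultimately show ?thesis by (simp only:)
  next
    case 2
    show ?thesis unfolding 2
      by (intro fun_algebra_matrix_mult fun_algebra.const fun_algebra_mono[OF _ ent_polyfun]) auto
  qed
qed

lemma openin_zariski_G: "openin (zariski G) U \<longleftrightarrow> (\<exists>I\<subseteq>reg G. U = {x \<in> carrier G. \<exists>f\<in>I. f x \<noteq> 0})"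
  by (rule openin_zariski) (auto simp: reg_G intro: fun_algebra.mult)

lemma topspace_zariski_G: "topspace (zariski G) = carrier G"
proof
  show "topspace (zariski G) \<subseteq> carrier G"
    using openin_topspace[of "zariski G"] unfolding openin_zariski_G by blast
  have "openin (zariski G) (carrier G)" unfolding openin_zariski_G
    by (rule exI[of _ "{\<lambda>_. 1}"]) (auto simp: reg_G fun_algebra.const)
  then show "carrier G \<subseteq> topspace (zariski G)" by (rule openin_subset)
qed

lemma closedin_zariski_G:
  "closedin (zariski G) H \<longleftrightarrow> (\<exists>I\<subseteq>reg G. H = {x \<in> carrier G. \<forall>f\<in>I. f x = 0})"
proof -
  have eq: "(H \<subseteq> carrier G \<and> carrier G - H = {x \<in> carrier G. \<exists>f\<in>I. f x \<noteq> 0}) \<longleftrightarrow>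
      H = {x \<in> carrier G. \<forall>f\<in>I. f x = 0}" for I :: "('f^'m^'m \<Rightarrow> 'f) set"
  proof -
    have "{x \<in> carrier G. \<forall>f\<in>I. f x = 0} = carrier G - {x \<in> carrier G. \<exists>f\<in>I. f x \<noteq> 0}"
      by auto
    then show ?thesis by auto
  qed
  have "closedin (zariski G) H \<longleftrightarrow>
      (\<exists>I\<subseteq>reg G. H \<subseteq> carrier G \<and> carrier G - H = {x \<in> carrier G. \<exists>f\<in>I. f x \<noteq> 0})"
    unfolding closedin_def topspace_zariski_G openin_zariski_G by auto
  then show ?thesis unfolding eq .
qed

end

text \<open>Tangency in terms of differentials: \<open>X\<close> is orthogonal to the vector of partial derivatives
  at the identity of every function vanishing on \<open>G\<close>. In this form the condition is visibly
  linear in \<open>X\<close>, and double annihilators can be formed.\<close>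

lemma (in linear_group) lie_algebra_iff:
  "X \<in> lie_algebra G \<longleftrightarrow> (\<forall>f q. f \<in> polyfun \<longrightarrow> (\<forall>g\<in>carrier G. f g = 0) \<longrightarrow> (\<forall>p. q p \<in> polyfun) \<longrightarrow>
     (\<forall>g. f g = (\<Sum>p\<in>UNIV. ent (g - mat 1) p * q p g)) \<longrightarrow> (\<Sum>p\<in>UNIV. ent X p * q p (mat 1)) = 0)"
    (is "?L \<longleftrightarrow> ?R")
proof
  assume L: ?L
  show ?R
  proof (intro allI impI)
    fix f q assume *: "f \<in> polyfun" "\<forall>g\<in>carrier G. f g = 0" "\<forall>p. q p \<in> polyfun"
      "\<forall>g. f g = (\<Sum>p\<in>UNIV. ent (g - mat 1) p * q p g)"
    then obtain P where "\<forall>z. poly P z = f (mat 1 + mat z ** X)"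
        "Polynomial.coeff P 1 = (\<Sum>p\<in>UNIV. ent X p * q p (mat 1))"
      using derivative_along_line[of q f X] by blast
    with L * show "(\<Sum>p\<in>UNIV. ent X p * q p (mat 1)) = 0" unfolding lie_algebra_def by auto
  qed
next
  assume R: ?R
  show ?L unfolding lie_algebra_def
  proof (intro CollectI ballI impI allI)
    fix f P assume *: "f \<in> polyfun" "\<forall>g\<in>carrier G. f g = 0" "\<forall>z. poly P z = f (mat 1 + mat z ** X)"
    obtain q where q: "\<And>p. q p \<in> polyfun" "\<And>g. f g = f (mat 1) + (\<Sum>p\<in>UNIV. ent (g - mat 1) p * q p g)"
      using polyfun_expand_at_one[OF *(1)] by blast
    have "f (mat 1) = 0" using *(2) by simp
    with q(2) have q2: "\<And>g. f g = (\<Sum>p\<in>UNIV. ent (g - mat 1) p * q p g)" by simp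
    obtain P' where P': "\<forall>z. poly P' z = f (mat 1 + mat z ** X)"
        "Polynomial.coeff P' 1 = (\<Sum>p\<in>UNIV. ent X p * q p (mat 1))"
      using derivative_along_line[of q f X] q(1) q2 by blast
    have "P = P'" by (rule poly_eq_if_agree) (use *(3) P'(1) in simp)
    moreover have "(\<Sum>p\<in>UNIV. ent X p * q p (mat 1)) = 0"
      using R *(1,2) q(1) q2 by blast
    ultimately show "Polynomial.coeff P 1 = 0" using P'(2) by simp
  qed
qed

text \<open>A subspace is its own double annihilator: if \<open>y\<close> is outside \<open>L\<close>, a basis of \<open>L\<close> stays
  independent when \<open>y\<close> is added, so some linear form vanishes on \<open>L\<close> and not at \<open>y\<close>.\<close>

lemma mem_subspace_if_annihilated:
  fixes L :: "('f::field^'k::finite) set"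
  assumes L: "vec.subspace L"
    and ann: "\<And>x. (\<And>h. h \<in> L \<Longrightarrow> (\<Sum>p\<in>UNIV. x $ p * h $ p) = 0) \<Longrightarrow> (\<Sum>p\<in>UNIV. x $ p * y $ p) = 0"
  shows "y \<in> L"
proof (rule ccontr)
  assume y: "y \<notin> L"
  obtain B where B: "B \<subseteq> L" "vec.independent B" "L \<subseteq> vec.span B"
    using vec.maximal_independent_subset by blast
  have "vec.span B \<subseteq> L" using B(1) L by (rule vec.span_minimal)
  with y have ind: "vec.independent (insert y B)" using B(2) by (intro vec.independent_insertI) auto
  have yB: "y \<notin> B" using y B(1) by blast
  obtain k0 :: 'k where True by blast
  define v where "v = (axis k0 1 :: 'f^'k)"
  obtain g where g: "Vector_Spaces.linear (*s) (*s) g" "\<And>b. b \<in> insert y B \<Longrightarrow> g b = (if b = y then v else 0)"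
    using vec.linear_independent_extend[OF ind, of "\<lambda>b. if b = y then v else 0"] by blast
  define x where "x = (\<chi> p. matrix g $ k0 $ p)"
  have gx: "g h $ k0 = (\<Sum>p\<in>UNIV. x $ p * h $ p)" for h
    using matrix_works[OF g(1), of h]
    by (simp add: x_def matrix_vector_mult_def vec_eq_iff)
  have "g h = 0" if "h \<in> L" for h
  proof -
    have "h \<in> vec.span B" using that B(3) by blast
    moreover have "vec.span B \<subseteq> {h. g h = 0}"
    proof (rule vec.span_minimal)
      show "B \<subseteq> {h. g h = 0}" using g(2) yB by auto
      show "vec.subspace {h. g h = 0}"
        using g(1) vec.linear_0[OF g(1)] by (auto simp: vec.subspace_def Vector_Spaces.linear_iff)
    qed
    ultimately show ?thesis by blast
  qed
  then have "(\<Sum>p\<in>UNIV. x $ p * y $ p) = 0" by (intro ann) (simp add: gx[symmetric])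
  moreover have "(\<Sum>p\<in>UNIV. x $ p * y $ p) = 1"
    using g(2)[of y] by (simp add: gx[symmetric] v_def)
  ultimately show False by simp
qed

section \<open>Centralizers of semisimple elements\<close>

lemma matrix_mult_diff:
  fixes X Y :: "'f::field^'m::finite^'m"
  shows "A ** (X - Y) = A ** X - A ** Y" "(X - Y) ** A = X ** A - Y ** A"
  by (simp_all add: vec_eq_iff matrix_matrix_mult_def algebra_simps sum_subtractf)

lemma ent_conj:
  fixes X :: "'f::field^'m::finite^'m"
  shows "ent (a ** X ** b) p = (\<Sum>r\<in>UNIV. ent X r * (ent a (fst p, fst r) * ent b (snd r, snd p)))"
proof -
  have "ent (a ** X ** b) p =
      (\<Sum>k\<in>UNIV. \<Sum>l\<in>UNIV. X $ l $ k * (a $ fst p $ l * b $ k $ snd p))"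
    by (simp add: ent_def matrix_matrix_mult_def sum_distrib_left sum_distrib_right mult.commute
        mult.left_commute)
  also have "\<dots> = (\<Sum>l\<in>UNIV. \<Sum>k\<in>UNIV. X $ l $ k * (a $ fst p $ l * b $ k $ snd p))"
    by (rule sum.swap)
  also have "\<dots> = (\<Sum>r\<in>UNIV \<times> UNIV. X $ fst r $ snd r * (a $ fst p $ fst r * b $ snd r $ snd p))"
    by (simp add: sum.cartesian_product case_prod_unfold)
  finally show ?thesis by (simp add: ent_def)
qed

context linear_group
begin

lemma conj_polyfun:
  fixes a b :: "'f^'m^'m"
  shows "(\<lambda>g. ent (a ** g ** b) p) \<in> polyfun"
  by (intro fun_algebra_matrix_mult ent_polyfun fun_algebra.const)

text \<open>Conjugation by \<open>n\<close> preserves \<open>G\<close>, hence composition with it preserves the functions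
  vanishing on \<open>G\<close>, and the chain rule transforms their differentials by the transpose of
  \<open>Ad(n)\<close>.\<close>

lemma Ad_lie_algebra:
  assumes n: "n \<in> carrier G" and X: "X \<in> lie_algebra G"
  shows "n ** X ** inv\<^bsub>G\<^esub> n \<in> lie_algebra G"
  unfolding lie_algebra_iff
proof (intro allI impI)
  fix f q
  assume f: "f \<in> polyfun" "\<forall>g\<in>carrier G. f g = 0" and q: "\<forall>p. q p \<in> polyfun"
    and fq: "\<forall>g. f g = (\<Sum>p\<in>UNIV. ent (g - mat 1) p * q p g)"
  let ?c = "\<lambda>g. n ** g ** inv\<^bsub>G\<^esub> n"
  define \<gamma> where "\<gamma> p r = ent n (fst p, fst r) * ent (inv\<^bsub>G\<^esub> n) (snd r, snd p)" for p r
  \<comment> \<open>Cofactors of \<open>f\<close> composed with conjugation: the matrix \<open>\<gamma>\<close> of \<open>Ad(n)\<close> enters by the chain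
    rule.\<close>
  define q' where "q' r g = (\<Sum>p\<in>UNIV. \<gamma> p r * q p (?c g))" for r g
  have c1: "?c (mat 1) = mat 1" using n by simp
  have "(\<Sum>r\<in>UNIV. ent X r * q' r (mat 1)) = 0"
  proof (rule X[unfolded lie_algebra_iff, rule_format])
    show "(\<lambda>g. f (?c g)) \<in> polyfun"
      by (rule polyfun_compose[OF conj_polyfun f(1)])
    show "f (?c g) = 0" if "g \<in> carrier G" for g
      using f(2) n that by simp
    show "q' p \<in> polyfun" for p unfolding q'_def
      by (intro fun_algebra_sum fun_algebra.mult fun_algebra.const polyfun_compose[OF conj_polyfun])
        (use q in auto)
    fix g
    have "f (?c g) = (\<Sum>p\<in>UNIV. ent (?c (g - mat 1)) p * q p (?c g))"
      using fq c1 by (simp add: matrix_mult_diff)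
    also have "\<dots> = (\<Sum>p\<in>UNIV. \<Sum>r\<in>UNIV. ent (g - mat 1) r * \<gamma> p r * q p (?c g))"
      unfolding ent_conj \<gamma>_def sum_distrib_right ..
    also have "\<dots> = (\<Sum>r\<in>UNIV. \<Sum>p\<in>UNIV. ent (g - mat 1) r * \<gamma> p r * q p (?c g))"
      by (rule sum.swap)
    also have "\<dots> = (\<Sum>r\<in>UNIV. ent (g - mat 1) r * q' r g)"
      by (simp add: q'_def sum_distrib_left mult.assoc)
    finally show "f (?c g) = (\<Sum>r\<in>UNIV. ent (g - mat 1) r * q' r g)" .
  qed
  also have "(\<Sum>r\<in>UNIV. ent X r * q' r (mat 1)) = (\<Sum>r\<in>UNIV. \<Sum>p\<in>UNIV. ent X r * \<gamma> p r * q p (mat 1))"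
    using c1 by (simp add: q'_def sum_distrib_left mult.assoc)
  also have "\<dots> = (\<Sum>p\<in>UNIV. \<Sum>r\<in>UNIV. ent X r * \<gamma> p r * q p (mat 1))"
    by (rule sum.swap)
  also have "\<dots> = (\<Sum>p\<in>UNIV. ent (?c X) p * q p (mat 1))"
    unfolding ent_conj \<gamma>_def sum_distrib_right ..
  finally show "(\<Sum>p\<in>UNIV. ent (?c X) p * q p (mat 1)) = 0" .
qed

text \<open>If a semisimple element \<open>s\<close> of a connected group acts trivially on the Lie algebra, it is
  central. Semisimplicity enters through the projection \<open>pr\<close> onto the fixed space of \<open>A = Ad(s)\<close>
  and the partial inverse \<open>B\<close> of \<open>A - 1\<close>, whose matrix is \<open>\<beta>\<close>.

  The linear functions \<open>y\<^sub>p = ent (g - pr g) p\<close> vanish exactly on the centralizer of \<open>s\<close>. As the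
  Lie algebra lies in the fixed space, the form \<open>X \<mapsto> ent (B X) p\<close> annihilates it and is
  therefore the differential of a function \<open>f\<close> vanishing on \<open>G\<close>. Then \<open>f \<circ> A - f\<close> also vanishes
  on \<open>G\<close> and has the differential \<open>y\<^sub>p\<close>, and it vanishes on the fixed space; so on \<open>G\<close> the
  function \<open>y\<^sub>p\<close> equals \<open>h = y\<^sub>p - (f \<circ> A - f)\<close>, which is of second order at the identity and zero
  on the fixed space. Hence \<open>h\<close> is a combination of the \<open>y\<^sub>q\<close> whose coefficients vanish at the
  identity, and Nakayama's argument shows that all \<open>y\<^sub>p\<close> vanish on a neighbourhood of the
  identity in \<open>G\<close>. The centralizer of \<open>s\<close> in \<open>G\<close> is thus open as well as closed.\<close>

lemma centralizer_of_semisimple: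
  fixes s and pr B :: "'f^'m^'m \<Rightarrow> 'f^'m^'m"
  defines "A \<equiv> \<lambda>X. s ** X ** inv\<^bsub>G\<^esub> s"
  assumes conn: "alg_connected G" and s: "s \<in> carrier G"
    and pr_poly: "\<And>p. (\<lambda>g. ent (pr g) p) \<in> polyfun"
    and A_pr: "\<And>X. A (pr X) = pr X"
    and pr_fix: "\<And>X. A X = X \<Longrightarrow> pr X = X"
    and B: "\<And>X p. ent (B X) p = (\<Sum>q\<in>UNIV. ent X q * \<beta> p q)"
    and B_A: "\<And>X. X - pr X = B (A X - X)"
    and B_fix: "\<And>X. A X = X \<Longrightarrow> B X = 0"
    and lie: "\<And>X. X \<in> lie_algebra G \<Longrightarrow> A X = X"
    and g: "g \<in> carrier G"
  shows "s ** g = g ** s"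
proof -
  have A_poly: "(\<lambda>g. ent (A g) p) \<in> polyfun" for p unfolding A_def by (rule conj_polyfun)
  have A_one: "A (mat 1) = mat 1" using s by (simp add: A_def)
  have pr_one: "pr (mat 1) = mat 1" by (rule pr_fix[OF A_one])
  have pr_pr: "pr (pr X) = pr X" for X by (rule pr_fix[OF A_pr])
  define y where "y p g = ent (g - pr g) p" for p g
  \<comment> \<open>\<open>MJ\<close> is the product of the maximal ideal of the identity and the ideal generated by the
    \<open>y\<^sub>q\<close>.\<close>
  define MJ where "MJ h \<longleftrightarrow> (\<exists>m. (\<forall>q. m q \<in> polyfun \<and> m q (mat 1) = 0) \<and>
      (\<forall>g. h g = (\<Sum>q\<in>UNIV. y q g * m q g)))" for h
  have MJ_prod: "MJ (\<lambda>g. m1 g * m2 g - m1 (pr g) * m2 (pr g))"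
    if m: "m1 \<in> polyfun" "m2 \<in> polyfun" "m1 (mat 1) = 0" "m2 (mat 1) = 0" for m1 m2
  proof -
    obtain a where a: "\<And>p. a p \<in> polyfun" "\<And>g. m1 g - m1 (pr g) = (\<Sum>p\<in>UNIV. y p g * a p g)"
      using polyfun_difference[of pr m1] pr_poly m(1) unfolding y_def by blast
    obtain b where b: "\<And>p. b p \<in> polyfun" "\<And>g. m2 g - m2 (pr g) = (\<Sum>p\<in>UNIV. y p g * b p g)"
      using polyfun_difference[of pr m2] pr_poly m(2) unfolding y_def by blast
    show ?thesis unfolding MJ_def
    proof (intro exI[of _ "\<lambda>p g. a p g * m2 g + m1 (pr g) * b p g"] conjI allI)
      fix q
      show "(\<lambda>g. a q g * m2 g + m1 (pr g) * b q g) \<in> polyfun"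
        by (intro fun_algebra.add fun_algebra.mult a b m polyfun_compose[OF pr_poly])
      show "a q (mat 1) * m2 (mat 1) + m1 (pr (mat 1)) * b q (mat 1) = 0"
        by (simp add: pr_one m)
    next
      fix g
      have "m1 g * m2 g - m1 (pr g) * m2 (pr g) = (m1 g - m1 (pr g)) * m2 g + m1 (pr g) * (m2 g - m2 (pr g))"
        by (simp add: algebra_simps)
      also have "\<dots> = (\<Sum>p\<in>UNIV. y p g * (a p g * m2 g + m1 (pr g) * b p g))"
        unfolding a(2) b(2)
        by (simp add: sum.distrib[symmetric] sum_distrib_left sum_distrib_right algebra_simps)
      finally show "m1 g * m2 g - m1 (pr g) * m2 (pr g) =
        (\<Sum>p\<in>UNIV. y p g * (a p g * m2 g + m1 (pr g) * b p g))" .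
    qed
  qed
  have MJ_diff: "MJ (\<lambda>g. h g - k g)" if hk: "MJ h" "MJ k" for h k
  proof -
    obtain m where m: "\<And>q. m q \<in> polyfun" "\<And>q. m q (mat 1) = 0" "\<And>g. h g = (\<Sum>q\<in>UNIV. y q g * m q g)"
      using hk(1) unfolding MJ_def by blast
    obtain m' where m': "\<And>q. m' q \<in> polyfun" "\<And>q. m' q (mat 1) = 0" "\<And>g. k g = (\<Sum>q\<in>UNIV. y q g * m' q g)"
      using hk(2) unfolding MJ_def by blast
    show ?thesis unfolding MJ_def
      by (intro exI[of _ "\<lambda>q g. m q g - m' q g"])
        (simp add: m m' fun_algebra_diff sum_subtractf right_diff_distrib)
  qed
  have MJ_sum: "MJ (\<lambda>g. \<Sum>i\<in>I. h i g)" if "finite I" "\<And>i. i \<in> I \<Longrightarrow> MJ (h i)" for I :: "('m \<times> 'm) set" and h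
  proof -
    have "\<forall>i\<in>I. \<exists>m. (\<forall>q. m q \<in> polyfun \<and> m q (mat 1) = 0) \<and> (\<forall>g. h i g = (\<Sum>q\<in>UNIV. y q g * m q g))"
      using that(2) unfolding MJ_def by blast
    from bchoice[OF this] obtain m where m: "\<forall>i\<in>I. (\<forall>q. m i q \<in> polyfun \<and> m i q (mat 1) = 0) \<and>
        (\<forall>g. h i g = (\<Sum>q\<in>UNIV. y q g * m i q g))" by blast
    show ?thesis unfolding MJ_def
    proof (intro exI[of _ "\<lambda>q g. \<Sum>i\<in>I. m i q g"] conjI allI)
      fix q
      show "(\<lambda>g. \<Sum>i\<in>I. m i q g) \<in> polyfun" by (intro fun_algebra_sum that(1)) (use m in blast)
      show "(\<Sum>i\<in>I. m i q (mat 1)) = 0" by (intro sum.neutral ballI) (use m in blast)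
    next
      fix g
      have "(\<Sum>i\<in>I. h i g) = (\<Sum>i\<in>I. \<Sum>q\<in>UNIV. y q g * m i q g)"
        by (intro sum.cong refl) (use m in blast)
      also have "\<dots> = (\<Sum>q\<in>UNIV. \<Sum>i\<in>I. y q g * m i q g)" by (rule sum.swap)
      finally show "(\<Sum>i\<in>I. h i g) = (\<Sum>q\<in>UNIV. y q g * (\<Sum>i\<in>I. m i q g))"
        by (simp add: sum_distrib_left)
    qed
  qed
  have ideal: "\<exists>m. (\<forall>q. m q \<in> polyfun \<and> m q (mat 1) = 0) \<and>
      (\<forall>g\<in>carrier G. y p g = (\<Sum>q\<in>UNIV. y q g * m q g))" for p
  proof -
    \<comment> \<open>\<open>L\<close> consists of the differentials at the identity of the polynomial functions vanishing
      on \<open>G\<close>.\<close>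
    define L :: "('f^('m \<times> 'm)) set" where
      "L = {h. \<exists>f q. f \<in> polyfun \<and> (\<forall>g\<in>carrier G. f g = 0) \<and> (\<forall>r. q r \<in> polyfun) \<and>
        (\<forall>g. f g = (\<Sum>r\<in>UNIV. ent (g - mat 1) r * q r g)) \<and> h = (\<chi> r. q r (mat 1))}"
    have LI: "(\<chi> r. q r (mat 1)) \<in> L" if "f \<in> polyfun" "\<And>g. g \<in> carrier G \<Longrightarrow> f g = 0" "\<And>r. q r \<in> polyfun"
      "\<And>g. f g = (\<Sum>r\<in>UNIV. ent (g - mat 1) r * q r g)" for f q
      unfolding L_def using that by blast
    have LE: "\<exists>f q. f \<in> polyfun \<and> (\<forall>g\<in>carrier G. f g = 0) \<and> (\<forall>r. q r \<in> polyfun) \<and>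
        (\<forall>g. f g = (\<Sum>r\<in>UNIV. ent (g - mat 1) r * q r g)) \<and> h = (\<chi> r. q r (mat 1))" if "h \<in> L" for h
      using that unfolding L_def by blast
    have "vec.subspace L"
      unfolding vec.subspace_def
    proof (intro conjI ballI allI)
      have "(\<chi> r. (\<lambda>_. 0) (mat 1 :: 'f^'m^'m)) \<in> L"
        by (rule LI[of "\<lambda>_. 0"]) (auto intro: fun_algebra.const)
      then show "0 \<in> L" by (simp add: zero_vec_def)
    next
      fix h k assume "h \<in> L" "k \<in> L"
      from LE[OF \<open>h \<in> L\<close>] obtain f q where 1: "f \<in> polyfun" "\<forall>g\<in>carrier G. f g = 0" "\<forall>r. q r \<in> polyfun"
        "\<forall>g. f g = (\<Sum>r\<in>UNIV. ent (g - mat 1) r * q r g)" "h = (\<chi> r. q r (mat 1))"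
        by (elim exE conjE) (rule that)
      from LE[OF \<open>k \<in> L\<close>] obtain f' q' where 2: "f' \<in> polyfun" "\<forall>g\<in>carrier G. f' g = 0" "\<forall>r. q' r \<in> polyfun"
        "\<forall>g. f' g = (\<Sum>r\<in>UNIV. ent (g - mat 1) r * q' r g)" "k = (\<chi> r. q' r (mat 1))"
        by (elim exE conjE) (rule that)
      note * = 1 2
      have "(\<chi> r. (\<lambda>g. q r g + q' r g) (mat 1)) \<in> L"
      proof (rule LI[of "\<lambda>g. f g + f' g"])
        show "(\<lambda>g. f g + f' g) \<in> polyfun" by (intro fun_algebra.add *)
        show "(\<lambda>g. q r g + q' r g) \<in> polyfun" for r
          by (intro fun_algebra.add *(3)[rule_format] *(8)[rule_format])
        show "f g + f' g = 0" if "g \<in> carrier G" for g using * that by auto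
        show "f g + f' g = (\<Sum>r\<in>UNIV. ent (g - mat 1) r * (q r g + q' r g))" for g
          using *(4,9) by (simp add: distrib_left sum.distrib del: ent_simps)
      qed
      then show "h + k \<in> L" by (simp add: * plus_vec_def)
    next
      fix c h assume "h \<in> L"
      from LE[OF this] obtain f q where *: "f \<in> polyfun" "\<forall>g\<in>carrier G. f g = 0" "\<forall>r. q r \<in> polyfun"
        "\<forall>g. f g = (\<Sum>r\<in>UNIV. ent (g - mat 1) r * q r g)" "h = (\<chi> r. q r (mat 1))"
        by (elim exE conjE) (rule that)
      have "(\<chi> r. (\<lambda>g. c * q r g) (mat 1)) \<in> L"
      proof (rule LI[of "\<lambda>g. c * f g"])
        show "(\<lambda>g. c * f g) \<in> polyfun" by (intro fun_algebra.mult fun_algebra.const *)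
        show "(\<lambda>g. c * q r g) \<in> polyfun" for r
          by (intro fun_algebra.mult fun_algebra.const *(3)[rule_format])
        show "c * f g = 0" if "g \<in> carrier G" for g using * that by auto
        show "c * f g = (\<Sum>r\<in>UNIV. ent (g - mat 1) r * (c * q r g))" for g
          using *(4) by (simp add: sum_distrib_left mult.left_commute del: ent_simps)
      qed
      then show "c *s h \<in> L" by (simp add: * vector_scalar_mult_def)
    qed
    \<comment> \<open>A vector orthogonal to \<open>L\<close> is in the Lie algebra, hence fixed by \<open>A\<close> and killed by \<open>B\<close>.\<close>
    moreover have "(\<Sum>r\<in>UNIV. x $ r * (\<chi> r. \<beta> p r) $ r) = 0"
      if x: "\<And>h. h \<in> L \<Longrightarrow> (\<Sum>r\<in>UNIV. x $ r * h $ r) = 0" for x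
    proof -
      define X :: "'f^'m^'m" where "X = (\<chi> i j. x $ (i, j))"
      have entX: "ent X r = x $ r" for r by (simp add: X_def ent_def)
      have "X \<in> lie_algebra G" unfolding lie_algebra_iff
      proof (intro allI impI)
        fix f q
        assume *: "f \<in> polyfun" "\<forall>g\<in>carrier G. f g = 0" "\<forall>p. q p \<in> polyfun"
          "\<forall>g. f g = (\<Sum>p\<in>UNIV. ent (g - mat 1) p * q p g)"
        have "(\<Sum>r\<in>UNIV. x $ r * (\<chi> r. q r (mat 1)) $ r) = 0"
          by (rule x, rule LI[of f]) (use * in auto)
        then show "(\<Sum>p\<in>UNIV. ent X p * q p (mat 1)) = 0" by (simp add: entX)
      qed
      then have "B X = 0" by (intro B_fix lie)
      then have "ent (B X) p = 0" by simp
      then show ?thesis unfolding B by (simp add: entX)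
    qed
    ultimately have "(\<chi> r. \<beta> p r) \<in> L" by (rule mem_subspace_if_annihilated)
    from LE[OF this] obtain f q where f: "f \<in> polyfun" "\<forall>g\<in>carrier G. f g = 0" "\<forall>r. q r \<in> polyfun"
        "\<forall>g. f g = (\<Sum>r\<in>UNIV. ent (g - mat 1) r * q r g)" and eq: "(\<chi> r. \<beta> p r) = (\<chi> r. q r (mat 1))"
      by (elim exE conjE) (rule that)
    have q1: "q r (mat 1) = \<beta> p r" for r
      using arg_cong[OF eq, of "\<lambda>v. v $ r"] by (simp only: vec_lambda_beta)
    define h where "h g = y p g - (f (A g) - f g)" for g
    define d where "d r g = q r g - q r (mat 1)" for r g
    \<comment> \<open>The first-order terms of \<open>f \<circ> A - f\<close> add up to \<open>ent (B (A g - g)) p = y p g\<close> and cancel;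
      every remaining term is a product of two functions vanishing at the identity.\<close>
    have h_eq: "h g = (\<Sum>r\<in>UNIV. ent (g - mat 1) r * d r g) - (\<Sum>r\<in>UNIV. ent (A g - mat 1) r * d r (A g))" for g
    proof -
      have "f (A g) - f g = (\<Sum>r\<in>UNIV. ent (A g - mat 1) r * q r (A g)) - (\<Sum>r\<in>UNIV. ent (g - mat 1) r * q r g)"
        using f(4) by simp
      also have "\<dots> = (\<Sum>r\<in>UNIV. ent (A g - mat 1) r * d r (A g)) - (\<Sum>r\<in>UNIV. ent (g - mat 1) r * d r g)
          + (\<Sum>r\<in>UNIV. (ent (A g - mat 1) r - ent (g - mat 1) r) * \<beta> p r)"
        by (simp add: d_def q1 sum.distrib[symmetric] sum_subtractf[symmetric] algebra_simps)
      also have "(\<Sum>r\<in>UNIV. (ent (A g - mat 1) r - ent (g - mat 1) r) * \<beta> p r) = ent (B (A g - g)) p"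
        unfolding B by simp
      also have "\<dots> = y p g" by (simp add: y_def B_A)
      finally show ?thesis by (simp add: h_def)
    qed
    have h_pr: "h (pr g) = 0" for g
      by (simp add: h_def y_def pr_pr A_pr)
    have d_poly: "d r \<in> polyfun" for r
      unfolding d_def by (intro fun_algebra_diff fun_algebra.const f(3)[rule_format])
    have e_poly: "(\<lambda>g. ent (g - mat 1) r) \<in> polyfun" for r
      by (simp, intro fun_algebra_diff fun_algebra.const ent_polyfun)
    have eA_poly: "(\<lambda>g. ent (A g - mat 1) r) \<in> polyfun" for r
      by (simp, intro fun_algebra_diff fun_algebra.const A_poly)
    \<comment> \<open>Subtracting \<open>h \<circ> pr = 0\<close> turns each product into a difference to which \<open>MJ_prod\<close>
      applies.\<close>
    have "MJ (\<lambda>g. (\<Sum>r\<in>UNIV. ent (g - mat 1) r * d r g - ent (pr g - mat 1) r * d r (pr g)) -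
       (\<Sum>r\<in>UNIV. ent (A g - mat 1) r * d r (A g) - ent (A (pr g) - mat 1) r * d r (A (pr g))))"
    proof (rule MJ_diff[OF MJ_sum MJ_sum])
      fix r
      show "MJ (\<lambda>g. ent (g - mat 1) r * d r g - ent (pr g - mat 1) r * d r (pr g))"
        by (rule MJ_prod[OF e_poly d_poly]) (simp_all add: d_def)
      show "MJ (\<lambda>g. ent (A g - mat 1) r * d r (A g) - ent (A (pr g) - mat 1) r * d r (A (pr g)))"
        by (rule MJ_prod[OF eA_poly polyfun_compose[OF A_poly d_poly]]) (simp_all add: d_def A_one)
    qed simp_all
    also have "(\<lambda>g. (\<Sum>r\<in>UNIV. ent (g - mat 1) r * d r g - ent (pr g - mat 1) r * d r (pr g)) -
       (\<Sum>r\<in>UNIV. ent (A g - mat 1) r * d r (A g) - ent (A (pr g) - mat 1) r * d r (A (pr g)))) = h"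
    proof
      fix g
      have "(\<Sum>r\<in>UNIV. ent (g - mat 1) r * d r g - ent (pr g - mat 1) r * d r (pr g)) -
       (\<Sum>r\<in>UNIV. ent (A g - mat 1) r * d r (A g) - ent (A (pr g) - mat 1) r * d r (A (pr g))) = h g - h (pr g)"
        unfolding h_eq sum_subtractf by (simp add: algebra_simps del: ent_simps)
      then show "(\<Sum>r\<in>UNIV. ent (g - mat 1) r * d r g - ent (pr g - mat 1) r * d r (pr g)) -
       (\<Sum>r\<in>UNIV. ent (A g - mat 1) r * d r (A g) - ent (A (pr g) - mat 1) r * d r (A (pr g))) = h g"
        by (simp add: h_pr del: ent_simps)
    qed
    finally have "MJ h" .
    then obtain m where m: "\<forall>q. m q \<in> polyfun \<and> m q (mat 1) = 0"
      "\<forall>g. h g = (\<Sum>q\<in>UNIV. y q g * m q g)" unfolding MJ_def by blast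
    have "y p g = h g" if "g \<in> carrier G" for g
    proof -
      have "A g \<in> carrier G" using s that by (simp add: A_def)
      then show ?thesis using f(2) that by (simp add: h_def)
    qed
    with m show ?thesis by auto
  qed
  have "\<exists>m. \<forall>p. (\<forall>q. m p q \<in> polyfun \<and> m p q (mat 1) = 0) \<and>
      (\<forall>g\<in>carrier G. y p g = (\<Sum>q\<in>UNIV. y q g * m p q g))"
    by (rule choice, rule allI, rule ideal)
  then obtain m where m: "\<And>p q. m p q \<in> polyfun" "\<And>p q. m p q (mat 1) = 0"
    "\<And>p g. g \<in> carrier G \<Longrightarrow> y p g = (\<Sum>q\<in>UNIV. y q g * m p q g)" by blast
  \<comment> \<open>Nakayama's argument: on \<open>G\<close> the matrix \<open>M g\<close> kills the vector of all \<open>y\<^sub>q(g)\<close>, and its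
    determinant is 1 at the identity.\<close>
  define M :: "'f^'m^'m \<Rightarrow> 'f^('m \<times> 'm)^('m \<times> 'm)" where "M g = mat 1 - (\<chi> p q. m p q g)" for g
  define D where "D g = det (M g)" for g
  have D_poly: "D \<in> polyfun" unfolding D_def
  proof (rule polyfun_det)
    fix i j
    have "(\<lambda>x. (mat 1 :: 'f^('m \<times> 'm)^('m \<times> 'm)) $ i $ j - m i j x) \<in> polyfun"
      by (intro fun_algebra_diff fun_algebra.const m)
    then show "(\<lambda>x. M x $ i $ j) \<in> polyfun" by (simp add: M_def)
  qed
  have "M (mat 1) = mat 1" unfolding M_def by (simp add: m vec_eq_iff)
  then have D_one: "D (mat 1) = 1" by (simp add: D_def)
  have comm_if_D: "s ** g = g ** s" if g: "g \<in> carrier G" "D g \<noteq> 0" for g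
  proof -
    have "M g *v (\<chi> q. y q g) = 0"
    proof -
      have "(M g *v (\<chi> q. y q g)) $ p = 0" for p
      proof -
        have "(M g *v (\<chi> q. y q g)) $ p = (\<Sum>q\<in>UNIV. ((if p = q then 1 else 0) - m p q g) * y q g)"
          by (simp add: M_def matrix_vector_mult_def mat_def)
        also have "\<dots> = (\<Sum>q\<in>UNIV. (if p = q then 1 else 0) * y q g) - (\<Sum>q\<in>UNIV. y q g * m p q g)"
          by (simp add: mult.commute[of _ "y _ g"] right_diff_distrib sum_subtractf)
        also have "(\<Sum>q\<in>UNIV. (if p = q then 1 else 0) * y q g) = y p g"
          by (simp add: if_distrib[of "\<lambda>x. x * _"] cong: if_cong)
        finally show ?thesis using m(3)[OF g(1), of p] by simp
      qed
      then show ?thesis by (simp add: vec_eq_iff)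
    qed
    moreover have "invertible (M g)" using g(2) by (simp add: D_def invertible_det_nz)
    ultimately have "(\<chi> q. y q g) = 0"
      by (metis invertible_def matrix_vector_mul_assoc matrix_vector_mul_lid matrix_vector_mult_0_right)
    then have "y q g = 0" for q using vec_lambda_beta[of "\<lambda>q. y q g" q] by (simp only: zero_index)
    then have "g = pr g" by (intro ent_eqI) (simp add: y_def)
    then have "s ** g ** inv\<^bsub>G\<^esub> s = g" using A_pr[of g] by (simp add: A_def)
    then have "s ** g ** (inv\<^bsub>G\<^esub> s ** s) = g ** s" by (simp add: matrix_mul_assoc)
    then show ?thesis using s by simp
  qed
  define H where "H = {x \<in> carrier G. s ** x = x ** s}"
  \<comment> \<open>Translating the neighbourhood \<open>D \<noteq> 0\<close> of the identity by elements of \<open>H\<close> covers \<open>H\<close>.\<close>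
  have "openin (zariski G) H"
    unfolding openin_zariski_G
  proof (intro exI[of _ "{\<lambda>x. D (inv\<^bsub>G\<^esub> h ** x ** mat 1) | h. h \<in> H}"] conjI)
    show "{\<lambda>x. D (inv\<^bsub>G\<^esub> h ** x ** mat 1) | h. h \<in> H} \<subseteq> reg G"
      using reg_G_compose_mult[OF polyfun_reg_G[OF D_poly]] by blast
    have "x \<in> H" if x: "x \<in> carrier G" "h \<in> H" "D (inv\<^bsub>G\<^esub> h ** x) \<noteq> 0" for x h
    proof -
      have h: "h \<in> carrier G" "s ** h = h ** s" using x(2) by (auto simp: H_def)
      have "s ** (inv\<^bsub>G\<^esub> h ** x) = (inv\<^bsub>G\<^esub> h ** x) ** s"
        by (rule comm_if_D) (use x h in auto)
      then have "h ** (s ** (inv\<^bsub>G\<^esub> h ** x)) = h ** (inv\<^bsub>G\<^esub> h ** x) ** s"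
        by (simp add: matrix_mul_assoc)
      then have "s ** (h ** inv\<^bsub>G\<^esub> h) ** x = (h ** inv\<^bsub>G\<^esub> h) ** x ** s"
        using h(2) by (simp add: matrix_mul_assoc)
      then show ?thesis using h(1) x(1) by (simp add: H_def)
    qed
    moreover have "x \<in> carrier G \<and> D (inv\<^bsub>G\<^esub> x ** x) \<noteq> 0" if "x \<in> H" for x
      using that by (simp add: H_def D_one)
    ultimately have iff: "x \<in> H \<longleftrightarrow> x \<in> carrier G \<and> (\<exists>h\<in>H. D (inv\<^bsub>G\<^esub> h ** x) \<noteq> 0)" for x by meson
    show "H = {x \<in> carrier G. \<exists>f\<in>{\<lambda>x. D (inv\<^bsub>G\<^esub> h ** x ** mat 1) | h. h \<in> H}. f x \<noteq> 0}"
    proof (rule Set.set_eqI)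
      fix x
      show "x \<in> H \<longleftrightarrow> x \<in> {x \<in> carrier G. \<exists>f\<in>{\<lambda>x. D (inv\<^bsub>G\<^esub> h ** x ** mat 1) | h. h \<in> H}. f x \<noteq> 0}"
        by (subst iff) auto
    qed
  qed
  moreover have "closedin (zariski G) H"
    unfolding closedin_zariski_G
  proof (intro exI[of _ "range (\<lambda>p x. ent (s ** x ** mat 1) p - ent (mat 1 ** x ** s) p)"] conjI)
    show "range (\<lambda>p x. ent (s ** x ** mat 1) p - ent (mat 1 ** x ** s) p) \<subseteq> reg G"
      by (intro subsetI, elim rangeE, simp only:)
        (intro polyfun_reg_G fun_algebra_diff conj_polyfun)
    have "s ** x = x ** s \<longleftrightarrow> (\<forall>p. ent (s ** x ** mat 1) p - ent (mat 1 ** x ** s) p = 0)" for x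
      using ent_eqI[of "s ** x" "x ** s"] by auto
    then show "H = {x \<in> carrier G. \<forall>f\<in>range (\<lambda>p x. ent (s ** x ** mat 1) p - ent (mat 1 ** x ** s) p). f x = 0}"
      by (auto simp: H_def)
  qed
  moreover have "mat 1 \<in> H" by (simp add: H_def)
  ultimately have "H = carrier G"
    using conn unfolding alg_connected_def connected_space_clopen_in topspace_zariski_G by blast
  with g show ?thesis by (auto simp: H_def)
qed

end

section \<open>Central cocharacters\<close>

text \<open>Composition with a map \<open>p\<close> that is given by functions of the algebra on \<open>H\<close> only, such as
  inversion.\<close>

lemma fun_algebra_pullback:
  assumes "\<And>b. b \<in> B \<Longrightarrow> \<exists>f\<in>fun_algebra B'. \<forall>t\<in>H. b (p t) = f t" "g \<in> fun_algebra B"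
  shows "\<exists>f\<in>fun_algebra B'. \<forall>t\<in>H. g (p t) = f t"
  using assms(2)
proof induction
  case (const c)
  show ?case by (rule bexI[of _ "\<lambda>_. c"]) (auto intro: fun_algebra.const)
next
  case (gen f)
  then show ?case by (rule assms(1))
next
  case (add f g)
  then obtain f' g' where "f' \<in> fun_algebra B'" "\<forall>t\<in>H. f (p t) = f' t"
    "g' \<in> fun_algebra B'" "\<forall>t\<in>H. g (p t) = g' t" by blast
  then show ?case by (intro bexI[of _ "\<lambda>t. f' t + g' t"] fun_algebra.add) auto
next
  case (mult f g)
  then obtain f' g' where "f' \<in> fun_algebra B'" "\<forall>t\<in>H. f (p t) = f' t"
    "g' \<in> fun_algebra B'" "\<forall>t\<in>H. g (p t) = g' t" by blast
  then show ?case by (intro bexI[of _ "\<lambda>t. f' t * g' t"] fun_algebra.mult) auto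
qed

lemma ent_sum [simp]: "ent (\<Sum>i\<in>I. X i) p = (\<Sum>i\<in>I. ent (X i) p)"
  for X :: "'i \<Rightarrow> 'f::field^'m::finite^'m"
  by (induction I rule: infinite_finite_induct) auto

context linear_group
begin

lemma det_nonzero: "g \<in> carrier G \<Longrightarrow> det g \<noteq> 0"
  using det_mul[of "inv\<^bsub>G\<^esub> g" g] by auto

text \<open>By Cramer's rule.\<close>

lemma reg_inv_entry: "\<exists>f\<in>reg G. \<forall>g\<in>carrier G. ent (inv\<^bsub>G\<^esub> g) p = f g"
proof -
  obtain i j where p: "p = (i, j)" by (cases p)
  define C :: "'f^'m^'m \<Rightarrow> 'f^'m^'m" where
    "C g = (\<chi> k l. if l = i then axis j 1 $ k else g $ k $ l)" for g
  have "(\<lambda>g. det (C g)) \<in> polyfun"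
  proof (rule polyfun_det)
    fix k l
    have "(\<lambda>g :: 'f^'m^'m. axis j 1 $ k :: 'f) \<in> polyfun" "(\<lambda>g :: 'f^'m^'m. g $ k $ l) \<in> polyfun"
      using ent_polyfun[of "(k, l)"] by (auto intro: fun_algebra.const simp: ent_def)
    then show "(\<lambda>g. C g $ k $ l) \<in> polyfun" by (cases "l = i") (auto simp: C_def)
  qed
  then have "(\<lambda>g. det (C g)) \<in> reg G" by (rule polyfun_reg_G)
  moreover have "(\<lambda>g. inverse (det g)) \<in> reg G" unfolding reg_G by (rule fun_algebra.gen) simp
  ultimately have "(\<lambda>g. det (C g) * inverse (det g)) \<in> reg G"
    unfolding reg_G by (rule fun_algebra.mult)
  moreover have "ent (inv\<^bsub>G\<^esub> g) p = det (C g) * inverse (det g)" if g: "g \<in> carrier G" for g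
  proof -
    have "g *v (\<chi> k. (inv\<^bsub>G\<^esub> g) $ k $ j) = axis j 1"
    proof -
      have "(g *v (\<chi> k. (inv\<^bsub>G\<^esub> g) $ k $ j)) $ l = (g ** inv\<^bsub>G\<^esub> g) $ l $ j" for l
        by (simp add: matrix_vector_mult_def matrix_matrix_mult_def)
      then show ?thesis using g by (simp add: vec_eq_iff axis_def mat_def)
    qed
    then have "(\<chi> k. (inv\<^bsub>G\<^esub> g) $ k $ j) =
        (\<chi> k. det (\<chi> a b. if b = k then axis j 1 $ a else g $ a $ b) / det g)"
      using cramer[OF det_nonzero[OF g]] by blast
    then have "(inv\<^bsub>G\<^esub> g) $ i $ j = det (C g) / det g"
      by (simp add: vec_eq_iff C_def)
    then show ?thesis by (simp add: p ent_def divide_inverse)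
  qed
  ultimately show ?thesis by (intro bexI[of _ "\<lambda>g. det (C g) * inverse (det g)"] ballI)
qed

lemma reg_inv:
  assumes "f \<in> reg G"
  shows "\<exists>k\<in>reg G. \<forall>g\<in>carrier G. f (inv\<^bsub>G\<^esub> g) = k g"
  unfolding reg_G
proof (rule fun_algebra_pullback[where p = "\<lambda>g. inv\<^bsub>G\<^esub> g", OF _ assms[unfolded reg_G]])
  fix b :: "'f^'m^'m \<Rightarrow> 'f" assume "b \<in> insert (\<lambda>A. inverse (det A)) matrix_entries"
  then consider "b = (\<lambda>A. inverse (det A))" | p where "b = (\<lambda>A. ent A p)"
    by (auto elim: matrix_entriesE)
  then show "\<exists>f\<in>fun_algebra (insert (\<lambda>A. inverse (det A)) matrix_entries). \<forall>t\<in>carrier G. b (inv\<^bsub>G\<^esub> t) = f t"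
  proof cases
    case 1
    have "(\<lambda>A :: 'f^'m^'m. det A) \<in> reg G"
      by (intro polyfun_reg_G polyfun_det) (use ent_polyfun in \<open>fastforce simp: ent_def\<close>)
    moreover have "inverse (det (inv\<^bsub>G\<^esub> g)) = det g" if "g \<in> carrier G" for g
      using det_mul[of "inv\<^bsub>G\<^esub> g" g] that by (simp add: inverse_unique)
    ultimately show ?thesis unfolding 1 reg_G by blast
  next
    case 2
    show ?thesis unfolding 2 using reg_inv_entry unfolding reg_G by blast
  qed
qed

text \<open>The Zariski closure \<open>H\<close> of the image of \<open>\<mu>\<close> is a closed subgroup, central because
  commuting with a given element is a closed condition, and therefore normal. It is connected
  because the multiplicative group is irreducible: two non-zero Laurent polynomials have a
  common non-zero point. Almost-simplicity leaves \<open>H = 1\<close> or \<open>H = G\<close>, and the latter is excluded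
  since \<open>G\<close> is not commutative.\<close>

lemma central_cocharacter_trivial:
  assumes simple: "almost_simple G"
    and hom: "\<mu> \<in> alg_hom Gm G"
    and central: "\<And>x g. x \<noteq> 0 \<Longrightarrow> g \<in> carrier G \<Longrightarrow> \<mu> x ** g = g ** \<mu> x"
    and x: "x \<noteq> 0"
  shows "\<mu> x = mat 1"
proof -
  have mG: "\<mu> x \<in> carrier G" if "x \<noteq> 0" for x
    using hom that unfolding alg_hom_def hom_def by auto
  have mm: "\<mu> (x * y) = \<mu> x ** \<mu> y" if "x \<noteq> 0" "y \<noteq> 0" for x y
    using hom that unfolding alg_hom_def hom_def by auto
  have mreg: "\<exists>k\<in>reg Gm. \<forall>x. x \<noteq> 0 \<longrightarrow> f (\<mu> x) = k x" if "f \<in> reg G" for f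
    using hom that unfolding alg_hom_def by auto
  have m1: "\<mu> 1 = mat 1"
  proof -
    have "\<mu> 1 ** \<mu> 1 = \<mu> 1" using mm[of 1 1] by simp
    then have "inv\<^bsub>G\<^esub> (\<mu> 1) ** \<mu> 1 ** \<mu> 1 = inv\<^bsub>G\<^esub> (\<mu> 1) ** \<mu> 1" by (simp add: matrix_mul_assoc[symmetric])
    then show ?thesis using mG[of 1] by simp
  qed
  define I where "I = {f \<in> reg G. \<forall>x. x \<noteq> 0 \<longrightarrow> f (\<mu> x) = 0}"
  define H where "H = {g \<in> carrier G. \<forall>f\<in>I. f g = 0}"
  have mH: "\<mu> x \<in> H" if "x \<noteq> 0" for x using that mG by (auto simp: H_def I_def)
  have HG: "h \<in> carrier G" if "h \<in> H" for h using that by (simp add: H_def)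
  have H_vanish: "f h = 0" if "f \<in> reg G" "\<And>x. x \<noteq> 0 \<Longrightarrow> f (\<mu> x) = 0" "h \<in> H" for f h
    using that unfolding H_def I_def by blast
  have H_central: "h ** g = g ** h" if h: "h \<in> H" and g: "g \<in> carrier G" for h g
  proof -
    have "ent (mat 1 ** h ** g) p - ent (g ** h ** mat 1) p = 0" for p
      by (rule H_vanish[OF _ _ h], intro polyfun_reg_G fun_algebra_diff conj_polyfun)
        (simp add: central g)
    then show ?thesis by (intro ent_eqI) simp
  qed
  have H_mult: "g ** h \<in> H" if g: "g \<in> H" and h: "h \<in> H" for g h
  proof -
    \<comment> \<open>The usual two steps for closures of subgroups: one factor in the image, then both in the
      closure.\<close>
    have 1: "g ** \<mu> x \<in> H" if g: "g \<in> H" and x: "x \<noteq> 0" for g x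
    proof -
      have "f (mat 1 ** g ** \<mu> x) = 0" if f: "f \<in> I" for f
        by (rule H_vanish[OF _ _ g], rule reg_G_compose_mult)
          (use f x in \<open>auto simp: I_def mm[symmetric]\<close>)
      then show ?thesis using HG[OF g] mG[OF x] by (simp add: H_def)
    qed
    have "f (mat 1 ** g ** h) = 0" if f: "f \<in> I" for f
    proof (rule H_vanish[OF _ _ g], rule reg_G_compose_mult)
      show "f \<in> reg G" using f by (simp add: I_def)
      fix x :: 'f assume x: "x \<noteq> 0"
      have "h ** \<mu> x \<in> H" by (rule 1[OF h x])
      then have "f (h ** \<mu> x) = 0" using f by (simp add: H_def)
      then show "f (mat 1 ** \<mu> x ** h) = 0" using H_central[OF h mG[OF x]] by simp
    qed
    then show ?thesis using HG[OF g] HG[OF h] by (simp add: H_def)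
  qed
  have H_inv: "inv\<^bsub>G\<^esub> h \<in> H" if h: "h \<in> H" for h
  proof -
    have "f (inv\<^bsub>G\<^esub> h) = 0" if f: "f \<in> I" for f
    proof -
      have f_reg: "f \<in> reg G" using f by (simp add: I_def)
      obtain k where k: "k \<in> reg G" "\<And>g. g \<in> carrier G \<Longrightarrow> f (inv\<^bsub>G\<^esub> g) = k g"
        using reg_inv[OF f_reg] by blast
      have "k h = 0"
      proof (rule H_vanish[OF k(1) _ h])
        fix x :: 'f assume x: "x \<noteq> 0"
        have "\<mu> x ** \<mu> (inverse x) = mat 1" using x by (simp add: mm[symmetric] m1)
        then have "inv\<^bsub>G\<^esub> (\<mu> x) = \<mu> (inverse x)"
          using inv_equality[of "\<mu> (inverse x)" "\<mu> x"] mG x m1 mm[of "inverse x" x] by simp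
        then show "k (\<mu> x) = 0"
          using k(2)[OF mG[OF x]] f x by (simp add: I_def)
      qed
      then show ?thesis using k(2) HG[OF h] by simp
    qed
    then show ?thesis using HG[OF h] by (simp add: H_def)
  qed
  have sub: "subgroup H G"
    using mH[of 1] m1 HG H_mult H_inv by (intro subgroupI) auto
  have "closedin (zariski G) H"
    unfolding closedin_zariski_G
  proof (intro exI[of _ I] conjI)
    show "I \<subseteq> reg G" by (auto simp: I_def)
    show "H = {x \<in> carrier G. \<forall>f\<in>I. f x = 0}" by (rule H_def)
  qed
  with sub have closed: "closed_subgroup H G" by (simp add: closed_subgroup_def)
  have "H \<lhd> G"
  proof (rule normal_invI[OF sub])
    fix g h assume gh: "g \<in> carrier G" "h \<in> H"
    have "g ** h ** inv\<^bsub>G\<^esub> g = h ** (g ** inv\<^bsub>G\<^esub> g)"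
      using H_central[OF gh(2,1)] by (simp add: matrix_mul_assoc)
    then show "g \<otimes>\<^bsub>G\<^esub> h \<otimes>\<^bsub>G\<^esub> inv\<^bsub>G\<^esub> g \<in> H" using gh by simp
  qed
  moreover have "alg_connected (G\<lparr>carrier := H\<rparr>)"
  proof -
    have op: "openin (zariski (G\<lparr>carrier := H\<rparr>)) U \<longleftrightarrow>
        (\<exists>I\<subseteq>reg G. U = {x \<in> H. \<exists>f\<in>I. f x \<noteq> 0})" for U
      by (subst openin_zariski) (auto simp: reg_G intro: fun_algebra.mult)
    have "\<exists>h. h \<in> E1 \<inter> E2" if E: "openin (zariski (G\<lparr>carrier := H\<rparr>)) E1"
      "openin (zariski (G\<lparr>carrier := H\<rparr>)) E2" "E1 \<noteq> {}" "E2 \<noteq> {}" for E1 E2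
    proof -
      \<comment> \<open>A non-empty open set of \<open>H\<close> contains a principal one that meets the image of \<open>\<mu>\<close>.\<close>
      have one: "\<exists>f\<in>reg G. (\<exists>x. x \<noteq> 0 \<and> f (\<mu> x) \<noteq> 0) \<and> (\<forall>h\<in>H. f h \<noteq> 0 \<longrightarrow> h \<in> E)"
        if asm: "openin (zariski (G\<lparr>carrier := H\<rparr>)) E" "E \<noteq> {}" for E
      proof -
        obtain J where J: "J \<subseteq> reg G" "E = {x \<in> H. \<exists>f\<in>J. f x \<noteq> 0}" using asm(1) unfolding op by auto
        have "\<exists>h. h \<in> E" using asm(2) by auto
        then obtain f h where f: "f \<in> J" "h \<in> H" "f h \<noteq> 0" unfolding J(2) by auto
        have fG: "f \<in> reg G" using J(1) f(1) by (rule subsetD)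
        have "\<exists>x. x \<noteq> 0 \<and> f (\<mu> x) \<noteq> 0" using H_vanish[OF fG _ f(2)] f(3) by auto
        moreover have "\<forall>h\<in>H. f h \<noteq> 0 \<longrightarrow> h \<in> E" using f(1) unfolding J(2) by auto
        ultimately show ?thesis using fG by (intro bexI[of _ f] conjI)
      qed
      obtain f1 x1 where f1: "f1 \<in> reg G" "x1 \<noteq> 0" "f1 (\<mu> x1) \<noteq> 0" "\<And>h. h \<in> H \<Longrightarrow> f1 h \<noteq> 0 \<Longrightarrow> h \<in> E1"
        using one[OF E(1,3)] by blast
      obtain f2 x2 where f2: "f2 \<in> reg G" "x2 \<noteq> 0" "f2 (\<mu> x2) \<noteq> 0" "\<And>h. h \<in> H \<Longrightarrow> f2 h \<noteq> 0 \<Longrightarrow> h \<in> E2"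
        using one[OF E(2,4)] by blast
      obtain k1 where k1: "k1 \<in> reg Gm" "\<And>x. x \<noteq> 0 \<Longrightarrow> f1 (\<mu> x) = k1 x" using mreg[OF f1(1)] by auto
      obtain k2 where k2: "k2 \<in> reg Gm" "\<And>x. x \<noteq> 0 \<Longrightarrow> f2 (\<mu> x) = k2 x" using mreg[OF f2(1)] by auto
      have "finite {y. y \<noteq> 0 \<and> k1 y = 0}" "finite {y. y \<noteq> 0 \<and> k2 y = 0}"
        using reg_Gm_zeros[OF k1(1), of x1] reg_Gm_zeros[OF k2(1), of x2] k1(2) k2(2) f1(2,3) f2(2,3) by auto
      then have "finite ({0} \<union> {y. y \<noteq> 0 \<and> k1 y = 0} \<union> {y. y \<noteq> 0 \<and> k2 y = 0})" by simp
      from ex_new_if_finite[OF infinite_alg_closed this]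
      obtain y where "y \<notin> {0} \<union> {y. y \<noteq> 0 \<and> k1 y = 0} \<union> {y. y \<noteq> 0 \<and> k2 y = 0}" ..
      then have "y \<noteq> 0" "f1 (\<mu> y) \<noteq> 0" "f2 (\<mu> y) \<noteq> 0" using k1(2) k2(2) by auto
      then show ?thesis using f1(4) f2(4) mH by blast
    qed
    then show ?thesis unfolding alg_connected_def connected_space_def by blast
  qed
  ultimately have "H = {\<one>\<^bsub>G\<^esub>} \<or> H = carrier G"
    using simple closed unfolding almost_simple_def by blast
  moreover have "H \<noteq> carrier G"
  proof
    assume "H = carrier G"
    then have "\<forall>g\<in>carrier G. \<forall>h\<in>carrier G. g \<otimes>\<^bsub>G\<^esub> h = h \<otimes>\<^bsub>G\<^esub> g" using H_central by auto
    then show False using simple unfolding almost_simple_def by blast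
  qed
  ultimately show ?thesis using mH[OF x] by auto
qed

end

section \<open>Tori\<close>

locale torus_group = linear_group G for G :: "('f::alg_closed_field^'m::finite^'m, 'f) alg_group" +
  fixes T :: "('f^'m^'m) set"
  assumes T_subgroup: "subgroup T G" and T_torus: "is_torus (G\<lparr>carrier := T\<rparr>)"
begin

abbreviation "TG \<equiv> G\<lparr>carrier := T\<rparr>"

lemma T_G: "t \<in> T \<Longrightarrow> t \<in> carrier G" using subgroup.subset[OF T_subgroup] by blast

lemma T_one [simp]: "mat 1 \<in> T" using subgroup.one_closed[OF T_subgroup] by simp

lemma T_mult [simp]: "t \<in> T \<Longrightarrow> t' \<in> T \<Longrightarrow> t ** t' \<in> T"
  using subgroup.m_closed[OF T_subgroup] by simp

lemma T_inv [simp]: "t \<in> T \<Longrightarrow> inv\<^bsub>G\<^esub> t \<in> T" using subgroup.m_inv_closed[OF T_subgroup] by simp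

lemma torus_coordinates:
  obtains r \<phi> \<psi> where "\<phi> \<in> alg_hom (Gm_power r) TG" "\<psi> \<in> alg_hom TG (Gm_power r)"
    "\<And>x. x \<in> carrier (Gm_power r) \<Longrightarrow> \<psi> (\<phi> x) = x" "\<And>t. t \<in> T \<Longrightarrow> \<phi> (\<psi> t) = t"
proof -
  obtain r \<phi> where "\<phi> \<in> alg_iso (Gm_power r) TG" using T_torus unfolding is_torus_def by blast
  then show ?thesis using that unfolding alg_iso_def by auto
qed

lemma T_comm: "t \<in> T \<Longrightarrow> t' \<in> T \<Longrightarrow> t ** t' = t' ** t"
proof -
  obtain r \<phi> \<psi> where c: "\<phi> \<in> alg_hom (Gm_power r) TG" "\<psi> \<in> alg_hom TG (Gm_power r)"
    "\<And>x. x \<in> carrier (Gm_power r) \<Longrightarrow> \<psi> (\<phi> x) = x" "\<And>t. t \<in> T \<Longrightarrow> \<phi> (\<psi> t) = t"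
    using torus_coordinates by metis
  assume t: "t \<in> T" "t' \<in> T"
  then have p: "\<psi> t \<in> carrier (Gm_power r)" "\<psi> t' \<in> carrier (Gm_power r)"
    using c(2) unfolding alg_hom_def hom_def by auto
  have m: "\<phi> (x \<otimes>\<^bsub>Gm_power r\<^esub> y) = \<phi> x ** \<phi> y" if "x \<in> carrier (Gm_power r)" "y \<in> carrier (Gm_power r)" for x y
    using c(1) that unfolding alg_hom_def hom_def by auto
  have "\<psi> t \<otimes>\<^bsub>Gm_power r\<^esub> \<psi> t' = \<psi> t' \<otimes>\<^bsub>Gm_power r\<^esub> \<psi> t"
    by (simp add: Gm_power_def mult.commute)
  then show ?thesis using m[OF p] m[OF p(2,1)] t c(4) by metis
qed

lemma characterD:
  assumes "\<eta> \<in> characters G T"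
  shows "t \<in> T \<Longrightarrow> t' \<in> T \<Longrightarrow> \<eta> (t ** t') = \<eta> t * \<eta> t'" "t \<in> T \<Longrightarrow> \<eta> t \<noteq> 0" "\<eta> \<in> extensional T"
    "\<exists>f\<in>reg G. \<forall>t\<in>T. \<eta> t = f t" "\<exists>f\<in>reg G. \<forall>t\<in>T. inverse (\<eta> t) = f t"
proof -
  have h: "\<eta> \<in> hom TG Gm" "\<eta> \<in> extensional T" "\<forall>g\<in>reg Gm. \<exists>f\<in>reg TG. \<forall>t\<in>carrier TG. g (\<eta> t) = f t"
    using assms unfolding characters_def alg_hom_def by auto
  show "t \<in> T \<Longrightarrow> t' \<in> T \<Longrightarrow> \<eta> (t ** t') = \<eta> t * \<eta> t'" "t \<in> T \<Longrightarrow> \<eta> t \<noteq> 0" "\<eta> \<in> extensional T"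
    using h(1,2) unfolding hom_def by auto
  have "(\<lambda>x. x) \<in> reg Gm" "inverse \<in> reg Gm" unfolding reg_Gm by (auto intro: fun_algebra.gen)
  then show "\<exists>f\<in>reg G. \<forall>t\<in>T. \<eta> t = f t" "\<exists>f\<in>reg G. \<forall>t\<in>T. inverse (\<eta> t) = f t"
    using h(3) by fastforce+
qed

lemma characterI:
  assumes "\<And>t t'. t \<in> T \<Longrightarrow> t' \<in> T \<Longrightarrow> \<eta> (t ** t') = \<eta> t * \<eta> t'" "\<And>t. t \<in> T \<Longrightarrow> \<eta> t \<noteq> 0" "\<eta> \<in> extensional T"
    "\<exists>f\<in>reg G. \<forall>t\<in>T. \<eta> t = f t" "\<exists>f\<in>reg G. \<forall>t\<in>T. inverse (\<eta> t) = f t"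
  shows "\<eta> \<in> characters G T"
proof -
  have "\<exists>f\<in>reg G. \<forall>t\<in>T. g (\<eta> t) = f t" if "g \<in> reg Gm" for g
    unfolding reg_G
  proof (rule fun_algebra_pullback[OF _ that[unfolded reg_Gm]])
    fix b :: "'f \<Rightarrow> 'f" assume "b \<in> {\<lambda>x. x, inverse}"
    then consider "b = (\<lambda>x. x)" | "b = inverse" by blast
    then show "\<exists>f\<in>fun_algebra (insert (\<lambda>A. inverse (det A)) matrix_entries). \<forall>t\<in>T. b (\<eta> t) = f t"
      using assms(4,5) unfolding reg_G by cases auto
  qed
  then show ?thesis using assms(1-3) unfolding characters_def alg_hom_def hom_def by auto
qed

lemma character_one: "\<eta> \<in> characters G T \<Longrightarrow> \<eta> (mat 1) = 1"
  using characterD(1)[of \<eta> "mat 1" "mat 1"] characterD(2)[of \<eta> "mat 1"] by simp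

lemma character_inv: "\<eta> \<in> characters G T \<Longrightarrow> t \<in> T \<Longrightarrow> \<eta> (inv\<^bsub>G\<^esub> t) = inverse (\<eta> t)"
  using characterD(1)[of \<eta> t "inv\<^bsub>G\<^esub> t"] by (auto simp: character_one T_G inverse_unique)

lemma reg_mult: "f \<in> reg G \<Longrightarrow> g \<in> reg G \<Longrightarrow> (\<lambda>x. f x * g x) \<in> reg G"
  unfolding reg_G by (rule fun_algebra.mult)

lemma trivial_character: "(\<lambda>t\<in>T. 1) \<in> characters G T"
proof (rule characterI)
  have "(\<lambda>_. 1) \<in> reg G" unfolding reg_G by (rule fun_algebra.const)
  then show "\<exists>f\<in>reg G. \<forall>t\<in>T. (\<lambda>t\<in>T. 1) t = f t" "\<exists>f\<in>reg G. \<forall>t\<in>T. inverse ((\<lambda>t\<in>T. 1) t) = f t"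
    by force+
qed auto

lemma character_mult:
  assumes "\<eta> \<in> characters G T" "\<xi> \<in> characters G T"
  shows "(\<lambda>t\<in>T. \<eta> t * \<xi> t) \<in> characters G T"
proof (rule characterI)
  obtain f g where "f \<in> reg G" "\<forall>t\<in>T. \<eta> t = f t" "g \<in> reg G" "\<forall>t\<in>T. \<xi> t = g t"
    using characterD(4) assms by metis
  then show "\<exists>f\<in>reg G. \<forall>t\<in>T. (\<lambda>t\<in>T. \<eta> t * \<xi> t) t = f t"
    using reg_mult[of f g] by (auto intro!: bexI[of _ "\<lambda>x. f x * g x"])
  obtain f g where "f \<in> reg G" "\<forall>t\<in>T. inverse (\<eta> t) = f t" "g \<in> reg G" "\<forall>t\<in>T. inverse (\<xi> t) = g t"
    using characterD(5) assms by metis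
  then show "\<exists>f\<in>reg G. \<forall>t\<in>T. inverse ((\<lambda>t\<in>T. \<eta> t * \<xi> t) t) = f t"
    using reg_mult[of f g] by (auto intro!: bexI[of _ "\<lambda>x. f x * g x"])
qed (use assms in \<open>auto simp: characterD(1,2)[OF assms(1)] characterD(1,2)[OF assms(2)]\<close>)

lemma character_inverse:
  assumes "\<eta> \<in> characters G T"
  shows "(\<lambda>t\<in>T. inverse (\<eta> t)) \<in> characters G T"
  by (rule characterI)
    (use characterD(4,5)[OF assms] in \<open>auto simp: characterD(1,2)[OF assms]\<close>)

text \<open>In coordinates a regular function on a torus is a Laurent polynomial, and the coordinates
  and their inverses are characters.\<close>

lemma reg_char_span:
  assumes "f \<in> reg G"
  shows "f \<in> char_span T (characters G T)"
proof -
  obtain r \<phi> \<psi> where c: "\<phi> \<in> alg_hom (Gm_power r) TG" "\<psi> \<in> alg_hom TG (Gm_power r)"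
    "\<And>x. x \<in> carrier (Gm_power r) \<Longrightarrow> \<psi> (\<phi> x) = x" "\<And>t. t \<in> T \<Longrightarrow> \<phi> (\<psi> t) = t"
    using torus_coordinates by metis
  obtain k where k: "k \<in> reg (Gm_power r)" "\<And>x. x \<in> carrier (Gm_power r) \<Longrightarrow> f (\<phi> x) = k x"
    using c(1) assms unfolding alg_hom_def by auto
  have psi_closed: "\<psi> t \<in> carrier (Gm_power r)" if "t \<in> T" for t
    using c(2) that unfolding alg_hom_def hom_def by auto
  have psi_mult: "\<psi> (t ** t') i = \<psi> t i * \<psi> t' i" if "t \<in> T" "t' \<in> T" for t t' i
    using c(2) that unfolding alg_hom_def hom_def Gm_power_def by auto
  have coord: "(\<lambda>t\<in>T. \<psi> t i) \<in> characters G T" if i: "i < r" for i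
  proof (rule characterI)
    have "(\<lambda>x. x i) \<in> reg (Gm_power r)" "(\<lambda>x. inverse (x i)) \<in> reg (Gm_power r)"
      using i by (auto simp: Gm_power_def intro!: fun_algebra.gen)
    then have "\<exists>f\<in>reg G. \<forall>t\<in>T. \<psi> t i = f t" "\<exists>f\<in>reg G. \<forall>t\<in>T. inverse (\<psi> t i) = f t"
      using c(2) unfolding alg_hom_def by fastforce+
    then show "\<exists>f\<in>reg G. \<forall>t\<in>T. (\<lambda>t\<in>T. \<psi> t i) t = f t" "\<exists>f\<in>reg G. \<forall>t\<in>T. inverse ((\<lambda>t\<in>T. \<psi> t i) t) = f t"
      by auto
    show "(\<lambda>t\<in>T. \<psi> t i) t \<noteq> 0" if "t \<in> T" for t
      using psi_closed[OF that] i that by (simp add: Gm_power_def)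
  qed (auto simp: psi_mult)
  have "(\<lambda>t. k (\<psi> t)) \<in> char_span T (characters G T)"
  proof (rule fun_algebra_char_span[OF character_mult trivial_character, where p = \<psi> and f = k
        and B = "{\<lambda>x. x i |i. i < r} \<union> {\<lambda>x. inverse (x i) |i. i < r}"])
    show "k \<in> fun_algebra ({\<lambda>x. x i |i. i < r} \<union> {\<lambda>x. inverse (x i) |i. i < r})"
      using k(1) by (simp add: Gm_power_def)
    fix b :: "(nat \<Rightarrow> 'f) \<Rightarrow> 'f" assume "b \<in> {\<lambda>x. x i |i. i < r} \<union> {\<lambda>x. inverse (x i) |i. i < r}"
    then consider i where "i < r" "b = (\<lambda>x. x i)" | i where "i < r" "b = (\<lambda>x. inverse (x i))" by blast
    then show "(\<lambda>t. b (\<psi> t)) \<in> char_span T (characters G T)"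
    proof cases
      case 1
      show ?thesis by (rule char_span_single[OF coord[OF 1(1)], of _ _ 1]) (simp add: 1)
    next
      case 2
      show ?thesis
        by (rule char_span_single[OF character_inverse[OF coord[OF 2(1)]], of _ _ 1]) (simp add: 2)
    qed
  qed
  then show ?thesis
    by (rule char_span_cong[rotated]) (metis c(4) k(2) psi_closed)
qed

lemma characters_on_torus_independent:
  assumes "finite K" "K \<subseteq> characters G T" "\<And>t. t \<in> T \<Longrightarrow> (\<Sum>\<eta>\<in>K. c \<eta> * \<eta> t) = 0" "\<eta> \<in> K"
  shows "c \<eta> = 0"
proof -
  have "\<forall>\<eta>\<in>K. c \<eta> = 0"
  proof (rule characters_independent[where H = T and m = "(**)" and \<eta> = "\<lambda>\<eta>. \<eta>"])
    fix \<xi> \<xi>' assume "\<xi> \<in> K" "\<xi>' \<in> K" "\<xi> \<noteq> \<xi>'"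
    then show "\<exists>x\<in>T. \<xi> x \<noteq> \<xi>' x"
      using characterD(3) assms(2) by (meson extensionalityI subsetD)
  next
    fix \<xi> x y assume "\<xi> \<in> K" "x \<in> T" "y \<in> T"
    then show "\<xi> (x ** y) = \<xi> x * \<xi> y" using characterD(1) assms(2) by blast
  next
    fix \<xi> assume "\<xi> \<in> K"
    then show "\<exists>x\<in>T. \<xi> x \<noteq> 0" using characterD(2) assms(2) T_one by blast
  qed (use assms in auto)
  then show ?thesis using assms(4) by blast
qed

text \<open>Complete reducibility of the adjoint action of a torus on all matrices: the matrix
  coefficients of \<open>Ad(t)\<close> are regular functions of \<open>t\<close>, hence combinations of characters, and
  finitely many characters suffice for the finitely many coefficients. The map with matrix \<open>c \<eta>\<close>
  will be the projection onto the weight space of \<open>\<eta>\<close>.\<close>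

lemma Ad_weights:
  obtains K c where "finite K" "K \<subseteq> characters G T"
    "\<And>t X p. t \<in> T \<Longrightarrow> ent (t ** X ** inv\<^bsub>G\<^esub> t) p = (\<Sum>\<eta>\<in>K. \<eta> t * (\<Sum>q\<in>UNIV. ent X q * c \<eta> p q))"
proof -
  have span: "(\<lambda>t. ent t (fst p, fst q) * ent (inv\<^bsub>G\<^esub> t) (snd q, snd p)) \<in> char_span T (characters G T)" for p q :: "'m \<times> 'm"
  proof (rule char_span_mult[OF character_mult])
    show "(\<lambda>t. ent t (fst p, fst q)) \<in> char_span T (characters G T)"
      by (intro reg_char_span polyfun_reg_G ent_polyfun)
    obtain f where f: "f \<in> reg G" "\<And>g. g \<in> carrier G \<Longrightarrow> ent (inv\<^bsub>G\<^esub> g) (snd q, snd p) = f g"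
      using reg_inv_entry by blast
    show "(\<lambda>t. ent (inv\<^bsub>G\<^esub> t) (snd q, snd p)) \<in> char_span T (characters G T)"
      by (rule char_span_cong[OF _ reg_char_span[OF f(1)]]) (simp add: f(2) T_G)
  qed
  have "\<forall>pq. \<exists>Kd. finite (fst Kd) \<and> fst Kd \<subseteq> characters G T \<and>
      (\<forall>t\<in>T. ent t (fst (fst pq), fst (snd pq)) * ent (inv\<^bsub>G\<^esub> t) (snd (snd pq), snd (fst pq)) =
        (\<Sum>\<eta>\<in>fst Kd. snd Kd \<eta> * \<eta> t))"
  proof
    fix pq :: "('m \<times> 'm) \<times> ('m \<times> 'm)"
    obtain K d where "finite K" "K \<subseteq> characters G T"
      "\<forall>t\<in>T. ent t (fst (fst pq), fst (snd pq)) * ent (inv\<^bsub>G\<^esub> t) (snd (snd pq), snd (fst pq)) =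
        (\<Sum>\<eta>\<in>K. d \<eta> * \<eta> t)"
      using span[of "fst pq" "snd pq"] unfolding char_span_def by auto
    then show "\<exists>Kd. finite (fst Kd) \<and> fst Kd \<subseteq> characters G T \<and>
      (\<forall>t\<in>T. ent t (fst (fst pq), fst (snd pq)) * ent (inv\<^bsub>G\<^esub> t) (snd (snd pq), snd (fst pq)) =
        (\<Sum>\<eta>\<in>fst Kd. snd Kd \<eta> * \<eta> t))" by (intro exI[of _ "(K, d)"]) simp
  qed
  from choice[OF this] obtain Kd where Kd: "\<And>pq. finite (fst (Kd pq)) \<and> fst (Kd pq) \<subseteq> characters G T \<and>
      (\<forall>t\<in>T. ent t (fst (fst pq), fst (snd pq)) * ent (inv\<^bsub>G\<^esub> t) (snd (snd pq), snd (fst pq)) =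
        (\<Sum>\<eta>\<in>fst (Kd pq). snd (Kd pq) \<eta> * \<eta> t))" by (elim exE) (rule that, erule spec)
  define K d where "K pq = fst (Kd pq)" and "d pq = snd (Kd pq)" for pq
  have K: "finite (K pq)" "K pq \<subseteq> characters G T"
    "t \<in> T \<Longrightarrow> ent t (fst (fst pq), fst (snd pq)) * ent (inv\<^bsub>G\<^esub> t) (snd (snd pq), snd (fst pq)) =
        (\<Sum>\<eta>\<in>K pq. d pq \<eta> * \<eta> t)" for pq t
    using Kd[of pq] unfolding K_def d_def by blast+
  define K' where "K' = (\<Union>pq. K pq)"
  define c where "c \<eta> p q = (if \<eta> \<in> K (p, q) then d (p, q) \<eta> else 0)" for \<eta> p q
  have fin: "finite K'" unfolding K'_def using K(1) by auto
  show ?thesis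
  proof (rule that[of K' c])
    show "finite K'" by (rule fin)
    show "K' \<subseteq> characters G T" unfolding K'_def by (intro UN_least K(2))
    fix t X p assume t: "t \<in> T"
    have "ent t (fst p, fst q) * ent (inv\<^bsub>G\<^esub> t) (snd q, snd p) = (\<Sum>\<eta>\<in>K'. c \<eta> p q * \<eta> t)" for q
    proof -
      have "(\<Sum>\<eta>\<in>K (p, q). d (p, q) \<eta> * \<eta> t) = (\<Sum>\<eta>\<in>K'. c \<eta> p q * \<eta> t)"
        by (intro sum.mono_neutral_cong_left) (use fin in \<open>auto simp: K'_def c_def\<close>)
      then show ?thesis using K(3)[OF t, of "(p, q)"] by simp
    qed
    then have "ent (t ** X ** inv\<^bsub>G\<^esub> t) p = (\<Sum>q\<in>UNIV. \<Sum>\<eta>\<in>K'. \<eta> t * (ent X q * c \<eta> p q))"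
      unfolding ent_conj by (simp add: sum_distrib_left mult_ac)
    also have "\<dots> = (\<Sum>\<eta>\<in>K'. \<Sum>q\<in>UNIV. \<eta> t * (ent X q * c \<eta> p q))" by (rule sum.swap)
    finally show "ent (t ** X ** inv\<^bsub>G\<^esub> t) p = (\<Sum>\<eta>\<in>K'. \<eta> t * (\<Sum>q\<in>UNIV. ent X q * c \<eta> p q))"
      by (simp add: sum_distrib_left)
  qed
qed

end

section \<open>Weights of the adjoint action\<close>

lemma mat_scalar_mult:
  fixes X a b :: "'f::field^'m::finite^'m"
  shows "a ** (mat z ** X) ** b = mat z ** (a ** X ** b)"
  by (rule ent_eqI) (simp add: ent_conj sum_distrib_left mult_ac)

context torus_group
begin

text \<open>Independence of characters turns every linear statement about \<open>Ad(t)\<close> that holds for all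
  \<open>t\<close> into one about each weight component \<open>P \<eta>\<close>. In particular the components of an element of
  the Lie algebra lie in the Lie algebra again, so a non-trivial weight occurring there is a
  root. If the roots are trivial at \<open>s\<close>, then \<open>Ad(s)\<close> is trivial on the Lie algebra, and
  \<open>centralizer_of_semisimple\<close> applies.\<close>

lemma central_if_roots_trivial:
  assumes conn: "alg_connected G" and s: "s \<in> T"
    and roots: "\<And>\<alpha>. \<alpha> \<in> roots G T \<Longrightarrow> \<alpha> s = 1"
    and g: "g \<in> carrier G"
  shows "s ** g = g ** s"
proof -
  obtain K c where K: "finite K" "K \<subseteq> characters G T"
    and Ad: "\<And>t X p. t \<in> T \<Longrightarrow> ent (t ** X ** inv\<^bsub>G\<^esub> t) p = (\<Sum>\<eta>\<in>K. \<eta> t * (\<Sum>q\<in>UNIV. ent X q * c \<eta> p q))"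
    by (rule Ad_weights, rule that)
  define P :: "('f^'m^'m \<Rightarrow> 'f) \<Rightarrow> 'f^'m^'m \<Rightarrow> 'f^'m^'m" where
    "P \<eta> X = (\<chi> i j. \<Sum>q\<in>UNIV. ent X q * c \<eta> (i, j) q)" for \<eta> X
  have entP: "ent (P \<eta> X) p = (\<Sum>q\<in>UNIV. ent X q * c \<eta> p q)" for \<eta> X p
    by (simp add: P_def ent_def)
  have P_diff: "P \<eta> (X - Y) = P \<eta> X - P \<eta> Y" for \<eta> X Y
    by (rule ent_eqI) (simp add: entP left_diff_distrib sum_subtractf)
  have P_zero: "P \<eta> 0 = 0" for \<eta> using P_diff[of \<eta> 0 0] by simp
  have P_sum: "P \<eta> (\<Sum>i\<in>I. mat (a i) ** X i) = (\<Sum>i\<in>I. mat (a i) ** P \<eta> (X i))"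
    for \<eta> and I :: "('f^'m^'m \<Rightarrow> 'f) set" and a X
  proof (rule ent_eqI)
    fix p
    have "ent (P \<eta> (\<Sum>i\<in>I. mat (a i) ** X i)) p = (\<Sum>q\<in>UNIV. \<Sum>i\<in>I. a i * ent (X i) q * c \<eta> p q)"
      by (simp add: entP sum_distrib_right)
    also have "\<dots> = (\<Sum>i\<in>I. \<Sum>q\<in>UNIV. a i * ent (X i) q * c \<eta> p q)" by (rule sum.swap)
    finally show "ent (P \<eta> (\<Sum>i\<in>I. mat (a i) ** X i)) p = ent (\<Sum>i\<in>I. mat (a i) ** P \<eta> (X i)) p"
      by (simp add: entP sum_distrib_left mult.assoc)
  qed
  have Ad_eq: "t ** X ** inv\<^bsub>G\<^esub> t = (\<Sum>\<eta>\<in>K. mat (\<eta> t) ** P \<eta> X)" if "t \<in> T" for t X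
    by (rule ent_eqI) (simp add: Ad[OF that] entP)
  \<comment> \<open>Compare \<open>Ad(t) Ad(t')\<close> with \<open>Ad(t t')\<close> and separate the characters of \<open>t'\<close>.\<close>
  have weight: "t ** P \<eta> X ** inv\<^bsub>G\<^esub> t = mat (\<eta> t) ** P \<eta> X" if t: "t \<in> T" and \<eta>: "\<eta> \<in> K" for t \<eta> X
  proof (rule ent_eqI)
    fix p
    have "ent (t ** P \<eta> X ** inv\<^bsub>G\<^esub> t) p - \<eta> t * ent (P \<eta> X) p = 0"
    proof (rule characters_on_torus_independent[OF K _ \<eta>,
          where c = "\<lambda>\<eta>. ent (t ** P \<eta> X ** inv\<^bsub>G\<^esub> t) p - \<eta> t * ent (P \<eta> X) p"])
      fix t' assume t': "t' \<in> T"
      define \<gamma> where "\<gamma> q = ent t (fst p, fst q) * ent (inv\<^bsub>G\<^esub> t) (snd q, snd p)" for q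
      have "t ** (t' ** X ** inv\<^bsub>G\<^esub> t') ** inv\<^bsub>G\<^esub> t = (t ** t') ** X ** (inv\<^bsub>G\<^esub> t' ** inv\<^bsub>G\<^esub> t)"
        by (simp add: matrix_mul_assoc)
      also have "inv\<^bsub>G\<^esub> t' ** inv\<^bsub>G\<^esub> t = inv\<^bsub>G\<^esub> (t ** t')"
        using inv_mult_group[of t t'] t t' T_G by simp
      finally have eq: "t ** (t' ** X ** inv\<^bsub>G\<^esub> t') ** inv\<^bsub>G\<^esub> t = (t ** t') ** X ** inv\<^bsub>G\<^esub> (t ** t')" .
      have "ent ((t ** t') ** X ** inv\<^bsub>G\<^esub> (t ** t')) p = (\<Sum>\<eta>\<in>K. \<eta> (t ** t') * ent (P \<eta> X) p)"
        using t t' by (simp add: Ad entP)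
      also have "\<dots> = (\<Sum>\<eta>\<in>K. \<eta> t * \<eta> t' * ent (P \<eta> X) p)"
        by (intro sum.cong refl) (use t t' K(2) characterD(1) in auto)
      finally have 1: "ent (t ** (t' ** X ** inv\<^bsub>G\<^esub> t') ** inv\<^bsub>G\<^esub> t) p = (\<Sum>\<eta>\<in>K. \<eta> t * \<eta> t' * ent (P \<eta> X) p)"
        unfolding eq .
      have "ent (t ** (t' ** X ** inv\<^bsub>G\<^esub> t') ** inv\<^bsub>G\<^esub> t) p = (\<Sum>q\<in>UNIV. ent (t' ** X ** inv\<^bsub>G\<^esub> t') q * \<gamma> q)"
        unfolding \<gamma>_def by (rule ent_conj)
      also have "\<dots> = (\<Sum>q\<in>UNIV. \<Sum>\<eta>\<in>K. \<eta> t' * ent (P \<eta> X) q * \<gamma> q)"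
        by (simp add: Ad[OF t'] entP sum_distrib_right)
      also have "\<dots> = (\<Sum>\<eta>\<in>K. \<Sum>q\<in>UNIV. \<eta> t' * ent (P \<eta> X) q * \<gamma> q)" by (rule sum.swap)
      also have "\<dots> = (\<Sum>\<eta>\<in>K. \<eta> t' * ent (t ** P \<eta> X ** inv\<^bsub>G\<^esub> t) p)"
        unfolding ent_conj[of t] \<gamma>_def by (simp add: sum_distrib_left mult.assoc)
      finally have 2: "(\<Sum>\<eta>\<in>K. \<eta> t' * ent (t ** P \<eta> X ** inv\<^bsub>G\<^esub> t) p) = (\<Sum>\<eta>\<in>K. \<eta> t * \<eta> t' * ent (P \<eta> X) p)"
        using 1 by simp
      have "(\<Sum>\<eta>\<in>K. (ent (t ** P \<eta> X ** inv\<^bsub>G\<^esub> t) p - \<eta> t * ent (P \<eta> X) p) * \<eta> t') =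
          (\<Sum>\<eta>\<in>K. \<eta> t' * ent (t ** P \<eta> X ** inv\<^bsub>G\<^esub> t) p) - (\<Sum>\<eta>\<in>K. \<eta> t * \<eta> t' * ent (P \<eta> X) p)"
        by (simp add: sum_subtractf[symmetric] algebra_simps)
      then show "(\<Sum>\<eta>\<in>K. (ent (t ** P \<eta> X ** inv\<^bsub>G\<^esub> t) p - \<eta> t * ent (P \<eta> X) p) * \<eta> t') = 0"
        using 2 by simp
    qed
    then show "ent (t ** P \<eta> X ** inv\<^bsub>G\<^esub> t) p = ent (mat (\<eta> t) ** P \<eta> X) p" by simp
  qed
  have orth: "P \<eta> (P \<xi> X) = (if \<eta> = \<xi> then P \<xi> X else 0)" if \<xi>: "\<xi> \<in> K" and \<eta>: "\<eta> \<in> K" for \<eta> \<xi> X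
  proof (rule ent_eqI)
    fix p
    have "ent (P \<eta> (P \<xi> X)) p - (if \<eta> = \<xi> then ent (P \<xi> X) p else 0) = 0"
    proof (rule characters_on_torus_independent[OF K _ \<eta>,
          where c = "\<lambda>\<eta>. ent (P \<eta> (P \<xi> X)) p - (if \<eta> = \<xi> then ent (P \<xi> X) p else 0)"])
      fix t assume t: "t \<in> T"
      have "(\<Sum>\<eta>\<in>K. \<eta> t * ent (P \<eta> (P \<xi> X)) p) = \<xi> t * ent (P \<xi> X) p"
        using arg_cong[OF Ad_eq[OF t, of "P \<xi> X"], of "\<lambda>Y. ent Y p"] weight[OF t \<xi>, of X] by simp
      moreover have "(\<Sum>\<eta>\<in>K. (if \<eta> = \<xi> then ent (P \<xi> X) p else 0) * \<eta> t) = \<xi> t * ent (P \<xi> X) p"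
      proof -
        have "(\<Sum>\<eta>\<in>K. (if \<eta> = \<xi> then ent (P \<xi> X) p else 0) * \<eta> t) =
            (\<Sum>\<eta>\<in>K. if \<eta> = \<xi> then \<xi> t * ent (P \<xi> X) p else 0)"
          by (intro sum.cong refl) simp
        then show ?thesis using K(1) \<xi> by simp
      qed
      ultimately show "(\<Sum>\<eta>\<in>K. (ent (P \<eta> (P \<xi> X)) p - (if \<eta> = \<xi> then ent (P \<xi> X) p else 0)) * \<eta> t) = 0"
        by (simp add: left_diff_distrib sum_subtractf mult.commute[of "ent _ _"])
    qed
    then show "ent (P \<eta> (P \<xi> X)) p = ent (if \<eta> = \<xi> then P \<xi> X else 0) p" by (cases "\<eta> = \<xi>") auto
  qed
  \<comment> \<open>\<open>Ad(s)\<close> acts by the scalar \<open>\<eta> s\<close> on the \<open>\<eta>\<close>-component: its fixed space collects the weights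
    in \<open>K0\<close>, and \<open>Ad(s) - 1\<close> is invertible on the components in \<open>K1\<close>.\<close>
  define K0 where "K0 = {\<eta> \<in> K. \<eta> s = 1}"
  define K1 where "K1 = {\<eta> \<in> K. \<eta> s \<noteq> 1}"
  have K01: "finite K0" "finite K1" "K = K0 \<union> K1" "K0 \<inter> K1 = {}"
    using K(1) by (auto simp: K0_def K1_def)
  have split: "(\<Sum>\<eta>\<in>K. F \<eta>) = (\<Sum>\<eta>\<in>K0. F \<eta>) + (\<Sum>\<eta>\<in>K1. F \<eta>)" for F :: "_ \<Rightarrow> 'f^'m^'m"
    unfolding K01(3) by (rule sum.union_disjoint[OF K01(1,2,4)])
  define A where "A X = s ** X ** inv\<^bsub>G\<^esub> s" for X
  define pr where "pr X = (\<Sum>\<eta>\<in>K0. P \<eta> X)" for X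
  define B where "B X = (\<Sum>\<eta>\<in>K1. mat (inverse (\<eta> s - 1)) ** P \<eta> X)" for X
  define \<beta> where "\<beta> p q = (\<Sum>\<eta>\<in>K1. inverse (\<eta> s - 1) * c \<eta> p q)" for p q
  have decomp: "X = (\<Sum>\<eta>\<in>K. P \<eta> X)" for X
  proof -
    have "inv\<^bsub>G\<^esub> (mat 1) = mat 1" using inv_one by simp
    then have "X = (\<Sum>\<eta>\<in>K. mat (\<eta> (mat 1)) ** P \<eta> X)" using Ad_eq[OF T_one, of X] by simp
    also have "\<dots> = (\<Sum>\<eta>\<in>K. P \<eta> X)"
      by (intro sum.cong refl) (simp add: character_one[OF subsetD[OF K(2)]])
    finally show ?thesis .
  qed
  have A_eq: "A X = (\<Sum>\<eta>\<in>K. mat (\<eta> s) ** P \<eta> X)" for X unfolding A_def by (rule Ad_eq[OF s])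
  have AX: "A X - X = (\<Sum>\<eta>\<in>K. mat (\<eta> s - 1) ** P \<eta> X)" for X
  proof (rule ent_eqI)
    fix p
    have "ent X p = (\<Sum>\<eta>\<in>K. ent (P \<eta> X) p)" using arg_cong[OF decomp[of X], of "\<lambda>Y. ent Y p"] by simp
    then show "ent (A X - X) p = ent (\<Sum>\<eta>\<in>K. mat (\<eta> s - 1) ** P \<eta> X) p"
      by (simp add: A_eq left_diff_distrib sum_subtractf)
  qed
  have P_AX: "P \<xi> (A X - X) = mat (\<xi> s - 1) ** P \<xi> X" if \<xi>: "\<xi> \<in> K" for \<xi> X
  proof (rule ent_eqI)
    fix p
    have "ent (P \<xi> (A X - X)) p = (\<Sum>\<eta>\<in>K. (\<eta> s - 1) * ent (P \<xi> (P \<eta> X)) p)"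
      unfolding AX P_sum by simp
    also have "\<dots> = (\<Sum>\<eta>\<in>K. if \<eta> = \<xi> then (\<xi> s - 1) * ent (P \<xi> X) p else 0)"
      by (intro sum.cong refl) (simp add: orth \<xi>)
    also have "\<dots> = ent (mat (\<xi> s - 1) ** P \<xi> X) p" using K(1) \<xi> by simp
    finally show "ent (P \<xi> (A X - X)) p = ent (mat (\<xi> s - 1) ** P \<xi> X) p" .
  qed
  have K1_vanish: "P \<eta> X = 0" if "A X = X" "\<eta> \<in> K1" for X \<eta>
  proof (rule ent_eqI)
    fix p
    have "mat (\<eta> s - 1) ** P \<eta> X = 0"
      using P_AX[of \<eta> X] that by (simp add: P_zero K1_def)
    then have "(\<eta> s - 1) * ent (P \<eta> X) p = 0" using ent_mat_mult[of "\<eta> s - 1" "P \<eta> X" p] by simp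
    then show "ent (P \<eta> X) p = ent 0 p" using that(2) by (simp add: K1_def)
  qed
  show ?thesis
  proof (rule centralizer_of_semisimple[OF conn, where pr = pr and B = B and \<beta> = \<beta>])
    show "s \<in> carrier G" using s by (rule T_G)
    show "(\<lambda>g. ent (pr g) p) \<in> polyfun" for p
      unfolding pr_def ent_sum entP
      by (intro fun_algebra_sum K01 fun_algebra.mult fun_algebra.const ent_polyfun) simp
    show "s ** pr X ** inv\<^bsub>G\<^esub> s = pr X" for X
    proof (rule ent_eqI)
      fix p
      have "s ** pr X ** inv\<^bsub>G\<^esub> s = (\<Sum>\<eta>\<in>K0. s ** P \<eta> X ** inv\<^bsub>G\<^esub> s)"
        unfolding pr_def using K01(1)
      proof (induction K0 rule: finite_induct)
        case empty
        show ?case by (rule ent_eqI) (simp add: ent_conj)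
      next
        case (insert a F)
        have "s ** (X + Y) ** inv\<^bsub>G\<^esub> s = s ** X ** inv\<^bsub>G\<^esub> s + s ** Y ** inv\<^bsub>G\<^esub> s" for X Y
          by (rule ent_eqI) (simp add: ent_conj distrib_right sum.distrib)
        with insert show ?case by simp
      qed
      also have "\<dots> = pr X" unfolding pr_def
      proof (rule sum.cong[OF refl])
        fix \<eta> assume "\<eta> \<in> K0"
        then have "\<eta> \<in> K" "\<eta> s = 1" by (auto simp: K0_def)
        then show "s ** P \<eta> X ** inv\<^bsub>G\<^esub> s = P \<eta> X" using weight[OF s, of \<eta> X] by simp
      qed
      finally show "ent (s ** pr X ** inv\<^bsub>G\<^esub> s) p = ent (pr X) p" by simp
    qed
    show "pr X = X" if "s ** X ** inv\<^bsub>G\<^esub> s = X" for X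
    proof -
      have "(\<Sum>\<eta>\<in>K1. P \<eta> X) = 0" by (rule sum.neutral) (use K1_vanish that A_def in auto)
      then show ?thesis using decomp[of X] split[of "\<lambda>\<eta>. P \<eta> X"] by (simp add: pr_def)
    qed
    show "ent (B X) p = (\<Sum>q\<in>UNIV. ent X q * \<beta> p q)" for X p
    proof -
      have "ent (B X) p = (\<Sum>\<eta>\<in>K1. \<Sum>q\<in>UNIV. inverse (\<eta> s - 1) * (ent X q * c \<eta> p q))"
        by (simp add: B_def entP sum_distrib_left)
      also have "\<dots> = (\<Sum>q\<in>UNIV. \<Sum>\<eta>\<in>K1. inverse (\<eta> s - 1) * (ent X q * c \<eta> p q))" by (rule sum.swap)
      finally show ?thesis by (simp add: \<beta>_def sum_distrib_left mult_ac)
    qed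
    show "X - pr X = B (s ** X ** inv\<^bsub>G\<^esub> s - X)" for X
    proof -
      have "X - pr X = (\<Sum>\<eta>\<in>K1. P \<eta> X)"
        using decomp[of X] split[of "\<lambda>\<eta>. P \<eta> X"] by (simp add: pr_def algebra_simps)
      also have "\<dots> = B (A X - X)" unfolding B_def
      proof (rule sum.cong[OF refl])
        fix \<eta> assume "\<eta> \<in> K1"
        then have "\<eta> \<in> K" "\<eta> s - 1 \<noteq> 0" by (auto simp: K1_def)
        then show "P \<eta> X = mat (inverse (\<eta> s - 1)) ** P \<eta> (A X - X)"
          by (intro ent_eqI) (simp add: P_AX)
      qed
      finally show ?thesis by (simp add: A_def)
    qed
    show "B X = 0" if "s ** X ** inv\<^bsub>G\<^esub> s = X" for X unfolding B_def
      by (rule sum.neutral, rule ballI, rule ent_eqI) (use K1_vanish that A_def in auto)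
    show "s ** X ** inv\<^bsub>G\<^esub> s = X" if X: "X \<in> lie_algebra G" for X
    proof -
      have "P \<eta> X = 0" if \<eta>: "\<eta> \<in> K1" for \<eta>
      proof (rule ccontr)
        assume nz: "P \<eta> X \<noteq> 0"
        have \<eta>K: "\<eta> \<in> K" "\<eta> s \<noteq> 1" using \<eta> by (auto simp: K1_def)
        \<comment> \<open>Each differential of a function vanishing on \<open>G\<close> annihilates all \<open>Ad(t) X\<close>, hence
          each component of \<open>X\<close>.\<close>
        have "P \<eta> X \<in> lie_algebra G" unfolding lie_algebra_iff
        proof (intro allI impI)
          fix f q
          assume *: "f \<in> polyfun" "\<forall>g\<in>carrier G. f g = 0" "\<forall>p. q p \<in> polyfun"
            "\<forall>g. f g = (\<Sum>p\<in>UNIV. ent (g - mat 1) p * q p g)"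
          show "(\<Sum>p\<in>UNIV. ent (P \<eta> X) p * q p (mat 1)) = 0"
          proof (rule characters_on_torus_independent[OF K _ \<eta>K(1),
                where c = "\<lambda>\<eta>. \<Sum>p\<in>UNIV. ent (P \<eta> X) p * q p (mat 1)"])
            fix t assume t: "t \<in> T"
            have "0 = (\<Sum>p\<in>UNIV. ent (t ** X ** inv\<^bsub>G\<^esub> t) p * q p (mat 1))"
              by (rule Ad_lie_algebra[OF T_G[OF t] X, unfolded lie_algebra_iff, rule_format, symmetric])
                (use * in blast)+
            also have "\<dots> = (\<Sum>p\<in>UNIV. \<Sum>\<eta>\<in>K. \<eta> t * ent (P \<eta> X) p * q p (mat 1))"
              by (simp add: Ad_eq[OF t] sum_distrib_right)
            also have "\<dots> = (\<Sum>\<eta>\<in>K. \<Sum>p\<in>UNIV. \<eta> t * ent (P \<eta> X) p * q p (mat 1))" by (rule sum.swap)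
            finally show "(\<Sum>\<eta>\<in>K. (\<Sum>p\<in>UNIV. ent (P \<eta> X) p * q p (mat 1)) * \<eta> t) = 0"
              by (simp add: sum_distrib_left mult_ac)
          qed
        qed
        then have "\<eta> \<in> roots G T"
          using \<eta>K K(2) nz s weight[OF _ \<eta>K(1), of _ X] unfolding roots_def by blast
        with roots \<eta>K(2) show False by blast
      qed
      then have "A X = X" using decomp[of X] split[of "\<lambda>\<eta>. P \<eta> X"] split[of "\<lambda>\<eta>. mat (\<eta> s) ** P \<eta> X"]
        by (simp add: A_eq K0_def)
      then show ?thesis by (simp add: A_def)
    qed
  qed (use g in auto)
qed

end

section \<open>Normalizer and Weyl group\<close>

context linear_group
begin

lemma conj_cancel:
  assumes "n \<in> carrier G"
  shows "inv\<^bsub>G\<^esub> n ** (n ** g ** inv\<^bsub>G\<^esub> n) ** n = g" and "n ** (inv\<^bsub>G\<^esub> n ** g ** n) ** inv\<^bsub>G\<^esub> n = g"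
proof -
  have "inv\<^bsub>G\<^esub> n ** (n ** g ** inv\<^bsub>G\<^esub> n) ** n = (inv\<^bsub>G\<^esub> n ** n) ** g ** (inv\<^bsub>G\<^esub> n ** n)"
    "n ** (inv\<^bsub>G\<^esub> n ** g ** n) ** inv\<^bsub>G\<^esub> n = (n ** inv\<^bsub>G\<^esub> n) ** g ** (n ** inv\<^bsub>G\<^esub> n)"
    by (simp_all only: matrix_mul_assoc)
  then show "inv\<^bsub>G\<^esub> n ** (n ** g ** inv\<^bsub>G\<^esub> n) ** n = g" "n ** (inv\<^bsub>G\<^esub> n ** g ** n) ** inv\<^bsub>G\<^esub> n = g"
    using assms by simp_all
qed

lemma conj_mult:
  assumes "n \<in> carrier G"
  shows "n ** (g ** h) ** inv\<^bsub>G\<^esub> n = (n ** g ** inv\<^bsub>G\<^esub> n) ** (n ** h ** inv\<^bsub>G\<^esub> n)"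
proof -
  have "(n ** g ** inv\<^bsub>G\<^esub> n) ** (n ** h ** inv\<^bsub>G\<^esub> n) = n ** g ** (inv\<^bsub>G\<^esub> n ** n) ** h ** inv\<^bsub>G\<^esub> n"
    by (simp only: matrix_mul_assoc)
  then show ?thesis using assms by (simp add: matrix_mul_assoc)
qed

lemma inv_conj:
  assumes "n \<in> carrier G" "g \<in> carrier G"
  shows "inv\<^bsub>G\<^esub> (n ** g ** inv\<^bsub>G\<^esub> n) = n ** inv\<^bsub>G\<^esub> g ** inv\<^bsub>G\<^esub> n"
  using inv_mult_group[of "n ** g" "inv\<^bsub>G\<^esub> n"] inv_mult_group[of n g] assms by (simp add: matrix_mul_assoc)

end

context torus_group
begin

abbreviation "NT \<equiv> normalizer G T"
abbreviation "WT \<equiv> weyl_group G T"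

lemma T_subset: "T \<subseteq> carrier G" using T_G by blast

lemma normalizer_coset: "n \<in> NT \<Longrightarrow> n \<in> carrier G \<and> n <#\<^bsub>G\<^esub> T #>\<^bsub>G\<^esub> inv\<^bsub>G\<^esub> n = T"
  unfolding normalizer_def stabilizer_def using T_subset by auto

lemma normalizerD:
  assumes n: "n \<in> NT"
  shows "n \<in> carrier G" and "t \<in> T \<Longrightarrow> n ** t ** inv\<^bsub>G\<^esub> n \<in> T" and "t \<in> T \<Longrightarrow> inv\<^bsub>G\<^esub> n ** t ** n \<in> T"
proof -
  show nG: "n \<in> carrier G" using normalizer_coset[OF n] by blast
  have T: "T = {n ** t ** inv\<^bsub>G\<^esub> n | t. t \<in> T}"
    using normalizer_coset[OF n] unfolding l_coset_def r_coset_def by auto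
  show "t \<in> T \<Longrightarrow> n ** t ** inv\<^bsub>G\<^esub> n \<in> T" using T by blast
  assume "t \<in> T"
  then obtain t' where t': "t' \<in> T" "t = n ** t' ** inv\<^bsub>G\<^esub> n" using T by blast
  then show "inv\<^bsub>G\<^esub> n ** t ** n \<in> T" by (simp add: conj_cancel[OF nG])
qed

lemma NT_subgroup: "subgroup NT G" by (rule normalizer_imp_subgroup[OF T_subset])

lemma NT_mult: "n \<in> NT \<Longrightarrow> m \<in> NT \<Longrightarrow> n ** m \<in> NT"
  using subgroup.m_closed[OF NT_subgroup] by simp

lemma NT_inv: "n \<in> NT \<Longrightarrow> inv\<^bsub>G\<^esub> n \<in> NT" by (rule subgroup.m_inv_closed[OF NT_subgroup])

lemma T_normal: "T \<lhd> G\<lparr>carrier := NT\<rparr>" by (rule subgroup_in_normalizer[OF T_subgroup])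

lemma T_NT: "t \<in> T \<Longrightarrow> t \<in> NT"
  using subgroup.subset[OF normal_imp_subgroup[OF T_normal]] by auto

lemma r_coset_NT: "T #>\<^bsub>G\<lparr>carrier := NT\<rparr>\<^esub> n = T #>\<^bsub>G\<^esub> n" by (simp add: r_coset_def)

lemma carrier_WT: "carrier WT = (\<lambda>n. T #>\<^bsub>G\<^esub> n) ` NT"
  unfolding weyl_group_def carrier_FactGroup by (simp add: r_coset_NT)

lemma group_WT: "Group.group WT"
  unfolding weyl_group_def by (rule normal.factorgroup_is_group[OF T_normal])

lemma mult_WT:
  assumes "n \<in> NT" "m \<in> NT"
  shows "(T #>\<^bsub>G\<^esub> n) \<otimes>\<^bsub>WT\<^esub> (T #>\<^bsub>G\<^esub> m) = T #>\<^bsub>G\<^esub> (n ** m)"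
  using normal.rcos_sum[OF T_normal, of n m] assms unfolding weyl_group_def by (simp add: r_coset_NT)

lemma one_WT: "\<one>\<^bsub>WT\<^esub> = T #>\<^bsub>G\<^esub> mat 1"
  using coset_mult_one[OF T_subset] unfolding weyl_group_def by simp

lemma mem_coset: "m \<in> T #>\<^bsub>G\<^esub> n \<longleftrightarrow> (\<exists>t\<in>T. m = t ** n)"
  unfolding r_coset_def by auto

lemma coset_eq_iff:
  assumes "n \<in> carrier G" "m \<in> carrier G"
  shows "T #>\<^bsub>G\<^esub> n = T #>\<^bsub>G\<^esub> m \<longleftrightarrow> (\<exists>t\<in>T. n = t ** m)"
proof
  assume "T #>\<^bsub>G\<^esub> n = T #>\<^bsub>G\<^esub> m"
  moreover have "n \<in> T #>\<^bsub>G\<^esub> n" unfolding mem_coset by (rule bexI[of _ "mat 1"]) auto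
  ultimately show "\<exists>t\<in>T. n = t ** m" by (simp add: mem_coset)
next
  assume "\<exists>t\<in>T. n = t ** m"
  then have "n \<in> T #>\<^bsub>G\<^esub> m" by (simp add: mem_coset)
  then show "T #>\<^bsub>G\<^esub> n = T #>\<^bsub>G\<^esub> m"
    using repr_independence[OF _ assms(2) T_subgroup] by simp
qed

section \<open>Cocharacters and the pairing\<close>

lemma cochar_alg_hom: "l \<in> carrier (cocharacter_group G T) \<Longrightarrow> l \<in> alg_hom Gm TG"
  by (simp add: cocharacter_group_def)

lemma cocharD:
  assumes "l \<in> carrier (cocharacter_group G T)"
  shows "x \<noteq> 0 \<Longrightarrow> l x \<in> T" and "x \<noteq> 0 \<Longrightarrow> y \<noteq> 0 \<Longrightarrow> l (x * y) = l x ** l y"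
    and "l 1 = mat 1" and "x \<noteq> 0 \<Longrightarrow> inv\<^bsub>G\<^esub> (l x) = l (inverse x)"
proof -
  have hom: "l \<in> hom Gm TG" using cochar_alg_hom[OF assms] unfolding alg_hom_def by blast
  have cl: "l x \<in> T" if "x \<noteq> 0" for x using hom that unfolding hom_def by auto
  have mu: "l (x * y) = l x ** l y" if "x \<noteq> 0" "y \<noteq> 0" for x y using hom that unfolding hom_def by auto
  show "x \<noteq> 0 \<Longrightarrow> l x \<in> T" "x \<noteq> 0 \<Longrightarrow> y \<noteq> 0 \<Longrightarrow> l (x * y) = l x ** l y" using cl mu by auto
  have "l 1 ** l 1 = l 1" using mu[of 1 1] by simp
  then have "inv\<^bsub>G\<^esub> (l 1) ** l 1 ** l 1 = inv\<^bsub>G\<^esub> (l 1) ** l 1" by (simp add: matrix_mul_assoc[symmetric])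
  then show one: "l 1 = mat 1" using T_G[OF cl[of 1]] by simp
  assume x: "x \<noteq> 0"
  then have "l (inverse x) ** l x = mat 1" using mu[of "inverse x" x] one by simp
  then show "inv\<^bsub>G\<^esub> (l x) = l (inverse x)"
    using inv_equality[of "l (inverse x)" "l x"] x T_G cl by simp
qed

text \<open>An exponent exists by \<open>alg_hom_Gm_power\<close> and is unique because the field is infinite, so
  the description that defines the pairing is met.\<close>

lemma pairing_eq:
  assumes \<eta>: "\<eta> \<in> characters G T" and l: "l \<in> carrier (cocharacter_group G T)" and x: "x \<noteq> 0"
  shows "\<eta> (l x) = x powi pairing \<eta> l"
proof -
  have "\<eta> \<in> alg_hom TG Gm" using \<eta> unfolding characters_def by blast
  then have "(\<lambda>x. \<eta> (l x)) \<in> alg_hom Gm Gm" by (rule alg_hom_compose[OF cochar_alg_hom[OF l]])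
  then obtain k :: int where k: "\<forall>x. x \<noteq> 0 \<longrightarrow> \<eta> (l x) = x powi k" using alg_hom_Gm_power by blast
  have "\<forall>x. x \<noteq> 0 \<longrightarrow> \<eta> (l x) = x powi pairing \<eta> l" unfolding pairing_def
  proof (rule theI[of _ k])
    fix j :: int assume j: "\<forall>x. x \<noteq> 0 \<longrightarrow> \<eta> (l x) = x powi j"
    show "j = k" by (rule power_int_exponent_unique[where 'f = 'f]) (use j k in metis)
  qed (rule k)
  with x show ?thesis by blast
qed

lemma square_root_exists: "\<exists>x. x\<^sup>2 = (y :: 'f)"
  using nth_root_exists[of 2 y] by auto

text \<open>The normalizer permutes the roots, since \<open>Ad(n)\<close> carries the weight space of \<open>\<alpha>\<close> in the
  Lie algebra to that of the transported character.\<close>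

lemma Ad_root:
  assumes \<alpha>: "\<alpha> \<in> roots G T" and n: "n \<in> NT"
  shows "(\<lambda>t\<in>T. \<alpha> (inv\<^bsub>G\<^esub> n ** t ** n)) \<in> roots G T"
proof -
  let ?\<beta> = "\<lambda>t\<in>T. \<alpha> (inv\<^bsub>G\<^esub> n ** t ** n)"
  have nG: "n \<in> carrier G" by (rule normalizerD(1)[OF n])
  have char: "\<alpha> \<in> characters G T" using \<alpha> unfolding roots_def by blast
  have split: "inv\<^bsub>G\<^esub> n ** (t ** t') ** n = (inv\<^bsub>G\<^esub> n ** t ** n) ** (inv\<^bsub>G\<^esub> n ** t' ** n)" for t t'
  proof -
    have "(inv\<^bsub>G\<^esub> n ** t ** n) ** (inv\<^bsub>G\<^esub> n ** t' ** n) = inv\<^bsub>G\<^esub> n ** t ** (n ** inv\<^bsub>G\<^esub> n) ** t' ** n"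
      by (simp only: matrix_mul_assoc)
    then show ?thesis using nG by (simp add: matrix_mul_assoc)
  qed
  have "?\<beta> \<in> characters G T"
  proof (rule characterI)
    obtain f where f: "f \<in> reg G" "\<forall>t\<in>T. \<alpha> t = f t" using characterD(4)[OF char] by blast
    show "\<exists>f\<in>reg G. \<forall>t\<in>T. ?\<beta> t = f t"
      by (rule bexI[OF _ reg_G_compose_mult[OF f(1), of "inv\<^bsub>G\<^esub> n" n]])
        (use f(2) normalizerD(3)[OF n] in auto)
    obtain f where f: "f \<in> reg G" "\<forall>t\<in>T. inverse (\<alpha> t) = f t" using characterD(5)[OF char] by blast
    show "\<exists>f\<in>reg G. \<forall>t\<in>T. inverse (?\<beta> t) = f t"
      by (rule bexI[OF _ reg_G_compose_mult[OF f(1), of "inv\<^bsub>G\<^esub> n" n]])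
        (use f(2) normalizerD(3)[OF n] in auto)
  qed (use characterD(1,2)[OF char] normalizerD(3)[OF n] in \<open>auto simp: split\<close>)
  moreover have "\<exists>t\<in>T. ?\<beta> t \<noteq> 1"
  proof -
    obtain t where t: "t \<in> T" "\<alpha> t \<noteq> 1" using \<alpha> unfolding roots_def by blast
    have "inv\<^bsub>G\<^esub> n ** (n ** t ** inv\<^bsub>G\<^esub> n) ** n = t" by (rule conj_cancel(1)[OF nG])
    then show ?thesis using t normalizerD(2)[OF n t(1)] by (intro bexI[of _ "n ** t ** inv\<^bsub>G\<^esub> n"]) simp_all
  qed
  moreover have "\<exists>Y \<in> lie_algebra G. Y \<noteq> 0 \<and> (\<forall>t\<in>T. t ** Y ** inv\<^bsub>G\<^esub> t = mat (?\<beta> t) ** Y)"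
  proof -
    obtain X where X: "X \<in> lie_algebra G" "X \<noteq> 0" "\<And>t. t \<in> T \<Longrightarrow> t ** X ** inv\<^bsub>G\<^esub> t = mat (\<alpha> t) ** X"
      using \<alpha> unfolding roots_def by blast
    define Y where "Y = n ** X ** inv\<^bsub>G\<^esub> n"
    have "inv\<^bsub>G\<^esub> n ** Y ** n = X" unfolding Y_def by (rule conj_cancel(1)[OF nG])
    then have "Y \<noteq> 0" using X(2) by (auto simp: matrix_matrix_mult_def zero_vec_def)
    moreover have "t ** Y ** inv\<^bsub>G\<^esub> t = mat (?\<beta> t) ** Y" if t: "t \<in> T" for t
    proof -
      define t' where "t' = inv\<^bsub>G\<^esub> n ** t ** n"
      have t': "t' \<in> T" unfolding t'_def by (rule normalizerD(3)[OF n t])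
      have nt: "n ** t' = t ** n" 
      proof -
        have "n ** t' = (n ** inv\<^bsub>G\<^esub> n) ** t ** n" unfolding t'_def by (simp only: matrix_mul_assoc)
        then show ?thesis using nG by simp
      qed
      have nt2: "inv\<^bsub>G\<^esub> t' ** inv\<^bsub>G\<^esub> n = inv\<^bsub>G\<^esub> n ** inv\<^bsub>G\<^esub> t"
        using inv_mult_group[of n t'] inv_mult_group[of t n] nt nG T_G[OF t] T_G[OF t'] by simp
      have "t ** Y ** inv\<^bsub>G\<^esub> t = (t ** n) ** X ** (inv\<^bsub>G\<^esub> n ** inv\<^bsub>G\<^esub> t)"
        unfolding Y_def by (simp only: matrix_mul_assoc)
      also have "\<dots> = n ** (t' ** X ** inv\<^bsub>G\<^esub> t') ** inv\<^bsub>G\<^esub> n"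
        unfolding nt[symmetric] nt2[symmetric] by (simp only: matrix_mul_assoc)
      also have "\<dots> = mat (\<alpha> t') ** Y" unfolding X(3)[OF t'] Y_def by (rule mat_scalar_mult)
      finally show ?thesis using t by (simp add: t'_def)
    qed
    moreover have "Y \<in> lie_algebra G" unfolding Y_def by (rule Ad_lie_algebra[OF nG X(1)])
    ultimately show ?thesis by blast
  qed
  ultimately show ?thesis unfolding roots_def by blast
qed

lemma conj_closed_subgroup:
  assumes U: "closed_subgroup U G" and n: "n \<in> carrier G"
  shows "closed_subgroup ((\<lambda>g. n ** g ** inv\<^bsub>G\<^esub> n) ` U) G"
proof -
  let ?U = "(\<lambda>g. n ** g ** inv\<^bsub>G\<^esub> n) ` U"
  have subU: "subgroup U G" and clU: "closedin (zariski G) U" using U by (auto simp: closed_subgroup_def)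
  note cancel = conj_cancel[OF n]
  have mem: "g \<in> ?U \<longleftrightarrow> inv\<^bsub>G\<^esub> n ** g ** n \<in> U" for g
  proof
    assume "g \<in> ?U"
    then obtain h where "h \<in> U" "g = n ** h ** inv\<^bsub>G\<^esub> n" by (elim imageE)
    then show "inv\<^bsub>G\<^esub> n ** g ** n \<in> U" by (simp add: cancel)
  next
    assume "inv\<^bsub>G\<^esub> n ** g ** n \<in> U"
    then show "g \<in> ?U" by (rule image_eqI[rotated]) (simp add: cancel)
  qed
  have UG: "U \<subseteq> carrier G" using subgroup.subset[OF subU] .
  obtain I where I: "I \<subseteq> reg G" "U = {x \<in> carrier G. \<forall>f\<in>I. f x = 0}"
    using clU unfolding closedin_zariski_G by auto
  have "subgroup ?U G"
  proof (rule subgroupI)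
    show "?U \<subseteq> carrier G" using UG n by auto
    show "?U \<noteq> {}" using subgroup.one_closed[OF subU] by blast
    fix a assume "a \<in> ?U"
    then obtain g where g: "g \<in> U" "a = n ** g ** inv\<^bsub>G\<^esub> n" by blast
    have gG: "g \<in> carrier G" using g(1) UG by blast
    show "inv\<^bsub>G\<^esub> a \<in> ?U" using subgroup.m_inv_closed[OF subU g(1)] unfolding g(2) inv_conj[OF n gG] by blast
    fix b assume "b \<in> ?U"
    then obtain h where h: "h \<in> U" "b = n ** h ** inv\<^bsub>G\<^esub> n" by blast
    have "a ** b = n ** (g ** h) ** inv\<^bsub>G\<^esub> n" unfolding g h by (rule conj_mult[OF n, symmetric])
    then show "a \<otimes>\<^bsub>G\<^esub> b \<in> ?U" using subgroup.m_closed[OF subU g(1) h(1)] by auto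
  qed
  moreover have "closedin (zariski G) ?U" unfolding closedin_zariski_G
  proof (intro exI[of _ "(\<lambda>f x. f (inv\<^bsub>G\<^esub> n ** x ** n)) ` I"] conjI)
    show "(\<lambda>f x. f (inv\<^bsub>G\<^esub> n ** x ** n)) ` I \<subseteq> reg G"
      using I(1) reg_G_compose_mult by blast
    have "inv\<^bsub>G\<^esub> n ** g ** n \<in> carrier G \<longleftrightarrow> g \<in> carrier G" for g
      using n cancel(2)[of g] matrix_closed[OF matrix_closed[OF n] inv_closed[OF n], of "inv\<^bsub>G\<^esub> n ** g ** n"] by auto
    then show "?U = {x \<in> carrier G. \<forall>f\<in>(\<lambda>f x. f (inv\<^bsub>G\<^esub> n ** x ** n)) ` I. f x = 0}"
      using mem unfolding I(2) by (intro Set.set_eqI) auto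
  qed
  ultimately show ?thesis by (simp add: closed_subgroup_def)
qed

end

section \<open>Root subgroups and Tits lifts\<close>

locale realized_group = torus_group G T for G :: "('f::alg_closed_field^'m::finite^'m, 'f) alg_group" and T +
  fixes cr :: "('f^'m^'m \<Rightarrow> 'f) \<Rightarrow> ('f \<Rightarrow> 'f^'m^'m)"
    and rf :: "('f^'m^'m \<Rightarrow> 'f) \<Rightarrow> ('f^'m^'m) set"
    and u :: "('f^'m^'m \<Rightarrow> 'f) \<Rightarrow> ('f \<Rightarrow> 'f^'m^'m)"
  assumes realization: "realization G T cr rf u" and char_ne_2: "CHAR('f) \<noteq> 2"
begin

lemma two_nonzero: "(2 :: 'f) \<noteq> 0"
proof
  assume "(2 :: 'f) = 0"
  then have "of_nat 2 = (0 :: 'f)" by simp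
  then have "CHAR('f) dvd 2" by (simp only: of_nat_eq_0_iff_char_dvd)
  moreover have "CHAR('f) \<noteq> 1" by simp
  ultimately show False using char_ne_2 by (metis prime_nat_iff two_is_prime_nat)
qed

abbreviation "sg \<alpha> \<equiv> tits_lift G T u \<alpha>"
abbreviation "neg \<alpha> \<equiv> neg_character T \<alpha>"

lemma root_character: "\<alpha> \<in> roots G T \<Longrightarrow> \<alpha> \<in> characters G T"
  unfolding roots_def by blast

lemma realizationD:
  assumes "\<alpha> \<in> roots G T"
  shows "cr \<alpha> \<in> carrier (cocharacter_group G T)" "pairing \<alpha> (cr \<alpha>) = 2" "is_reflection G T \<alpha> (cr \<alpha>) (rf \<alpha>)"
    "sg \<alpha> \<in> NT" "T #>\<^bsub>G\<^esub> sg \<alpha> = rf \<alpha>"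
    "x \<noteq> 0 \<Longrightarrow> u \<alpha> x ** u (neg \<alpha>) (- inverse x) ** u \<alpha> x = cr \<alpha> x ** sg \<alpha>"
    "\<exists>U. is_root_subgroup G T \<alpha> U \<and> root_isomorphism G T \<alpha> U (u \<alpha>)"
  using realization assms unfolding realization_def coroot_reflection_def by auto

lemma root_coroot: "\<alpha> \<in> roots G T \<Longrightarrow> x \<noteq> 0 \<Longrightarrow> \<alpha> (cr \<alpha> x) = x\<^sup>2"
  using pairing_eq[OF root_character realizationD(1), of \<alpha> \<alpha> x] realizationD(2)[of \<alpha>] by simp

text \<open>The value at \<open>\<alpha>\<^sup>\<or>(x)\<close> is \<open>x\<^sup>2\<close>, and square roots exist.\<close>

lemma root_surj:
  assumes \<alpha>: "\<alpha> \<in> roots G T" and y: "y \<noteq> 0"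
  obtains t where "t \<in> T" "\<alpha> t = y"
proof -
  obtain x where x: "x\<^sup>2 = y" using square_root_exists by blast
  with y have "x \<noteq> 0" by auto
  then show ?thesis using that[of "cr \<alpha> x"] cocharD(1)[OF realizationD(1)[OF \<alpha>]] root_coroot[OF \<alpha>] x by simp
qed

lemma sg_act:
  assumes \<alpha>: "\<alpha> \<in> roots G T" and t: "t \<in> T"
  shows "sg \<alpha> ** t ** inv\<^bsub>G\<^esub> (sg \<alpha>) = t ** inv\<^bsub>G\<^esub> (cr \<alpha> (\<alpha> t))"
proof -
  have "sg \<alpha> \<in> rf \<alpha>" unfolding realizationD(5)[OF \<alpha>, symmetric] mem_coset
    by (rule bexI[of _ "mat 1"]) auto
  then show ?thesis using realizationD(3)[OF \<alpha>] t unfolding is_reflection_def by auto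
qed

text \<open>The lift \<open>\<sigma>\<^sub>\<alpha>\<close> normalizes \<open>T\<close> and induces the reflection, which takes \<open>\<alpha>\<close> to \<open>-\<alpha>\<close>.\<close>

lemma neg_root:
  assumes \<alpha>: "\<alpha> \<in> roots G T"
  shows "neg \<alpha> \<in> roots G T"
proof -
  note char = root_character[OF \<alpha>] and n = realizationD(4)[OF \<alpha>] and cr = realizationD(1)[OF \<alpha>]
  have nG: "sg \<alpha> \<in> carrier G" by (rule normalizerD(1)[OF n])
  have "\<alpha> (inv\<^bsub>G\<^esub> (sg \<alpha>) ** t ** sg \<alpha>) = inverse (\<alpha> t)" if t: "t \<in> T" for t
  proof -
    define t' where "t' = inv\<^bsub>G\<^esub> (sg \<alpha>) ** t ** sg \<alpha>"
    have t': "t' \<in> T" unfolding t'_def by (rule normalizerD(3)[OF n t])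
    have nz: "\<alpha> t' \<noteq> 0" by (rule characterD(2)[OF char t'])
    have "t = t' ** inv\<^bsub>G\<^esub> (cr \<alpha> (\<alpha> t'))"
      using sg_act[OF \<alpha> t'] conj_cancel(2)[OF nG, of t] by (simp add: t'_def)
    then have "\<alpha> t = \<alpha> t' * inverse ((\<alpha> t')\<^sup>2)"
      using characterD(1)[OF char t'] character_inv[OF char] cocharD(1)[OF cr nz] root_coroot[OF \<alpha> nz] by simp
    then have "\<alpha> t = inverse (\<alpha> t')" using nz by (simp add: power2_eq_square)
    then show ?thesis by (simp add: t'_def)
  qed
  then have "(\<lambda>t\<in>T. \<alpha> (inv\<^bsub>G\<^esub> (sg \<alpha>) ** t ** sg \<alpha>)) = neg \<alpha>"
    unfolding neg_character_def by (intro restrict_ext) simp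
  then show ?thesis using Ad_root[OF \<alpha> n] by simp
qed

lemma neg_apply: "t \<in> T \<Longrightarrow> neg \<alpha> t = inverse (\<alpha> t)" by (simp add: neg_character_def)

lemma root_iso:
  assumes "\<alpha> \<in> roots G T"
  obtains U \<psi> where "is_root_subgroup G T \<alpha> U" "closed_subgroup U G" "u \<alpha> \<in> alg_hom Ga (G\<lparr>carrier := U\<rparr>)"
    "\<psi> \<in> alg_hom (G\<lparr>carrier := U\<rparr>) Ga" "\<And>x. \<psi> (u \<alpha> x) = x" "\<And>g. g \<in> U \<Longrightarrow> u \<alpha> (\<psi> g) = g"
    "\<And>t x. t \<in> T \<Longrightarrow> t ** u \<alpha> x ** inv\<^bsub>G\<^esub> t = u \<alpha> (\<alpha> t * x)"
proof -
  obtain U where U: "is_root_subgroup G T \<alpha> U" "root_isomorphism G T \<alpha> U (u \<alpha>)"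
    using realizationD(7)[OF assms] by blast
  moreover have "closed_subgroup U G" using U(1) unfolding is_root_subgroup_def by blast
  moreover obtain \<psi> where "u \<alpha> \<in> alg_hom Ga (G\<lparr>carrier := U\<rparr>)"
    "\<psi> \<in> alg_hom (G\<lparr>carrier := U\<rparr>) Ga" "\<forall>x\<in>carrier Ga. \<psi> (u \<alpha> x) = x"
    "\<forall>g\<in>carrier (G\<lparr>carrier := U\<rparr>). u \<alpha> (\<psi> g) = g"
    using U(2) unfolding root_isomorphism_def alg_iso_def by blast
  moreover have "\<forall>t\<in>T. \<forall>x. t ** u \<alpha> x ** inv\<^bsub>G\<^esub> t = u \<alpha> (\<alpha> t * x)"
    using U(2) unfolding root_isomorphism_def by simp
  ultimately show ?thesis by (intro that[of U \<psi>]) (auto simp: Ga_def)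
qed

lemma u_props:
  assumes "\<alpha> \<in> roots G T"
  shows "u \<alpha> x \<in> carrier G" "u \<alpha> (x + y) = u \<alpha> x ** u \<alpha> y" "u \<alpha> x = u \<alpha> y \<Longrightarrow> x = y" "u \<alpha> 0 = mat 1"
    "inv\<^bsub>G\<^esub> (u \<alpha> x) = u \<alpha> (- x)" "t \<in> T \<Longrightarrow> t ** u \<alpha> x ** inv\<^bsub>G\<^esub> t = u \<alpha> (\<alpha> t * x)"
proof -
  obtain U \<psi> where U: "is_root_subgroup G T \<alpha> U" "closed_subgroup U G" "u \<alpha> \<in> alg_hom Ga (G\<lparr>carrier := U\<rparr>)"
    "\<psi> \<in> alg_hom (G\<lparr>carrier := U\<rparr>) Ga" "\<And>x. \<psi> (u \<alpha> x) = x" "\<And>g. g \<in> U \<Longrightarrow> u \<alpha> (\<psi> g) = g"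
    "\<And>t x. t \<in> T \<Longrightarrow> t ** u \<alpha> x ** inv\<^bsub>G\<^esub> t = u \<alpha> (\<alpha> t * x)" by (rule root_iso[OF assms], rule that)
  have UG: "U \<subseteq> carrier G" using U(2) subgroup.subset unfolding closed_subgroup_def by blast
  have uU: "u \<alpha> x \<in> U" for x using U(3) unfolding alg_hom_def hom_def by (auto simp: Ga_def)
  then show uG: "u \<alpha> x \<in> carrier G" for x using UG by blast
  show add: "u \<alpha> (x + y) = u \<alpha> x ** u \<alpha> y" for x y
    using U(3) unfolding alg_hom_def hom_def by (auto simp: Ga_def)
  show "u \<alpha> x = u \<alpha> y \<Longrightarrow> x = y" using U(5) by metis
  have "u \<alpha> 0 ** u \<alpha> 0 = u \<alpha> 0" using add[of 0 0] by simp
  then have "inv\<^bsub>G\<^esub> (u \<alpha> 0) ** u \<alpha> 0 ** u \<alpha> 0 = inv\<^bsub>G\<^esub> (u \<alpha> 0) ** u \<alpha> 0" by (simp add: matrix_mul_assoc[symmetric])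
  then show zero: "u \<alpha> 0 = mat 1" using uG[of 0] by simp
  have "u \<alpha> (- x) ** u \<alpha> x = mat 1" using add[of "- x" x] zero by simp
  then show "inv\<^bsub>G\<^esub> (u \<alpha> x) = u \<alpha> (- x)" using inv_equality[of "u \<alpha> (- x)" "u \<alpha> x"] uG by simp
  show "t \<in> T \<Longrightarrow> t ** u \<alpha> x ** inv\<^bsub>G\<^esub> t = u \<alpha> (\<alpha> t * x)" by (rule U(7))
qed

text \<open>The realization identity at \<open>x = -1\<close> has on its left-hand side the inverse of the product
  that defines \<open>\<sigma>\<^sub>\<alpha>\<close>, so it reads \<open>\<sigma>\<^sub>\<alpha>\<^sup>-\<^sup>1 = \<alpha>\<^sup>\<or>(-1) \<sigma>\<^sub>\<alpha>\<close>.\<close>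

lemma sg_square:
  assumes \<alpha>: "\<alpha> \<in> roots G T"
  shows "sg \<alpha> ** sg \<alpha> = cr \<alpha> (- 1)"
proof -
  note u = u_props[OF \<alpha>] and v = u_props[OF neg_root[OF \<alpha>]] and cr = realizationD(1)[OF \<alpha>]
  have s: "sg \<alpha> = u \<alpha> 1 ** u (neg \<alpha>) (- 1) ** u \<alpha> 1" by (simp add: tits_lift_def)
  have cc: "cr \<alpha> (- 1) ** cr \<alpha> (- 1) = mat 1"
    using cocharD(2)[OF cr, of "- 1" "- 1"] cocharD(3)[OF cr] by simp
  have uu: "u \<alpha> (- 1) ** u \<alpha> 1 = mat 1" using u(2)[of "- 1" 1] u(4) by simp
  have "cr \<alpha> (- 1) ** sg \<alpha> = u \<alpha> (- 1) ** u (neg \<alpha>) 1 ** u \<alpha> (- 1)"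
    using realizationD(6)[OF \<alpha>, of "- 1"] by simp
  then have "cr \<alpha> (- 1) ** sg \<alpha> ** sg \<alpha> =
      u \<alpha> (- 1) ** u (neg \<alpha>) 1 ** (u \<alpha> (- 1) ** u \<alpha> 1) ** u (neg \<alpha>) (- 1) ** u \<alpha> 1"
    unfolding s by (simp only: matrix_mul_assoc)
  also have "u \<alpha> (- 1) ** u \<alpha> 1 = mat 1" by (rule uu)
  also have "u \<alpha> (- 1) ** u (neg \<alpha>) 1 ** mat 1 ** u (neg \<alpha>) (- 1) ** u \<alpha> 1 =
      u \<alpha> (- 1) ** (u (neg \<alpha>) 1 ** u (neg \<alpha>) (- 1)) ** u \<alpha> 1" by (simp add: matrix_mul_assoc)
  also have "u (neg \<alpha>) 1 ** u (neg \<alpha>) (- 1) = mat 1" using v(2)[of 1 "- 1"] v(4) by simp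
  also have "u \<alpha> (- 1) ** mat 1 ** u \<alpha> 1 = mat 1" by (simp add: uu)
  finally have "cr \<alpha> (- 1) ** (cr \<alpha> (- 1) ** sg \<alpha> ** sg \<alpha>) = cr \<alpha> (- 1)" by simp
  then have "(cr \<alpha> (- 1) ** cr \<alpha> (- 1)) ** sg \<alpha> ** sg \<alpha> = cr \<alpha> (- 1)" by (simp only: matrix_mul_assoc)
  then show ?thesis by (simp add: cc)
qed

text \<open>The conjugated subgroup carries a \<open>T\<close>-equivariant parametrization by \<open>\<beta>\<close>, so it is the
  root subgroup of \<open>\<beta>\<close> by uniqueness. Two equivariant parametrizations are proportional because
  \<open>\<beta>\<close> is surjective: both are determined by their values at 1.\<close>

lemma root_subgroup_conj:
  assumes \<alpha>: "\<alpha> \<in> roots G T" and \<beta>: "\<beta> \<in> roots G T" and n: "n \<in> NT"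
    and match: "\<And>t. t \<in> T \<Longrightarrow> \<alpha> (inv\<^bsub>G\<^esub> n ** t ** n) = \<beta> t"
  shows "\<exists>c. c \<noteq> 0 \<and> (\<forall>x. n ** u \<alpha> x ** inv\<^bsub>G\<^esub> n = u \<beta> (c * x))"
proof -
  have nG: "n \<in> carrier G" by (rule normalizerD(1)[OF n])
  obtain U \<psi> where U: "is_root_subgroup G T \<alpha> U" "closed_subgroup U G" "u \<alpha> \<in> alg_hom Ga (G\<lparr>carrier := U\<rparr>)"
    "\<psi> \<in> alg_hom (G\<lparr>carrier := U\<rparr>) Ga" "\<And>x. \<psi> (u \<alpha> x) = x" "\<And>g. g \<in> U \<Longrightarrow> u \<alpha> (\<psi> g) = g"
    "\<And>t x. t \<in> T \<Longrightarrow> t ** u \<alpha> x ** inv\<^bsub>G\<^esub> t = u \<alpha> (\<alpha> t * x)" by (rule root_iso[OF \<alpha>], rule that)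
  obtain U2 \<psi>2 where U2: "is_root_subgroup G T \<beta> U2" "closed_subgroup U2 G" "u \<beta> \<in> alg_hom Ga (G\<lparr>carrier := U2\<rparr>)"
    "\<psi>2 \<in> alg_hom (G\<lparr>carrier := U2\<rparr>) Ga" "\<And>x. \<psi>2 (u \<beta> x) = x" "\<And>g. g \<in> U2 \<Longrightarrow> u \<beta> (\<psi>2 g) = g"
    "\<And>t x. t \<in> T \<Longrightarrow> t ** u \<beta> x ** inv\<^bsub>G\<^esub> t = u \<beta> (\<beta> t * x)" by (rule root_iso[OF \<beta>], rule that)
  let ?U = "(\<lambda>g. n ** g ** inv\<^bsub>G\<^esub> n) ` U"
  define v where "v x = n ** u \<alpha> x ** inv\<^bsub>G\<^esub> n" for x
  have uU: "u \<alpha> x \<in> U" for x using U(3) unfolding alg_hom_def hom_def by (auto simp: Ga_def)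
  note cancel = conj_cancel(1)[OF nG]
  have v_act: "t ** v x ** inv\<^bsub>G\<^esub> t = v (\<beta> t * x)" if t: "t \<in> T" for t x
  proof -
    define t' where "t' = inv\<^bsub>G\<^esub> n ** t ** n"
    have t': "t' \<in> T" unfolding t'_def by (rule normalizerD(3)[OF n t])
    have nt: "t ** n = n ** t'"
    proof -
      have "n ** t' = (n ** inv\<^bsub>G\<^esub> n) ** t ** n" unfolding t'_def by (simp only: matrix_mul_assoc)
      then show ?thesis using nG by simp
    qed
    have nt2: "inv\<^bsub>G\<^esub> n ** inv\<^bsub>G\<^esub> t = inv\<^bsub>G\<^esub> t' ** inv\<^bsub>G\<^esub> n"
      using inv_mult_group[of n t'] inv_mult_group[of t n] nt nG T_G[OF t] T_G[OF t'] by simp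
    have "t ** v x ** inv\<^bsub>G\<^esub> t = (t ** n) ** u \<alpha> x ** (inv\<^bsub>G\<^esub> n ** inv\<^bsub>G\<^esub> t)"
      unfolding v_def by (simp only: matrix_mul_assoc)
    also have "\<dots> = n ** (t' ** u \<alpha> x ** inv\<^bsub>G\<^esub> t') ** inv\<^bsub>G\<^esub> n"
      unfolding nt nt2 by (simp only: matrix_mul_assoc)
    also have "t' ** u \<alpha> x ** inv\<^bsub>G\<^esub> t' = u \<alpha> (\<beta> t * x)"
      unfolding U(7)[OF t'] using match[OF t] by (simp add: t'_def)
    finally show ?thesis by (simp add: v_def)
  qed
  have "root_isomorphism G T \<beta> ?U v"
  proof -
    have "v \<in> alg_hom Ga (G\<lparr>carrier := ?U\<rparr>)"
      unfolding alg_hom_def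
    proof (intro CollectI conjI ballI)
      have "u \<alpha> (x + y) = u \<alpha> x ** u \<alpha> y" for x y by (rule u_props(2)[OF \<alpha>])
      then show "v \<in> hom Ga (G\<lparr>carrier := ?U\<rparr>)"
        using uU by (auto simp: hom_def Ga_def v_def conj_mult[OF nG])
      fix g assume "g \<in> reg (G\<lparr>carrier := ?U\<rparr>)"
      then have g': "(\<lambda>x. g (n ** x ** inv\<^bsub>G\<^esub> n)) \<in> reg G" using reg_G_compose_mult by simp
      have "\<forall>g\<in>reg G. \<exists>f\<in>reg Ga. \<forall>x\<in>carrier Ga. g (u \<alpha> x) = f x"
        using U(3) by (simp add: alg_hom_def)
      from bspec[OF this g'] show "\<exists>f\<in>reg Ga. \<forall>x\<in>carrier Ga. g (v x) = f x"
        unfolding v_def .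
    qed
    moreover have "(\<lambda>g. \<psi> (inv\<^bsub>G\<^esub> n ** g ** n)) \<in> alg_hom (G\<lparr>carrier := ?U\<rparr>) Ga"
      unfolding alg_hom_def
    proof (intro CollectI conjI ballI)
      have "\<psi> (g ** h) = \<psi> g + \<psi> h" if "g \<in> U" "h \<in> U" for g h
        using U(4) that unfolding alg_hom_def hom_def by (auto simp: Ga_def)
      then show "(\<lambda>g. \<psi> (inv\<^bsub>G\<^esub> n ** g ** n)) \<in> hom (G\<lparr>carrier := ?U\<rparr>) Ga"
        by (auto simp: hom_def Ga_def cancel conj_mult[OF nG, symmetric])
      fix g :: "'f \<Rightarrow> 'f" assume "g \<in> reg Ga"
      then obtain f where f: "f \<in> reg G" "\<forall>x\<in>U. g (\<psi> x) = f x"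
        using U(4) unfolding alg_hom_def by auto
      show "\<exists>f\<in>reg (G\<lparr>carrier := ?U\<rparr>). \<forall>x\<in>carrier (G\<lparr>carrier := ?U\<rparr>). g (\<psi> (inv\<^bsub>G\<^esub> n ** x ** n)) = f x"
        using reg_G_compose_mult[OF f(1), of "inv\<^bsub>G\<^esub> n" n] f(2)
        by (intro bexI[of _ "\<lambda>x. f (inv\<^bsub>G\<^esub> n ** x ** n)"]) (auto simp: cancel)
    qed
    ultimately have "v \<in> alg_iso Ga (G\<lparr>carrier := ?U\<rparr>)"
      unfolding alg_iso_def
      by (auto intro!: bexI[of _ "\<lambda>g. \<psi> (inv\<^bsub>G\<^esub> n ** g ** n)"] simp: v_def cancel U(5,6))
    then show ?thesis unfolding root_isomorphism_def using v_act by simp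
  qed
  then have "?U \<in> {U'. closed_subgroup U' G \<and> (\<exists>v. root_isomorphism G T \<beta> U' v)}"
    using conj_closed_subgroup[OF U(2) nG] by blast
  then have "?U \<in> {U2}" using U2(1) by (simp only: is_root_subgroup_def)
  then have "?U = U2" by (rule singletonD)
  then have v1: "v 1 \<in> U2" using uU unfolding v_def by blast
  define c where "c = \<psi>2 (v 1)"
  have c: "u \<beta> c = v 1" unfolding c_def by (rule U2(6)[OF v1])
  have v_eq: "v x = u \<beta> (c * x)" for x
  proof (cases "x = 0")
    case True
    then show ?thesis using nG by (simp add: v_def u_props(4)[OF \<alpha>] u_props(4)[OF \<beta>])
  next
    case False
    obtain t where t: "t \<in> T" "\<beta> t = x" by (rule root_surj[OF \<beta> False])
    have "v x = t ** v 1 ** inv\<^bsub>G\<^esub> t" using v_act[OF t(1), of 1] t(2) by simp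
    also have "\<dots> = u \<beta> (x * c)" using c U2(7)[OF t(1), of c] t(2) by simp
    finally show ?thesis by (simp add: mult.commute)
  qed
  have "c \<noteq> 0"
  proof
    assume "c = 0"
    then have "v 1 = v 0" using v_eq[of 1] v_eq[of 0] by simp
    then have "inv\<^bsub>G\<^esub> n ** v 1 ** n = inv\<^bsub>G\<^esub> n ** v 0 ** n" by simp
    then have "u \<alpha> 1 = u \<alpha> 0" unfolding v_def cancel .
    then show False using u_props(3)[OF \<alpha>] by fastforce
  qed
  then show ?thesis using v_eq unfolding v_def by blast
qed

text \<open>Suppose that \<open>d \<noteq> 0\<close> and compare \<open>u\<^sub>\<beta>(c) u\<^sub>-\<^sub>\<beta>(d) u\<^sub>\<beta>(-c)\<close> with its conjugates under \<open>T\<close>. It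
  follows that conjugation by \<open>u\<^sub>\<beta>(c)\<close> maps \<open>u\<^sub>-\<^sub>\<beta>(y)\<close> to \<open>u\<^sub>-\<^sub>\<beta>(d y / (d - y))\<close> for all \<open>y \<noteq> d\<close>.
  This contradicts additivity, as \<open>y \<mapsto> d y / (d - y)\<close> does not commute with doubling.\<close>

lemma opposite_root_centralizing:
  assumes \<beta>: "\<beta> \<in> roots G T" and c: "c \<noteq> 0"
    and comm: "\<And>t. t \<in> T \<Longrightarrow> t ** (u \<beta> c ** u (neg \<beta>) d ** u \<beta> (- c)) ** inv\<^bsub>G\<^esub> t = u \<beta> c ** u (neg \<beta>) d ** u \<beta> (- c)"
  shows "d = 0"
proof (rule ccontr)
  assume d: "d \<noteq> 0"
  note u = u_props[OF \<beta>] and v = u_props[OF neg_root[OF \<beta>]]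
  have conj3: "t ** (x ** y ** z) ** inv\<^bsub>G\<^esub> t = (t ** x ** inv\<^bsub>G\<^esub> t) ** (t ** y ** inv\<^bsub>G\<^esub> t) ** (t ** z ** inv\<^bsub>G\<^esub> t)"
    if "t \<in> T" for t x y z
    by (simp only: conj_mult[OF T_G[OF that]])
  have act: "t ** (u \<beta> e ** u (neg \<beta>) y ** u \<beta> e') ** inv\<^bsub>G\<^esub> t =
      u \<beta> (\<beta> t * e) ** u (neg \<beta>) (inverse (\<beta> t) * y) ** u \<beta> (\<beta> t * e')" if "t \<in> T" for t e y e'
    using that by (simp add: conj3 u(6) v(6) neg_apply)
  \<comment> \<open>The map \<open>y \<mapsto> d y / (d - y)\<close>, parametrized by \<open>y = (a - 1) d / a\<close>.\<close>
  have E: "u \<beta> c ** u (neg \<beta>) ((a - 1) * d / a) ** u \<beta> (- c) = u (neg \<beta>) ((a - 1) * d)"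
    if a: "a \<noteq> 0" "a \<noteq> 1" for a
  proof -
    obtain t where t: "t \<in> T" "\<beta> t = a" by (rule root_surj[OF \<beta> a(1)])
    have "u \<beta> (a * c) ** u (neg \<beta>) (inverse a * d) ** u \<beta> (a * (- c)) = u \<beta> c ** u (neg \<beta>) d ** u \<beta> (- c)"
      using act[OF t(1), of c d "- c"] comm[OF t(1)] t(2) by simp
    then have "u \<beta> (- c) ** (u \<beta> (a * c) ** u (neg \<beta>) (inverse a * d) ** u \<beta> (a * (- c))) ** u \<beta> c =
        u \<beta> (- c) ** (u \<beta> c ** u (neg \<beta>) d ** u \<beta> (- c)) ** u \<beta> c" by simp
    then have "(u \<beta> (- c) ** u \<beta> (a * c)) ** u (neg \<beta>) (inverse a * d) ** (u \<beta> (a * (- c)) ** u \<beta> c) =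
        (u \<beta> (- c) ** u \<beta> c) ** u (neg \<beta>) d ** (u \<beta> (- c) ** u \<beta> c)" by (simp only: matrix_mul_assoc)
    moreover have "- c + a * c = (a - 1) * c" "a * (- c) + c = - ((a - 1) * c)" by (simp_all add: algebra_simps)
    ultimately have F: "u \<beta> ((a - 1) * c) ** u (neg \<beta>) (inverse a * d) ** u \<beta> (- ((a - 1) * c)) = u (neg \<beta>) d"
      by (simp add: u(2)[symmetric] u(4) del: mult_minus_right mult_minus_left)
    \<comment> \<open>Rescaling by an element of \<open>T\<close> brings the conjugating element \<open>u\<^sub>\<beta>((a - 1) c)\<close> back to
      \<open>u\<^sub>\<beta>(c)\<close>, independently of \<open>a\<close>.\<close>
    define b where "b = inverse (a - 1)"
    have b: "b \<noteq> 0" using a by (simp add: b_def)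
    obtain t where t: "t \<in> T" "\<beta> t = b" by (rule root_surj[OF \<beta> b])
    have "u \<beta> (b * ((a - 1) * c)) ** u (neg \<beta>) (inverse b * (inverse a * d)) ** u \<beta> (b * (- ((a - 1) * c))) =
        u (neg \<beta>) (inverse b * d)"
      using act[OF t(1), of "(a - 1) * c" "inverse a * d" "- ((a - 1) * c)"] F v(6)[OF t(1), of d] t neg_apply[OF t(1), of \<beta>]
      by (simp del: mult_minus_right mult_minus_left)
    moreover have "b * ((a - 1) * c) = c" "b * (- ((a - 1) * c)) = - c" "inverse b * (inverse a * d) = (a - 1) * d / a"
      "inverse b * d = (a - 1) * d"
      using a by (simp_all add: b_def field_simps)
    ultimately show ?thesis by simp
  qed
  have "finite {0, 1, 2 :: 'f}" by simp
  from ex_new_if_finite[OF infinite_alg_closed this] obtain p :: 'f where "p \<notin> {0, 1, 2}" ..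
  then have p: "p \<noteq> 0" "p \<noteq> 1" "2 - p \<noteq> 0" by auto
  \<comment> \<open>This \<open>q\<close> satisfies \<open>(q - 1) / q = 2 (p - 1) / p\<close>, that is, it parametrizes the double of
    the point given by \<open>p\<close>.\<close>
  define q where "q = p / (2 - p)"
  have "q \<noteq> 1"
  proof
    assume "q = 1"
    then have "p = 2 - p" using p(3) by (simp add: q_def)
    then have "2 * (p - 1) = 0" by (simp add: algebra_simps)
    then show False using two_nonzero p(2) by simp
  qed
  then have q: "q \<noteq> 0" "q \<noteq> 1" using p by (auto simp: q_def)
  let ?y = "(p - 1) * d / p"
  have "u (neg \<beta>) ((p - 1) * d + (p - 1) * d) =
      (u \<beta> c ** u (neg \<beta>) ?y ** u \<beta> (- c)) ** (u \<beta> c ** u (neg \<beta>) ?y ** u \<beta> (- c))"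
    by (simp only: v(2) E[OF p(1,2)])
  also have "\<dots> = u \<beta> c ** u (neg \<beta>) ?y ** (u \<beta> (- c) ** u \<beta> c) ** u (neg \<beta>) ?y ** u \<beta> (- c)"
    by (simp only: matrix_mul_assoc)
  also have "\<dots> = u \<beta> c ** (u (neg \<beta>) ?y ** u (neg \<beta>) ?y) ** u \<beta> (- c)"
    by (simp add: u(2)[symmetric] u(4) matrix_mul_assoc)
  also have "u (neg \<beta>) ?y ** u (neg \<beta>) ?y = u (neg \<beta>) ((q - 1) * d / q)"
  proof -
    have "(q - 1) * d / q = ?y + ?y" using p q by (simp add: q_def field_simps)
    then show ?thesis by (simp only: v(2))
  qed
  also have "u \<beta> c ** u (neg \<beta>) ((q - 1) * d / q) ** u \<beta> (- c) = u (neg \<beta>) ((q - 1) * d)" by (rule E[OF q])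
  finally have "(p - 1) * d + (p - 1) * d = (q - 1) * d" by (rule v(3))
  then have "(2 * (p - 1)) * d = (q - 1) * d" by (simp add: algebra_simps)
  then have "2 * (p - 1) = q - 1" using d by simp
  also have "q - 1 = 2 * (p - 1) / (2 - p)" using p(3) by (simp add: q_def field_simps)
  finally have "2 * (p - 1) * (2 - p) = 2 * (p - 1) * 1" using p(3) by (simp add: eq_divide_eq)
  moreover have "2 * (p - 1) \<noteq> 0" using p(2) two_nonzero by simp
  ultimately have "2 - p = 1" using mult_left_cancel by blast
  then show False using p(2) by (simp add: algebra_simps)
qed

text \<open>The conjugate \<open>m1\<close> of \<open>\<sigma>\<^sub>\<alpha>\<close> is a product \<open>u\<^sub>\<beta>(c) u\<^sub>-\<^sub>\<beta>(-c') u\<^sub>\<beta>(c)\<close>, and the realization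
  identity exhibits \<open>m2 = \<beta>\<^sup>\<or>(c) \<sigma>\<^sub>\<beta>\<close> as a product of the same shape with \<open>c\<^sup>-\<^sup>1\<close> in place of \<open>c'\<close>.
  Both induce the reflection in \<open>\<beta>\<close> on \<open>T\<close>, so \<open>m1 m2\<^sup>-\<^sup>1\<close> centralizes \<open>T\<close>; it is conjugate to
  \<open>u\<^sub>-\<^sub>\<beta>(c\<^sup>-\<^sup>1 - c')\<close>, and \<open>opposite_root_centralizing\<close> gives \<open>m1 = m2\<close>. The argument avoids the
  theorem that \<open>T\<close> is its own centralizer.\<close>

lemma conj_tits_lift:
  assumes \<alpha>: "\<alpha> \<in> roots G T" and \<beta>: "\<beta> \<in> roots G T" and n: "n \<in> NT"
    and match: "\<And>t. t \<in> T \<Longrightarrow> \<alpha> (inv\<^bsub>G\<^esub> n ** t ** n) = \<beta> t"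
    and comatch: "\<And>x. x \<noteq> 0 \<Longrightarrow> n ** cr \<alpha> x ** inv\<^bsub>G\<^esub> n = cr \<beta> x"
  shows "\<exists>t\<in>T. n ** sg \<alpha> ** inv\<^bsub>G\<^esub> n = t ** sg \<beta>"
proof -
  have nG: "n \<in> carrier G" by (rule normalizerD(1)[OF n])
  note u = u_props[OF \<beta>] and v = u_props[OF neg_root[OF \<beta>]]
  obtain c where c: "c \<noteq> 0" "\<And>x. n ** u \<alpha> x ** inv\<^bsub>G\<^esub> n = u \<beta> (c * x)"
    using root_subgroup_conj[OF \<alpha> \<beta> n match] by blast
  have "neg \<alpha> (inv\<^bsub>G\<^esub> n ** t ** n) = neg \<beta> t" if "t \<in> T" for t
    using match[OF that] normalizerD(3)[OF n that] that by (simp add: neg_apply)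
  then obtain c' where c': "\<And>x. n ** u (neg \<alpha>) x ** inv\<^bsub>G\<^esub> n = u (neg \<beta>) (c' * x)"
    using root_subgroup_conj[OF neg_root[OF \<alpha>] neg_root[OF \<beta>] n] by blast
  define m1 where "m1 = n ** sg \<alpha> ** inv\<^bsub>G\<^esub> n"
  define m2 where "m2 = cr \<beta> c ** sg \<beta>"
  have crT: "cr \<beta> c \<in> T" by (rule cocharD(1)[OF realizationD(1)[OF \<beta>] c(1)])
  have m1N: "m1 \<in> NT" unfolding m1_def by (intro NT_mult NT_inv n realizationD(4)[OF \<alpha>])
  have m2N: "m2 \<in> NT" unfolding m2_def by (intro NT_mult T_NT crT realizationD(4)[OF \<beta>])
  have m1G: "m1 \<in> carrier G" and m2G: "m2 \<in> carrier G" using m1N m2N normalizerD(1) by auto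
  have m1: "m1 = u \<beta> c ** u (neg \<beta>) (- c') ** u \<beta> c"
    unfolding m1_def tits_lift_def by (simp add: conj_mult[OF nG] c(2) c')
  have m2: "m2 = u \<beta> c ** u (neg \<beta>) (- inverse c) ** u \<beta> c"
    unfolding m2_def using realizationD(6)[OF \<beta> c(1)] by simp
  have act1: "m1 ** t ** inv\<^bsub>G\<^esub> m1 = t ** inv\<^bsub>G\<^esub> (cr \<beta> (\<beta> t))" if t: "t \<in> T" for t
  proof -
    define t' where "t' = inv\<^bsub>G\<^esub> n ** t ** n"
    have t': "t' \<in> T" unfolding t'_def by (rule normalizerD(3)[OF n t])
    have \<beta>t: "\<beta> t \<noteq> 0" by (rule characterD(2)[OF root_character[OF \<beta>] t])
    have sG: "sg \<alpha> \<in> carrier G" by (rule normalizerD(1)[OF realizationD(4)[OF \<alpha>]])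
    have "inv\<^bsub>G\<^esub> m1 = n ** inv\<^bsub>G\<^esub> (sg \<alpha>) ** inv\<^bsub>G\<^esub> n"
      unfolding m1_def by (rule inv_conj[OF nG sG])
    then have "m1 ** t ** inv\<^bsub>G\<^esub> m1 = n ** (sg \<alpha> ** t' ** inv\<^bsub>G\<^esub> (sg \<alpha>)) ** inv\<^bsub>G\<^esub> n"
      unfolding m1_def t'_def by (simp only: matrix_mul_assoc)
    also have "\<dots> = (n ** t' ** inv\<^bsub>G\<^esub> n) ** (n ** inv\<^bsub>G\<^esub> (cr \<alpha> (\<alpha> t')) ** inv\<^bsub>G\<^esub> n)"
      unfolding sg_act[OF \<alpha> t'] by (rule conj_mult[OF nG])
    also have "n ** t' ** inv\<^bsub>G\<^esub> n = t" unfolding t'_def by (rule conj_cancel(2)[OF nG])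
    also have "\<alpha> t' = \<beta> t" unfolding t'_def by (rule match[OF t])
    also have "inv\<^bsub>G\<^esub> (cr \<alpha> (\<beta> t)) = cr \<alpha> (inverse (\<beta> t))"
      by (rule cocharD(4)[OF realizationD(1)[OF \<alpha>] \<beta>t])
    also have "n ** cr \<alpha> (inverse (\<beta> t)) ** inv\<^bsub>G\<^esub> n = cr \<beta> (inverse (\<beta> t))"
      by (rule comatch) (use \<beta>t in simp)
    also have "cr \<beta> (inverse (\<beta> t)) = inv\<^bsub>G\<^esub> (cr \<beta> (\<beta> t))"
      by (rule cocharD(4)[OF realizationD(1)[OF \<beta>] \<beta>t, symmetric])
    finally show ?thesis .
  qed
  have act2: "m2 ** t ** inv\<^bsub>G\<^esub> m2 = t ** inv\<^bsub>G\<^esub> (cr \<beta> (\<beta> t))" if t: "t \<in> T" for t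
  proof -
    have sG: "sg \<beta> \<in> carrier G" by (rule normalizerD(1)[OF realizationD(4)[OF \<beta>]])
    have crG: "cr \<beta> c \<in> carrier G" by (rule T_G[OF crT])
    have "\<beta> t \<noteq> 0" by (rule characterD(2)[OF root_character[OF \<beta>] t])
    then have T': "t ** inv\<^bsub>G\<^esub> (cr \<beta> (\<beta> t)) \<in> T" using t cocharD(1)[OF realizationD(1)[OF \<beta>]] by simp
    have "inv\<^bsub>G\<^esub> m2 = inv\<^bsub>G\<^esub> (sg \<beta>) ** inv\<^bsub>G\<^esub> (cr \<beta> c)"
      unfolding m2_def using inv_mult_group[of "cr \<beta> c" "sg \<beta>"] sG crG by simp
    then have "m2 ** t ** inv\<^bsub>G\<^esub> m2 = cr \<beta> c ** (sg \<beta> ** t ** inv\<^bsub>G\<^esub> (sg \<beta>)) ** inv\<^bsub>G\<^esub> (cr \<beta> c)"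
      unfolding m2_def by (simp only: matrix_mul_assoc)
    also have "\<dots> = (t ** inv\<^bsub>G\<^esub> (cr \<beta> (\<beta> t))) ** cr \<beta> c ** inv\<^bsub>G\<^esub> (cr \<beta> c)"
      unfolding sg_act[OF \<beta> t] T_comm[OF crT T'] ..
    also have "\<dots> = t ** inv\<^bsub>G\<^esub> (cr \<beta> (\<beta> t)) ** (cr \<beta> c ** inv\<^bsub>G\<^esub> (cr \<beta> c))" by (simp only: matrix_mul_assoc)
    finally show ?thesis using crG by simp
  qed
  have m_eq: "m1 = m1 ** inv\<^bsub>G\<^esub> m2 ** m2"
  proof -
    have "m1 ** inv\<^bsub>G\<^esub> m2 ** m2 = m1 ** (inv\<^bsub>G\<^esub> m2 ** m2)" by (simp only: matrix_mul_assoc)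
    then show ?thesis using m2G by simp
  qed
  define d where "d = inverse c - c'"
  have k: "m1 ** inv\<^bsub>G\<^esub> m2 = u \<beta> c ** u (neg \<beta>) d ** u \<beta> (- c)"
  proof -
    have "inv\<^bsub>G\<^esub> m2 = u \<beta> (- c) ** u (neg \<beta>) (inverse c) ** u \<beta> (- c)"
      unfolding m2 using inv_mult_group[of "u \<beta> c ** u (neg \<beta>) (- inverse c)" "u \<beta> c"]
        inv_mult_group[of "u \<beta> c" "u (neg \<beta>) (- inverse c)"] u(1) v(1)
      by (simp add: u(5) v(5) matrix_mul_assoc)
    then have "m1 ** inv\<^bsub>G\<^esub> m2 =
        u \<beta> c ** u (neg \<beta>) (- c') ** (u \<beta> c ** u \<beta> (- c)) ** u (neg \<beta>) (inverse c) ** u \<beta> (- c)"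
      unfolding m1 by (simp only: matrix_mul_assoc)
    also have "\<dots> = u \<beta> c ** (u (neg \<beta>) (- c') ** u (neg \<beta>) (inverse c)) ** u \<beta> (- c)"
      by (simp add: u(2)[symmetric] u(4) matrix_mul_assoc)
    also have "u (neg \<beta>) (- c') ** u (neg \<beta>) (inverse c) = u (neg \<beta>) d"
      by (simp add: v(2)[symmetric] d_def)
    finally show ?thesis .
  qed
  have "d = 0"
  proof (rule opposite_root_centralizing[OF \<beta> c(1)])
    fix t assume t: "t \<in> T"
    define w where "w = inv\<^bsub>G\<^esub> m2 ** t ** m2"
    have w: "w \<in> T" unfolding w_def by (rule normalizerD(3)[OF m2N t])
    have "m2 ** w ** inv\<^bsub>G\<^esub> m2 = t" unfolding w_def by (rule conj_cancel(2)[OF m2G])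
    then have "m1 ** w ** inv\<^bsub>G\<^esub> m1 = t" using act1[OF w] act2[OF w] by simp
    then have "t ** (m1 ** inv\<^bsub>G\<^esub> m2) = m1 ** w ** inv\<^bsub>G\<^esub> m1 ** (m1 ** inv\<^bsub>G\<^esub> m2)" by simp
    also have "\<dots> = m1 ** w ** (inv\<^bsub>G\<^esub> m1 ** m1) ** inv\<^bsub>G\<^esub> m2" by (simp only: matrix_mul_assoc)
    also have "\<dots> = m1 ** w ** inv\<^bsub>G\<^esub> m2" using m1G by simp
    also have "\<dots> = m1 ** inv\<^bsub>G\<^esub> m2 ** t ** (m2 ** inv\<^bsub>G\<^esub> m2)" unfolding w_def by (simp only: matrix_mul_assoc)
    finally have "t ** (m1 ** inv\<^bsub>G\<^esub> m2) = m1 ** inv\<^bsub>G\<^esub> m2 ** t" using m2G by simp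
    then have "t ** (m1 ** inv\<^bsub>G\<^esub> m2) ** inv\<^bsub>G\<^esub> t = m1 ** inv\<^bsub>G\<^esub> m2 ** (t ** inv\<^bsub>G\<^esub> t)"
      by (simp only: matrix_mul_assoc)
    then have "t ** (m1 ** inv\<^bsub>G\<^esub> m2) ** inv\<^bsub>G\<^esub> t = m1 ** inv\<^bsub>G\<^esub> m2" using T_G[OF t] by simp
    then show "t ** (u \<beta> c ** u (neg \<beta>) d ** u \<beta> (- c)) ** inv\<^bsub>G\<^esub> t = u \<beta> c ** u (neg \<beta>) d ** u \<beta> (- c)"
      unfolding k .
  qed
  then have "m1 ** inv\<^bsub>G\<^esub> m2 = mat 1" unfolding k by (simp add: u(2)[symmetric] u(4) v(4))
  then have "m1 = m2" using m_eq by simp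
  then show ?thesis using crT unfolding m1_def m2_def by blast
qed

end

section \<open>The cocharacter group\<close>

context torus_group
begin

lemma alg_hom_Gm_mult:
  assumes l: "l \<in> alg_hom Gm TG" and m: "m \<in> alg_hom Gm TG"
  shows "(\<lambda>x. l x ** m x) \<in> alg_hom Gm TG"
proof -
  have lT: "l x \<in> T" "m x \<in> T" if "x \<noteq> 0" for x
    using l m that unfolding alg_hom_def hom_def by auto
  have hom: "l (x * y) = l x ** l y" "m (x * y) = m x ** m y" if "x \<noteq> 0" "y \<noteq> 0" for x y
    using l m that unfolding alg_hom_def hom_def by auto
  have lm: "(\<lambda>x. l x ** m x) \<in> hom Gm TG"
  proof (rule homI)
    fix x y :: 'f assume "x \<in> carrier Gm" "y \<in> carrier Gm"
    then have xy: "x \<noteq> 0" "y \<noteq> 0" by auto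
    have "l (x * y) ** m (x * y) = l x ** (l y ** m x) ** m y"
      by (simp add: hom[OF xy] matrix_mul_assoc)
    also have "l y ** m x = m x ** l y" by (rule T_comm) (use lT xy in auto)
    finally show "l (x \<otimes>\<^bsub>Gm\<^esub> y) ** m (x \<otimes>\<^bsub>Gm\<^esub> y) = (l x ** m x) \<otimes>\<^bsub>TG\<^esub> (l y ** m y)"
      by (simp add: matrix_mul_assoc)
  qed (use lT in auto)
  have reg_l: "\<exists>f\<in>reg Gm. \<forall>x\<in>{x. x \<noteq> 0}. g (l x) = f x" if "g \<in> reg G" for g
    using l that unfolding alg_hom_def by auto
  have reg_m: "\<exists>f\<in>reg Gm. \<forall>x\<in>{x. x \<noteq> 0}. g (m x) = f x" if "g \<in> reg G" for g
    using m that unfolding alg_hom_def by auto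
  have "\<exists>f\<in>reg Gm. \<forall>x\<in>{x. x \<noteq> 0}. g (l x ** m x) = f x" if g: "g \<in> reg G" for g
    unfolding reg_Gm
  proof (rule fun_algebra_pullback[OF _ g[unfolded reg_G]])
    fix b :: "'f^'m^'m \<Rightarrow> 'f" assume "b \<in> insert (\<lambda>A. inverse (det A)) matrix_entries"
    then consider "b = (\<lambda>A. inverse (det A))" | p where "b = (\<lambda>A. ent A p)"
      by (auto elim: matrix_entriesE)
    then show "\<exists>f\<in>fun_algebra {\<lambda>x. x, inverse}. \<forall>x\<in>{x. x \<noteq> 0}. b (l x ** m x) = f x"
    proof cases
      case 1
      have d: "(\<lambda>A. inverse (det A)) \<in> reg G" unfolding reg_G by (rule fun_algebra.gen) simp
      obtain f where f: "f \<in> reg Gm" "\<forall>x\<in>{x. x \<noteq> 0}. inverse (det (l x)) = f x"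
        using reg_l[OF d] by (elim bexE) (rule that)
      obtain f' where f': "f' \<in> reg Gm" "\<forall>x\<in>{x. x \<noteq> 0}. inverse (det (m x)) = f' x"
        using reg_m[OF d] by (elim bexE) (rule that)
      show ?thesis unfolding 1
      proof (intro bexI[of _ "\<lambda>x. f x * f' x"] fun_algebra.mult ballI)
        fix x :: 'f assume "x \<in> {x. x \<noteq> 0}"
        with f f' show "inverse (det (l x ** m x)) = f x * f' x" by (simp add: det_mul)
      qed (use f f' reg_Gm in auto)
    next
      case 2
      have e: "(\<lambda>A. ent A q) \<in> reg G" for q by (rule polyfun_reg_G[OF ent_polyfun])
      have "\<forall>q. \<exists>f. f \<in> reg Gm \<and> (\<forall>x\<in>{x. x \<noteq> 0}. ent (l x) q = f x)" 
        by (rule allI, rule reg_l[OF e, unfolded Bex_def])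
      from choice[OF this] obtain f where f: "\<forall>q. f q \<in> reg Gm \<and> (\<forall>x\<in>{x. x \<noteq> 0}. ent (l x) q = f q x)" ..
      have "\<forall>q. \<exists>f. f \<in> reg Gm \<and> (\<forall>x\<in>{x. x \<noteq> 0}. ent (m x) q = f x)" 
        by (rule allI, rule reg_m[OF e, unfolded Bex_def])
      from choice[OF this] obtain f' where f': "\<forall>q. f' q \<in> reg Gm \<and> (\<forall>x\<in>{x. x \<noteq> 0}. ent (m x) q = f' q x)" ..
      have "(\<lambda>x. \<Sum>k\<in>UNIV. f (fst p, k) x * f' (k, snd p) x) \<in> fun_algebra {\<lambda>x. x, inverse}"
        by (intro fun_algebra_sum fun_algebra.mult) (use f f' reg_Gm in auto)
      moreover have "ent (l x ** m x) p = (\<Sum>k\<in>UNIV. f (fst p, k) x * f' (k, snd p) x)" if "x \<noteq> 0" for x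
      proof -
        have "ent (l x ** m x) p = (\<Sum>k\<in>UNIV. ent (l x) (fst p, k) * ent (m x) (k, snd p))"
          by (simp add: ent_def matrix_matrix_mult_def)
        then show ?thesis using f f' that by simp
      qed
      ultimately show ?thesis unfolding 2 by auto
    qed
  qed
  with lm show ?thesis unfolding alg_hom_def by auto
qed

lemma alg_hom_powi: "(\<lambda>x. x powi k) \<in> alg_hom Gm (Gm :: ('f, 'f) alg_group)"
proof -
  have pw: "\<exists>f\<in>fun_algebra {\<lambda>x. x, inverse}. \<forall>x\<in>{x. x \<noteq> (0 :: 'f)}. x powi k = f x" for k :: int
  proof -
    have "(\<lambda>x :: 'f. x) \<in> fun_algebra {\<lambda>x. x, inverse}" "(inverse :: 'f \<Rightarrow> 'f) \<in> fun_algebra {\<lambda>x. x, inverse}"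
      by (auto intro: fun_algebra.gen)
    then have "(\<lambda>x :: 'f. \<Prod>i\<in>{..<m}. x) \<in> fun_algebra {\<lambda>x. x, inverse}"
      "(\<lambda>x :: 'f. \<Prod>i\<in>{..<m}. inverse x) \<in> fun_algebra {\<lambda>x. x, inverse}" for m :: nat
      by (intro fun_algebra_prod; simp)+
    then have "(\<lambda>x :: 'f. x ^ m) \<in> fun_algebra {\<lambda>x. x, inverse}"
      "(\<lambda>x :: 'f. inverse x ^ m) \<in> fun_algebra {\<lambda>x. x, inverse}" for m :: nat by simp_all
    then show ?thesis by (cases "k \<ge> 0") (auto simp: power_int_def)
  qed
  have "\<exists>f\<in>reg Gm. \<forall>x\<in>{x. x \<noteq> 0}. g (x powi k) = f x" if "g \<in> reg Gm" for g :: "'f \<Rightarrow> 'f"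
    unfolding reg_Gm
  proof (rule fun_algebra_pullback[OF _ that[unfolded reg_Gm]])
    fix b :: "'f \<Rightarrow> 'f" assume "b \<in> {\<lambda>x. x, inverse}"
    then consider "b = (\<lambda>x. x)" | "b = inverse" by blast
    then show "\<exists>f\<in>fun_algebra {\<lambda>x. x, inverse}. \<forall>x\<in>{x. x \<noteq> 0}. b (x powi k) = f x"
      using pw[of k] pw[of "- k"] by cases (auto simp: power_int_minus)
  qed
  then show ?thesis unfolding alg_hom_def hom_def by (auto simp: power_int_mult_distrib)
qed

abbreviation "cg \<equiv> cocharacter_group G T"

lemma cocharI: "l \<in> alg_hom Gm TG \<Longrightarrow> (\<lambda>x\<in>{x. x \<noteq> 0}. l x) \<in> carrier cg"
  unfolding cocharacter_group_def by (auto intro!: alg_hom_cong[of l])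

lemma mult_cg: "l \<otimes>\<^bsub>cg\<^esub> m = (\<lambda>x\<in>{x. x \<noteq> 0}. l x ** m x)"
  and one_cg: "\<one>\<^bsub>cg\<^esub> = (\<lambda>x\<in>{x. x \<noteq> 0}. mat 1)"
  by (simp_all add: cocharacter_group_def)

lemma trivial_cochar: "(\<lambda>x. mat 1) \<in> alg_hom Gm TG"
proof (rule alg_homI)
  show "(\<lambda>x. g (mat 1)) \<in> reg Gm" for g :: "'f^'m^'m \<Rightarrow> 'f" unfolding reg_Gm by (rule fun_algebra.const)
qed (auto simp: hom_def)

lemma cochar_ext:
  assumes "l \<in> carrier cg" "m \<in> carrier cg" "\<And>x. x \<noteq> 0 \<Longrightarrow> l x = m x"
  shows "l = m"
  using assms unfolding cocharacter_group_def by (auto intro: extensionalityI)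

lemma mult_cg_closed: "l \<in> carrier cg \<Longrightarrow> m \<in> carrier cg \<Longrightarrow> l \<otimes>\<^bsub>cg\<^esub> m \<in> carrier cg"
  unfolding mult_cg by (intro cocharI alg_hom_Gm_mult cochar_alg_hom)

lemma inverse_cochar:
  assumes "l \<in> carrier cg"
  shows "(\<lambda>x\<in>{x. x \<noteq> 0}. l (inverse x)) \<in> carrier cg"
proof (rule cocharI)
  have "(\<lambda>x. l (x powi (- 1))) \<in> alg_hom Gm TG"
    by (rule alg_hom_compose[OF alg_hom_powi cochar_alg_hom[OF assms]])
  then show "(\<lambda>x. l (inverse x)) \<in> alg_hom Gm TG" by (simp add: power_int_minus)
qed

lemma group_cg: "Group.group cg"
proof (rule groupI)
  fix l assume l: "l \<in> carrier cg"
  show "\<exists>m\<in>carrier cg. m \<otimes>\<^bsub>cg\<^esub> l = \<one>\<^bsub>cg\<^esub>"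
  proof (rule bexI[OF _ inverse_cochar[OF l]])
    show "(\<lambda>x\<in>{x. x \<noteq> 0}. l (inverse x)) \<otimes>\<^bsub>cg\<^esub> l = \<one>\<^bsub>cg\<^esub>"
      unfolding mult_cg one_cg
      by (intro restrict_ext) (simp add: cocharD(2)[OF l, symmetric] cocharD(3)[OF l])
  qed
  show "\<one>\<^bsub>cg\<^esub> \<otimes>\<^bsub>cg\<^esub> l = l"
    by (rule cochar_ext[OF mult_cg_closed[OF _ l] l])
      (auto simp: mult_cg one_cg intro!: cocharI trivial_cochar)
next
  fix l m k assume *: "l \<in> carrier cg" "m \<in> carrier cg" "k \<in> carrier cg"
  show "l \<otimes>\<^bsub>cg\<^esub> m \<otimes>\<^bsub>cg\<^esub> k = l \<otimes>\<^bsub>cg\<^esub> (m \<otimes>\<^bsub>cg\<^esub> k)"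
    by (rule cochar_ext[OF mult_cg_closed[OF mult_cg_closed[OF *(1,2)] *(3)]
          mult_cg_closed[OF *(1) mult_cg_closed[OF *(2,3)]]])
      (simp add: mult_cg matrix_mul_assoc)
qed (auto simp: one_cg intro!: mult_cg_closed cocharI trivial_cochar)

lemma inv_cg: "l \<in> carrier cg \<Longrightarrow> inv\<^bsub>cg\<^esub> l = (\<lambda>x\<in>{x. x \<noteq> 0}. l (inverse x))"
proof (rule group.inv_equality[OF group_cg])
  assume l: "l \<in> carrier cg"
  show "(\<lambda>x\<in>{x. x \<noteq> 0}. l (inverse x)) \<otimes>\<^bsub>cg\<^esub> l = \<one>\<^bsub>cg\<^esub>"
      unfolding mult_cg one_cg
      by (intro restrict_ext) (simp add: cocharD(2)[OF l, symmetric] cocharD(3)[OF l])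
qed (auto simp: inverse_cochar)

end

section \<open>The half-spin lattice of type D\<close>

text \<open>The Dynkin diagram: the chain \<open>1, \<dots>, n - 1\<close>, with \<open>n\<close> attached to \<open>n - 2\<close>.\<close>

definition adj :: "nat \<Rightarrow> nat \<Rightarrow> nat \<Rightarrow> bool" where
  "adj n i j \<longleftrightarrow> (i < n \<and> j < n \<and> (j = i + 1 \<or> i = j + 1)) \<or> (i + 2 = n \<and> j = n) \<or> (i = n \<and> j + 2 = n)"

lemma cartan_D:
  assumes n: "n \<ge> 4" and i: "i \<in> {1..n}" and j: "j \<in> {1..n}"
  shows "(\<Sum>k=1..n. bourbaki_D n i k * bourbaki_D n j k) = (if i = j then 2 else if adj n i j then - 1 else 0)"
proof -
  have pick: "(\<Sum>k=1..n. of_bool (k = m) * f k) = f m" if "m \<in> {1..n}" for m and f :: "nat \<Rightarrow> int"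
    using that by (simp add: if_distrib[of "\<lambda>x. x * _"] of_bool_def cong: if_cong)
  show ?thesis
  proof (cases "i < n")
    case True
    have "(\<Sum>k=1..n. bourbaki_D n i k * bourbaki_D n j k) = bourbaki_D n j i - bourbaki_D n j (i + 1)"
      unfolding bourbaki_D_def[of n i] using True i
      by (simp only: if_True left_diff_distrib sum_subtractf) (subst (1 2) pick; simp)
    then show ?thesis using True i j n by (auto simp: bourbaki_D_def adj_def)
  next
    case False
    then have [simp]: "i = n" using i by simp
    have "(\<Sum>k=1..n. bourbaki_D n i k * bourbaki_D n j k) = bourbaki_D n j (n - 1) + bourbaki_D n j n"
      unfolding bourbaki_D_def[of n i] using n
      by (simp only: \<open>i = n\<close> less_irrefl if_False distrib_right sum.distrib) (subst (1 2) pick; simp)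
    then show ?thesis using i j n by (auto simp: bourbaki_D_def adj_def)
  qed
qed

locale half_spin_group = realized_group G T cr rf u
  for G :: "('f::alg_closed_field^'m::finite^'m, 'f) alg_group" and T cr rf u +
  fixes n :: nat and \<alpha> :: "nat \<Rightarrow> 'f^'m^'m \<Rightarrow> 'f" and \<omega> :: "'f \<Rightarrow> 'f^'m^'m"
  assumes conn: "alg_connected G" and simple: "almost_simple G"
    and n6: "6 \<le> n" and n_even: "even n"
    and simple_roots: "simple_roots G T n \<alpha>" and type_D: "type_D n \<alpha> cr"
    and coweight: "is_fundamental_coweight G T n \<alpha> (n - 1) \<omega>"
    and lattice: "carrier (cocharacter_group G T) =
      generate (cocharacter_group G T) ((\<lambda>i. cr (\<alpha> i)) ` {1..n} \<union> {\<omega>})"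
begin

text \<open>These cocharacters turn out to be a basis: they generate by \<open>cochar_te\<close> and are
  independent by \<open>lam_independent\<close>.\<close>

definition lam :: "nat \<Rightarrow> 'f \<Rightarrow> 'f^'m^'m" where
  "lam i = (if i = 1 then \<omega> else cr (\<alpha> i))"

abbreviation "te \<equiv> torus_element G n lam"

lemma simple_root: "i \<in> {1..n} \<Longrightarrow> \<alpha> i \<in> roots G T"
  using simple_roots unfolding simple_roots_def by blast

lemmas simple_char = root_character[OF simple_root]
lemmas simple_coroot = realizationD(1)[OF simple_root]

lemma omega_cochar: "\<omega> \<in> carrier cg"
  using coweight unfolding is_fundamental_coweight_def by blast

lemma lam_cochar: "k \<in> {1..n} \<Longrightarrow> lam k \<in> carrier cg"
  using omega_cochar simple_coroot by (auto simp: lam_def)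

lemma root_of_coroot:
  assumes "i \<in> {1..n}" "j \<in> {1..n}" "x \<noteq> 0"
  shows "\<alpha> i (cr (\<alpha> j) x) = (if i = j then x\<^sup>2 else if adj n i j then inverse x else 1)"
proof -
  have "pairing (\<alpha> i) (cr (\<alpha> j)) = (if i = j then 2 else if adj n i j then - 1 else 0)"
    using type_D assms(1,2) cartan_D[of n i j] n6 unfolding type_D_def by simp
  then show ?thesis
    using pairing_eq[OF simple_char[OF assms(1)] simple_coroot[OF assms(2)] assms(3)]
    by (simp add: power_int_minus)
qed

lemma root_of_omega:
  assumes "i \<in> {1..n}" "x \<noteq> 0"
  shows "\<alpha> i (\<omega> x) = (if i = n - 1 then x else 1)"
  using pairing_eq[OF simple_char[OF assms(1)] omega_cochar assms(2)] coweight assms(1)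
  unfolding is_fundamental_coweight_def by simp

lemma root_of_lam:
  assumes "i \<in> {1..n}" "k \<in> {1..n}" "x \<noteq> 0"
  shows "\<alpha> i (lam k x) = (if k = 1 then (if i = n - 1 then x else 1)
     else if i = k then x\<^sup>2 else if adj n i k then inverse x else 1)"
  using root_of_omega[OF assms(1,3)] root_of_coroot[OF assms] by (simp add: lam_def)

lemma word_T:
  "(\<And>k. k \<in> set ks \<Longrightarrow> k \<in> {1..n} \<and> x k \<noteq> 0) \<Longrightarrow> word_prod G (\<lambda>k. lam k (x k)) ks \<in> T"
  by (induction ks) (auto simp: word_prod_def cocharD(1)[OF lam_cochar])

lemma word_mult:
  "(\<And>k. k \<in> set ks \<Longrightarrow> k \<in> {1..n} \<and> x k \<noteq> 0 \<and> y k \<noteq> 0) \<Longrightarrow>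
   word_prod G (\<lambda>k. lam k (x k * y k)) ks =
   word_prod G (\<lambda>k. lam k (x k)) ks ** word_prod G (\<lambda>k. lam k (y k)) ks"
proof (induction ks)
  case Nil
  show ?case by (simp add: word_prod_def)
next
  case (Cons k ks)
  let ?w = "\<lambda>x. word_prod G (\<lambda>k. lam k (x k)) ks"
  have w: "?w x \<in> T" "?w y \<in> T" by (rule word_T, use Cons.prems in auto)+
  have k: "k \<in> {1..n}" "x k \<noteq> 0" "y k \<noteq> 0" using Cons.prems by auto
  have "lam k (x k * y k) ** (?w x ** ?w y) = lam k (x k) ** (lam k (y k) ** ?w x) ** ?w y"
    using cocharD(2)[OF lam_cochar[OF k(1)] k(2,3)] by (simp add: matrix_mul_assoc)
  also have "lam k (y k) ** ?w x = ?w x ** lam k (y k)"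
    by (rule T_comm[OF cocharD(1)[OF lam_cochar[OF k(1)] k(3)] w(1)])
  finally have "lam k (x k * y k) ** (?w x ** ?w y) = (lam k (x k) ** ?w x) ** (lam k (y k) ** ?w y)"
    by (simp add: matrix_mul_assoc)
  moreover have "word_prod G (\<lambda>k. lam k (x k * y k)) ks = ?w x ** ?w y"
    by (rule Cons.IH) (use Cons.prems in auto)
  ultimately show ?case by (simp add: word_prod_def)
qed

lemma word_character:
  fixes \<eta> :: "'f^'m^'m \<Rightarrow> 'f"
  assumes \<eta>: "\<And>t t'. t \<in> T \<Longrightarrow> t' \<in> T \<Longrightarrow> \<eta> (t ** t') = \<eta> t * \<eta> t'" and one: "\<eta> (mat 1) = 1"
  shows "distinct ks \<Longrightarrow> (\<And>k. k \<in> set ks \<Longrightarrow> k \<in> {1..n} \<and> x k \<noteq> 0) \<Longrightarrow>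
   \<eta> (word_prod G (\<lambda>k. lam k (x k)) ks) = (\<Prod>k\<in>set ks. \<eta> (lam k (x k)))"
proof (induction ks)
  case Nil
  show ?case by (simp add: word_prod_def one)
next
  case (Cons k ks)
  have "word_prod G (\<lambda>k. lam k (x k)) ks \<in> T" by (rule word_T) (use Cons.prems in auto)
  moreover have "lam k (x k) \<in> T" by (rule cocharD(1)[OF lam_cochar]) (use Cons.prems in auto)
  moreover have "\<eta> (word_prod G (\<lambda>k. lam k (x k)) ks) = (\<Prod>k\<in>set ks. \<eta> (lam k (x k)))"
    by (rule Cons.IH) (use Cons.prems in auto)
  ultimately show ?case using Cons.prems(1) \<eta> by (simp add: word_prod_def)
qed

lemma word_single:
  assumes k: "k \<in> {1..n}"
  shows "distinct ks \<Longrightarrow> set ks \<subseteq> {1..n} \<Longrightarrow>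
    word_prod G (\<lambda>j. lam j (if j = k then y else 1)) ks = (if k \<in> set ks then lam k y else mat 1)"
proof (induction ks)
  case Nil
  show ?case by (simp add: word_prod_def)
next
  case (Cons j ks)
  have "word_prod G (\<lambda>j. lam j (if j = k then y else 1)) ks = (if k \<in> set ks then lam k y else mat 1)"
    by (rule Cons.IH) (use Cons.prems in auto)
  moreover have "lam j 1 = mat 1" by (rule cocharD(3)[OF lam_cochar]) (use Cons.prems in auto)
  ultimately show ?case using Cons.prems by (auto simp: word_prod_def)
qed

lemma set_upt_1: "set [1..<Suc n] = {1..n}" by auto

lemma te_T: "(\<And>k. k \<in> {1..n} \<Longrightarrow> x k \<noteq> 0) \<Longrightarrow> te x \<in> T"
  unfolding torus_element_def by (rule word_T) auto

lemma te_mult: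
  "(\<And>k. k \<in> {1..n} \<Longrightarrow> x k \<noteq> 0) \<Longrightarrow> (\<And>k. k \<in> {1..n} \<Longrightarrow> y k \<noteq> 0) \<Longrightarrow>
   te x ** te y = te (\<lambda>k. x k * y k)"
  unfolding torus_element_def by (rule word_mult[symmetric]) auto

lemma te_cong: "(\<And>k. k \<in> {1..n} \<Longrightarrow> x k = y k) \<Longrightarrow> te x = te y"
  unfolding torus_element_def word_prod_def by (intro foldr_cong) auto

lemma te_one: "te (\<lambda>_. 1) = mat 1"
proof -
  have "word_prod G (\<lambda>k. lam k 1) ks = mat 1" if "set ks \<subseteq> {1..n}" for ks
    using that by (induction ks) (auto simp: word_prod_def cocharD(3)[OF lam_cochar])
  then show ?thesis unfolding torus_element_def set_upt_1[symmetric] by simp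
qed

lemma te_single: "k \<in> {1..n} \<Longrightarrow> te (\<lambda>j. if j = k then y else 1) = lam k y"
  unfolding torus_element_def by (subst word_single) (simp_all only: set_upt_1 distinct_upt subset_refl if_True)

lemma te_character:
  fixes \<eta> :: "'f^'m^'m \<Rightarrow> 'f"
  assumes "\<And>t t'. t \<in> T \<Longrightarrow> t' \<in> T \<Longrightarrow> \<eta> (t ** t') = \<eta> t * \<eta> t'" and "\<eta> (mat 1) = 1"
    and "\<And>k. k \<in> {1..n} \<Longrightarrow> x k \<noteq> 0"
  shows "\<eta> (te x) = (\<Prod>k\<in>{1..n}. \<eta> (lam k (x k)))"
  unfolding torus_element_def set_upt_1[symmetric] by (rule word_character) (use assms in auto)

text \<open>A row of the Cartan matrix, with two peculiarities: the first coordinate belongs to \<open>\<omega>\<^sub>n\<^sub>-\<^sub>1\<close>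
  and enters \<open>\<alpha>\<^sub>n\<^sub>-\<^sub>1\<close> only, and the end of the chain and the fork at \<open>n - 2\<close> need separate
  formulas.\<close>

lemma root_of_te:
  assumes i: "i \<in> {1..n}" and x: "\<And>k. k \<in> {1..n} \<Longrightarrow> x k \<noteq> 0"
  shows "\<alpha> i (te x) =
    (if i = 1 then inverse (x 2)
     else if i = 2 then (x 2)\<^sup>2 / x 3
     else if i \<le> n - 3 then (x i)\<^sup>2 / (x (i - 1) * x (i + 1))
     else if i = n - 2 then (x i)\<^sup>2 / (x (n - 3) * x (n - 1) * x n)
     else if i = n - 1 then x 1 * (x i)\<^sup>2 / x (n - 2)
     else (x n)\<^sup>2 / x (n - 2))"
proof -
  have eq: "\<alpha> i (te x) = (\<Prod>k\<in>S. \<alpha> i (lam k (x k)))"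
    if S: "S \<subseteq> {1..n}" "\<And>k. k \<in> {1..n} - S \<Longrightarrow> k = 1 \<and> i \<noteq> n - 1 \<or> k \<noteq> 1 \<and> i \<noteq> k \<and> \<not> adj n i k" for S
  proof -
    have "\<alpha> i (te x) = (\<Prod>k\<in>{1..n}. \<alpha> i (lam k (x k)))"
      by (rule te_character[OF characterD(1)[OF simple_char[OF i]] character_one[OF simple_char[OF i]] x])
    also have "\<dots> = (\<Prod>k\<in>S. \<alpha> i (lam k (x k)))"
    proof (rule prod.mono_neutral_right)
      show "\<forall>k\<in>{1..n} - S. \<alpha> i (lam k (x k)) = 1"
      proof
        fix k assume k: "k \<in> {1..n} - S"
        then have "k \<in> {1..n}" by simp
        then show "\<alpha> i (lam k (x k)) = 1" using S(2)[OF k] root_of_lam[OF i _ x] by auto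
      qed
    qed (use S in auto)
    finally show ?thesis .
  qed
  have val: "\<alpha> i (lam k (x k)) = (if k = 1 then (if i = n - 1 then x k else 1)
     else if i = k then (x k)\<^sup>2 else if adj n i k then inverse (x k) else 1)" if "k \<in> {1..n}" for k
    by (rule root_of_lam[OF i that x[OF that]])
  consider "i = 1" | "i = 2" | "3 \<le> i" "i \<le> n - 3" | "i = n - 2" | "i = n - 1" | "i = n"
    using i by force
  then show ?thesis
  proof cases
    case 1
    then have "\<alpha> i (te x) = (\<Prod>k\<in>{2}. \<alpha> i (lam k (x k)))"
      using n6 by (intro eq) (auto simp: adj_def)
    then show ?thesis using 1 n6 val[of 2] by (simp add: adj_def)
  next
    case 2
    then have "\<alpha> i (te x) = (\<Prod>k\<in>{2, 3}. \<alpha> i (lam k (x k)))"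
      using n6 by (intro eq) (auto simp: adj_def)
    then show ?thesis using 2 n6 val[of 2] val[of 3] by (simp add: adj_def field_simps)
  next
    case 3
    then obtain j where j: "i = Suc j" by (cases i) auto
    have j2: "2 \<le> j" "Suc (Suc j) < n" "j \<noteq> n - 2" using 3 j n6 by auto
    have "\<alpha> i (te x) = (\<Prod>k\<in>{j, Suc j, Suc (Suc j)}. \<alpha> i (lam k (x k)))"
      using n6 j j2 3 by (intro eq) (auto simp: adj_def)
    also have "\<dots> = \<alpha> i (lam j (x j)) * (\<alpha> i (lam (Suc j) (x (Suc j))) * \<alpha> i (lam (Suc (Suc j)) (x (Suc (Suc j)))))"
      by simp
    also have "\<dots> = inverse (x j) * ((x (Suc j))\<^sup>2 * inverse (x (Suc (Suc j))))"
      using j2 val[of j] val[of "Suc j"] val[of "Suc (Suc j)"] by (simp add: adj_def j)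
    finally show ?thesis using 3 j2 n6 by (simp add: j divide_inverse mult_ac)
  next
    case 4
    have a: "adj n (n - 2) (n - 3)" "adj n (n - 2) (n - 1)" "adj n (n - 2) n"
      "n - 3 \<in> {1..n}" "n - 2 \<in> {1..n}" "n - 1 \<in> {1..n}" "n \<in> {1..n}"
      "n - 3 \<noteq> 1" "n - 2 \<noteq> 1" "n - 1 \<noteq> 1" "n \<noteq> 1" "n - 2 \<noteq> n - 3" "n - 2 \<noteq> n - 1" "n - 2 \<noteq> n"
      "i \<noteq> 1" "i \<noteq> 2" "\<not> i \<le> n - 3" "i = n - 2"
      using 4 n6 by (auto simp: adj_def)
    from 4 have "\<alpha> i (te x) = (\<Prod>k\<in>{n - 3, n - 2, n - 1, n}. \<alpha> i (lam k (x k)))"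
      using n6 by (intro eq) (auto simp: adj_def)
    also have "\<dots> = \<alpha> i (lam (n - 3) (x (n - 3))) * (\<alpha> i (lam (n - 2) (x (n - 2))) *
        (\<alpha> i (lam (n - 1) (x (n - 1))) * \<alpha> i (lam n (x n))))"
      using n6 by (subst prod.insert; simp; linarith?)+
    also have "\<dots> = inverse (x (n - 3)) * ((x (n - 2))\<^sup>2 * (inverse (x (n - 1)) * inverse (x n)))"
      unfolding val[OF a(4)] val[OF a(5)] val[OF a(6)] val[OF a(7)] by (simp only: a if_True if_False simp_thms)
    finally have te_x: "\<alpha> i (te x) = (x i)\<^sup>2 / (x (n - 3) * x (n - 1) * x n)"
      unfolding 4 by (simp add: divide_inverse mult_ac)
    have f: "(i = 1) = False" "(i = 2) = False" "(i \<le> n - 3) = False" "(i = n - 2) = True"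
      using 4 n6 by auto
    show ?thesis unfolding te_x f if_False if_True ..
  next
    case 5
    have a: "adj n (n - 1) (n - 2)" "1 \<in> {1..n}" "n - 2 \<in> {1..n}" "n - 1 \<in> {1..n}"
      "n - 2 \<noteq> 1" "n - 1 \<noteq> 1" "n - 1 \<noteq> n - 2"
      "i \<noteq> 1" "i \<noteq> 2" "\<not> i \<le> n - 3" "i \<noteq> n - 2" "i = n - 1"
      using 5 n6 by (auto simp: adj_def)
    from 5 have "\<alpha> i (te x) = (\<Prod>k\<in>{1, n - 2, n - 1}. \<alpha> i (lam k (x k)))"
      using n6 by (intro eq) (auto simp: adj_def)
    also have "\<dots> = \<alpha> i (lam 1 (x 1)) * (\<alpha> i (lam (n - 2) (x (n - 2))) * \<alpha> i (lam (n - 1) (x (n - 1))))"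
      using n6 by (subst prod.insert; simp; linarith?)+
    also have "\<dots> = x 1 * (inverse (x (n - 2)) * (x (n - 1))\<^sup>2)"
      unfolding val[OF a(2)] val[OF a(3)] val[OF a(4)] by (simp only: a if_True if_False simp_thms)
    finally show ?thesis using a by (simp add: divide_inverse mult_ac)
  next
    case 6
    have a: "adj n n (n - 2)" "n - 2 \<in> {1..n}" "n \<in> {1..n}"
      "n - 2 \<noteq> 1" "n \<noteq> 1" "n \<noteq> n - 2" "n \<noteq> 2" "\<not> n \<le> n - 3" "n \<noteq> n - 1" "i = n"
      using 6 n6 by (auto simp: adj_def)
    from 6 have "\<alpha> i (te x) = (\<Prod>k\<in>{n - 2, n}. \<alpha> i (lam k (x k)))"
      using n6 by (intro eq) (auto simp: adj_def)
    also have "\<dots> = \<alpha> i (lam (n - 2) (x (n - 2))) * \<alpha> i (lam n (x n))"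
      using n6 by (subst prod.insert; simp)+
    also have "\<dots> = inverse (x (n - 2)) * (x n)\<^sup>2"
      unfolding val[OF a(2)] val[OF a(3)] by (simp only: a if_True if_False simp_thms)
    finally show ?thesis using a by (simp add: divide_inverse mult_ac)
  qed
qed

lemma te_power_alg_hom: "(\<lambda>x. te (\<lambda>k. x powi v k)) \<in> alg_hom Gm TG"
proof -
  have alg: "(\<lambda>x. word_prod G (\<lambda>k. lam k (x powi v k)) ks) \<in> alg_hom Gm TG" if "set ks \<subseteq> {1..n}" for ks
    using that
  proof (induction ks)
    case Nil
    show ?case using trivial_cochar by (simp add: word_prod_def)
  next
    case (Cons k ks)
    have "(\<lambda>x. lam k (x powi v k)) \<in> alg_hom Gm TG"
      by (rule alg_hom_compose[OF alg_hom_powi cochar_alg_hom[OF lam_cochar]]) (use Cons.prems in simp)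
    moreover have "(\<lambda>x. word_prod G (\<lambda>k. lam k (x powi v k)) ks) \<in> alg_hom Gm TG"
      by (rule Cons.IH) (use Cons.prems in simp)
    ultimately show ?case using alg_hom_Gm_mult by (simp add: word_prod_def)
  qed
  show ?thesis unfolding torus_element_def by (rule alg) (simp only: set_upt_1 subset_refl)
qed

text \<open>All roots are products of powers of the simple ones, so the image of such a cocharacter is
  central, and \<open>central_cocharacter_trivial\<close> applies.\<close>

lemma simple_kernel_trivial:
  fixes x :: 'f
  assumes \<mu>: "\<mu> \<in> alg_hom Gm TG" and ker: "\<And>i (x :: 'f). i \<in> {1..n} \<Longrightarrow> x \<noteq> 0 \<Longrightarrow> \<alpha> i (\<mu> x) = 1" and x: "x \<noteq> 0"
  shows "\<mu> x = mat 1"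
proof (rule central_cocharacter_trivial[OF simple _ _ x])
  have \<mu>T: "\<mu> x \<in> T" if "x \<noteq> 0" for x using \<mu> that unfolding alg_hom_def hom_def by auto
  show "\<mu> \<in> alg_hom Gm G" using \<mu> T_G unfolding alg_hom_def hom_def by auto
  fix x :: 'f and g assume xg: "x \<noteq> 0" "g \<in> carrier G"
  show "\<mu> x ** g = g ** \<mu> x"
  proof (rule central_if_roots_trivial[OF conn \<mu>T[OF xg(1)] _ xg(2)])
    fix \<beta> assume \<beta>: "\<beta> \<in> roots G T"
    have "\<forall>\<beta> \<in> roots G T. \<exists>k :: nat \<Rightarrow> int. (\<forall>t\<in>T. \<beta> t = (\<Prod>i=1..n. \<alpha> i t powi k i)) \<and>
        ((\<forall>i\<in>{1..n}. 0 \<le> k i) \<or> (\<forall>i\<in>{1..n}. k i \<le> 0))"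
      using simple_roots unfolding simple_roots_def by (elim conjE)
    from bspec[OF this \<beta>] obtain k :: "nat \<Rightarrow> int" where "\<forall>t\<in>T. \<beta> t = (\<Prod>i=1..n. \<alpha> i t powi k i)"
      by (elim exE conjE) (rule that)
    then show "\<beta> (\<mu> x) = 1" using \<mu>T[OF xg(1)] ker xg(1) by simp
  qed
qed

text \<open>In the coweight space
  \<open>2 \<omega>\<^sub>n\<^sub>-\<^sub>1 = \<alpha>\<^sub>1\<^sup>\<or> + 2 \<alpha>\<^sub>2\<^sup>\<or> + \<dots> + (n - 2) \<alpha>\<^sub>n\<^sub>-\<^sub>2\<^sup>\<or> + (n/2) \<alpha>\<^sub>n\<^sub>-\<^sub>1\<^sup>\<or> + ((n - 2)/2) \<alpha>\<^sub>n\<^sup>\<or>\<close>, and the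
  coefficients are integral because \<open>n\<close> is even. To have the relation for cocharacters of \<open>T\<close>,
  the quotient of both sides is checked against the simple roots.\<close>

lemma first_coroot:
  assumes x: "x \<noteq> 0"
  shows "cr (\<alpha> 1) x = te (\<lambda>k. x powi (if k = 1 then 2 else if k \<le> n - 2 then - int k
    else if k = n - 1 then - int (n div 2) else - int ((n - 2) div 2)))"
proof -
  define v where "v k = (if k = 1 then 2 else if k \<le> n - 2 then - int k
    else if k = n - 1 then - int (n div 2) else - int ((n - 2) div 2))" for k
  obtain N where N: "n = 2 * N" using n_even by blast
  have N3: "3 \<le> N" using n6 N by simp
  have v: "v (Suc 0) = 2" "v (n - Suc 0) = - int N" "v n = 1 - int N" "2 \<le> k \<Longrightarrow> k \<le> n - 2 \<Longrightarrow> v k = - int k" for k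
    using N N3 by (auto simp: v_def of_nat_diff)
  have int_n: "int n = 2 * int N" "int (n - 2) = 2 * int N - 2" "int (n - 3) = 2 * int N - 3"
    using N N3 by auto
  have one: "1 \<in> {1..n}" using n6 by simp
  have inv1: "(\<lambda>x. te (\<lambda>k. x powi (- v k))) \<in> alg_hom Gm TG" by (rule te_power_alg_hom)
  let ?\<mu> = "\<lambda>x. cr (\<alpha> 1) x ** te (\<lambda>k. x powi (- v k))"
  have "?\<mu> x = mat 1"
  proof (rule simple_kernel_trivial[OF alg_hom_Gm_mult[OF cochar_alg_hom[OF simple_coroot[OF one]] inv1] _ x])
    fix i and x :: 'f assume i: "i \<in> {1..n}" and x: "x \<noteq> 0"
    have nz: "x powi (- v k) \<noteq> 0" for k using x by simp
    have "\<alpha> i (?\<mu> x) = \<alpha> i (cr (\<alpha> 1) x) * \<alpha> i (te (\<lambda>k. x powi (- v k)))"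
      by (rule characterD(1)[OF simple_char[OF i] cocharD(1)[OF simple_coroot[OF one] x] te_T]) (rule nz)
    also have "\<alpha> i (cr (\<alpha> 1) x) = x powi (if i = 1 then 2 else if i = 2 then - 1 else 0)"
      using root_of_coroot[OF i one x] n6 i by (auto simp: adj_def power_int_minus)
    also have "\<alpha> i (te (\<lambda>k. x powi (- v k))) = x powi (if i = 1 then - 2 else if i = 2 then 1 else 0)"
    proof -
      have sq: "(x powi a)\<^sup>2 = x powi (2 * a)" for a :: int
        using x by (simp add: power2_eq_square power_int_add[symmetric])
      have dv: "x powi a / x powi b = x powi (a - b)" "x powi a * x powi b = x powi (a + b)"
        "inverse (x powi a) = x powi (- a)" for a b :: int
        using x by (simp_all add: power_int_diff power_int_add power_int_minus)
      note te_root = root_of_te[where x = "\<lambda>k. x powi (- v k)", OF i nz, unfolded sq dv]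
      consider "i = 1" | "i = 2" | "3 \<le> i" "i \<le> n - 3" | "i = n - 2" | "i = n - 1" | "i = n"
        using i by force
      then show ?thesis
      proof cases
        case 1
        then show ?thesis using n6 v(4)[of 2] unfolding te_root by simp
      next
        case 2
        then show ?thesis using n6 v(4)[of 2] v(4)[of 3] unfolding te_root by simp
      next
        case 3
        have "v (i - 1) = - int (i - 1)" by (rule v(4)) (use 3 in auto)
        moreover have "v i = - int i" by (rule v(4)) (use 3 in auto)
        moreover have "v (i + 1) = - int (i + 1)" by (rule v(4)) (use 3 n6 in auto)
        moreover note 3 n6
        ultimately show ?thesis unfolding te_root by (simp add: of_nat_diff)
      next
        case 4
        then have f: "(i = 1) = False" "(i = 2) = False" "(i \<le> n - 3) = False" "(i = n - 2) = True"
          using n6 by auto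
        have "v (n - 2) = - int (n - 2)" by (rule v(4)) (use n6 in auto)
        moreover have "v (n - 3) = - int (n - 3)" by (rule v(4)) (use n6 in auto)
        ultimately have "2 * - v i - (- v (n - 3) + - v (n - 1) + - v n) = 0"
          using v(2,3) int_n unfolding 4 by simp
        then show ?thesis unfolding te_root f if_False if_True by (simp only:)
      next
        case 5
        then have f: "(i = 1) = False" "(i = 2) = False" "(i \<le> n - 3) = False" "(i = n - 2) = False" "(i = n - 1) = True"
          using n6 by auto
        have "v (n - 2) = - int (n - 2)" by (rule v(4)) (use n6 in auto)
        then have "- v 1 + 2 * - v i - - v (n - 2) = 0"
          using v(1,2) int_n unfolding 5 by simp
        then show ?thesis unfolding te_root f if_False if_True by (simp only:)
      next
        case 6
        then have f: "(i = 1) = False" "(i = 2) = False" "(i \<le> n - 3) = False" "(i = n - 2) = False" "(i = n - 1) = False"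
          using n6 by auto
        have "v (n - 2) = - int (n - 2)" by (rule v(4)) (use n6 in auto)
        then have "2 * - v n - - v (n - 2) = 0"
          using v(3) int_n by simp
        then show ?thesis unfolding te_root f if_False if_True by (simp only:)
      qed
    qed
    finally show "\<alpha> i (?\<mu> x) = 1" using x by (simp add: power_int_add[symmetric])
  qed
  moreover have "te (\<lambda>k. x powi v k) ** te (\<lambda>k. x powi (- v k)) = mat 1"
  proof -
    have "te (\<lambda>k. x powi v k) ** te (\<lambda>k. x powi (- v k)) = te (\<lambda>_. 1)"
      by (subst te_mult) (use x in \<open>auto intro!: te_cong simp: power_int_minus\<close>)
    then show ?thesis by (simp add: te_one)
  qed
  ultimately have "?\<mu> x ** inv\<^bsub>G\<^esub> (te (\<lambda>k. x powi (- v k))) =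
      te (\<lambda>k. x powi v k) ** te (\<lambda>k. x powi (- v k)) ** inv\<^bsub>G\<^esub> (te (\<lambda>k. x powi (- v k)))" by simp
  moreover have "te (\<lambda>k. x powi (- v k)) \<in> carrier G" by (rule T_G, rule te_T) (use x in simp)
  ultimately have "cr (\<alpha> 1) x = te (\<lambda>k. x powi v k)" by (simp add: matrix_mul_assoc[symmetric])
  then show ?thesis unfolding v_def .
qed

end

section \<open>Coordinates on the torus\<close>

text \<open>The solution of \<open>\<alpha>\<^sub>i = e\<^sub>i\<close> from the free end of the chain up to the fork: the equation for
  \<open>k + 1\<close> determines the coordinate \<open>k + 2\<close>. The values 1 at the indices 0 and 1 stand for
  neighbours that do not occur in the equations for \<open>\<alpha>\<^sub>1\<close> and \<open>\<alpha>\<^sub>2\<close>.\<close>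

fun chain_solution :: "(nat \<Rightarrow> 'f::field) \<Rightarrow> nat \<Rightarrow> 'f" where
  "chain_solution e 0 = 1"
| "chain_solution e (Suc 0) = 1"
| "chain_solution e (Suc (Suc k)) = (chain_solution e (Suc k))\<^sup>2 / (chain_solution e k * e (Suc k))"

lemma power_int_sum:
  fixes x :: "'f::field"
  assumes "finite I" "x \<noteq> 0"
  shows "(\<Prod>i\<in>I. x powi a i) = x powi (\<Sum>i\<in>I. a i)"
  using assms(1) by induction (use assms(2) in \<open>simp_all add: power_int_add\<close>)

context half_spin_group
begin

text \<open>The generators of the lattice are the basis elements and \<open>\<alpha>\<^sub>1\<^sup>\<or>\<close>, which \<open>first_coroot\<close>
  expresses in the others.\<close>

lemma cochar_te:
  assumes "l \<in> carrier cg"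
  shows "\<exists>v :: nat \<Rightarrow> int. \<forall>x. x \<noteq> 0 \<longrightarrow> l x = te (\<lambda>k. x powi v k)"
proof -
  have gen: "\<exists>v :: nat \<Rightarrow> int. \<forall>x. x \<noteq> 0 \<longrightarrow> l x = te (\<lambda>k. x powi v k)"
    if asm: "l \<in> (\<lambda>i. cr (\<alpha> i)) ` {1..n} \<union> {\<omega>}" for l
  proof -
    have single: "\<exists>v :: nat \<Rightarrow> int. \<forall>x. x \<noteq> 0 \<longrightarrow> lam j x = te (\<lambda>k. x powi v k)" if j: "j \<in> {1..n}" for j
    proof (intro exI[of _ "\<lambda>k. if k = j then 1 else 0"] allI impI)
      fix x :: 'f
      show "lam j x = te (\<lambda>k. x powi (if k = j then 1 else 0))"
        unfolding te_single[OF j, symmetric] by (rule te_cong) simp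
    qed
    show ?thesis
    proof (cases "l = \<omega>")
      case True
      then have "l = lam 1" by (simp add: lam_def)
      then show ?thesis using single[of 1] n6 by simp
    next
      case False
      then obtain i where i: "i \<in> {1..n}" "l = cr (\<alpha> i)" using asm by blast
      show ?thesis
      proof (cases "i = 1")
        case True
        show ?thesis unfolding i(2) True by (intro exI allI impI) (erule first_coroot)
      next
        case False
        then have "l = lam i" by (simp add: lam_def i(2))
        then show ?thesis using single[OF i(1)] by simp
      qed
    qed
  qed
  have sub: "(\<lambda>i. cr (\<alpha> i)) ` {1..n} \<union> {\<omega>} \<subseteq> carrier cg"
    using simple_coroot omega_cochar by auto
  from assms have "l \<in> generate cg ((\<lambda>i. cr (\<alpha> i)) ` {1..n} \<union> {\<omega>})" by (simp only: lattice)
  then show ?thesis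
  proof induction
    case one
    show ?case by (rule exI[of _ "\<lambda>_. 0"]) (simp add: one_cg te_one)
  next
    case (incl h)
    then show ?case by (rule gen)
  next
    case (inv h)
    obtain v :: "nat \<Rightarrow> int" where v: "\<forall>x. x \<noteq> 0 \<longrightarrow> h x = te (\<lambda>k. x powi v k)" using gen[OF inv] ..
    have h: "h \<in> carrier cg" using inv sub by blast
    show ?case
    proof (intro exI[of _ "\<lambda>k. - v k"] allI impI)
      fix x :: 'f assume x: "x \<noteq> 0"
      have "(inv\<^bsub>cg\<^esub> h) x = te (\<lambda>k. inverse x powi v k)" using x v by (simp add: inv_cg[OF h])
      also have "\<dots> = te (\<lambda>k. x powi (- v k))"
        by (rule te_cong) (simp add: power_int_minus power_int_inverse)
      finally show "(inv\<^bsub>cg\<^esub> h) x = te (\<lambda>k. x powi (- v k))" .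
    qed
  next
    case (eng h1 h2)
    obtain v1 :: "nat \<Rightarrow> int" where v1: "\<forall>x. x \<noteq> 0 \<longrightarrow> h1 x = te (\<lambda>k. x powi v1 k)" using eng.IH(1) ..
    obtain v2 :: "nat \<Rightarrow> int" where v2: "\<forall>x. x \<noteq> 0 \<longrightarrow> h2 x = te (\<lambda>k. x powi v2 k)" using eng.IH(2) ..
    show ?case
    proof (intro exI[of _ "\<lambda>k. v1 k + v2 k"] allI impI)
      fix x :: 'f assume x: "x \<noteq> 0"
      have "(h1 \<otimes>\<^bsub>cg\<^esub> h2) x = te (\<lambda>k. x powi v1 k) ** te (\<lambda>k. x powi v2 k)"
        using x v1 v2 by (simp add: mult_cg)
      also have "\<dots> = te (\<lambda>k. x powi v1 k * x powi v2 k)" by (rule te_mult) (use x in auto)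
      also have "\<dots> = te (\<lambda>k. x powi (v1 k + v2 k))" by (rule te_cong) (use x in \<open>simp add: power_int_add\<close>)
      finally show "(h1 \<otimes>\<^bsub>cg\<^esub> h2) x = te (\<lambda>k. x powi (v1 k + v2 k))" .
    qed
  qed
qed

text \<open>Away from the fork \<open>\<alpha>\<^sub>i = 1\<close> determines the coordinate \<open>i + 1\<close> from those at \<open>i - 1\<close> and
  \<open>i\<close>.\<close>

lemma chain_upward:
  assumes x: "\<And>k. k \<in> {1..n} \<Longrightarrow> x k \<noteq> 0" and m: "m \<le> n - 3"
    and x2: "x 2 = 1" and roots: "\<And>i. 2 \<le> i \<Longrightarrow> i \<le> m \<Longrightarrow> \<alpha> i (te x) = 1"
  shows "2 \<le> k \<Longrightarrow> k \<le> m + 1 \<Longrightarrow> x k = 1"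
proof (induction k rule: less_induct)
  case (less k)
  show ?case
  proof (cases "k = 2")
    case True
    then show ?thesis by (simp add: x2)
  next
    case False
    then obtain i where i: "k = Suc i" "2 \<le> i" "i \<le> m" using less.prems by (cases k) auto
    have iD: "i \<in> {1..n}" "i \<le> n - 3" using i m n6 by auto
    have xi: "x i = 1" by (rule less.IH) (use i in auto)
    have kn: "k \<in> {1..n}" using i m n6 by auto
    have r: "\<alpha> i (te x) = 1" by (rule roots[OF i(2,3)])
    show ?thesis
    proof (cases "i = 2")
      case True
      then show ?thesis using r root_of_te[OF iD(1) x] xi x[OF kn] n6 i by (simp add: eval_nat_numeral)
    next
      case 3: False
      have "x (i - 1) = 1" by (rule less.IH) (use i 3 in auto)
      then show ?thesis using r root_of_te[OF iD(1) x] xi x[OF kn] iD i 3 by simp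
    qed
  qed
qed

text \<open>The Cartan pairing with the simple roots is non-degenerate. The exponents vanish
  successively: \<open>\<alpha>\<^sub>1\<close> gives \<open>v\<^sub>2\<close>, the chain gives those up to \<open>n - 2\<close>, then \<open>\<alpha>\<^sub>n\<close>, \<open>\<alpha>\<^sub>n\<^sub>-\<^sub>2\<close> and
  \<open>\<alpha>\<^sub>n\<^sub>-\<^sub>1\<close> give \<open>v\<^sub>n\<close>, \<open>v\<^sub>n\<^sub>-\<^sub>1\<close> and \<open>v\<^sub>1\<close>.\<close>

lemma lam_independent:
  assumes v: "\<And>y. y \<noteq> 0 \<Longrightarrow> te (\<lambda>k. y powi v k) = mat 1" and k: "k \<in> {1..n}"
  shows "v k = 0"
proof -
  have nz: "y \<noteq> 0 \<Longrightarrow> y powi v k \<noteq> 0" for y :: 'f and k by simp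
  have root: "\<alpha> i (te (\<lambda>k. y powi v k)) = 1" if "i \<in> {1..n}" "y \<noteq> 0" for i y
    using v[OF that(2)] character_one[OF simple_char[OF that(1)]] by simp
  have mem: "1 \<in> {1..n}" "n - 2 \<in> {1..n}" "n - 1 \<in> {1..n}" "n \<in> {1..n}" using n6 by auto
  have y2: "y powi v 2 = 1" if y: "y \<noteq> 0" for y :: 'f
    using root[OF mem(1) y] root_of_te[OF mem(1), of "\<lambda>k. y powi v k"] nz[OF y] by simp
  have low: "v k = 0" if k: "2 \<le> k" "k \<le> n - 2" for k
  proof (rule power_int_all_one[where 'f = 'f])
    fix y :: 'f assume y: "y \<noteq> 0"
    show "y powi v k = 1"
      by (rule chain_upward[where m = "n - 3"]) (use root y y2 nz k n6 in auto)
  qed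
  have "v n * 2 = 0"
  proof (rule power_int_all_one[where 'f = 'f])
    fix y :: 'f assume y: "y \<noteq> 0"
    have f: "(n = 1) = False" "(n = 2) = False" "(n \<le> n - 3) = False" "(n = n - 2) = False" "(n = n - 1) = False"
      using n6 by auto
    have "(y powi v n)\<^sup>2 / y powi v (n - 2) = 1"
      using root[OF mem(4) y] unfolding root_of_te[where x = "\<lambda>k. y powi v k", OF mem(4) nz[OF y]] f if_False .
    moreover have "v (n - 2) = 0" by (rule low) (use n6 in auto)
    ultimately show "y powi (v n * 2) = 1" by (simp add: power_int_mult)
  qed
  then have vn: "v n = 0" by simp
  have f: "(n - 2 = 1) = False" "(n - 2 = 2) = False" "(n - 2 \<le> n - 3) = False" "(n - 2 = n - 2) = True"
    using n6 by auto
  have vn1: "v (n - 1) = 0"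
  proof (rule power_int_all_one[where 'f = 'f])
    fix y :: 'f assume y: "y \<noteq> 0"
    have "(y powi v (n - 2))\<^sup>2 / (y powi v (n - 3) * y powi v (n - 1) * y powi v n) = 1"
      using root[OF mem(2) y] unfolding root_of_te[where x = "\<lambda>k. y powi v k", OF mem(2) nz[OF y]] f if_False if_True .
    moreover have "v (n - 2) = 0" "v (n - 3) = 0" by (rule low; use n6 in simp)+
    ultimately show "y powi v (n - 1) = 1" using vn by simp
  qed
  have v1: "v 1 = 0"
  proof (rule power_int_all_one[where 'f = 'f])
    fix y :: 'f assume y: "y \<noteq> 0"
    have g: "(n - 1 = 1) = False" "(n - 1 = 2) = False" "(n - 1 \<le> n - 3) = False" "(n - 1 = n - 2) = False" "(n - 1 = n - 1) = True"
      using n6 by auto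
    have "y powi v 1 * (y powi v (n - 1))\<^sup>2 / y powi v (n - 2) = 1"
      using root[OF mem(3) y] unfolding root_of_te[where x = "\<lambda>k. y powi v k", OF mem(3) nz[OF y]] g if_False if_True .
    moreover have "v (n - 2) = 0" by (rule low) (use n6 in auto)
    ultimately show "y powi v 1 = 1" using vn1 by simp
  qed
  consider "k = 1" | "2 \<le> k" "k \<le> n - 2" | "k = n - 1" | "k = n" using k by force
  then show ?thesis using v1 low vn1 vn by cases auto
qed

text \<open>Let \<open>\<phi>\<close> be an isomorphism from a power of the multiplicative group to \<open>T\<close> with inverse
  \<open>\<psi>\<close>. Its restriction to the \<open>j\<close>-th factor is a cocharacter, hence an integral combination of
  the \<open>\<lambda>\<^sub>k\<close>, with exponents \<open>V\<^sub>j\<^sub>k\<close>, say. Then \<open>\<kappa>\<^sub>k = \<Prod>j. \<psi>\<^sub>j ^ V\<^sub>j\<^sub>k\<close> are coordinates: they reproduce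
  \<open>t\<close> by construction, and \<open>\<kappa>\<^sub>k(\<lambda>\<^sub>l(x))\<close> is as it should be by independence of the \<open>\<lambda>\<^sub>k\<close>.\<close>

lemma coordinates_exist:
  "\<exists>\<kappa> :: nat \<Rightarrow> 'f^'m^'m \<Rightarrow> 'f.
     (\<forall>k t t'. t \<in> T \<longrightarrow> t' \<in> T \<longrightarrow> \<kappa> k (t ** t') = \<kappa> k t * \<kappa> k t') \<and>
     (\<forall>k t. t \<in> T \<longrightarrow> \<kappa> k t \<noteq> 0) \<and> (\<forall>t. t \<in> T \<longrightarrow> te (\<lambda>k. \<kappa> k t) = t) \<and>
     (\<forall>k x. k \<in> {1..n} \<longrightarrow> (\<forall>j\<in>{1..n}. x j \<noteq> 0) \<longrightarrow> \<kappa> k (te x) = x k)"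
proof -
  obtain r \<phi> \<psi> where c: "\<phi> \<in> alg_hom (Gm_power r) TG" "\<psi> \<in> alg_hom TG (Gm_power r)"
    "\<And>x. x \<in> carrier (Gm_power r) \<Longrightarrow> \<psi> (\<phi> x) = x" "\<And>t. t \<in> T \<Longrightarrow> \<phi> (\<psi> t) = t"
    by (rule torus_coordinates, rule that)
  have \<psi>_closed: "\<psi> t \<in> carrier (Gm_power r)" if "t \<in> T" for t
    using c(2) that unfolding alg_hom_def hom_def by auto
  have \<psi>_nz: "\<psi> t j \<noteq> 0" if "t \<in> T" "j < r" for t j
    using \<psi>_closed[OF that(1)] that(2) by (simp add: Gm_power_def)
  have \<psi>_mult: "\<psi> (t ** t') i = \<psi> t i * \<psi> t' i" if "t \<in> T" "t' \<in> T" for t t' i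
    using c(2) that unfolding alg_hom_def hom_def Gm_power_def by auto
  have \<phi>_mult: "\<phi> (\<lambda>i. x i * y i) = \<phi> x ** \<phi> y"
    if "x \<in> carrier (Gm_power r)" "y \<in> carrier (Gm_power r)" for x y
    using c(1) that unfolding alg_hom_def hom_def Gm_power_def by auto
  have \<phi>_closed: "\<phi> x \<in> T" if "x \<in> carrier (Gm_power r)" for x
    using c(1) that unfolding alg_hom_def hom_def by auto
  have \<phi>_one: "\<phi> (\<lambda>_. 1) = mat 1"
  proof -
    have o: "(\<lambda>_. 1) \<in> carrier (Gm_power r)" by (simp add: Gm_power_def)
    have "\<phi> (\<lambda>_. 1) ** \<phi> (\<lambda>_. 1) = \<phi> (\<lambda>_. 1)" using \<phi>_mult[OF o o] by simp
    then have "inv\<^bsub>G\<^esub> (\<phi> (\<lambda>_. 1)) ** \<phi> (\<lambda>_. 1) ** \<phi> (\<lambda>_. 1) = inv\<^bsub>G\<^esub> (\<phi> (\<lambda>_. 1)) ** \<phi> (\<lambda>_. 1)"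
      by (simp add: matrix_mul_assoc[symmetric])
    then show ?thesis using T_G[OF \<phi>_closed[OF o]] by simp
  qed
  \<comment> \<open>The embedding of the \<open>j\<close>-th factor.\<close>
  define em :: "nat \<Rightarrow> 'f \<Rightarrow> nat \<Rightarrow> 'f" where "em j x = (\<lambda>i. if i = j then x else 1)" for j x
  have em: "em j x \<in> carrier (Gm_power r)" if "j < r" "x \<noteq> 0" for j x
    using that by (auto simp: em_def Gm_power_def)
  have em_hom: "em j \<in> alg_hom Gm (Gm_power r)" if j: "j < r" for j
  proof (rule alg_homI)
    show "em j \<in> hom Gm (Gm_power r)"
    proof (rule homI)
      fix x y :: 'f
      show "em j (x \<otimes>\<^bsub>Gm\<^esub> y) = em j x \<otimes>\<^bsub>Gm_power r\<^esub> em j y" by (auto simp: em_def Gm_power_def)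
    qed (use em[OF j] in auto)
    fix g :: "(nat \<Rightarrow> 'f) \<Rightarrow> 'f" assume "g \<in> reg (Gm_power r)"
    then have g: "g \<in> fun_algebra ({\<lambda>x. x i |i. i < r} \<union> {\<lambda>x. inverse (x i) |i. i < r})"
      by (simp add: Gm_power_def)
    show "(\<lambda>x. g (em j x)) \<in> reg Gm" unfolding reg_Gm
    proof (rule fun_algebra_compose[OF _ g])
      fix b :: "(nat \<Rightarrow> 'f) \<Rightarrow> 'f" assume "b \<in> {\<lambda>x. x i |i. i < r} \<union> {\<lambda>x. inverse (x i) |i. i < r}"
      then consider i where "b = (\<lambda>x. x i)" | i where "b = (\<lambda>x. inverse (x i))" by blast
      then show "(\<lambda>x. b (em j x)) \<in> fun_algebra {\<lambda>x. x, inverse}"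
      proof cases
        case 1
        show ?thesis unfolding 1 em_def by (cases "i = j") (auto intro: fun_algebra.intros)
      next
        case 2
        have "(\<lambda>x :: 'f. inverse x) \<in> fun_algebra {\<lambda>x. x, inverse}" by (rule fun_algebra.gen) simp
        then show ?thesis unfolding 2 em_def by (cases "i = j") (auto intro: fun_algebra.const)
      qed
    qed
  qed
  have "\<exists>v :: nat \<Rightarrow> int. \<forall>x. x \<noteq> 0 \<longrightarrow> \<phi> (em j x) = te (\<lambda>k. x powi v k)" if j: "j < r" for j
    using cochar_te[OF cocharI[OF alg_hom_compose[OF em_hom[OF j] c(1)]]] by simp
  then have "\<forall>j\<in>{..<r}. \<exists>v :: nat \<Rightarrow> int. \<forall>x. x \<noteq> 0 \<longrightarrow> \<phi> (em j x) = te (\<lambda>k. x powi v k)" by blast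
  from bchoice[OF this] obtain V :: "nat \<Rightarrow> nat \<Rightarrow> int" where
    V: "\<forall>j\<in>{..<r}. \<forall>x. x \<noteq> 0 \<longrightarrow> \<phi> (em j x) = te (\<lambda>k. x powi V j k)" ..
  define \<kappa> where "\<kappa> k t = (\<Prod>j<r. \<psi> t j powi V j k)" for k t
  have \<kappa>_nz: "\<kappa> k t \<noteq> 0" if "t \<in> T" for k t
    using \<psi>_nz[OF that] by (simp add: \<kappa>_def)
  have \<kappa>_mult: "\<kappa> k (t ** t') = \<kappa> k t * \<kappa> k t'" if "t \<in> T" "t' \<in> T" for k t t'
    by (simp add: \<kappa>_def \<psi>_mult[OF that] power_int_mult_distrib prod.distrib)
  have \<kappa>_one: "\<kappa> k (mat 1) = 1" for k
    using \<kappa>_mult[of "mat 1" "mat 1" k] \<kappa>_nz[of "mat 1" k] by simp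
  have te_\<kappa>: "te (\<lambda>k. \<kappa> k t) = t" if t: "t \<in> T" for t
  proof -
    let ?y = "\<psi> t"
    have part: "m \<le> r \<Longrightarrow> \<phi> (\<lambda>i. if i < m then ?y i else 1) = te (\<lambda>k. \<Prod>j<m. ?y j powi V j k)" for m
    proof (induction m)
      case 0
      show ?case by (simp add: \<phi>_one te_one)
    next
      case (Suc m)
      have mr: "m < r" using Suc.prems by simp
      have "(\<lambda>i. if i < Suc m then ?y i else 1) = (\<lambda>i. (if i < m then ?y i else 1) * em m (?y m) i)"
        by (auto simp: em_def)
      moreover have "(\<lambda>i. if i < m then ?y i else 1) \<in> carrier (Gm_power r)"
        using \<psi>_closed[OF t] mr by (auto simp: Gm_power_def)
      ultimately have "\<phi> (\<lambda>i. if i < Suc m then ?y i else 1) =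
          \<phi> (\<lambda>i. if i < m then ?y i else 1) ** \<phi> (em m (?y m))"
        using \<phi>_mult em[OF mr \<psi>_nz[OF t mr]] by simp
      also have "\<dots> = te (\<lambda>k. \<Prod>j<m. ?y j powi V j k) ** te (\<lambda>k. ?y m powi V m k)"
        using Suc.IH mr V \<psi>_nz[OF t mr] by simp
      also have "\<dots> = te (\<lambda>k. (\<Prod>j<m. ?y j powi V j k) * ?y m powi V m k)"
        by (rule te_mult) (use \<psi>_nz[OF t] mr in auto)
      finally show ?case by (simp add: mult.commute)
    qed
    have "(\<lambda>i. if i < r then ?y i else 1) = ?y" using \<psi>_closed[OF t] by (auto simp: Gm_power_def)
    then show ?thesis using part[of r] c(4)[OF t] by (simp add: \<kappa>_def)
  qed
  have proj: "(\<lambda>y :: nat \<Rightarrow> 'f. y j) \<in> alg_hom (Gm_power r) Gm" if j: "j < r" for j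
  proof (rule alg_homI)
    show "(\<lambda>y :: nat \<Rightarrow> 'f. y j) \<in> hom (Gm_power r) Gm" using j by (auto simp: hom_def Gm_power_def Gm_def)
    fix g :: "'f \<Rightarrow> 'f" assume "g \<in> reg Gm"
    then have g: "g \<in> fun_algebra {\<lambda>x. x, inverse}" by (simp add: reg_Gm)
    have "(\<lambda>y. g (y j)) \<in> fun_algebra ({\<lambda>x. x i |i. i < r} \<union> {\<lambda>x. inverse (x i) |i. i < r})"
      by (rule fun_algebra_compose[OF _ g]) (use j in \<open>auto intro!: fun_algebra.gen\<close>)
    then show "(\<lambda>y. g (y j)) \<in> reg (Gm_power r)" by (simp add: Gm_power_def)
  qed
  have \<kappa>_lam: "\<kappa> k (lam k' x) = (if k = k' then x else 1)"
    if k: "k \<in> {1..n}" and k': "k' \<in> {1..n}" and x: "x \<noteq> 0" for k k' x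
  proof -
    have "\<exists>a :: int. \<forall>x. x \<noteq> 0 \<longrightarrow> \<psi> (lam k' x) j = x powi a" if "j < r" for j
      by (rule alg_hom_Gm_power[OF alg_hom_compose[OF alg_hom_compose[OF cochar_alg_hom[OF lam_cochar[OF k']] c(2)] proj[OF that]]])
    then have "\<forall>j\<in>{..<r}. \<exists>a :: int. \<forall>x. x \<noteq> 0 \<longrightarrow> \<psi> (lam k' x) j = x powi a" by blast
    from bchoice[OF this] obtain L :: "nat \<Rightarrow> int" where
      L: "\<forall>j\<in>{..<r}. \<forall>x. x \<noteq> 0 \<longrightarrow> \<psi> (lam k' x) j = x powi L j" ..
    \<comment> \<open>The exponents in \<open>\<kappa>\<^sub>k(\<lambda>\<^sub>k'(x)) = x ^ M\<^sub>k\<close>; expanding \<open>\<lambda>\<^sub>k'(x)\<close> in its own coordinates shows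
      that they form a unit vector.\<close>
    define M where "M k = (\<Sum>j<r. L j * V j k)" for k
    have M: "\<kappa> k (lam k' x) = x powi M k" if "x \<noteq> 0" for x k
    proof -
      have "\<kappa> k (lam k' x) = (\<Prod>j<r. x powi (L j * V j k))"
        unfolding \<kappa>_def by (intro prod.cong refl) (use L that in \<open>simp add: power_int_mult\<close>)
      then show ?thesis using power_int_sum[of "{..<r}" x "\<lambda>j. L j * V j k"] that by (simp add: M_def)
    qed
    have "M k - (if k = k' then 1 else 0) = 0"
    proof (rule lam_independent[OF _ k, where v = "\<lambda>k. M k - (if k = k' then 1 else 0)"])
      fix y :: 'f assume y: "y \<noteq> 0"
      have lT: "lam k' y \<in> T" by (rule cocharD(1)[OF lam_cochar[OF k'] y])
      have 1: "te (\<lambda>k. y powi M k) = lam k' y"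
        using te_\<kappa>[OF lT] M[OF y] by simp
      have 2: "te (\<lambda>k. y powi (if k = k' then 1 else 0)) = lam k' y"
        unfolding te_single[OF k', symmetric] by (rule te_cong) simp
      have "te (\<lambda>k. y powi M k) = te (\<lambda>k. y powi (M k - (if k = k' then 1 else 0)) * y powi (if k = k' then 1 else 0))"
        by (rule te_cong) (use y in \<open>simp add: power_int_diff\<close>)
      also have "\<dots> = te (\<lambda>k. y powi (M k - (if k = k' then 1 else 0))) ** te (\<lambda>k. y powi (if k = k' then 1 else 0))"
        by (rule te_mult[symmetric]) (use y in auto)
      finally have "lam k' y = te (\<lambda>k. y powi (M k - (if k = k' then 1 else 0))) ** lam k' y" unfolding 1 2 .
      then have "lam k' y ** inv\<^bsub>G\<^esub> (lam k' y) =
          te (\<lambda>k. y powi (M k - (if k = k' then 1 else 0))) ** (lam k' y ** inv\<^bsub>G\<^esub> (lam k' y))"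
        by (simp add: matrix_mul_assoc)
      then show "te (\<lambda>k. y powi (M k - (if k = k' then 1 else 0))) = mat 1" using T_G[OF lT] by simp
    qed
    then have "M k = (if k = k' then 1 else 0)" by simp
    then show ?thesis using M[OF x, of k] by simp
  qed
  have \<kappa>_te: "\<kappa> k (te x) = x k" if k: "k \<in> {1..n}" and x: "\<forall>j\<in>{1..n}. x j \<noteq> 0" for k x
  proof -
    have "\<kappa> k (te x) = (\<Prod>k'\<in>{1..n}. \<kappa> k (lam k' (x k')))"
      by (rule te_character) (use \<kappa>_mult \<kappa>_one x in auto)
    also have "\<dots> = (\<Prod>k'\<in>{1..n}. if k = k' then x k' else 1)"
      by (intro prod.cong refl \<kappa>_lam k) (use x in auto)
    also have "\<dots> = x k" using k by simp
    finally show ?thesis .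
  qed
  show ?thesis
    by (intro exI[of _ \<kappa>] conjI allI impI \<kappa>_mult \<kappa>_nz te_\<kappa> \<kappa>_te)
qed

definition coord :: "nat \<Rightarrow> 'f^'m^'m \<Rightarrow> 'f" where
  "coord = (SOME \<kappa>. (\<forall>k t t'. t \<in> T \<longrightarrow> t' \<in> T \<longrightarrow> \<kappa> k (t ** t') = \<kappa> k t * \<kappa> k t') \<and>
     (\<forall>k t. t \<in> T \<longrightarrow> \<kappa> k t \<noteq> 0) \<and> (\<forall>t. t \<in> T \<longrightarrow> te (\<lambda>k. \<kappa> k t) = t) \<and>
     (\<forall>k x. k \<in> {1..n} \<longrightarrow> (\<forall>j\<in>{1..n}. x j \<noteq> 0) \<longrightarrow> \<kappa> k (te x) = x k))"

lemma coord:
  shows coord_mult: "t \<in> T \<Longrightarrow> t' \<in> T \<Longrightarrow> coord k (t ** t') = coord k t * coord k t'"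
    and coord_nz: "t \<in> T \<Longrightarrow> coord k t \<noteq> 0"
    and te_coord: "t \<in> T \<Longrightarrow> te (\<lambda>k. coord k t) = t"
    and coord_te: "k \<in> {1..n} \<Longrightarrow> (\<And>j. j \<in> {1..n} \<Longrightarrow> x j \<noteq> 0) \<Longrightarrow> coord k (te x) = x k"
  using someI_ex[OF coordinates_exist, folded coord_def] by blast+

lemma coord_one: "coord k (mat 1) = 1"
  using coord_mult[of "mat 1" "mat 1" k] coord_nz[of "mat 1" k] by simp

lemma coord_inv: "t \<in> T \<Longrightarrow> coord k (inv\<^bsub>G\<^esub> t) = inverse (coord k t)"
  using coord_mult[of t "inv\<^bsub>G\<^esub> t" k] coord_one[of k] T_G[of t] by (simp add: inverse_unique)

lemma coord_eqI:
  assumes "t \<in> T" "t' \<in> T" "\<And>k. k \<in> {1..n} \<Longrightarrow> coord k t = coord k t'"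
  shows "t = t'"
  using te_cong[of "\<lambda>k. coord k t" "\<lambda>k. coord k t'"] te_coord assms by metis

lemma coord_coroot:
  assumes "i \<in> {2..n}" "k \<in> {1..n}" "y \<noteq> 0"
  shows "coord k (cr (\<alpha> i) y) = (if k = i then y else 1)"
proof -
  have "cr (\<alpha> i) y = te (\<lambda>j. if j = i then y else 1)"
    using te_single[of i y] assms(1) by (simp add: lam_def)
  then show ?thesis using coord_te[OF assms(2), of "\<lambda>j. if j = i then y else 1"] assms(3) by simp
qed

lemma coord_first_coroot:
  assumes "k \<in> {1..n}" "y \<noteq> 0"
  shows "coord k (cr (\<alpha> 1) y) = y powi (if k = 1 then 2 else if k \<le> n - 2 then - int k
    else if k = n - 1 then - int (n div 2) else - int ((n - 2) div 2))"
  unfolding first_coroot[OF assms(2)] by (rule coord_te[OF assms(1)]) (use assms(2) in simp)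

text \<open>The equations are solved from the free end of the chain; \<open>\<alpha>\<^sub>n\<close> then asks for a square root
  \<open>w\<close>, \<open>\<alpha>\<^sub>n\<^sub>-\<^sub>2\<close> determines the coordinate \<open>p\<close> at \<open>n - 1\<close>, and \<open>\<alpha>\<^sub>n\<^sub>-\<^sub>1\<close> is adjusted by the first
  coordinate.\<close>

lemma simple_roots_surjective:
  assumes e: "\<And>i. i \<in> {1..n} \<Longrightarrow> e i \<noteq> 0"
  shows "\<exists>t\<in>T. \<forall>i\<in>{1..n}. \<alpha> i t = e i"
proof -
  let ?g = "chain_solution e"
  have g_nz: "k \<le> n - 2 \<Longrightarrow> ?g k \<noteq> 0" for k
  proof (induction k rule: less_induct)
    case (less k)
    show ?case
    proof (cases "k \<le> 1")
      case True
      then have "k = 0 \<or> k = 1" by auto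
      then show ?thesis by auto
    next
      case False
      then obtain j where j: "k = Suc (Suc j)" by (intro that[of "k - 2"]) simp
      then have "?g (Suc j) \<noteq> 0" "?g j \<noteq> 0" "e (Suc j) \<noteq> 0" using less e by auto
      then show ?thesis using j by simp
    qed
  qed
  obtain w where w: "w\<^sup>2 = e n * ?g (n - 2)" using square_root_exists by blast
  have wnz: "w \<noteq> 0" using w e[of n] g_nz[of "n - 2"] n6 by auto
  have g2: "?g (n - 2) \<noteq> 0" "?g (n - 3) \<noteq> 0" by (rule g_nz; simp)+
  have e2: "e (n - 2) \<noteq> 0" "e (n - 1) \<noteq> 0" by (rule e; use n6 in auto)+
  define p where "p = (?g (n - 2))\<^sup>2 / (?g (n - 3) * w * e (n - 2))"
  have pnz: "p \<noteq> 0" using g2 wnz e2 by (simp add: p_def)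
  define x where "x k = (if k = 1 then e (n - 1) * ?g (n - 2) / p\<^sup>2 else if k \<le> n - 2 then ?g k
    else if k = n - 1 then p else w)" for k
  have xnz: "x k \<noteq> 0" if "k \<in> {1..n}" for k
    using g_nz[of k] g2 e2 pnz wnz by (auto simp: x_def)
  have x: "x 1 = e (n - 1) * ?g (n - 2) / p\<^sup>2" "x (n - 1) = p" "x n = w" "2 \<le> k \<Longrightarrow> k \<le> n - 2 \<Longrightarrow> x k = ?g k" for k
    using n6 by (auto simp: x_def)
  have "\<alpha> i (te x) = e i" if i: "i \<in> {1..n}" for i
  proof -
    have ei: "e i \<noteq> 0" by (rule e[OF i])
    have te_root: "\<alpha> i (te x) =
      (if i = 1 then inverse (x 2)
       else if i = 2 then (x 2)\<^sup>2 / x 3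
       else if i \<le> n - 3 then (x i)\<^sup>2 / (x (i - 1) * x (i + 1))
       else if i = n - 2 then (x i)\<^sup>2 / (x (n - 3) * x (n - 1) * x n)
       else if i = n - 1 then x 1 * (x i)\<^sup>2 / x (n - 2)
       else (x n)\<^sup>2 / x (n - 2))"
      by (rule root_of_te[OF i]) (rule xnz)
    consider "i = 1" | "i = 2" | "3 \<le> i" "i \<le> n - 3" | "i = n - 2" | "i = n - 1" | "i = n"
      using i by force
    then show ?thesis
    proof cases
      case 1
      have "x 2 = inverse (e 1)" using n6 by (simp add: x(4) eval_nat_numeral inverse_eq_divide)
      moreover have "\<alpha> i (te x) = inverse (x 2)" by (subst te_root) (use 1 in auto)
      ultimately show ?thesis using 1 by simp
    next
      case 2
      have g23: "?g 2 \<noteq> 0" by (rule g_nz) (use n6 in simp)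
      have "?g 3 = (?g 2)\<^sup>2 / (?g 1 * e 2)" by (simp add: eval_nat_numeral)
      then have "x 3 = (x 2)\<^sup>2 / e 2" using n6 by (simp add: x(4))
      moreover have "\<alpha> i (te x) = (x 2)\<^sup>2 / x 3" by (subst te_root) (use 2 in auto)
      moreover have "x 2 \<noteq> 0" using g23 n6 by (simp add: x(4))
      ultimately show ?thesis using 2 ei by simp
    next
      case 3
      then obtain j where j: "i = Suc j" by (cases i) auto
      have "?g (Suc (Suc j)) = (?g (Suc j))\<^sup>2 / (?g j * e (Suc j))" by simp
      moreover have "x j = ?g j" "x (Suc j) = ?g (Suc j)" "x (Suc (Suc j)) = ?g (Suc (Suc j))"
        by (rule x(4); use 3 j in simp)+
      moreover have "?g j \<noteq> 0" "?g (Suc j) \<noteq> 0" by (rule g_nz; use 3 j in simp)+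
      ultimately show ?thesis unfolding te_root using 3 j ei by simp
    next
      case 4
      have f: "(i = 1) = False" "(i = 2) = False" "(i \<le> n - 3) = False" "(i = n - 2) = True"
        using 4 n6 by auto
      have "x (n - 2) = ?g (n - 2)" "x (n - 3) = ?g (n - 3)" by (rule x(4); use n6 in simp)+
      then show ?thesis unfolding te_root f if_False if_True
        using g2 wnz e2 unfolding 4 x(2,3) p_def by simp
    next
      case 5
      have f: "(i = 1) = False" "(i = 2) = False" "(i \<le> n - 3) = False" "(i = n - 2) = False" "(i = n - 1) = True"
        using 5 n6 by auto
      have "x (n - 2) = ?g (n - 2)" by (rule x(4); use n6 in simp)
      then show ?thesis unfolding te_root f if_False if_True
        using g2 pnz unfolding 5 x(1,2) by simp
    next
      case 6
      have f: "(i = 1) = False" "(i = 2) = False" "(i \<le> n - 3) = False" "(i = n - 2) = False" "(i = n - 1) = False"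
        using 6 n6 by auto
      have "x (n - 2) = ?g (n - 2)" by (rule x(4); use n6 in simp)
      then show ?thesis unfolding te_root f if_False
        using g2 unfolding 6 x(3) w by simp
    qed
  qed
  then show ?thesis using te_T[of x] xnz by blast
qed

end

section \<open>The action of the simple reflections\<close>

lemma adj_sym: "adj n i j \<Longrightarrow> adj n j i" and adj_neq: "adj n i j \<Longrightarrow> i \<noteq> j"
  by (auto simp: adj_def)

context half_spin_group
begin

abbreviation "II \<equiv> {1..n}"
abbreviation "co i \<equiv> cr (\<alpha> i)"
abbreviation "sig i \<equiv> sg (\<alpha> i)"
abbreviation "sr i \<equiv> rf (\<alpha> i)"

lemma sig_N: "i \<in> II \<Longrightarrow> sig i \<in> NT" by (rule realizationD(4)[OF simple_root])
lemma sig_G: "i \<in> II \<Longrightarrow> sig i \<in> carrier G" by (rule normalizerD(1)[OF sig_N])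
lemma sr_eq: "i \<in> II \<Longrightarrow> sr i = T #>\<^bsub>G\<^esub> sig i" using realizationD(5)[OF simple_root] by simp
lemma co_T: "i \<in> II \<Longrightarrow> y \<noteq> 0 \<Longrightarrow> co i y \<in> T" by (rule cocharD(1)[OF simple_coroot])
lemma co_mult: "i \<in> II \<Longrightarrow> x \<noteq> 0 \<Longrightarrow> y \<noteq> 0 \<Longrightarrow> co i (x * y) = co i x ** co i y"
  by (rule cocharD(2)[OF simple_coroot])
lemma co_one: "i \<in> II \<Longrightarrow> co i 1 = mat 1" by (rule cocharD(3)[OF simple_coroot])
lemma co_inv: "i \<in> II \<Longrightarrow> y \<noteq> 0 \<Longrightarrow> inv\<^bsub>G\<^esub> (co i y) = co i (inverse y)"
  by (rule cocharD(4)[OF simple_coroot])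
lemma root_nz: "i \<in> II \<Longrightarrow> t \<in> T \<Longrightarrow> \<alpha> i t \<noteq> 0" by (rule characterD(2)[OF simple_char])
lemma root_mult: "i \<in> II \<Longrightarrow> t \<in> T \<Longrightarrow> t' \<in> T \<Longrightarrow> \<alpha> i (t ** t') = \<alpha> i t * \<alpha> i t'"
  by (rule characterD(1)[OF simple_char])
lemma root_inv: "i \<in> II \<Longrightarrow> t \<in> T \<Longrightarrow> \<alpha> i (inv\<^bsub>G\<^esub> t) = inverse (\<alpha> i t)"
  by (rule character_inv[OF simple_char])

lemma cancel_right: "g \<in> carrier G \<Longrightarrow> x ** g = y ** g \<Longrightarrow> x = y"
proof -
  assume g: "g \<in> carrier G" and "x ** g = y ** g"
  then have "x ** g ** inv\<^bsub>G\<^esub> g = y ** g ** inv\<^bsub>G\<^esub> g" by simp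
  then show "x = y" using g by (simp add: matrix_mul_assoc[symmetric])
qed

text \<open>The action of the reflection \<open>s\<^sub>i\<close> on \<open>T\<close>, which is conjugation by any of its
  representatives.\<close>

definition act :: "nat \<Rightarrow> 'f^'m^'m \<Rightarrow> 'f^'m^'m" where
  "act i t = t ** inv\<^bsub>G\<^esub> (co i (\<alpha> i t))"

lemma act_T: "i \<in> II \<Longrightarrow> t \<in> T \<Longrightarrow> act i t \<in> T"
  unfolding act_def by (intro T_mult T_inv co_T root_nz)

lemma sig_act: "i \<in> II \<Longrightarrow> t \<in> T \<Longrightarrow> sig i ** t ** inv\<^bsub>G\<^esub> (sig i) = act i t"
  unfolding act_def by (rule sg_act[OF simple_root])

lemma sig_swap: "i \<in> II \<Longrightarrow> t \<in> T \<Longrightarrow> sig i ** t = act i t ** sig i"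
proof -
  assume i: "i \<in> II" and t: "t \<in> T"
  have "act i t ** sig i = sig i ** t ** (inv\<^bsub>G\<^esub> (sig i) ** sig i)"
    unfolding sig_act[OF i t, symmetric] by (simp only: matrix_mul_assoc)
  then show ?thesis using sig_G[OF i] by simp
qed

lemma root_of_act:
  assumes "i \<in> II" "j \<in> II" "t \<in> T"
  shows "\<alpha> j (act i t) = (if i = j then inverse (\<alpha> i t) else if adj n i j then \<alpha> j t * \<alpha> i t else \<alpha> j t)"
proof -
  have "\<alpha> j (act i t) = \<alpha> j t * inverse (\<alpha> j (co i (\<alpha> i t)))"
    unfolding act_def using assms by (simp add: root_mult root_inv co_T root_nz)
  then show ?thesis using root_of_coroot[OF assms(2,1) root_nz[OF assms(1,3)]] root_nz[OF assms(1,3)] adj_sym[of n i j] adj_sym[of n j i]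
    by (auto simp: power2_eq_square)
qed

lemma act_coroot:
  assumes "i \<in> II" "j \<in> II" "y \<noteq> 0"
  shows "act i (co j y) = (if i = j then co i (inverse y) else if adj n i j then co j y ** co i y else co j y)"
proof -
  have "act i (co j y) = co j y ** co i (inverse (\<alpha> i (co j y)))"
    unfolding act_def using assms by (simp add: co_inv co_T root_nz)
  moreover have "co i y ** co i (inverse (y\<^sup>2)) = co i (inverse y)"
  proof -
    have "y * inverse (y\<^sup>2) = inverse y" using assms(3) by (simp add: power2_eq_square)
    moreover have "co i y ** co i (inverse (y\<^sup>2)) = co i (y * inverse (y\<^sup>2))"
      by (rule co_mult[OF assms(1,3), symmetric]) (use assms(3) in simp)
    ultimately show ?thesis by simp
  qed
  ultimately show ?thesis using root_of_coroot[OF assms] assms by (auto simp: co_one)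
qed

section \<open>Braid relations in the Weyl group\<close>

text \<open>The form in which \<open>conj_tits_lift\<close> is used: if the Weyl group element of \<open>g\<close> takes \<open>\<alpha>\<^sub>i\<close> to
  \<open>\<alpha>\<^sub>j\<close> and \<open>\<alpha>\<^sub>i\<^sup>\<or>\<close> to \<open>\<alpha>\<^sub>j\<^sup>\<or>\<close>, then \<open>g s\<^sub>i = s\<^sub>j g\<close> in the Weyl group. Here \<open>w\<close> is the action of \<open>g\<close>
  on \<open>T\<close>.\<close>

lemma conj_sig:
  assumes i: "i \<in> II" and j: "j \<in> II" and g: "g \<in> NT" and w: "\<And>t. t \<in> T \<Longrightarrow> w t \<in> T"
    and g_w: "\<And>t. t \<in> T \<Longrightarrow> g ** t = w t ** g"
    and match: "\<And>t. t \<in> T \<Longrightarrow> \<alpha> j (w t) = \<alpha> i t" and comatch: "\<And>y. y \<noteq> 0 \<Longrightarrow> w (co i y) = co j y"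
  shows "\<exists>t\<in>T. g ** sig i = t ** (sig j ** g)"
proof -
  have gG: "g \<in> carrier G" by (rule normalizerD(1)[OF g])
  have "\<exists>t\<in>T. g ** sig i ** inv\<^bsub>G\<^esub> g = t ** sig j"
  proof (rule conj_tits_lift[OF simple_root[OF i] simple_root[OF j] g])
    fix t assume t: "t \<in> T"
    let ?t' = "inv\<^bsub>G\<^esub> g ** t ** g"
    have t': "?t' \<in> T" by (rule normalizerD(3)[OF g t])
    have "g ** ?t' = (g ** inv\<^bsub>G\<^esub> g) ** t ** g" by (simp only: matrix_mul_assoc)
    then have "w ?t' ** g = t ** g" using g_w[OF t'] gG by simp
    then have "w ?t' = t" by (rule cancel_right[OF gG])
    then show "\<alpha> i ?t' = \<alpha> j t" using match[OF t'] by simp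
  next
    fix y :: 'f assume y: "y \<noteq> 0"
    have "g ** co i y = co j y ** g" using g_w[OF co_T[OF i y]] comatch[OF y] by simp
    then have "g ** co i y ** inv\<^bsub>G\<^esub> g = co j y ** (g ** inv\<^bsub>G\<^esub> g)" by (simp only: matrix_mul_assoc)
    then show "g ** co i y ** inv\<^bsub>G\<^esub> g = co j y" using gG by simp
  qed
  then obtain t where t: "t \<in> T" "g ** sig i ** inv\<^bsub>G\<^esub> g = t ** sig j" by blast
  have "g ** sig i ** (inv\<^bsub>G\<^esub> g ** g) = t ** (sig j ** g)" using t(2) by (simp add: matrix_mul_assoc)
  then show ?thesis using t(1) gG by auto
qed

text \<open>The reflection \<open>s\<^sub>i\<close> fixes \<open>\<alpha>\<^sub>j\<close>.\<close>

lemma weyl_commute: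
  assumes i: "i \<in> II" and j: "j \<in> II" and ij: "i \<noteq> j" "\<not> adj n i j"
  shows "\<exists>t\<in>T. sig i ** sig j = t ** (sig j ** sig i)"
proof (rule conj_sig[OF j j sig_N[OF i] act_T[OF i] sig_swap[OF i]])
  show "\<alpha> j (act i t) = \<alpha> j t" if "t \<in> T" for t using root_of_act[OF i j that] ij by simp
  show "act i (co j y) = co j y" if "y \<noteq> 0" for y using act_coroot[OF i j that] ij by simp
qed

text \<open>The product \<open>s\<^sub>i s\<^sub>j\<close> takes \<open>\<alpha>\<^sub>i\<close> to \<open>\<alpha>\<^sub>j\<close>.\<close>

lemma weyl_braid:
  assumes i: "i \<in> II" and j: "j \<in> II" and ij: "adj n i j"
  shows "\<exists>t\<in>T. sig i ** sig j ** sig i = t ** (sig j ** (sig i ** sig j))"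
proof (rule conj_sig[OF i j])
  show "sig i ** sig j \<in> NT" by (intro NT_mult sig_N i j)
  have ne: "i \<noteq> j" by (rule adj_neq[OF ij])
  have ji: "adj n j i" by (rule adj_sym[OF ij])
  show "act i (act j t) \<in> T" if "t \<in> T" for t by (intro act_T i j that)
  show "sig i ** sig j ** t = act i (act j t) ** (sig i ** sig j)" if t: "t \<in> T" for t
  proof -
    have "sig i ** sig j ** t = sig i ** (sig j ** t)" by (simp only: matrix_mul_assoc)
    also have "\<dots> = (sig i ** act j t) ** sig j" by (simp only: sig_swap[OF j t] matrix_mul_assoc)
    finally show ?thesis by (simp only: sig_swap[OF i act_T[OF j t]] matrix_mul_assoc)
  qed
  show "\<alpha> j (act i (act j t)) = \<alpha> i t" if t: "t \<in> T" for t
    using root_of_act[OF i j act_T[OF j t]] root_of_act[OF j i t] root_of_act[OF j j t] ne ij ji root_nz[OF j t] by simp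
  show "act i (act j (co i y)) = co j y" if y: "y \<noteq> 0" for y
  proof -
    have "act j (co i y) = co i y ** co j y" using act_coroot[OF j i y] ne ji by simp
    moreover have "\<alpha> i (co i y ** co j y) = y"
      using root_of_coroot[OF i i y] root_of_coroot[OF i j y] ne ij y
      by (simp add: root_mult[OF i co_T[OF i y] co_T[OF j y]] power2_eq_square)
    ultimately have "act i (act j (co i y)) = co i y ** co j y ** inv\<^bsub>G\<^esub> (co i y)" by (simp add: act_def)
    also have "\<dots> = co j y ** (co i y ** inv\<^bsub>G\<^esub> (co i y))"
      using T_comm[OF co_T[OF i y] co_T[OF j y]] by (simp add: matrix_mul_assoc)
    finally show ?thesis using T_G[OF co_T[OF i y]] by simp
  qed
qed

section \<open>Reduced words\<close>

lemma word_prod_simps: "word_prod M g [] = \<one>\<^bsub>M\<^esub>" "word_prod M g (i # ws) = g i \<otimes>\<^bsub>M\<^esub> word_prod M g ws"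
  by (simp_all add: word_prod_def)

lemma word_N: "set ws \<subseteq> II \<Longrightarrow> word_prod G sig ws \<in> NT"
  by (induction ws) (auto simp: word_prod_simps T_NT NT_mult sig_N)

lemma word_weyl: "set ws \<subseteq> II \<Longrightarrow> word_prod WT sr ws = T #>\<^bsub>G\<^esub> word_prod G sig ws"
proof (induction ws)
  case Nil
  show ?case by (simp add: word_prod_simps one_WT)
next
  case (Cons i ws)
  then have "word_prod WT sr (i # ws) = (T #>\<^bsub>G\<^esub> sig i) \<otimes>\<^bsub>WT\<^esub> (T #>\<^bsub>G\<^esub> word_prod G sig ws)"
    by (simp add: word_prod_simps sr_eq)
  also have "\<dots> = T #>\<^bsub>G\<^esub> (sig i ** word_prod G sig ws)"
    by (rule mult_WT) (use Cons.prems sig_N word_N in auto)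
  finally show ?case by (simp add: word_prod_simps)
qed

text \<open>Elements of \<open>N\<close> in the same coset of \<open>T\<close> act alike on the commutative group \<open>T\<close>. Fixed
  elements will serve to tell elements of the Weyl group apart.\<close>

lemma weyl_eq_fix:
  assumes vs: "set vs \<subseteq> II" and ws: "set ws \<subseteq> II" and eq: "word_prod WT sr vs = word_prod WT sr ws"
    and t: "t \<in> T" and fx: "word_prod G sig vs ** t = t ** word_prod G sig vs"
  shows "word_prod G sig ws ** t = t ** word_prod G sig ws"
proof -
  let ?v = "word_prod G sig vs" and ?w = "word_prod G sig ws"
  have G: "?v \<in> carrier G" "?w \<in> carrier G" using word_N[OF vs] word_N[OF ws] normalizerD(1) by auto
  have "\<exists>\<tau>\<in>T. ?w = \<tau> ** ?v"
    using eq coset_eq_iff[OF G(2,1)] by (simp add: word_weyl[OF vs] word_weyl[OF ws])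
  then obtain \<tau> where \<tau>: "\<tau> \<in> T" "?w = \<tau> ** ?v" ..
  have "?w ** t = \<tau> ** (?v ** t)" unfolding \<tau>(2) by (simp only: matrix_mul_assoc)
  also have "\<dots> = (\<tau> ** t) ** ?v" unfolding fx by (simp only: matrix_mul_assoc)
  also have "\<dots> = t ** ?w" unfolding \<tau>(2) T_comm[OF \<tau>(1) t] by (simp only: matrix_mul_assoc)
  finally show ?thesis .
qed

lemma fix1:
  assumes k: "k \<in> II" and t: "t \<in> T"
  shows "sig k ** t = t ** sig k \<longleftrightarrow> act k t = t"
  using sig_swap[OF k t] cancel_right[OF sig_G[OF k], of "act k t" t] by auto

lemma fix2:
  assumes k: "k \<in> II" and l: "l \<in> II" and t: "t \<in> T"
  shows "sig k ** sig l ** t = t ** (sig k ** sig l) \<longleftrightarrow> act k (act l t) = t"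
proof -
  have "sig k ** sig l ** t = sig k ** (sig l ** t)" by (simp only: matrix_mul_assoc)
  also have "\<dots> = (sig k ** act l t) ** sig l" by (simp only: sig_swap[OF l t] matrix_mul_assoc)
  also have "\<dots> = act k (act l t) ** (sig k ** sig l)"
    by (simp only: sig_swap[OF k act_T[OF l t]] matrix_mul_assoc)
  finally show ?thesis using cancel_right[of "sig k ** sig l" "act k (act l t)" t] sig_G k l by auto
qed

lemma fix3:
  assumes k: "k \<in> II" and l: "l \<in> II" and t: "t \<in> T"
  shows "sig k ** (sig l ** sig k) ** t = t ** (sig k ** (sig l ** sig k)) \<longleftrightarrow> act k (act l (act k t)) = t"
proof -
  have "sig k ** (sig l ** sig k) ** t = sig k ** (sig l ** (sig k ** t))" by (simp only: matrix_mul_assoc)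
  also have "\<dots> = sig k ** (sig l ** act k t) ** sig k" by (simp only: sig_swap[OF k t] matrix_mul_assoc)
  also have "\<dots> = (sig k ** act l (act k t)) ** sig l ** sig k"
    by (simp only: sig_swap[OF l act_T[OF k t]] matrix_mul_assoc)
  also have "\<dots> = act k (act l (act k t)) ** (sig k ** (sig l ** sig k))"
    by (simp only: sig_swap[OF k act_T[OF l act_T[OF k t]]] matrix_mul_assoc)
  finally show ?thesis
    using cancel_right[of "sig k ** (sig l ** sig k)" "act k (act l (act k t))" t] sig_G k l by auto
qed

lemma act_trivial: "i \<in> II \<Longrightarrow> \<alpha> i t = 1 \<Longrightarrow> act i t = t"
  unfolding act_def using co_one[of i] inv_one by simp

lemma act_act:
  assumes i: "i \<in> II" and t: "t \<in> T"
  shows "act i (act i t) = t"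
proof -
  note nz = root_nz[OF i t]
  have "act i (act i t) = t ** (inv\<^bsub>G\<^esub> (co i (\<alpha> i t)) ** inv\<^bsub>G\<^esub> (co i (inverse (\<alpha> i t))))"
    using root_of_act[OF i i t] unfolding act_def[of i "act i t"] by (simp add: act_def matrix_mul_assoc)
  also have "inv\<^bsub>G\<^esub> (co i (\<alpha> i t)) ** inv\<^bsub>G\<^esub> (co i (inverse (\<alpha> i t))) = mat 1"
    using co_mult[OF i, of "inverse (\<alpha> i t)" "\<alpha> i t"] nz by (simp add: co_inv[OF i] co_one[OF i])
  finally show ?thesis by simp
qed

lemma act_fix_root: "k \<in> II \<Longrightarrow> t \<in> T \<Longrightarrow> act k t = t \<Longrightarrow> (\<alpha> k t)\<^sup>2 = 1"
  using root_of_act[of k k t] root_nz[of k t] by (simp add: power2_eq_square field_simps)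

text \<open>The rotation \<open>s\<^sub>k s\<^sub>l\<close> has order 2 or 3 on the span of \<open>\<alpha>\<^sub>k\<close> and \<open>\<alpha>\<^sub>l\<close> and fixes no non-zero
  vector there; so these roots have values of order dividing 2 or 3 at a fixed element.\<close>

lemma act2_fix_root:
  assumes k: "k \<in> II" and l: "l \<in> II" and kl: "k \<noteq> l" and t: "t \<in> T" and fx: "act k (act l t) = t"
  shows "(\<alpha> k t) ^ 6 = 1" "(\<alpha> l t) ^ 6 = 1"
proof -
  let ?p = "\<alpha> k t" and ?q = "\<alpha> l t"
  have nz: "?p \<noteq> 0" "?q \<noteq> 0" using root_nz k l t by auto
  have lk: "adj n l k \<longleftrightarrow> adj n k l" using adj_sym by blast
  have 1: "?p = inverse (\<alpha> k (act l t))" using root_of_act[OF k k act_T[OF l t]] fx by simp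
  have 2: "?q = (if adj n k l then \<alpha> l (act l t) * \<alpha> k (act l t) else \<alpha> l (act l t))"
    using root_of_act[OF k l act_T[OF l t]] fx kl by simp
  have 3: "\<alpha> k (act l t) = (if adj n k l then ?p * ?q else ?p)" using root_of_act[OF l k t] kl lk by simp
  have 4: "\<alpha> l (act l t) = inverse ?q" using root_of_act[OF l l t] by simp
  show "?p ^ 6 = 1" "?q ^ 6 = 1"
  proof -
    have "?p ^ 6 = 1 \<and> ?q ^ 6 = 1"
    proof (cases "adj n k l")
      case True
      have "?q = \<alpha> l (act l t) * \<alpha> k (act l t)" using 2 True by simp
      also have "\<dots> = inverse ?q * (?p * ?q)" using 3 4 True by simp
      also have "\<dots> = ?p" using nz by simp
      finally have "?q = ?p" .
      moreover have "?p * (?p * ?q) = 1" using 1 3 True nz by (simp add: field_simps)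
      ultimately have "?p ^ 3 = 1" "?q = ?p" by (simp_all add: power3_eq_cube mult.assoc)
      moreover have "?p ^ 6 = (?p ^ 3)\<^sup>2" by (simp add: power_mult[symmetric])
      ultimately show ?thesis by simp
    next
      case False
      have "?p\<^sup>2 = 1" "?q\<^sup>2 = 1" using 1 2 3 4 False nz by (simp_all add: power2_eq_square field_simps)
      moreover have "x ^ 6 = 1" if "x\<^sup>2 = 1" for x :: 'f
      proof -
        have "x ^ 6 = (x\<^sup>2) ^ 3" by (simp add: power_mult[symmetric])
        also have "\<dots> = 1" unfolding that by simp
        finally show ?thesis .
      qed
      ultimately show ?thesis by blast
    qed
    then show "?p ^ 6 = 1" "?q ^ 6 = 1" by auto
  qed
qed

lemma generic_value: obtains y :: 'f where "y \<noteq> 0" "y ^ 6 \<noteq> 1" "y\<^sup>2 \<noteq> 1"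
proof -
  have "finite {y :: 'f. poly (Polynomial.monom 1 7 - Polynomial.monom 1 1) y = 0}"
  proof (rule poly_roots_finite)
    have "Polynomial.coeff (Polynomial.monom 1 7 - Polynomial.monom 1 1 :: 'f poly) 7 = 1" by simp
    then show "Polynomial.monom 1 7 - Polynomial.monom 1 1 \<noteq> (0 :: 'f poly)" by (metis coeff_0 zero_neq_one)
  qed
  from ex_new_if_finite[OF infinite_alg_closed this]
  obtain y :: 'f where "y \<notin> {y. poly (Polynomial.monom 1 7 - Polynomial.monom 1 1) y = 0}" ..
  then have y: "y ^ 7 - y \<noteq> 0" by (simp add: poly_monom)
  have y0: "y \<noteq> 0" using y by auto
  have y6: "y ^ 6 \<noteq> 1"
  proof
    assume "y ^ 6 = 1"
    then have "y ^ 6 * y = y" by simp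
    moreover have "y ^ 7 = y ^ 6 * y" by (simp add: power_add[of y 6 1, simplified])
    ultimately show False using y by simp
  qed
  have "y\<^sup>2 \<noteq> 1"
  proof
    assume "y\<^sup>2 = 1"
    then have "(y\<^sup>2) ^ 3 = 1" by simp
    then show False using y6 by (simp add: power_mult[symmetric])
  qed
  with y0 y6 show ?thesis by (rule that)
qed

lemma indicator_element:
  assumes "y \<noteq> 0"
  obtains t where "t \<in> T" "\<And>i. i \<in> II \<Longrightarrow> \<alpha> i t = (if i = m then y else 1)"
proof -
  have "\<exists>t\<in>T. \<forall>i\<in>II. \<alpha> i t = (if i = m then y else 1)"
    by (rule simple_roots_surjective) (use assms in simp)
  then show ?thesis using that by blast
qed

text \<open>An element where \<open>\<alpha>\<^sub>i\<close> or \<open>\<alpha>\<^sub>j\<close> is generic is not fixed by \<open>s\<^sub>i s\<^sub>j\<close>. The identity and a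
  single reflection \<open>s\<^sub>k\<close> fix such an element: choose the generic root different from \<open>\<alpha>\<^sub>k\<close> and
  let the other simple roots be trivial.\<close>

lemma reduced_pair:
  assumes i: "i \<in> II" and j: "j \<in> II" and ij: "i \<noteq> j"
  shows "reduced_word WT n sr [i, j]"
  unfolding reduced_word_def
proof (intro conjI allI impI)
  show "set [i, j] \<subseteq> II" using i j by simp
  fix vs assume vs: "set vs \<subseteq> II \<and> word_prod WT sr vs = word_prod WT sr [i, j]"
  obtain y :: 'f where y: "y \<noteq> 0" "y ^ 6 \<noteq> 1" "y\<^sup>2 \<noteq> 1" by (rule generic_value)
  have not_fixed: "\<not> (word_prod G sig vs ** t = t ** word_prod G sig vs)"
    if t: "t \<in> T" "m \<in> {i, j}" "\<alpha> m t = y" for t m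
  proof
    assume "word_prod G sig vs ** t = t ** word_prod G sig vs"
    then have "word_prod G sig [i, j] ** t = t ** word_prod G sig [i, j]"
      using weyl_eq_fix[of vs "[i, j]" t] vs i j t(1) by auto
    then have "act i (act j t) = t" using fix2[OF i j t(1)] by (simp add: word_prod_simps)
    then show False using act2_fix_root[OF i j ij t(1)] t(2,3) y(2) by auto
  qed
  show "length [i, j] \<le> length vs"
  proof (rule ccontr)
    assume "\<not> length [i, j] \<le> length vs"
    then consider "vs = []" | k where "vs = [k]" by (cases vs) (auto simp: Suc_le_eq)
    then show False
    proof cases
      case 1
      obtain t where t: "t \<in> T" "\<And>p. p \<in> II \<Longrightarrow> \<alpha> p t = (if p = i then y else 1)" by (rule indicator_element[OF y(1), where m = i], rule that)
      then show False using not_fixed[of t i] i 1 by (simp add: word_prod_simps)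
    next
      case 2
      then have k: "k \<in> II" using vs by simp
      obtain m where m: "m \<in> {i, j}" "m \<noteq> k" using ij by auto
      then have mI: "m \<in> II" using i j by auto
      obtain t where t: "t \<in> T" "\<And>p. p \<in> II \<Longrightarrow> \<alpha> p t = (if p = m then y else 1)" by (rule indicator_element[OF y(1), where m = m], rule that)
      have "act k t = t" by (rule act_trivial[OF k]) (use t(2)[OF k] m in simp)
      then have "sig k ** t = t ** sig k" using fix1[OF k t(1)] by simp
      then show False using not_fixed[OF t(1) m(1)] t(2)[OF mI] 2 by (simp add: word_prod_simps)
    qed
  qed
qed

text \<open>The element \<open>s\<^sub>i s\<^sub>j s\<^sub>i\<close> is the reflection in \<open>\<alpha>\<^sub>i + \<alpha>\<^sub>j\<close>. It is not trivial, and it fixes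
  every element where both roots are trivial, as well as elements \<open>t0\<close> with generic
  \<open>\<alpha>\<^sub>i(t0) = \<alpha>\<^sub>j(t0)\<^sup>-\<^sup>1\<close>. A word of length one or two in different letters acts non-trivially on
  elements with a generic value of one of its letters; so its letters would have to be \<open>i\<close> or
  \<open>j\<close> by the first kind of elements, and cannot be by the second.\<close>

lemma reduced_triple:
  assumes i: "i \<in> II" and j: "j \<in> II" and ij: "adj n i j"
  shows "reduced_word WT n sr [i, j, i]"
  unfolding reduced_word_def
proof (intro conjI allI impI)
  show "set [i, j, i] \<subseteq> II" using i j by simp
  fix vs assume vs: "set vs \<subseteq> II \<and> word_prod WT sr vs = word_prod WT sr [i, j, i]"
  have ne: "i \<noteq> j" and ji: "adj n j i" using adj_neq[OF ij] adj_sym[OF ij] by auto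
  obtain y :: 'f where y: "y \<noteq> 0" "y ^ 6 \<noteq> 1" "y\<^sup>2 \<noteq> 1" by (rule generic_value)
  have fixed: "word_prod G sig vs ** t = t ** word_prod G sig vs \<longleftrightarrow> act i (act j (act i t)) = t"
    if t: "t \<in> T" for t
  proof -
    have "word_prod G sig vs ** t = t ** word_prod G sig vs \<longleftrightarrow>
        word_prod G sig [i, j, i] ** t = t ** word_prod G sig [i, j, i]"
      using weyl_eq_fix[of vs "[i, j, i]" t] weyl_eq_fix[of "[i, j, i]" vs t] vs i j t by auto
    then show ?thesis using fix3[OF i j t] by (simp add: word_prod_simps)
  qed
  have nontrivial: "\<exists>t\<in>T. word_prod G sig vs ** t \<noteq> t ** word_prod G sig vs"
  proof -
    obtain t where t: "t \<in> T" "\<And>p. p \<in> II \<Longrightarrow> \<alpha> p t = (if p = i then y else 1)" by (rule indicator_element[OF y(1), where m = i], rule that)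
    have r: "\<alpha> i t = y" "\<alpha> j t = 1" using t(2) i j ne by auto
    have "\<alpha> i (act i (act j (act i t))) = 1"
      using root_of_act[OF i i act_T[OF j act_T[OF i t(1)]]] root_of_act[OF j i act_T[OF i t(1)]]
        root_of_act[OF i i t(1)] root_of_act[OF i j t(1)] ne ij ji r y(1) by simp
    then have "act i (act j (act i t)) \<noteq> t" using r y(3) by auto
    then show ?thesis using fixed[OF t(1)] t(1) by blast
  qed
  have away: "word_prod G sig vs ** t = t ** word_prod G sig vs"
    if m: "m \<notin> {i, j}" and t: "t \<in> T" "\<And>p. p \<in> II \<Longrightarrow> \<alpha> p t = (if p = m then y else 1)" for t m
  proof -
    have "act i t = t" "act j t = t" using act_trivial[OF i] act_trivial[OF j] t(2)[OF i] t(2)[OF j] m by auto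
    then show ?thesis using fixed[OF t(1)] by simp
  qed
  have "\<exists>t\<in>T. \<forall>p\<in>II. \<alpha> p t = (if p = i then y else if p = j then inverse y else 1)"
    by (rule simple_roots_surjective) (use y(1) in simp)
  then obtain t0 where t0: "t0 \<in> T" "\<forall>p\<in>II. \<alpha> p t0 = (if p = i then y else if p = j then inverse y else 1)" ..
  have r0: "\<alpha> i t0 = y" "\<alpha> j t0 = inverse y" using t0(2) i j ne by auto
  have t0_fixed: "word_prod G sig vs ** t0 = t0 ** word_prod G sig vs"
  proof -
    have "\<alpha> j (act i t0) = 1" using root_of_act[OF i j t0(1)] ne ij r0 y(1) by simp
    then have a: "act j (act i t0) = act i t0" by (rule act_trivial[OF j])
    then show ?thesis using fixed[OF t0(1)] act_act[OF i t0(1)] by simp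
  qed
  have gen_ne: "(\<alpha> k t0) ^ 6 \<noteq> 1" "(\<alpha> k t0)\<^sup>2 \<noteq> 1" if "k \<in> {i, j}" for k
    using that r0 y by (auto simp: power_inverse)
  \<comment> \<open>If all elements with generic \<open>\<alpha>\<^sub>k\<close> are moved, then \<open>k\<close> is \<open>i\<close> or \<open>j\<close>: otherwise take \<open>t\<close>
    with \<open>\<alpha>\<^sub>k\<close> generic and all other simple roots trivial.\<close>
  have close: "k \<in> {i, j}" if k: "k \<in> II" and bad: "\<And>t. t \<in> T \<Longrightarrow> \<alpha> k t = y \<Longrightarrow>
      word_prod G sig vs ** t = t ** word_prod G sig vs \<Longrightarrow> False" for k
  proof (rule ccontr)
    assume "k \<notin> {i, j}"
    obtain t where t: "t \<in> T" "\<And>p. p \<in> II \<Longrightarrow> \<alpha> p t = (if p = k then y else 1)" by (rule indicator_element[OF y(1), where m = k], rule that)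
    show False by (rule bad[OF t(1) _ away[OF \<open>k \<notin> {i, j}\<close> t]]) (use t(2)[OF k] in auto)
  qed
  show "length [i, j, i] \<le> length vs"
  proof (rule ccontr)
    assume l: "\<not> length [i, j, i] \<le> length vs"
    consider "vs = []" | k where "vs = [k]" | k l where "vs = [k, l]"
    proof (cases vs)
      case (Cons k ws)
      then show ?thesis using that l by (cases ws) (auto simp: Suc_le_eq)
    qed (use that in auto)
    then show False
    proof cases
      case 1
      then show False using nontrivial by (auto simp: word_prod_simps)
    next
      case (2 k)
      then have k: "k \<in> II" using vs by simp
      have fx: "(\<alpha> k t)\<^sup>2 = 1" if "t \<in> T" "word_prod G sig vs ** t = t ** word_prod G sig vs" for t
        using that 2 fix1[OF k that(1)] act_fix_root[OF k that(1)] by (simp add: word_prod_simps)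
      have "k \<in> {i, j}" by (rule close[OF k]) (use fx y(3) in auto)
      then show False using fx[OF t0(1) t0_fixed] gen_ne(2) by simp
    next
      case (3 k l)
      then have kl: "k \<in> II" "l \<in> II" using vs by auto
      show False
      proof (cases "k = l")
        case True
        then show False using nontrivial fix2[OF kl(1) kl(1)] act_act[OF kl(1)] 3 by (auto simp: word_prod_simps)
      next
        case False
        have fx: "(\<alpha> k t) ^ 6 = 1" "(\<alpha> l t) ^ 6 = 1"
          if "t \<in> T" "word_prod G sig vs ** t = t ** word_prod G sig vs" for t
          using that 3 fix2[OF kl that(1)] act2_fix_root[OF kl False that(1)] by (simp_all add: word_prod_simps)
        have "k \<in> {i, j}" by (rule close[OF kl(1)]) (use fx y(2) in auto)
        then show False using fx(1)[OF t0(1) t0_fixed] gen_ne(1) by simp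
      qed
    qed
  qed
qed

section \<open>Coordinates of a section\<close>

lemma root_coord:
  assumes i: "i \<in> II" and t: "t \<in> T"
  shows "\<alpha> i t =
    (if i = 1 then inverse (coord 2 t)
     else if i = 2 then (coord 2 t)\<^sup>2 / coord 3 t
     else if i \<le> n - 3 then (coord i t)\<^sup>2 / (coord (i - 1) t * coord (i + 1) t)
     else if i = n - 2 then (coord i t)\<^sup>2 / (coord (n - 3) t * coord (n - 1) t * coord n t)
     else if i = n - 1 then coord 1 t * (coord i t)\<^sup>2 / coord (n - 2) t
     else (coord n t)\<^sup>2 / coord (n - 2) t)"
proof -
  have "\<alpha> i (te (\<lambda>k. coord k t)) =
    (if i = 1 then inverse (coord 2 t)
     else if i = 2 then (coord 2 t)\<^sup>2 / coord 3 t
     else if i \<le> n - 3 then (coord i t)\<^sup>2 / (coord (i - 1) t * coord (i + 1) t)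
     else if i = n - 2 then (coord i t)\<^sup>2 / (coord (n - 3) t * coord (n - 1) t * coord n t)
     else if i = n - 1 then coord 1 t * (coord i t)\<^sup>2 / coord (n - 2) t
     else (coord n t)\<^sup>2 / coord (n - 2) t)"
    by (rule root_of_te[OF i]) (rule coord_nz[OF t])
  then show ?thesis by (simp only: te_coord[OF t])
qed

lemma root_coord_cases:
  assumes t: "t \<in> T"
  shows "\<alpha> 1 t = inverse (coord 2 t)"
    and "3 \<le> i \<Longrightarrow> i \<le> n - 3 \<Longrightarrow> \<alpha> i t = (coord i t)\<^sup>2 / (coord (i - 1) t * coord (i + 1) t)"
    and "\<alpha> (n - 2) t = (coord (n - 2) t)\<^sup>2 / (coord (n - 3) t * coord (n - 1) t * coord n t)"
    and "\<alpha> (n - 1) t = coord 1 t * (coord (n - 1) t)\<^sup>2 / coord (n - 2) t"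
    and "\<alpha> n t = (coord n t)\<^sup>2 / coord (n - 2) t"
proof -
  have mem: "1 \<in> II" "n - 2 \<in> II" "n - 1 \<in> II" "n \<in> II" using n6 by auto
  show "\<alpha> 1 t = inverse (coord 2 t)" by (subst root_coord[OF mem(1) t]) simp
  show "3 \<le> i \<Longrightarrow> i \<le> n - 3 \<Longrightarrow> \<alpha> i t = (coord i t)\<^sup>2 / (coord (i - 1) t * coord (i + 1) t)"
    by (subst root_coord[OF _ t]) auto
  have f: "(n - 2 = 1) = False" "(n - 2 = 2) = False" "(n - 2 \<le> n - 3) = False" "(n - 2 = n - 2) = True"
    "(n - 1 = 1) = False" "(n - 1 = 2) = False" "(n - 1 \<le> n - 3) = False" "(n - 1 = n - 2) = False" "(n - 1 = n - 1) = True"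
    "(n = 1) = False" "(n = 2) = False" "(n \<le> n - 3) = False" "(n = n - 2) = False" "(n = n - 1) = False"
    using n6 by auto
  show "\<alpha> (n - 2) t = (coord (n - 2) t)\<^sup>2 / (coord (n - 3) t * coord (n - 1) t * coord n t)"
    unfolding root_coord[OF mem(2) t] f if_False if_True ..
  show "\<alpha> (n - 1) t = coord 1 t * (coord (n - 1) t)\<^sup>2 / coord (n - 2) t"
    unfolding root_coord[OF mem(3) t] f if_False if_True ..
  show "\<alpha> n t = (coord n t)\<^sup>2 / coord (n - 2) t"
    unfolding root_coord[OF mem(4) t] f if_False if_True ..
qed

text \<open>The combinatorial core. For commuting \<open>i\<close> and \<open>j\<close> the two coroots involved are
  independent, so all root values \<open>\<alpha>\<^sub>i(t\<^sub>j)\<close> with \<open>i\<close> and \<open>j\<close> different and not adjacent are 1.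
  For adjacent \<open>i\<close> and \<open>j\<close> the coordinates of \<open>t\<^sub>i\<close> and \<open>t\<^sub>j\<close> other than \<open>i\<close> and \<open>j\<close> agree, when
  both indices exceed 1. For \<open>j \<ge> 2\<close> these two conditions determine the coordinates of \<open>t\<^sub>j\<close>
  except the \<open>j\<close>-th: those below \<open>j\<close> from the free end of the chain (\<open>low\<close>), those at 1,
  \<open>n - 1\<close>, \<open>n\<close> from the fork by moving along the chain (\<open>top\<close>), and those above \<open>j\<close> downwards
  from the fork (\<open>high\<close>). Finally \<open>t\<^sub>1\<close> is compared with \<open>t\<^sub>2\<close>.\<close>

lemma braid_coordinates:
  assumes t: "\<And>j. j \<in> II \<Longrightarrow> t j \<in> T"
    and comm: "\<And>i j k. i \<in> II \<Longrightarrow> j \<in> II \<Longrightarrow> k \<in> II \<Longrightarrow> i \<noteq> j \<Longrightarrow> \<not> adj n i j \<Longrightarrow>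
      coord k (co i (\<alpha> i (t j))) = coord k (co j (\<alpha> j (t i)))"
    and braid: "\<And>i j k. i \<in> II \<Longrightarrow> j \<in> II \<Longrightarrow> k \<in> II \<Longrightarrow> adj n i j \<Longrightarrow>
      coord k (t i) * inverse (coord k (co i (\<alpha> i (t i) * \<alpha> j (t i)))) =
      coord k (t j) * inverse (coord k (co j (\<alpha> j (t j) * \<alpha> i (t j))))"
  shows "\<exists>c y. c\<^sup>2 = 1 \<and> y \<noteq> 0 \<and>
    (\<forall>k\<in>II. coord k (t 1) = coord k (co 1 y) * (if k \<in> {n - 1, n} then c else 1)) \<and>
    (\<forall>i\<in>{2..n}. \<forall>k\<in>II. k \<noteq> i \<longrightarrow> coord k (t i) = (if k \<in> {n - 1, n} then c else 1))"
proof -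
  define X where "X j k = coord k (t j)" for j k
  have Xnz: "X j k \<noteq> 0" if "j \<in> II" for j k unfolding X_def by (rule coord_nz[OF t[OF that]])
  have Anz: "\<alpha> i (t j) \<noteq> 0" if "i \<in> II" "j \<in> II" for i j by (rule root_nz[OF that(1) t[OF that(2)]])
  have mem: "1 \<in> II" "2 \<in> II" "n - 3 \<in> II" "n - 2 \<in> II" "n - 1 \<in> II" "n \<in> II" using n6 by auto
  have mem2: "n - 2 \<in> {2..n}" "n - 1 \<in> {2..n}" "n \<in> {2..n}" using n6 by auto
  obtain N where N: "n = 2 * N" using n_even by blast
  have N3: "3 \<le> N" using n6 N by simp
  have F1: "\<alpha> i (t j) = 1" if "i \<in> {2..n}" "j \<in> {2..n}" "i \<noteq> j" "\<not> adj n i j" for i j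
  proof -
    have ij: "i \<in> II" "j \<in> II" using that by auto
    show ?thesis
      using comm[OF ij ij(1) that(3,4)] coord_coroot[OF that(1) ij(1) Anz[OF ij]]
        coord_coroot[OF that(2) ij(1) Anz[OF ij(2,1)]] that(3) by simp
  qed
  have F2: "\<alpha> 1 (t j) = 1 \<and> \<alpha> j (t 1) = 1" if j: "j \<in> {3..n}" for j
  proof -
    have jI: "j \<in> II" "j \<in> {2..n}" "1 \<noteq> j" "\<not> adj n 1 j" using j n6 by (auto simp: adj_def)
    define a where "a = \<alpha> 1 (t j)"
    have anz: "a \<noteq> 0" unfolding a_def by (rule Anz[OF mem(1) jI(1)])
    have c: "coord k (co 1 a) = 1" if "k \<in> II" "k \<noteq> j" for k
      using comm[OF mem(1) jI(1) that(1) jI(3,4)] coord_coroot[OF jI(2) that(1) Anz[OF jI(1) mem(1)]] that(2)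
      by (simp add: a_def)
    \<comment> \<open>All coordinates of \<open>\<alpha>\<^sub>1\<^sup>\<or>(a)\<close> other than the \<open>j\<close>-th are 1. Two of the exponents involved
      are coprime: 2 and 3 at the coordinates 1 and 3, or, if \<open>j = 3\<close>, the consecutive ones at
      \<open>n - 1\<close> and \<open>n\<close>.\<close>
    have a1: "a = 1"
    proof (cases "j = 3")
      case False
      have m3: "3 \<in> II" using n6 by auto
      have "coord 1 (co 1 a) = a powi 2" "coord 3 (co 1 a) = a powi (- 3)"
        using coord_first_coroot[OF mem(1) anz] coord_first_coroot[OF m3 anz] n6 by simp_all
      then have "a powi 2 = 1" "a powi (- 3) = 1"
        using c[OF mem(1) jI(3)] c[OF m3] False by simp_all
      then have "a powi (- 3) * (a powi 2 * a powi 2) = 1" by simp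
      then show ?thesis using anz by (simp add: power_int_add[symmetric] del: power_int_numeral)
    next
      case True
      have f: "(n - 1 = 1) = False" "(n - 1 \<le> n - 2) = False" "(n = 1) = False" "(n \<le> n - 2) = False" "(n = n - 1) = False"
        "(n - 1 = n - 1) = True"
        using n6 by auto
      have E: "a powi (- int (n div 2)) = 1" "a powi (- int ((n - 2) div 2)) = 1"
        using c[OF mem(5)] c[OF mem(6)] True n6
        unfolding coord_first_coroot[OF mem(5) anz] coord_first_coroot[OF mem(6) anz] f if_False if_True by auto
      have idx: "- int ((n - 2) div 2) = - int (n div 2) + 1" using N N3 by (simp add: of_nat_diff)
      have "a powi (- int (n div 2) + 1) = a powi (- int (n div 2)) * a"
        by (subst power_int_add) (use anz in auto)
      then show ?thesis unfolding idx[symmetric] E by simp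
    qed
    have "coord j (co 1 a) = \<alpha> j (t 1)"
      using comm[OF mem(1) jI(1) jI(1) jI(3,4)] coord_coroot[OF jI(2,1) Anz[OF jI(1) mem(1)]] by (simp add: a_def)
    then have "\<alpha> j (t 1) = 1" using co_one[OF mem(1)] coord_one by (simp add: a1)
    then show ?thesis using a1 by (simp add: a_def)
  qed
  have F3: "X i k = X j k" if "i \<in> {2..n}" "j \<in> {2..n}" "adj n i j" "k \<in> II" "k \<noteq> i" "k \<noteq> j" for i j k
  proof -
    have ij: "i \<in> II" "j \<in> II" using that by auto
    show ?thesis
      using braid[OF ij that(4,3)] coord_coroot[OF that(1,4)] coord_coroot[OF that(2,4)] that(5,6)
        Anz[OF ij(1,1)] Anz[OF ij(2,1)] Anz[OF ij(2,2)] Anz[OF ij] by (simp add: X_def)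
  qed
  have low: "X j k = 1" if j: "j \<in> {3..n}" and k: "2 \<le> k" "k < j" "k \<le> n - 2" for j k
  proof -
    have jI: "j \<in> II" using j by auto
    define m where "m = min (j - 2) (n - 3)"
    have "coord k (t j) = 1"
    proof (rule chain_upward[where x = "\<lambda>k. coord k (t j)" and m = m])
      show "coord k (t j) \<noteq> 0" for k by (rule coord_nz[OF t[OF jI]])
      show "m \<le> n - 3" by (simp add: m_def)
      show "coord 2 (t j) = 1"
        using F2[OF j] root_coord_cases(1)[OF t[OF jI]] by simp
      show "2 \<le> k" "k \<le> m + 1" using k by (auto simp: m_def)
      fix i assume i: "2 \<le> i" "i \<le> m"
      have "\<alpha> i (t j) = 1" by (rule F1) (use i j in \<open>auto simp: m_def adj_def\<close>)
      then show "\<alpha> i (te (\<lambda>k. coord k (t j))) = 1" by (simp only: te_coord[OF t[OF jI]])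
    qed
    then show ?thesis by (simp add: X_def)
  qed
  \<comment> \<open>The unknowns around the fork; \<open>c\<close> is the sign to be found, and \<open>e = 1\<close> and \<open>p = c\<close> will be
    shown.\<close>
  define c where "c = X (n - 1) n"
  define e where "e = X (n - 2) 1"
  define p where "p = X (n - 2) (n - 1)"
  define z where "z = X (n - 1) (n - 1)"
  have adj1: "adj n (n - 1) (n - 2)" "adj n (n - 2) n" using n6 by (auto simp: adj_def)
  have l1: "X n (n - 2) = 1" "X (n - 1) (n - 2) = 1" "X (n - 1) (n - 3) = 1"
    by (rule low; use n6 in auto)+
  have c2: "c\<^sup>2 = 1"
  proof -
    have "\<alpha> n (t (n - 1)) = 1" by (rule F1) (use n6 in \<open>auto simp: adj_def\<close>)
    then show ?thesis using root_coord_cases(5)[OF t[OF mem(5)]] l1(2) by (simp add: c_def X_def)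
  qed
  have c0: "c \<noteq> 0" using c2 by auto
  have Xc: "X (n - 2) n = c" using F3[OF mem2(2,1) adj1(1) mem(6)] n6 by (simp add: c_def)
  have Xe: "X (n - 1) 1 = e" using F3[OF mem2(2,1) adj1(1) mem(1)] n6 by (simp add: e_def)
  have Xe': "X n 1 = e" using F3[OF mem2(1,3) adj1(2) mem(1)] n6 by (simp add: e_def)
  have Xp: "X n (n - 1) = p" using F3[OF mem2(1,3) adj1(2) mem(5)] n6 by (simp add: p_def)
  have e0: "e \<noteq> 0" and z0: "z \<noteq> 0" unfolding e_def z_def using Xnz mem by auto
  have ep: "e * p\<^sup>2 = 1"
  proof -
    have "\<alpha> (n - 1) (t n) = 1" by (rule F1) (use n6 in \<open>auto simp: adj_def\<close>)
    then show ?thesis using root_coord_cases(4)[OF t[OF mem(6)]] l1(1) Xe' Xp by (simp add: X_def)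
  qed
  \<comment> \<open>The \<open>(n - 1)\<close>-st coordinate of the relation for \<open>n - 1\<close> and \<open>n - 2\<close>.\<close>
  have pc: "p = c / e"
  proof -
    have a1: "\<alpha> (n - 1) (t (n - 1)) = e * z\<^sup>2"
      using root_coord_cases(4)[OF t[OF mem(5)]] l1(2) Xe by (simp add: X_def z_def)
    have a2: "\<alpha> (n - 2) (t (n - 1)) = 1 / (z * c)"
      using root_coord_cases(3)[OF t[OF mem(5)]] l1(2,3) by (simp add: X_def z_def c_def)
    have "n - 1 \<noteq> n - 2" using n6 by simp
    then have "X (n - 1) (n - 1) * inverse (\<alpha> (n - 1) (t (n - 1)) * \<alpha> (n - 2) (t (n - 1))) = X (n - 2) (n - 1)"
      using braid[OF mem(5,4) mem(5) adj1(1)] coord_coroot[OF mem2(2) mem(5)] coord_coroot[OF mem2(1) mem(5)]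
        Anz[OF mem(5,5)] Anz[OF mem(4,5)] Anz[OF mem(4,4)] Anz[OF mem(5,4)] by (simp add: X_def)
    then have "z * inverse (e * z\<^sup>2 * (1 / (z * c))) = p" unfolding a1 a2 by (simp add: z_def p_def)
    then show ?thesis using z0 c0 e0 by (simp add: power2_eq_square field_simps)
  qed
  have e1: "e = 1" using ep e0 c2 unfolding pc by (simp add: power_divide power2_eq_square)
  then have pc1: "p = c" using pc by simp
  have top: "X j k = X (n - 2) k" if j: "2 \<le> j" "j \<le> n - 2" and k: "k \<in> {1, n - 1, n}" for j k
    using j(2,1)
  proof (induction j rule: inc_induct)
    case base
    then show ?case by simp
  next
    case (step j)
    have "X j k = X (Suc j) k"
      by (rule F3) (use step k n6 in \<open>auto simp: adj_def\<close>)
    then show ?case using step by simp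
  qed
  have top1: "X j 1 = 1" "X j (n - 1) = c" "X j n = c" if "2 \<le> j" "j \<le> n - 2" for j
    using top[OF that, of 1] top[OF that, of "n - 1"] top[OF that, of n] e1 pc1 Xc
    by (simp_all add: e_def p_def)
  have high: "X j k = 1" if j: "2 \<le> j" "j < k" "k \<le> n - 2" for j k
  proof -
    have jI: "j \<in> II" "j \<in> {2..n}" "j \<le> n - 3" "j \<le> n - 2" using j by auto
    have h2: "X j (n - 2) = 1"
    proof -
      have "\<alpha> n (t j) = 1" by (rule F1) (use jI n6 in \<open>auto simp: adj_def\<close>)
      then show ?thesis using root_coord_cases(5)[OF t[OF jI(1)]] top1(3)[OF j(1) jI(4)] c2 Xnz[OF jI(1), of "n - 2"]
        by (simp add: X_def)
    qed
    show ?thesis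
    proof (cases "k = n - 2")
      case True
      then show ?thesis using h2 by simp
    next
      case False
      then have k3: "k \<le> n - 3" using j by auto
      have h3: "X j (n - 3) = 1"
      proof -
        have "\<alpha> (n - 2) (t j) = 1" by (rule F1) (use j k3 jI n6 in \<open>auto simp: adj_def\<close>)
        then have "1 = 1 / (X j (n - 3) * c * c)"
          using root_coord_cases(3)[OF t[OF jI(1)]] top1(2,3)[OF j(1) jI(4)] h2 by (simp add: X_def)
        then show ?thesis using c2 Xnz[OF jI(1), of "n - 3"] c0 by (simp add: power2_eq_square mult.assoc)
      qed
      have "X j k = 1 \<and> X j (Suc k) = 1"
        using k3 j(2)
      proof (induction k rule: inc_induct)
        case base
        have "Suc (n - 3) = n - 2" using n6 by simp
        then show ?case using h2 h3 by simp
      next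
        case (step k)
        have "\<alpha> (Suc k) (t j) = 1" by (rule F1) (use step j in \<open>auto simp: adj_def\<close>)
        moreover have "\<alpha> (Suc k) (t j) = (coord (Suc k) (t j))\<^sup>2 / (coord (Suc k - 1) (t j) * coord (Suc k + 1) (t j))"
          by (rule root_coord_cases(2)[OF t[OF jI(1)]]) (use step j in auto)
        moreover have "X j (Suc k) = 1" "X j (Suc (Suc k)) = 1" using step by auto
        ultimately show ?case using Xnz[OF jI(1), of k] by (simp add: X_def)
      qed
      then show ?thesis ..
    qed
  qed
  have off: "X i k = (if k \<in> {n - 1, n} then c else 1)" if i: "i \<in> {2..n}" and k: "k \<in> II" "k \<noteq> i" for i k
  proof -
    consider "i \<le> n - 2" | "i = n - 1" | "i = n" using i by force
    then show ?thesis
    proof cases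
      case 1
      have i2: "2 \<le> i" using i by simp
      consider "k = 1" | "2 \<le> k" "k < i" | "i < k" "k \<le> n - 2" | "k = n - 1" | "k = n" using k by force
      then show ?thesis
      proof cases
        case 2
        then show ?thesis using low[of i k] 1 n6 i by auto
      qed (use top1[OF i2 1] high[OF i2] n6 in auto)
    next
      case 2
      consider "k = 1" | "2 \<le> k" "k \<le> n - 2" | "k = n" using k 2 by force
      then show ?thesis by cases (use 2 low[of "n - 1" k] Xe e1 n6 c_def in auto)
    next
      case 3
      consider "k = 1" | "2 \<le> k" "k \<le> n - 2" | "k = n - 1" using k 3 by force
      then show ?thesis by cases (use 3 low[of n k] Xe' e1 Xp pc1 n6 in auto)
    qed
  qed
  \<comment> \<open>The value of \<open>\<alpha>\<^sub>1\<^sup>\<or>\<close> by which \<open>t\<^sub>1\<close> and \<open>t\<^sub>2\<close> differ away from the second coordinate.\<close>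
  define y where "y = \<alpha> 1 (t 1) * \<alpha> 2 (t 1)"
  have y0: "y \<noteq> 0" unfolding y_def using Anz mem by simp
  have adj12: "adj n 1 2" using n6 by (simp add: adj_def)
  have two: "2 \<in> {2..n}" using n6 by simp
  have first: "X 1 k = coord k (co 1 y) * (if k \<in> {n - 1, n} then c else 1)" if k: "k \<in> II" for k
  proof -
    have other: "X 1 k = coord k (co 1 y) * (if k \<in> {n - 1, n} then c else 1)" if k: "k \<in> II" "k \<noteq> 2" for k
    proof -
      have "coord k (co 2 (\<alpha> 2 (t 2) * \<alpha> 1 (t 2))) = 1"
        using coord_coroot[OF two k(1)] k(2) Anz mem by simp
      then have "X 1 k * inverse (coord k (co 1 y)) = X 2 k"
        using braid[OF mem(1,2) k(1) adj12] by (simp add: X_def y_def)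
      moreover have "coord k (co 1 y) \<noteq> 0" by (rule coord_nz[OF co_T[OF mem(1) y0]])
      ultimately have "X 1 k = coord k (co 1 y) * X 2 k" by (simp add: field_simps)
      then show ?thesis using off[OF two k] by simp
    qed
    show ?thesis
    proof (cases "k = 2")
      case True
      have m34: "3 \<in> II" "4 \<in> II" "3 \<in> {3..n}" using n6 by auto
      have "coord 3 (co 1 y) = y powi (- 3)" "coord 4 (co 1 y) = y powi (- 4)" "coord 2 (co 1 y) = y powi (- 2)"
        using coord_first_coroot[OF m34(1) y0] coord_first_coroot[OF m34(2) y0] coord_first_coroot[OF mem(2) y0] n6 by simp_all
      then have x34: "X 1 3 = y powi (- 3)" "X 1 4 = y powi (- 4)" and h2: "coord 2 (co 1 y) = y powi (- 2)"
        using other[OF m34(1)] other[OF m34(2)] n6 by auto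
      \<comment> \<open>The second coordinate of \<open>t\<^sub>1\<close> is recovered from \<open>\<alpha>\<^sub>3(t\<^sub>1) = 1\<close> and the coordinates 3 and
        4.\<close>
      have "\<alpha> 3 (t 1) = (coord 3 (t 1))\<^sup>2 / (coord (3 - 1) (t 1) * coord (3 + 1) (t 1))"
        by (rule root_coord_cases(2)[OF t[OF mem(1)]]) (use n6 in auto)
      then have "1 = (X 1 3)\<^sup>2 / (X 1 2 * X 1 4)" using F2[OF m34(3)] by (simp add: X_def)
      then have "X 1 2 * X 1 4 = (X 1 3)\<^sup>2" using Xnz[OF mem(1)] by (simp add: field_simps)
      then have "X 1 2 * y powi (- 4) = y powi (- 3) * y powi (- 3)" unfolding x34 power2_eq_square .
      also have "\<dots> = y powi (- 2) * y powi (- 4)" using y0 by (simp add: power_int_add[symmetric])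
      finally have "X 1 2 = y powi (- 2)" using y0 by simp
      then show ?thesis using True h2 n6 by auto
    qed (rule other[OF k])
  qed
  show ?thesis
    using c2 y0 first off unfolding X_def by (intro exI[of _ c] exI[of _ y]) blast
qed

end

section \<open>Sections of the Weyl group\<close>

context half_spin_group
begin

text \<open>The element \<open>\<alpha>\<^sub>n\<^sub>-\<^sub>1\<^sup>\<or>(c) \<alpha>\<^sub>n\<^sup>\<or>(c)\<close>. For \<open>c\<^sup>2 = 1\<close> all roots are trivial on it.\<close>

definition zc :: "'f \<Rightarrow> 'f^'m^'m" where
  "zc c = te (\<lambda>k. if k \<in> {n - 1, n} then c else 1)"

lemma zc_facts:
  assumes c: "c\<^sup>2 = 1"
  shows "zc c \<in> T" and "k \<in> II \<Longrightarrow> coord k (zc c) = (if k \<in> {n - 1, n} then c else 1)"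
    and "i \<in> II \<Longrightarrow> \<alpha> i (zc c) = 1"
proof -
  have c0: "c \<noteq> 0" using c by auto
  show T: "zc c \<in> T" unfolding zc_def by (rule te_T) (use c0 in auto)
  have co: "coord k (zc c) = (if k \<in> {n - 1, n} then c else 1)" if "k \<in> II" for k
    unfolding zc_def by (rule coord_te[OF that]) (use c0 in auto)
  then show "k \<in> II \<Longrightarrow> coord k (zc c) = (if k \<in> {n - 1, n} then c else 1)" .
  assume i: "i \<in> II"
  have mem: "1 \<in> II" "2 \<in> II" "3 \<in> II" "n - 3 \<in> II" "n - 2 \<in> II" "n - 1 \<in> II" "n \<in> II" using n6 by auto
  have small: "coord k (zc c) = 1" if "k \<in> II" "k \<le> n - 2" for k using co[OF that(1)] that n6 by auto
  have big: "coord (n - 1) (zc c) = c" "coord n (zc c) = c" using co mem by auto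
  have cc: "c * c = 1" using c by (simp add: power2_eq_square)
  consider "i = 1" | "i = 2" | "3 \<le> i" "i \<le> n - 3" | "i = n - 2" | "i = n - 1" | "i = n"
    using i by force
  then show "\<alpha> i (zc c) = 1"
  proof cases
    case 1
    show ?thesis unfolding 1 root_coord_cases(1)[OF T] using small[OF mem(2)] n6 by simp
  next
    case 2
    have "\<alpha> 2 (zc c) = (coord 2 (zc c))\<^sup>2 / coord 3 (zc c)" by (subst root_coord[OF mem(2) T]) simp
    then show ?thesis unfolding 2 using small[OF mem(2)] small[OF mem(3)] n6 by simp
  next
    case 3
    have "coord (i - 1) (zc c) = 1" by (rule small) (use 3 in auto)
    moreover have "coord i (zc c) = 1" by (rule small) (use 3 in auto)
    moreover have "coord (i + 1) (zc c) = 1" by (rule small) (use 3 in auto)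
    ultimately show ?thesis unfolding root_coord_cases(2)[OF T 3] by simp
  next
    case 4
    show ?thesis unfolding 4 root_coord_cases(3)[OF T] using small[OF mem(4)] small[OF mem(5)] big cc by simp
  next
    case 5
    show ?thesis unfolding 5 root_coord_cases(4)[OF T] using small[OF mem(1)] small[OF mem(5)] big c n6 by simp
  next
    case 6
    show ?thesis unfolding 6 root_coord_cases(5)[OF T] using small[OF mem(5)] big c by simp
  qed
qed

lemma minus_one_ne_one: "(- 1 :: 'f) \<noteq> 1"
proof
  assume "(- 1 :: 'f) = 1"
  then have "(1 :: 'f) + 1 = 0" by (metis add.left_inverse)
  then show False using two_nonzero by simp
qed

text \<open>For \<open>i \<ge> 2\<close> the coroot is a basis element; \<open>\<alpha>\<^sub>1\<^sup>\<or>\<close> has the odd exponent \<open>-3\<close> at the third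
  coordinate.\<close>

lemma coroot_minus_one: "i \<in> II \<Longrightarrow> co i (- 1) \<noteq> mat 1"
proof
  assume i: "i \<in> II" and eq: "co i (- 1) = mat 1"
  show False
  proof (cases "i = 1")
    case True
    have m3: "3 \<in> II" using n6 by auto
    have "coord 3 (co 1 (- 1)) = (- 1) powi (- 3)"
      using coord_first_coroot[OF m3, of "- 1"] n6 by simp
    then show False using eq minus_one_ne_one by (simp add: coord_one True power_int_minus)
  next
    case False
    then have "coord i (co i (- 1)) = - 1" using coord_coroot[of i i "- 1"] i by simp
    then show False using eq minus_one_ne_one by (simp add: coord_one)
  qed
qed

text \<open>The reflection inverts \<open>\<alpha>\<^sub>i\<^sup>\<or>(d)\<close> and fixes \<open>z\<^sub>c\<close>, so moving one \<open>\<sigma>\<^sub>i\<close> past the torus part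
  leaves \<open>z\<^sub>c\<^sup>2 \<sigma>\<^sub>i\<^sup>2 = \<sigma>\<^sub>i\<^sup>2\<close>.\<close>

lemma square_of_lift:
  assumes i: "i \<in> II" and d: "d \<noteq> 0" and c: "c\<^sup>2 = 1"
  shows "(co i d ** zc c ** sig i) ** (co i d ** zc c ** sig i) = co i (- 1)"
proof -
  let ?t = "co i d ** zc c"
  note z = zc_facts[OF c]
  have dT: "co i d \<in> T" and ddT: "co i (d * d) \<in> T" using co_T[OF i] d by auto
  have tT: "?t \<in> T" using dT z(1) by simp
  have root: "\<alpha> i ?t = d * d"
    using root_mult[OF i dT z(1)] z(3)[OF i] root_of_coroot[OF i i d] by (simp add: power2_eq_square)
  have act: "act i ?t = ?t ** inv\<^bsub>G\<^esub> (co i (d * d))" unfolding act_def root ..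
  have one: "?t ** act i ?t = mat 1"
  proof (rule coord_eqI)
    show "?t ** act i ?t \<in> T" using tT act_T[OF i tT] by simp
    fix k assume k: "k \<in> II"
    have nz: "coord k (co i d) \<noteq> 0" by (rule coord_nz[OF dT])
    have cc: "c * c = 1" using c by (simp add: power2_eq_square)
    have "coord k (co i (d * d)) = coord k (co i d) * coord k (co i d)"
      using co_mult[OF i d d] coord_mult[OF dT dT] by simp
    then have "coord k (?t ** act i ?t) = (coord k (co i d) * coord k (zc c)) *
        (coord k (co i d) * coord k (zc c) * inverse (coord k (co i d) * coord k (co i d)))"
      unfolding act using dT ddT z(1) tT by (simp add: coord_mult coord_inv)
    also have "\<dots> = coord k (zc c) * coord k (zc c)" using nz by (simp add: field_simps)
    finally have "coord k (?t ** act i ?t) = coord k (zc c) * coord k (zc c)" .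
    then show "coord k (?t ** act i ?t) = coord k (mat 1)" using z(2)[OF k] cc by (simp add: coord_one)
  qed simp
  have "(?t ** sig i) ** (?t ** sig i) = ?t ** (sig i ** ?t) ** sig i" by (simp only: matrix_mul_assoc)
  also have "\<dots> = (?t ** act i ?t) ** (sig i ** sig i)" unfolding sig_swap[OF i tT] by (simp only: matrix_mul_assoc)
  finally show ?thesis unfolding one using sg_square[OF simple_root[OF i]] by simp
qed

text \<open>Because \<open>t s\<^sub>i(t)\<^sup>-\<^sup>1 = \<alpha>\<^sub>i\<^sup>\<or>(\<alpha>\<^sub>i(t))\<close>.\<close>

lemma conj_lift:
  assumes i: "i \<in> II" and t: "t \<in> T" and x: "x \<in> T"
  shows "t ** (x ** sig i) ** inv\<^bsub>G\<^esub> t = co i (\<alpha> i t) ** x ** sig i"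
proof -
  have \<alpha>t: "\<alpha> i t \<noteq> 0" by (rule root_nz[OF i t])
  have coT: "co i (\<alpha> i t) \<in> T" by (rule co_T[OF i \<alpha>t])
  have "act i (inv\<^bsub>G\<^esub> t) = inv\<^bsub>G\<^esub> t ** co i (\<alpha> i t)"
    unfolding act_def root_inv[OF i t] using co_inv[OF i, of "inverse (\<alpha> i t)"] \<alpha>t by simp
  then have sw: "sig i ** inv\<^bsub>G\<^esub> t = inv\<^bsub>G\<^esub> t ** co i (\<alpha> i t) ** sig i"
    using sig_swap[OF i T_inv[OF t]] by simp
  have "t ** (x ** sig i) ** inv\<^bsub>G\<^esub> t = t ** x ** (sig i ** inv\<^bsub>G\<^esub> t)" by (simp only: matrix_mul_assoc)
  also have "\<dots> = (t ** x) ** inv\<^bsub>G\<^esub> t ** co i (\<alpha> i t) ** sig i" unfolding sw by (simp only: matrix_mul_assoc)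
  also have "(t ** x) ** inv\<^bsub>G\<^esub> t = x ** (t ** inv\<^bsub>G\<^esub> t)"
    unfolding T_comm[OF t x] by (simp only: matrix_mul_assoc)
  also have "x ** (t ** inv\<^bsub>G\<^esub> t) ** co i (\<alpha> i t) = co i (\<alpha> i t) ** x"
    using T_G[OF t] T_comm[OF x coT] by simp
  finally show ?thesis .
qed

abbreviation "sec \<equiv> is_section G T n (\<lambda>i. rf (\<alpha> i))"

lemma sr_W: "i \<in> II \<Longrightarrow> sr i \<in> carrier WT"
  using sr_eq sig_N carrier_WT by auto

lemma section_lift:
  assumes S: "sec S" and i: "i \<in> II"
  shows "\<exists>t\<in>T. S (sr i) = t ** sig i"
proof -
  have "S (sr i) \<in> NT" "T #>\<^bsub>G\<^esub> S (sr i) = sr i" using S sr_W[OF i] unfolding is_section_def by auto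
  then show ?thesis using coset_eq_iff[of "S (sr i)" "sig i"] sr_eq[OF i] sig_G[OF i] normalizerD(1) by simp
qed

lemma section_word:
  "sec S \<Longrightarrow> reduced_word WT n (\<lambda>i. rf (\<alpha> i)) ws \<Longrightarrow>
    S (word_prod WT (\<lambda>i. rf (\<alpha> i)) ws) = word_prod G (\<lambda>i. S (sr i)) ws"
  unfolding is_section_def by blast

lemma weyl_word_eq:
  assumes "set vs \<subseteq> II" "set ws \<subseteq> II" "\<exists>\<tau>\<in>T. word_prod G sig vs = \<tau> ** word_prod G sig ws"
  shows "word_prod WT (\<lambda>i. rf (\<alpha> i)) vs = word_prod WT (\<lambda>i. rf (\<alpha> i)) ws"
  using assms coset_eq_iff[of "word_prod G sig vs" "word_prod G sig ws"] word_N normalizerD(1)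
  by (simp add: word_weyl)

text \<open>Both \<open>[i, j]\<close> and \<open>[j, i]\<close> are reduced words for the same element of the Weyl group, so
  the section has one value for both products.\<close>

lemma section_commute:
  assumes S: "sec S" and i: "i \<in> II" and j: "j \<in> II" and ij: "i \<noteq> j" "\<not> adj n i j"
  shows "S (sr i) ** S (sr j) = S (sr j) ** S (sr i)"
proof -
  have "word_prod WT (\<lambda>i. rf (\<alpha> i)) [i, j] = word_prod WT (\<lambda>i. rf (\<alpha> i)) [j, i]"
    by (rule weyl_word_eq) (use i j weyl_commute[OF i j ij] in \<open>auto simp: word_prod_simps\<close>)
  then show ?thesis
    using section_word[OF S reduced_pair[OF i j ij(1)]] section_word[OF S reduced_pair[OF j i ij(1)[symmetric]]]
    by (simp add: word_prod_def)
qed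

lemma section_braid:
  assumes S: "sec S" and i: "i \<in> II" and j: "j \<in> II" and ij: "adj n i j"
  shows "S (sr i) ** (S (sr j) ** S (sr i)) = S (sr j) ** (S (sr i) ** S (sr j))"
proof -
  have "\<exists>\<tau>\<in>T. word_prod G sig [i, j, i] = \<tau> ** word_prod G sig [j, i, j]"
    using weyl_braid[OF i j ij] by (simp add: word_prod_simps matrix_mul_assoc)
  then have "word_prod WT (\<lambda>i. rf (\<alpha> i)) [i, j, i] = word_prod WT (\<lambda>i. rf (\<alpha> i)) [j, i, j]"
    by (intro weyl_word_eq) (use i j in auto)
  then show ?thesis
    using section_word[OF S reduced_triple[OF i j ij]] section_word[OF S reduced_triple[OF j i adj_sym[OF ij]]]
    by (simp add: word_prod_def)
qed

end

locale half_spin_tits = half_spin_group G T cr rf u n \<alpha> \<omega>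
  for G :: "('f::alg_closed_field^'m::finite^'m, 'f) alg_group" and T cr rf u n \<alpha> \<omega> +
  fixes tits :: "('f^'m^'m) set \<Rightarrow> 'f^'m^'m"
  assumes weyl_gen: "generate (weyl_group G T) ((\<lambda>i. rf (\<alpha> i)) ` {1..n}) = carrier (weyl_group G T)"
    and tits: "is_tits_section G T n (\<lambda>i. rf (\<alpha> i)) (\<lambda>i. tits_lift G T u (\<alpha> i)) tits"
begin

lemma tits_sec: "sec tits" and tits_sig: "i \<in> II \<Longrightarrow> tits (sr i) = sig i"
  using tits unfolding is_tits_section_def by auto

lemma sig_commute: "i \<in> II \<Longrightarrow> j \<in> II \<Longrightarrow> i \<noteq> j \<Longrightarrow> \<not> adj n i j \<Longrightarrow> sig i ** sig j = sig j ** sig i"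
  using section_commute[OF tits_sec, of i j] tits_sig by simp

lemma sig_braid: "i \<in> II \<Longrightarrow> j \<in> II \<Longrightarrow> adj n i j \<Longrightarrow> sig i ** (sig j ** sig i) = sig j ** (sig i ** sig j)"
  using section_braid[OF tits_sec, of i j] tits_sig by simp

text \<open>The Tits lifts satisfy the braid relations, being the values of a section; so in the braid
  relations for \<open>t\<^sub>i \<sigma>\<^sub>i\<close> all \<open>\<sigma>\<^sub>i\<close> can be moved to the right and cancelled. What remains are
  equations in \<open>T\<close>, to which \<open>braid_coordinates\<close> applies after inserting the action of the
  reflections. The freely varying \<open>i\<close>-th coordinate of \<open>t\<^sub>i\<close>, or the scalar for \<open>t\<^sub>1\<close>, becomes
  \<open>d\<^sub>i\<close>.\<close>

lemma section_form:
  assumes S: "sec S"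
  shows "\<exists>c d. c\<^sup>2 = 1 \<and> (\<forall>i\<in>II. d i \<noteq> 0 \<and> S (sr i) = co i (d i) ** zc c ** sig i)"
proof -
  have "\<forall>i\<in>II. \<exists>t. t \<in> T \<and> S (sr i) = t ** sig i" using section_lift[OF S] by blast
  from bchoice[OF this] obtain t where t: "\<forall>i\<in>II. t i \<in> T \<and> S (sr i) = t i ** sig i" ..
  then have tT: "\<And>i. i \<in> II \<Longrightarrow> t i \<in> T" and St: "\<And>i. i \<in> II \<Longrightarrow> S (sr i) = t i ** sig i" by auto
  have tco: "t i ** act i (t j) = t j ** act j (t i)"
    if ij: "i \<in> II" "j \<in> II" "i \<noteq> j" "\<not> adj n i j" for i j
  proof -
    have "t i ** act i (t j) ** (sig i ** sig j) = t i ** (act i (t j) ** sig i) ** sig j" by (simp only: matrix_mul_assoc)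
    also have "\<dots> = (t i ** sig i) ** (t j ** sig j)"
      unfolding sig_swap[OF ij(1) tT[OF ij(2)], symmetric] by (simp only: matrix_mul_assoc)
    also have "\<dots> = (t j ** sig j) ** (t i ** sig i)"
      using section_commute[OF S ij] St ij by simp
    also have "\<dots> = t j ** (act j (t i) ** sig j) ** sig i"
      unfolding sig_swap[OF ij(2) tT[OF ij(1)], symmetric] by (simp only: matrix_mul_assoc)
    also have "\<dots> = t j ** act j (t i) ** (sig i ** sig j)"
      unfolding sig_commute[OF ij] by (simp only: matrix_mul_assoc)
    finally show ?thesis by (rule cancel_right[rotated]) (use sig_G ij in auto)
  qed
  have tbr: "t i ** act i (t j ** act j (t i)) = t j ** act j (t i ** act i (t j))"
    if ij: "i \<in> II" "j \<in> II" "adj n i j" for i j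
  proof -
    have one: "(t i ** sig i) ** ((t j ** sig j) ** (t i ** sig i)) = t i ** act i (t j ** act j (t i)) ** (sig i ** (sig j ** sig i))"
      if ij: "i \<in> II" "j \<in> II" for i j
    proof -
      have aT: "t j ** act j (t i) \<in> T" using tT ij act_T by simp
      have "(t i ** sig i) ** ((t j ** sig j) ** (t i ** sig i)) = t i ** (sig i ** (t j ** (sig j ** t i))) ** sig i"
          by (simp only: matrix_mul_assoc)
      also have "t j ** (sig j ** t i) = (t j ** act j (t i)) ** sig j"
          unfolding sig_swap[OF ij(2) tT[OF ij(1)]] by (simp only: matrix_mul_assoc)
      also have "sig i ** ((t j ** act j (t i)) ** sig j) = (sig i ** (t j ** act j (t i))) ** sig j" by (simp only: matrix_mul_assoc)
      also have "\<dots> = act i (t j ** act j (t i)) ** sig i ** sig j" unfolding sig_swap[OF ij(1) aT] ..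
      finally show ?thesis by (simp only: matrix_mul_assoc)
    qed
    have "t i ** act i (t j ** act j (t i)) ** (sig i ** (sig j ** sig i)) =
        t j ** act j (t i ** act i (t j)) ** (sig j ** (sig i ** sig j))"
      using one[OF ij(1,2)] one[OF ij(2,1)] section_braid[OF S ij] St ij by simp
    then show ?thesis unfolding sig_braid[OF ij, symmetric]
      by (rule cancel_right[rotated]) (use sig_G ij in auto)
  qed
  have coord_act: "coord k (act i x) = coord k x * inverse (coord k (co i (\<alpha> i x)))"
    if "i \<in> II" "x \<in> T" for i k x
    unfolding act_def using that by (simp add: coord_mult coord_inv co_T root_nz)
  have "\<exists>c y. c\<^sup>2 = 1 \<and> y \<noteq> 0 \<and>
    (\<forall>k\<in>II. coord k (t 1) = coord k (co 1 y) * (if k \<in> {n - 1, n} then c else 1)) \<and>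
    (\<forall>i\<in>{2..n}. \<forall>k\<in>II. k \<noteq> i \<longrightarrow> coord k (t i) = (if k \<in> {n - 1, n} then c else 1))"
  proof (rule braid_coordinates[OF tT])
    fix i j k assume ij: "i \<in> II" "j \<in> II" and k: "k \<in> II" and nadj: "i \<noteq> j" "\<not> adj n i j"
    note T = tT[OF ij(1)] tT[OF ij(2)] act_T[OF ij(1) tT[OF ij(2)]] act_T[OF ij(2) tT[OF ij(1)]]
    have "coord k (t i) * (coord k (t j) * inverse (coord k (co i (\<alpha> i (t j))))) =
        coord k (t j) * (coord k (t i) * inverse (coord k (co j (\<alpha> j (t i)))))"
      using arg_cong[OF tco[OF ij nadj], of "coord k"]
      by (simp only: coord_mult[OF T(1,3)] coord_mult[OF T(2,4)] coord_act[OF ij(1) T(2)] coord_act[OF ij(2) T(1)])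
    then show "coord k (co i (\<alpha> i (t j))) = coord k (co j (\<alpha> j (t i)))"
      using coord_nz[OF T(1), of k] coord_nz[OF T(2), of k] by simp
  next
    fix i j k assume ij: "i \<in> II" "j \<in> II" and k: "k \<in> II" and adj: "adj n i j"
    have ne: "i \<noteq> j" and ji: "adj n j i" using adj_neq[OF adj] adj_sym[OF adj] by auto
    have expand: "coord k (t i ** act i (t j ** act j (t i))) =
        coord k (t i) * (coord k (t j) * coord k (t i)) *
        (inverse (coord k (co i (\<alpha> i (t i) * \<alpha> j (t i)))) * inverse (coord k (co i (\<alpha> i (t j)))) * inverse (coord k (co j (\<alpha> j (t i)))))"
      if ij: "i \<in> II" "j \<in> II" and adj: "adj n i j" for i j
    proof -
      have ne: "i \<noteq> j" and ji: "adj n j i" using adj_neq[OF adj] adj_sym[OF adj] by auto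
      note T = tT[OF ij(1)] tT[OF ij(2)] act_T[OF ij(2) tT[OF ij(1)]]
      have nz: "\<alpha> i (t i) \<noteq> 0" "\<alpha> j (t i) \<noteq> 0" "\<alpha> i (t j) \<noteq> 0" using root_nz T ij by auto
      have inner: "t j ** act j (t i) \<in> T" using T by simp
      have "\<alpha> i (t j ** act j (t i)) = \<alpha> i (t j) * (\<alpha> i (t i) * \<alpha> j (t i))"
        using root_mult[OF ij(1) T(2,3)] root_of_act[OF ij(2,1) T(1)] ne ji by simp
      then have "co i (\<alpha> i (t j ** act j (t i))) = co i (\<alpha> i (t j)) ** co i (\<alpha> i (t i) * \<alpha> j (t i))"
        using co_mult[OF ij(1)] nz by simp
      moreover have "co i (\<alpha> i (t j)) \<in> T" "co i (\<alpha> i (t i) * \<alpha> j (t i)) \<in> T" using co_T[OF ij(1)] nz by auto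
      ultimately have "coord k (co i (\<alpha> i (t j ** act j (t i)))) = coord k (co i (\<alpha> i (t j))) * coord k (co i (\<alpha> i (t i) * \<alpha> j (t i)))"
        by (simp add: coord_mult)
      then show ?thesis
        by (simp add: coord_mult[OF T(1) act_T[OF ij(1) inner]] coord_act[OF ij(1) inner] coord_mult[OF T(2,3)]
            coord_act[OF ij(2) T(1)] mult_ac)
    qed
    have nz: "coord k (t i) \<noteq> 0" "coord k (t j) \<noteq> 0" using coord_nz tT ij by auto
    have nz2: "coord k (co i (\<alpha> i (t j))) \<noteq> 0" "coord k (co j (\<alpha> j (t i))) \<noteq> 0"
      using coord_nz co_T root_nz tT ij by auto
    have "coord k (t i ** act i (t j ** act j (t i))) = coord k (t j ** act j (t i ** act i (t j)))"
      using tbr[OF ij adj] by simp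
    then show "coord k (t i) * inverse (coord k (co i (\<alpha> i (t i) * \<alpha> j (t i)))) =
      coord k (t j) * inverse (coord k (co j (\<alpha> j (t j) * \<alpha> i (t j))))"
      unfolding expand[OF ij adj] expand[OF ij(2,1) ji] using nz nz2 by (simp add: mult_ac)
  qed
  then obtain c y where c: "c\<^sup>2 = 1" and y: "y \<noteq> 0"
    and t1: "\<forall>k\<in>II. coord k (t 1) = coord k (co 1 y) * (if k \<in> {n - 1, n} then c else 1)"
    and ti: "\<forall>i\<in>{2..n}. \<forall>k\<in>II. k \<noteq> i \<longrightarrow> coord k (t i) = (if k \<in> {n - 1, n} then c else 1)"
    by (elim exE conjE)
  \<comment> \<open>For \<open>i \<ge> n - 1\<close> the \<open>i\<close>-th coordinate of \<open>z\<^sub>c\<close> is \<open>c = c\<^sup>-\<^sup>1\<close> and is split off.\<close>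
  define d where "d i = (if i = 1 then y else coord i (t i) * (if i \<in> {n - 1, n} then c else 1))" for i
  note z = zc_facts[OF c]
  have c0: "c \<noteq> 0" and cc: "c * c = 1" using c by (auto simp: power2_eq_square)
  have "d i \<noteq> 0 \<and> S (sr i) = co i (d i) ** zc c ** sig i" if i: "i \<in> II" for i
  proof
    show d0: "d i \<noteq> 0" using y c0 coord_nz[OF tT[OF i]] by (simp add: d_def)
    have "t i = co i (d i) ** zc c"
    proof (rule coord_eqI)
      fix k assume k: "k \<in> II"
      have eq: "coord k (co i (d i) ** zc c) = coord k (co i (d i)) * (if k \<in> {n - 1, n} then c else 1)"
        using coord_mult[OF co_T[OF i d0] z(1)] z(2)[OF k] by simp
      show "coord k (t i) = coord k (co i (d i) ** zc c)"
      proof (cases "i = 1")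
        case True
        then show ?thesis using t1 k unfolding eq by (simp add: d_def)
      next
        case False
        then have i2: "i \<in> {2..n}" using i by auto
        show ?thesis
        proof (cases "k = i")
          case True
          show ?thesis unfolding eq coord_coroot[OF i2 k d0] using True False cc
            by (auto simp: d_def mult.assoc)
        next
          case ki: False
          show ?thesis unfolding eq coord_coroot[OF i2 k d0] using ti i2 k ki by auto
        qed
      qed
    qed (use tT[OF i] co_T[OF i d0] z(1) in auto)
    then show "S (sr i) = co i (d i) ** zc c ** sig i" using St[OF i] by simp
  qed
  then show ?thesis using c by blast
qed

text \<open>The equation \<open>a\<^sup>3 = b\<^sup>2\<close> parametrizes by \<open>a = y\<^sup>-\<^sup>2\<close> and \<open>b = y\<^sup>-\<^sup>3\<close>; with \<open>y = d\<^sub>1\<close> the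
  prescribed coordinates of \<open>t\<^sub>1\<close> are those of \<open>\<alpha>\<^sub>1\<^sup>\<or>(y) z\<^sub>c\<close>, whose exponents are listed in
  \<open>coord_first_coroot\<close>.\<close>

lemma parameters_exist:
  assumes c: "c\<^sup>2 = 1" and S: "\<And>i. i \<in> II \<Longrightarrow> d i \<noteq> 0 \<and> S (sr i) = co i (d i) ** zc c ** sig i"
  shows "\<exists>a b d. has_parameters G n (\<lambda>i. rf (\<alpha> i)) (\<lambda>i. sg (\<alpha> i)) lam S a b c d"
proof -
  have one: "1 \<in> II" using n6 by simp
  define y where "y = d 1"
  have y: "y \<noteq> 0" using S[OF one] by (simp add: y_def)
  define a where "a = inverse (y ^ 2)"
  define b where "b = inverse (y ^ 3)"
  define d' where "d' i = d i * (if i \<in> {n - 1, n} then c else 1)" for i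
  note z = zc_facts[OF c]
  have c0: "c \<noteq> 0" using c by auto
  have ab: "inverse a * b = inverse y" using y by (simp add: a_def b_def power2_eq_square power3_eq_cube field_simps)
  have a_pow: "a ^ m = inverse (y ^ (2 * m))" for m by (simp add: a_def power_inverse power_mult[symmetric] mult.commute)
  have first: "section_coord n a b c d' 1 k = coord k (co 1 y) * (if k \<in> {n - 1, n} then c else 1)" if k: "k \<in> II" for k
  proof -
    note h = coord_first_coroot[OF k y]
    consider "k = 1" | "2 \<le> k" "k \<le> n - 2" "even k" | "2 \<le> k" "k \<le> n - 2" "odd k" | "k = n - 1" | "k = n"
      using k by force
    then show ?thesis
    proof cases
      case 1
      then show ?thesis unfolding h section_coord_def Let_def using n6 by (simp add: a_def)
    next
      case 2
      then obtain m where m: "k = 2 * m" by blast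
      have f: "(k = 1) = False" "(k \<le> n - 2) = True" "k \<notin> {n - 1, n}" using 2 n6 by auto
      have "a ^ (k div 2) = inverse (y ^ k)" by (simp add: m a_pow)
      then have "a ^ (k div 2) = y powi (- int k)" by (simp add: power_int_minus)
      then show ?thesis unfolding h section_coord_def Let_def f if_False if_True using f(3) 2(3) by simp
    next
      case 3
      then obtain m where m: "k = Suc (2 * m)" by (auto elim: oddE)
      then have "m \<noteq> 0" using 3 by auto
      then obtain l where l: "m = Suc l" by (cases m) auto
      have "(k - 3) div 2 = l" using m l by simp
      moreover have "b * a ^ l = inverse (y ^ k)"
        unfolding b_def a_pow m l by (simp add: power_add[symmetric] inverse_mult_distrib[symmetric] del: inverse_mult_distrib power_Suc)
          (simp add: eval_nat_numeral mult_ac)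
      ultimately show ?thesis unfolding h section_coord_def Let_def using 3 n6
        by (simp add: power_int_minus) (auto simp: power_int_def)
    next
      case 4
      have f: "(k = 1) = False" "(k \<le> n - 2) = False" "(k = n - 1) = True" "k \<in> {n - 1, n}" using 4 n6 by auto
      show ?thesis unfolding h section_coord_def Let_def f if_False if_True ab
        using f(4) by (simp add: power_int_minus power_inverse)
    next
      case 5
      have f: "(k = 1) = False" "(k \<le> n - 2) = False" "(k = n - 1) = False" "k \<in> {n - 1, n}" using 5 n6 by auto
      show ?thesis unfolding h section_coord_def Let_def f if_False if_True ab
        using f(4) by (simp add: power_int_minus power_inverse)
    qed
  qed
  have "torus_element G n lam (section_coord n a b c d' i) = co i (d i) ** zc c" if i: "i \<in> II" for i
  proof -
    have d0: "d i \<noteq> 0" using S[OF i] by simp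
    have T: "co i (d i) ** zc c \<in> T" using co_T[OF i d0] z(1) by simp
    have "te (section_coord n a b c d' i) = te (\<lambda>k. coord k (co i (d i) ** zc c))"
    proof (rule te_cong)
      fix k assume k: "k \<in> II"
      have eq: "coord k (co i (d i) ** zc c) = coord k (co i (d i)) * (if k \<in> {n - 1, n} then c else 1)"
        using coord_mult[OF co_T[OF i d0] z(1)] z(2)[OF k] by simp
      show "section_coord n a b c d' i k = coord k (co i (d i) ** zc c)"
      proof (cases "i = 1")
        case True
        then show ?thesis unfolding eq using first[OF k] by (simp add: y_def)
      next
        case False
        then have i2: "i \<in> {2..n}" using i by auto
        show ?thesis unfolding eq coord_coroot[OF i2 k d0] section_coord_def Let_def d'_def using False by auto
      qed
    qed
    then show ?thesis using te_coord[OF T] by simp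
  qed
  then have "has_parameters G n (\<lambda>i. rf (\<alpha> i)) (\<lambda>i. sg (\<alpha> i)) lam S a b c d'"
    unfolding has_parameters_def using y c0 c S
    by (auto simp: a_def b_def d'_def power_inverse power_mult[symmetric])
  then show ?thesis by blast
qed

text \<open>The sign is the \<open>n\<close>-th coordinate of \<open>t\<^sub>2\<close>, whatever the other parameters are.\<close>

lemma c_value_eq:
  assumes c: "c\<^sup>2 = 1" and S: "\<And>i. i \<in> II \<Longrightarrow> d i \<noteq> 0 \<and> S (sr i) = co i (d i) ** zc c ** sig i"
  shows "c_value G n (\<lambda>i. rf (\<alpha> i)) (\<lambda>i. sg (\<alpha> i)) lam S = c"
  unfolding c_value_def
proof (rule the_equality)
  show "\<exists>a b d. has_parameters G n (\<lambda>i. rf (\<alpha> i)) (\<lambda>i. sg (\<alpha> i)) lam S a b c d"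
    by (rule parameters_exist[OF c S])
  fix c' assume "\<exists>a b d. has_parameters G n (\<lambda>i. rf (\<alpha> i)) (\<lambda>i. sg (\<alpha> i)) lam S a b c' d"
  then obtain a b d' where p: "has_parameters G n (\<lambda>i. rf (\<alpha> i)) (\<lambda>i. sg (\<alpha> i)) lam S a b c' d'" by blast
  have two: "2 \<in> II" "2 \<in> {2..n}" and nI: "n \<in> II" using n6 by auto
  have c'0: "c' \<noteq> 0" and d'0: "d' 2 \<noteq> 0" using p two unfolding has_parameters_def by auto
  have d0: "d 2 \<noteq> 0" using S[OF two(1)] by simp
  have "te (section_coord n a b c' d' 2) ** sig 2 = co 2 (d 2) ** zc c ** sig 2"
    using p S[OF two(1)] two(1) unfolding has_parameters_def by simp
  then have "te (section_coord n a b c' d' 2) = co 2 (d 2) ** zc c" by (rule cancel_right[OF sig_G[OF two(1)]])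
  then have "coord n (te (section_coord n a b c' d' 2)) = coord n (co 2 (d 2)) * coord n (zc c)"
    using coord_mult[OF co_T[OF two(1) d0] zc_facts(1)[OF c]] by simp
  moreover have "coord n (te (section_coord n a b c' d' 2)) = section_coord n a b c' d' 2 n"
    by (rule coord_te[OF nI]) (use c'0 d'0 in \<open>auto simp: section_coord_def Let_def\<close>)
  ultimately show "c' = c"
    using coord_coroot[OF two(2) nI d0] zc_facts(2)[OF c nI] n6 by (simp add: section_coord_def Let_def)
qed

text \<open>A shortest word in the generating reflections. Inverses of generators need not be
  considered, as \<open>\<sigma>\<^sub>i\<^sup>2\<close> lies in \<open>T\<close>.\<close>

lemma weyl_reduced_word:
  assumes w: "w \<in> carrier WT"
  obtains ws where "reduced_word WT n (\<lambda>i. rf (\<alpha> i)) ws" "word_prod WT (\<lambda>i. rf (\<alpha> i)) ws = w"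
proof -
  interpret W: group WT by (rule group_WT)
  let ?wp = "word_prod WT (\<lambda>i. rf (\<alpha> i))"
  have closed: "?wp ws \<in> carrier WT" if "set ws \<subseteq> II" for ws
    using that by (induction ws) (auto simp: word_prod_simps sr_W)
  have append: "?wp (vs @ ws) = ?wp vs \<otimes>\<^bsub>WT\<^esub> ?wp ws" if "set vs \<subseteq> II" "set ws \<subseteq> II" for vs ws
    using that(1) by (induction vs) (simp_all add: word_prod_simps closed[OF that(2)] closed sr_W W.m_assoc)
  have "w \<in> generate WT ((\<lambda>i. rf (\<alpha> i)) ` II)" using w weyl_gen by simp
  then have "\<exists>ws. set ws \<subseteq> II \<and> ?wp ws = w"
  proof induction
    case one
    show ?case by (rule exI[of _ "[]"]) (simp add: word_prod_simps)
  next
    case (incl h)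
    then obtain i where "i \<in> II" "h = sr i" by blast
    then show ?case by (intro exI[of _ "[i]"]) (simp add: word_prod_simps sr_W)
  next
    case (inv h)
    then obtain i where i: "i \<in> II" "h = sr i" by blast
    have "sr i \<otimes>\<^bsub>WT\<^esub> sr i = T #>\<^bsub>G\<^esub> (sig i ** sig i)"
      unfolding sr_eq[OF i(1)] by (rule mult_WT) (use sig_N i in auto)
    also have "\<dots> = \<one>\<^bsub>WT\<^esub>"
    proof -
      have T: "co i (- 1) \<in> T" by (rule co_T[OF i(1)]) simp
      have "T #>\<^bsub>G\<^esub> co i (- 1) = T #>\<^bsub>G\<^esub> mat 1"
        by (rule iffD2[OF coset_eq_iff[OF T_G[OF T] mat_one_closed]], rule bexI[OF _ T]) simp
      then show ?thesis unfolding one_WT sg_square[OF simple_root[OF i(1)]] .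
    qed
    finally have "inv\<^bsub>WT\<^esub> h = sr i" using W.inv_equality[of "sr i" "sr i"] sr_W i by simp
    then show ?case using i by (intro exI[of _ "[i]"]) (simp add: word_prod_simps sr_W)
  next
    case (eng h1 h2)
    then obtain vs ws where "set vs \<subseteq> II" "?wp vs = h1" "set ws \<subseteq> II" "?wp ws = h2" by blast
    then show ?case by (intro exI[of _ "vs @ ws"]) (simp add: append)
  qed
  then obtain ws where ws: "set ws \<subseteq> II \<and> ?wp ws = w" "\<And>vs. set vs \<subseteq> II \<and> ?wp vs = w \<Longrightarrow> length ws \<le> length vs"
    using ex_has_least_nat[of "\<lambda>ws. set ws \<subseteq> II \<and> ?wp ws = w" _ length] by blast
  then have "reduced_word WT n (\<lambda>i. rf (\<alpha> i)) ws" unfolding reduced_word_def by auto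
  then show ?thesis using ws(1) that by blast
qed

text \<open>Along a reduced word both sections are products of their values at the simple
  reflections.\<close>

lemma conjugate_if_simple:
  assumes S: "sec S" and S': "sec S'" and t: "t \<in> T"
    and eq: "\<And>i. i \<in> II \<Longrightarrow> t ** S (sr i) ** inv\<^bsub>G\<^esub> t = S' (sr i)"
  shows "T_conjugate G T S S'"
  unfolding T_conjugate_def
proof (intro bexI[OF _ t] ballI)
  fix w assume "w \<in> carrier WT"
  then obtain ws where ws: "reduced_word WT n (\<lambda>i. rf (\<alpha> i)) ws" "word_prod WT (\<lambda>i. rf (\<alpha> i)) ws = w"
    by (rule weyl_reduced_word)
  have tG: "t \<in> carrier G" by (rule T_G[OF t])
  have "t ** word_prod G (\<lambda>i. S (sr i)) vs ** inv\<^bsub>G\<^esub> t = word_prod G (\<lambda>i. S' (sr i)) vs" if "set vs \<subseteq> II" for vs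
    using that
  proof (induction vs)
    case Nil
    show ?case using tG by (simp add: word_prod_simps)
  next
    case (Cons i vs)
    let ?p = "word_prod G (\<lambda>i. S (sr i)) vs"
    have e: "t ** S (sr i) ** inv\<^bsub>G\<^esub> t = S' (sr i)" by (rule eq) (use Cons.prems in simp)
    have IH: "t ** ?p ** inv\<^bsub>G\<^esub> t = word_prod G (\<lambda>i. S' (sr i)) vs" by (rule Cons.IH) (use Cons.prems in simp)
    have "t ** (S (sr i) ** ?p) ** inv\<^bsub>G\<^esub> t = t ** S (sr i) ** (inv\<^bsub>G\<^esub> t ** t) ** ?p ** inv\<^bsub>G\<^esub> t"
      using tG by (simp add: matrix_mul_assoc)
    also have "\<dots> = (t ** S (sr i) ** inv\<^bsub>G\<^esub> t) ** (t ** ?p ** inv\<^bsub>G\<^esub> t)" by (simp only: matrix_mul_assoc)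
    finally have "t ** (S (sr i) ** ?p) ** inv\<^bsub>G\<^esub> t = S' (sr i) ** word_prod G (\<lambda>i. S' (sr i)) vs"
      unfolding e IH .
    then show ?case by (simp add: word_prod_simps)
  qed
  moreover have "set ws \<subseteq> II" using ws(1) unfolding reduced_word_def by blast
  ultimately show "t \<otimes>\<^bsub>G\<^esub> S w \<otimes>\<^bsub>G\<^esub> inv\<^bsub>G\<^esub> t = S' w"
    using section_word[OF S ws(1)] section_word[OF S' ws(1)] ws(2) by simp
qed

text \<open>Conjugation by \<open>t\<close> replaces \<open>d\<^sub>i\<close> by \<open>\<alpha>\<^sub>i(t) d\<^sub>i\<close> and keeps \<open>c\<close>. The \<open>n\<close>-th coordinate at
  \<open>i = 2\<close> shows that \<open>c\<close> is an invariant, and a \<open>t\<close> with \<open>\<alpha>\<^sub>i(t) = d'\<^sub>i / d\<^sub>i\<close> conjugates two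
  sections with the same \<open>c\<close>.\<close>

lemma conjugate_iff:
  assumes S: "sec S" and S': "sec S'"
  shows "T_conjugate G T S S' \<longleftrightarrow> c_value G n (\<lambda>i. rf (\<alpha> i)) (\<lambda>i. sg (\<alpha> i)) lam S =
      c_value G n (\<lambda>i. rf (\<alpha> i)) (\<lambda>i. sg (\<alpha> i)) lam S'"
proof -
  obtain c d where c: "c\<^sup>2 = 1" and d: "\<And>i. i \<in> II \<Longrightarrow> d i \<noteq> 0 \<and> S (sr i) = co i (d i) ** zc c ** sig i"
    using section_form[OF S] by blast
  obtain c' d' where c': "c'\<^sup>2 = 1" and d': "\<And>i. i \<in> II \<Longrightarrow> d' i \<noteq> 0 \<and> S' (sr i) = co i (d' i) ** zc c' ** sig i"
    using section_form[OF S'] by blast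
  note z = zc_facts[OF c] and z' = zc_facts[OF c']
  have conj: "t ** S (sr i) ** inv\<^bsub>G\<^esub> t = co i (\<alpha> i t * d i) ** zc c ** sig i" if t: "t \<in> T" and i: "i \<in> II" for t i
  proof -
    have "co i (d i) ** zc c \<in> T" using co_T[OF i] d[OF i] z(1) by simp
    then have "t ** S (sr i) ** inv\<^bsub>G\<^esub> t = co i (\<alpha> i t) ** (co i (d i) ** zc c) ** sig i"
      using conj_lift[OF i t] d[OF i] by simp
    also have "\<dots> = co i (\<alpha> i t * d i) ** zc c ** sig i"
      using co_mult[OF i root_nz[OF i t]] d[OF i] by (simp add: matrix_mul_assoc)
    finally show ?thesis .
  qed
  have "T_conjugate G T S S' \<longleftrightarrow> c = c'"
  proof
    assume "T_conjugate G T S S'"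
    then obtain t where t: "t \<in> T" "\<And>w. w \<in> carrier WT \<Longrightarrow> t ** S w ** inv\<^bsub>G\<^esub> t = S' w"
      unfolding T_conjugate_def by auto
    have two: "2 \<in> II" "2 \<in> {2..n}" and nI: "n \<in> II" using n6 by auto
    have nz: "\<alpha> 2 t * d 2 \<noteq> 0" "d' 2 \<noteq> 0" using root_nz[OF two(1) t(1)] d[OF two(1)] d'[OF two(1)] by auto
    have "co 2 (\<alpha> 2 t * d 2) ** zc c ** sig 2 = co 2 (d' 2) ** zc c' ** sig 2"
      using conj[OF t(1) two(1)] t(2)[OF sr_W[OF two(1)]] d'[OF two(1)] by simp
    then have "co 2 (\<alpha> 2 t * d 2) ** zc c = co 2 (d' 2) ** zc c'" by (rule cancel_right[OF sig_G[OF two(1)]])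
    then have "coord n (co 2 (\<alpha> 2 t * d 2)) * coord n (zc c) = coord n (co 2 (d' 2)) * coord n (zc c')"
      using coord_mult[OF co_T[OF two(1) nz(1)] z(1)] coord_mult[OF co_T[OF two(1) nz(2)] z'(1)] by simp
    then show "c = c'"
      using coord_coroot[OF two(2) nI nz(1)] coord_coroot[OF two(2) nI nz(2)] z(2)[OF nI] z'(2)[OF nI] n6 by simp
  next
    assume cc: "c = c'"
    have "\<exists>t\<in>T. \<forall>i\<in>II. \<alpha> i t = d' i / d i"
      by (rule simple_roots_surjective) (use d d' in simp)
    then obtain t where t: "t \<in> T" "\<forall>i\<in>II. \<alpha> i t = d' i / d i" ..
    show "T_conjugate G T S S'"
    proof (rule conjugate_if_simple[OF S S' t(1)])
      fix i assume i: "i \<in> II"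
      then have "\<alpha> i t * d i = d' i" using t(2) d by simp
      then show "t ** S (sr i) ** inv\<^bsub>G\<^esub> t = S' (sr i)" using conj[OF t(1) i] d'[OF i] cc by simp
    qed
  qed
  then show ?thesis using c_value_eq[OF c d] c_value_eq[OF c' d'] by simp
qed

lemma section_order:
  assumes S: "sec S" and i: "i \<in> II"
  shows "elt_order G (S (sr i)) = 4" "S (sr i) \<otimes>\<^bsub>G\<^esub> S (sr i) \<noteq> \<one>\<^bsub>G\<^esub>"
proof -
  obtain c d where c: "c\<^sup>2 = 1" and d: "\<And>i. i \<in> II \<Longrightarrow> d i \<noteq> 0 \<and> S (sr i) = co i (d i) ** zc c ** sig i"
    using section_form[OF S] by blast
  let ?g = "S (sr i)"
  have sq: "?g ** ?g = co i (- 1)" using square_of_lift[OF i _ c] d[OF i] by simp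
  have gG: "?g \<in> carrier G" using S sr_W[OF i] normalizerD(1) unfolding is_section_def by blast
  show ne: "?g \<otimes>\<^bsub>G\<^esub> ?g \<noteq> \<one>\<^bsub>G\<^esub>" using coroot_minus_one[OF i] sq by simp
  have four: "?g [^]\<^bsub>G\<^esub> (4::nat) = \<one>\<^bsub>G\<^esub>"
  proof -
    have "?g [^]\<^bsub>G\<^esub> (4::nat) = (?g ** ?g) ** (?g ** ?g)"
      by (simp add: nat_pow_def eval_nat_numeral matrix_mul_assoc)
    also have "\<dots> = co i ((- 1) * (- 1))" unfolding sq by (rule co_mult[OF i, symmetric]) simp_all
    finally show ?thesis by (simp add: co_one[OF i])
  qed
  have two: "?g [^]\<^bsub>G\<^esub> (2::nat) \<noteq> \<one>\<^bsub>G\<^esub>" using ne by (simp add: nat_pow_def eval_nat_numeral)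
  have dvd4: "ord ?g dvd 4" using pow_eq_id[OF gG] four by simp
  have ndvd2: "\<not> ord ?g dvd 2" using pow_eq_id[OF gG] two by simp
  have "ord ?g \<le> 4" using dvd4 by (rule dvd_imp_le) simp
  then have "ord ?g \<in> {0, 1, 2, 3, 4}" by auto
  then have "ord ?g = 4" using dvd4 ndvd2 by auto
  then show "elt_order G ?g = 4" unfolding elt_order_def by (simp add: numeral_eq_enat)
qed

lemma section_profiles_eq: "section_profiles G T n (\<lambda>i. rf (\<alpha> i)) = {order_profile G n (\<lambda>i. rf (\<alpha> i)) tits}"
proof -
  have "order_profile G n (\<lambda>i. rf (\<alpha> i)) S = (\<lambda>i\<in>II. 4)" if "sec S" for S
    unfolding order_profile_def by (intro restrict_ext) (rule section_order(1)[OF that])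
  then have "order_profile G n (\<lambda>i. rf (\<alpha> i)) S = order_profile G n (\<lambda>i. rf (\<alpha> i)) tits" if "sec S" for S
    using that tits_sec by simp
  then show ?thesis unfolding section_profiles_def using tits_sec by blast
qed

lemma tits_optimal: "optimal_section G T n (\<lambda>i. rf (\<alpha> i)) tits"
proof -
  have "\<not> profile_less n p p" for p :: "nat \<Rightarrow> enat"
    unfolding profile_less_def using n6 by (auto intro!: bexI[of _ 1])
  then show ?thesis
    unfolding optimal_section_def maximal_profile_def section_profiles_eq using tits_sec by auto
qed

end

theorem proposition3p13:
  fixes G :: "('f::alg_closed_field^'m::finite^'m, 'f) alg_group"
    and T :: "('f^'m^'m) set"
    and n :: nat
    and \<alpha> :: "nat \<Rightarrow> 'f^'m^'m \<Rightarrow> 'f"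
    and cr :: "('f^'m^'m \<Rightarrow> 'f) \<Rightarrow> ('f \<Rightarrow> 'f^'m^'m)"
    and refl :: "('f^'m^'m \<Rightarrow> 'f) \<Rightarrow> ('f^'m^'m) set"
    and u :: "('f^'m^'m \<Rightarrow> 'f) \<Rightarrow> ('f \<Rightarrow> 'f^'m^'m)"
    and \<omega> :: "'f \<Rightarrow> 'f^'m^'m"
    and tits :: "('f^'m^'m) set \<Rightarrow> 'f^'m^'m"
  defines "s \<equiv> \<lambda>i. refl (\<alpha> i)"
    and "\<sigma> \<equiv> \<lambda>i. tits_lift G T u (\<alpha> i)"
    and "lam \<equiv> \<lambda>i. if i = 1 then \<omega> else cr (\<alpha> i)"
  assumes "CHAR('f) \<noteq> 2"
    and "linear_algebraic_group G" "alg_connected G" "reductive G" "almost_simple G"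
    and "maximal_torus G T"
    and "realization G T cr refl u"
    and "6 \<le> n" "even n"
    and "simple_roots G T n \<alpha>" "type_D n \<alpha> cr"
    and "generate (weyl_group G T) (s ` {1..n}) = carrier (weyl_group G T)"
    and "is_fundamental_coweight G T n \<alpha> (n - 1) \<omega>"
    and "carrier (cocharacter_group G T) =
           generate (cocharacter_group G T) ((\<lambda>i. cr (\<alpha> i)) ` {1..n} \<union> {\<omega>})"
    and "is_tits_section G T n s \<sigma> tits"
  shows "(optimal_section G T n s tits \<and>
          (\<forall>i\<in>{1..n}. tits (s i) \<otimes>\<^bsub>G\<^esub> tits (s i) \<noteq> \<one>\<^bsub>G\<^esub>) \<and>
          (\<forall>S. is_section G T n s S \<longrightarrow> (\<forall>i\<in>{1..n}. elt_order G (S (s i)) = 4)) \<and>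
          (\<exists>!p. p \<in> section_profiles G T n s)) \<and>
         (\<forall>S S'. is_section G T n s S \<and> is_section G T n s S' \<longrightarrow>
            (T_conjugate G T S S' \<longleftrightarrow> c_value G n s \<sigma> lam S = c_value G n s \<sigma> lam S'))"
proof -
  have "subgroup T G" "is_torus (G\<lparr>carrier := T\<rparr>)"
    using \<open>maximal_torus G T\<close> unfolding maximal_torus_def closed_subgroup_def by auto
  then interpret half_spin_tits G T cr refl u n \<alpha> \<omega> tits
    using assms(4-) unfolding s_def \<sigma>_def
    by (intro half_spin_tits.intro half_spin_group.intro realized_group.intro torus_group.intro linear_group.intro
        half_spin_tits_axioms.intro half_spin_group_axioms.intro realized_group_axioms.intro torus_group_axioms.intro)
  have lam_eq: "lam = half_spin_group.lam cr \<alpha> \<omega>" unfolding assms(3) by (rule ext) (simp add: lam_def)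
  show ?thesis
    unfolding s_def \<sigma>_def lam_eq section_profiles_eq
  proof (intro conjI allI impI ballI)
    show "tits (refl (\<alpha> i)) \<otimes>\<^bsub>G\<^esub> tits (refl (\<alpha> i)) \<noteq> \<one>\<^bsub>G\<^esub>" if "i \<in> {1..n}" for i
      by (rule section_order(2)[OF tits_sec that])
    show "elt_order G (S (refl (\<alpha> i))) = 4" if "sec S" "i \<in> {1..n}" for S i
      by (rule section_order(1)[OF that])
  qed (use tits_optimal conjugate_iff in auto)
qed

end
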